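(* Let $\nu>1$ and let $F$ be an almost smooth circle map with a flat spot $U$, with critical exponent $(\nu,\nu)$ and irrational rotation number. Let $$\sigma(n)=\frac{\operatorname{dist}(U,F^{q_n}(U))}{\operatorname{dist}(U,F^{q_{n-2}}(U))}.$$ If $\nu\le 2$, then $\lim_{n\to\infty}\sigma(n)=0$. If $\nu>2$ and the rotation number of $F$ is of bounded type, then $\liminf_{n\to\infty}\sigma(n)>0$.
   Context: An almost smooth map with a flat spot is a continuous, weakly order-preserving, degree one circle endomorphism $F:{\bf S}^1\to{\bf S}^1$ for which there is an open arc $U$ (the flat spot) such that: (1) $F(U)$ is one point; (2) the restriction of $F$ to ${\bf S}^1\setminus\overline{U}$ is a $C^2$-diffeomorphism onto its image; (3) if $f$ is a lifting of $F$ to the real line and $(a,b)$ is a lift of $U$, then on some right-sided neighborhood of $b$ one has $f(x)=h_r((x-b)^{p_r})$ with $p_r\ge 1$, where $h_r$ extends as a $C^2$-diffeomorphism to a full neighborhood of the relevant endpoint, and analogously on some left-sided neighborhood of $a$ one has $f(x)=h_l((a-x)^{p_l})$ with $p_l\geq 1$. The pair $(p_l,p_r)$ is the critical exponent. The rotation number is $\rho(F)=\lim_{n\to\infty} f^n(x)/n \pmod 1$, which exists and does not depend on $x$. $q_n$ denotes the closest return times (the denominators of the continued fraction convergents) of $\rho(F)$. The rotation number is of bounded type if the ratios $q_n/q_{n-1}$ are uniformly bounded. For sets $X,Y$ in the circle, $\operatorname{dist}(X,Y)=\inf\{\operatorname{dist}(x,y):x\in X,y\in Y\}$. For $i\ge1$,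 $F^i(U)$ is a single point. *)

theory Defs
  imports "HOL-Analysis.Analysis"
begin

abbreviation circle :: "complex set" where
  "circle \<equiv> sphere 0 1"

text \<open>The universal covering of the circle; the deck transformations are the integer translations.\<close>

definition circ :: "real \<Rightarrow> complex" where
  "circ x = cis (2 * pi * x)"

text \<open>Arc length distance, normalised so that the circle has length 1.\<close>

definition circle_dist :: "complex \<Rightarrow> complex \<Rightarrow> real" where
  "circle_dist z w = \<bar>Arg (z / w)\<bar> / (2 * pi)"

definition circle_setdist :: "complex set \<Rightarrow> complex set \<Rightarrow> real" where
  "circle_setdist X Y = (INF (x, y)\<in>X \<times> Y. circle_dist x y)"

definition circle_lift :: "(complex \<Rightarrow> complex) \<Rightarrow> (real \<Rightarrow> real) \<Rightarrow> bool" where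
  "circle_lift F f \<longleftrightarrow> continuous_on UNIV f \<and> (\<forall>x. F (circ x) = circ (f x))"

definition arc_lift :: "complex set \<Rightarrow> real \<Rightarrow> real \<Rightarrow> bool" where
  "arc_lift U a b \<longleftrightarrow> a < b \<and> b < a + 1 \<and> U = circ ` {a<..<b}"

text \<open>Continuous, weakly order-preserving circle endomorphisms of degree one. Lifts are unique up
  to an integer constant, so it does not matter which lift is taken.\<close>

definition monotone_degree_one :: "(complex \<Rightarrow> complex) \<Rightarrow> bool" where
  "monotone_degree_one F \<longleftrightarrow> continuous_on circle F \<and> F \<in> circle \<rightarrow> circle \<and>
     (\<exists>f. circle_lift F f \<and> mono f \<and> (\<forall>x. f (x + 1) = f x + 1))"

text \<open>The next two notions are meant for open sets only.\<close>

definition C2_on :: "real set \<Rightarrow> (real \<Rightarrow> real) \<Rightarrow> bool" where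
  "C2_on S f \<longleftrightarrow> (\<exists>f' f''. (\<forall>x\<in>S. (f has_real_derivative f' x) (at x) \<and>
       (f' has_real_derivative f'' x) (at x)) \<and> continuous_on S f'')"

definition C2_diffeo_on :: "real set \<Rightarrow> (real \<Rightarrow> real) \<Rightarrow> bool" where
  "C2_diffeo_on S f \<longleftrightarrow> C2_on S f \<and> inj_on f S \<and> open (f ` S) \<and> C2_on (f ` S) (the_inv_into S f)"

text \<open>The arc complementary to the closure of \<open>U\<close> lifts to the open interval from \<open>b\<close> to \<open>a + 1\<close>.
  Together with injectivity on the circle, the \<open>C\<^sup>2\<close> condition on the lift there says that
  the restriction of \<open>F\<close> to the complementary arc is a \<open>C\<^sup>2\<close>-diffeomorphism onto its image.\<close>

definition almost_smooth_flat :: "(complex \<Rightarrow> complex) \<Rightarrow> complex set \<Rightarrow> real \<Rightarrow> real \<Rightarrow> bool" where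
  "almost_smooth_flat F U p\<^sub>l p\<^sub>r \<longleftrightarrow>
     monotone_degree_one F \<and>
     (\<exists>a b. arc_lift U a b) \<and>
     (\<exists>c. F ` U = {c}) \<and>
     inj_on F (circle - closure U) \<and>
     p\<^sub>l \<ge> 1 \<and> p\<^sub>r \<ge> 1 \<and>
     (\<forall>f a b. circle_lift F f \<and> arc_lift U a b \<longrightarrow>
        C2_diffeo_on {b<..<a + 1} f \<and>
        (\<exists>h N. open N \<and> 0 \<in> N \<and> C2_diffeo_on N h \<and>
           (\<forall>\<^sub>F x in at_right b. f x = h ((x - b) powr p\<^sub>r))) \<and>
        (\<exists>h N. open N \<and> 0 \<in> N \<and> C2_diffeo_on N h \<and>
           (\<forall>\<^sub>F x in at_left a. f x = h ((a - x) powr p\<^sub>l))))"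

text \<open>The representative in \<open>[0, 1)\<close> of the rotation number.\<close>

definition rotation_number :: "(complex \<Rightarrow> complex) \<Rightarrow> real" where
  "rotation_number F = (THE \<rho>. 0 \<le> \<rho> \<and> \<rho> < 1 \<and>
     (\<forall>f x. circle_lift F f \<longrightarrow>
        (\<exists>k::int. (\<lambda>n. (f ^^ n) x / real n) \<longlonglongrightarrow> \<rho> + of_int k)))"

text \<open>Complete quotients, and denominators of the convergents, of the regular continued fraction
  of an irrational number.\<close>

fun cf_quot :: "real \<Rightarrow> nat \<Rightarrow> real" where
  "cf_quot x 0 = x"
| "cf_quot x (Suc n) = 1 / frac (cf_quot x n)"

definition cf_coeff :: "real \<Rightarrow> nat \<Rightarrow> int" where
  "cf_coeff x n = \<lfloor>cf_quot x n\<rfloor>"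

text \<open>The conversion by \<open>nat\<close> loses nothing: partial quotients of positive index are positive.\<close>

fun cf_denom :: "real \<Rightarrow> nat \<Rightarrow> nat" where
  "cf_denom x 0 = 1"
| "cf_denom x (Suc 0) = nat (cf_coeff x 1)"
| "cf_denom x (Suc (Suc n)) = nat (cf_coeff x (Suc (Suc n))) * cf_denom x (Suc n) + cf_denom x n"

definition bounded_type :: "real \<Rightarrow> bool" where
  "bounded_type x \<longleftrightarrow> (\<exists>C. \<forall>n\<ge>1. real (cf_denom x n) / real (cf_denom x (n - 1)) \<le> C)"

text \<open>Meaningful for \<open>n \<ge> 2\<close>; for smaller \<open>n\<close> the index \<open>n - 2\<close> is truncated.\<close>

definition sigma_ratio :: "(complex \<Rightarrow> complex) \<Rightarrow> complex set \<Rightarrow> nat \<Rightarrow> real" where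
  "sigma_ratio F U n =
     (let q = cf_denom (rotation_number F) in
      circle_setdist U ((F ^^ q n) ` U) / circle_setdist U ((F ^^ q (n - 2)) ` U))"

end

theory Submission
  imports Defs
begin

text \<open>Everything is done on a lift \<open>f\<close> of \<open>F\<close>. On the closed arc complementary to \<open>U\<close> the derivative
  of \<open>f\<close> is the weight \<open>((x - b) (a + 1 - x)) powr (\<nu> - 1)\<close> times a factor with Lipschitz logarithm, and
  the primitive of that weight does not decrease Poincare ratios. Hence iterates of \<open>f\<close> control cross
  ratios up to the exponential of a sum of lengths of disjoint arcs. Applied to closest returns this
  bounds the preimages of \<open>U\<close> from below relative to the gaps between them; so the preimages of \<open>U\<close> have
  full length, and the distortion errors tend to zero.

  Let \<open>Y n\<close> and \<open>m n\<close> be the distances of \<open>F(U)\<close> from its closest forward and backward returns.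
  If the rotation number is of bounded type, the ratios of consecutive \<open>Y\<close> are controlled by the ratios
  of consecutive \<open>m\<close>, and for \<open>\<nu> > 2\<close> the resulting second order recursion keeps
  \<open>ln (Y n * Y (n - 1) / (m n)\<^sup>2)\<close> bounded on one side, which bounds \<open>Y (n + 2) / Y n\<close> from below.
  If \<open>\<nu> \<le> 2\<close>, then \<open>Q n = sqrt (Y (n + 1) * Y n) * (1 / m (n + 1) + 1 / m n)\<close> is almost
  nondecreasing, also along the intermediate returns. As long as \<open>Q\<close> is bounded it gains a definite
  factor at every level; a long run of nearly parabolic returns cannot destroy the gain, because
  \<open>x \<mapsto> x powr (1 / \<nu>)\<close> strictly decreases Poincare ratios. So \<open>Q\<close> tends to infinity, and this
  forces \<open>Y (n + 2) / Y n\<close> to tend to zero.\<close>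

section \<open>Distortion of cross ratios\<close>

text \<open>Distortion is always charged to a single arc of a cross ratio: the iterates of that arc
  can be kept disjoint from each other and from many preimages of \<open>U\<close>, so the errors
  sum to at most the length those preimages leave over. The exponent two is critical because
  \<open>Q\<close> contains a square root: for \<open>\<nu> \<le> 2\<close>, half the drop of
  \<open>ln Y\<close> between intermediate returns is at most, up to distortion, the drop of the
  logarithm of the distance to \<open>U\<close>, which cross ratios bound. The obstacle there is
  that a level may contain arbitrarily many intermediate returns, so small errors can pile up. A
  bound on \<open>Q\<close> confines the logarithms of the heights to a fixed range; a dangerous run
  then consists of tiny steps, and four well separated ones among them would contradict the strict
  contraction by powers. \<open>Q\<close> governs the ratio because \<open>Y (n + 2)\<close>
  comparable to \<open>Y n\<close> would force \<open>m n\<close> and \<open>m (n + 1)\<close> to be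
  at least of the order of \<open>Y n\<close>, hence \<open>Q n\<close> to be bounded. For
  \<open>\<nu> > 2\<close> the excess \<open>\<nu> - 2\<close> acts as friction in the recursion;
  comparing ratios of \<open>Y\<close> with ratios of \<open>m\<close> costs a constant per
  intermediate return, whence bounded type.\<close>

definition cr :: "real \<Rightarrow> real \<Rightarrow> real \<Rightarrow> real \<Rightarrow> real" where
  "cr w x y z = (x - w) * (z - y) / ((y - w) * (z - x))"

text \<open>In the Poincare metric of \<open>(w, z)\<close> the arc \<open>[x, y]\<close> has length
  \<open>- ln (cr w x y z)\<close>, so \<open>po\<close> is one minus the exponential of minus that
  length: it grows exactly when the arc gets longer in this metric.\<close>

definition po :: "real \<Rightarrow> real \<Rightarrow> real \<Rightarrow> real \<Rightarrow> real" where
  "po w x y z = (y - x) * (z - w) / ((y - w) * (z - x))"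

lemma cr_po: "w < y \<Longrightarrow> x < z \<Longrightarrow> cr w x y z = 1 - po w x y z"
  unfolding cr_def po_def
  by (subst diff_divide_eq_iff, simp, simp add: divide_eq_eq eq_divide_eq)
     (simp add: algebra_simps diff_divide_distrib[symmetric] add_divide_distrib[symmetric])

text \<open>The hypothesis \<open>gm\<close> says that the mixed second derivative of
  \<open>ln ((g t - g s) / (t - s))\<close> is nonpositive. Its integral over \<open>s\<close> in
  \<open>[w, x]\<close> and \<open>t\<close> in \<open>[y, z]\<close> is the difference of the
  logarithms of the two Poincare ratios, up to sign.\<close>

lemma po_expand:
  fixes g p :: "real \<Rightarrow> real"
  assumes cont: "continuous_on {b..e} g"
    and der: "\<And>x. b < x \<Longrightarrow> x < e \<Longrightarrow> (g has_real_derivative p x) (at x)"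
    and inc: "\<And>x y. b \<le> x \<Longrightarrow> x < y \<Longrightarrow> y \<le> e \<Longrightarrow> g x < g y"
    and gm: "\<And>s t. b < s \<Longrightarrow> s < t \<Longrightarrow> t < e \<Longrightarrow> p s * p t * (t - s)\<^sup>2 \<le> (g t - g s)\<^sup>2"
    and ord: "b \<le> w" "w < x" "x < y" "y < z" "z \<le> e"
  shows "po w x y z \<le> po (g w) (g x) (g y) (g z)"
proof -
  define \<phi> where "\<phi> t = ln ((g t - g x) / (t - x)) - ln ((g t - g w) / (t - w))" for t
  \<comment> \<open>This is the integration over \<open>s\<close>; monotonicity of
    \<open>\<phi>\<close> below is the one over \<open>t\<close>.\<close>
  have psi: "p t / (g t - g x) - 1 / (t - x) \<le> p t / (g t - g w) - 1 / (t - w)"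
    if t: "y < t" "t < z" for t
  proof -
    define \<psi> where "\<psi> s = p t / (g t - g s) - 1 / (t - s)" for s
    have "\<psi> x \<le> \<psi> w"
    proof (rule DERIV_nonpos_imp_decreasing_open[of w x])
      show "w \<le> x" using ord by simp
    next
      fix s assume s: "w < s" "s < x"
      have gs: "g t - g s > 0" using inc[of s t] s t ord by simp
      have gmst: "p s * p t * (t - s)\<^sup>2 \<le> (g t - g s)\<^sup>2" using gm[of s t] s t ord by simp
      have "(\<psi> has_real_derivative p t * p s / (g t - g s)\<^sup>2 - 1 / (t - s)\<^sup>2) (at s)"
        unfolding \<psi>_def
        apply (rule derivative_eq_intros der | use s t ord gs in \<open>simp; fail\<close>)+
        by (simp add: power2_eq_square)
      moreover have "p t * p s / (g t - g s)\<^sup>2 - 1 / (t - s)\<^sup>2 \<le> 0"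
      proof -
        have "p t * p s / (g t - g s)\<^sup>2 \<le> 1 / (t - s)\<^sup>2"
          using gmst gs s t ord by (simp add: divide_simps mult.commute mult.left_commute split: if_splits)
        then show ?thesis by simp
      qed
      ultimately show "\<exists>d. (\<psi> has_real_derivative d) (at s) \<and> d \<le> 0" by blast
    next
      have "continuous_on {w..x} g" using cont by (rule continuous_on_subset) (use ord in auto)
      moreover have "g t - g s \<noteq> 0" if "s \<in> {w..x}" for s using inc[of s t] that t ord by simp
      ultimately show "continuous_on {w..x} \<psi>" unfolding \<psi>_def
        by (intro continuous_intros) (use t ord in auto)
    qed
    then show ?thesis by (simp add: \<psi>_def)
  qed
  have posx: "g t - g x > 0" if "t \<in> {y..z}" for t using inc[of x t] that ord by simp
  have posw: "g t - g w > 0" if "t \<in> {y..z}" for t using inc[of w t] that ord by simp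
  have "\<phi> z \<le> \<phi> y"
  proof (rule DERIV_nonpos_imp_decreasing_open[of y z])
    show "y \<le> z" using ord by simp
  next
    fix t assume t: "y < t" "t < z"
    have P: "g t - g x > 0" "g t - g w > 0" using posx[of t] posw[of t] t by auto
    have Q: "(g t - g x) / (t - x) > 0" "(g t - g w) / (t - w) > 0" using P t ord by auto
    have d: "(g has_real_derivative p t) (at t)" using der[of t] t ord by auto
    have "(\<phi> has_real_derivative (p t / (g t - g x) - 1 / (t - x)) - (p t / (g t - g w) - 1 / (t - w))) (at t)"
      unfolding \<phi>_def
      using P t ord Q d
      by (auto intro!: derivative_eq_intros simp: divide_simps) (simp add: algebra_simps)?
    then show "\<exists>d. (\<phi> has_real_derivative d) (at t) \<and> d \<le> 0" using psi[OF t] by fastforce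
  next
    have c: "continuous_on {y..z} g" using cont by (rule continuous_on_subset) (use ord in auto)
    have n: "g t - g x \<noteq> 0" "g t - g w \<noteq> 0" if "t \<in> {y..z}" for t using posx[of t] posw[of t] that by auto
    have "t - x \<noteq> 0" "t - w \<noteq> 0" if "t \<in> {y..z}" for t using that ord by auto
    then show "continuous_on {y..z} \<phi>" unfolding \<phi>_def
      by (intro continuous_intros c) (use n in auto)
  qed
  moreover have "ln (po (g w) (g x) (g y) (g z)) - ln (po w x y z) = \<phi> y - \<phi> z"
  proof -
    have "g y - g x > 0" "g z - g x > 0" "g y - g w > 0" "g z - g w > 0"
      using posx[of y] posx[of z] posw[of y] posw[of z] ord by auto
    moreover have "y - x > 0" "z - x > 0" "y - w > 0" "z - w > 0" using ord by auto
    ultimately show ?thesis unfolding \<phi>_def po_def by (simp add: ln_div ln_mult)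
  qed
  moreover have "po (g w) (g x) (g y) (g z) > 0" "po w x y z > 0"
    unfolding po_def using posx[of y] posx[of z] posw[of y] posw[of z] ord by auto
  ultimately show ?thesis by (smt (verit) ln_less_cancel_iff)
qed

text \<open>Two adjacent arcs are stretched by their own factors \<open>v1\<close> and
  \<open>v2\<close>. These differ by a relative amount \<open>C * d\<close>, with \<open>d\<close>
  the length of the union, but the second arc carries a share of order \<open>K / d\<close> of the
  total. So \<open>d\<close> cancels, and the error is proportional to the length \<open>K\<close>
  of the second arc alone.\<close>

lemma lnratio:
  fixes v1 v2 G1 G2 C D d K :: real
  assumes pos: "v1 > 0" "v2 > 0" "G1 > 0" "G2 > 0" and C: "C \<ge> 0" and d: "0 < d" "d \<le> 1"
    and lip: "\<bar>ln v1 - ln v2\<bar> \<le> C * d"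
    and dbl: "G2 / (G1 + G2) \<le> D * K / d" and K: "K \<ge> 0" "D \<ge> 0"
  shows "\<bar>ln ((v1 * G1 + v2 * G2) / (v1 * G1)) - ln ((G1 + G2) / G1)\<bar> \<le> D * C * exp C * K"
proof -
  define r q where "r = v2 / v1" and "q = G2 / G1"
  have rq: "r > 0" "q > 0" using pos by (auto simp: r_def q_def)
  have e1: "(v1 * G1 + v2 * G2) / (v1 * G1) = 1 + r * q"
    using pos by (simp add: r_def q_def field_simps)
  have e2: "(G1 + G2) / G1 = 1 + q" using pos by (simp add: q_def field_simps)
  have lam: "q / (1 + q) \<le> D * K / d" using dbl pos by (simp add: q_def field_simps)
  have lnr: "\<bar>ln r\<bar> \<le> C * d" using lip pos by (simp add: r_def ln_div abs_minus_commute)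
  have key: "(exp (C * d) - 1) * (D * K / d) \<le> D * C * exp C * K"
  proof -
    have "1 \<le> exp (- (C * d)) + C * d" using exp_ge_add_one_self[of "-(C*d)"] by simp
    then have "exp (C*d) * 1 \<le> exp (C*d) * (exp (- (C * d)) + C * d)" by (intro mult_left_mono) auto
    then have "exp (C * d) - 1 \<le> C * d * exp (C * d)" by (simp add: algebra_simps flip: exp_add)
    also have "\<dots> \<le> C * d * exp C" using C d by (intro mult_left_mono) (auto simp: mult_left_le)
    finally have "(exp (C * d) - 1) * (D * K / d) \<le> C * d * exp C * (D * K / d)"
      using K d by (intro mult_right_mono) auto
    also have "\<dots> = D * C * exp C * K" using d by simp
    finally show ?thesis .
  qed
  \<comment> \<open>Needed twice: with \<open>r\<close> for the upper bound, and with
    \<open>1 / r\<close> for the lower one, where the weighted and the unweighted sum change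
    places.\<close>
  have gen: "ln (1 + s * u) - ln (1 + u) \<le> D * C * exp C * K"
    if su: "s > 0" "u > 0" and lns: "\<bar>ln s\<bar> \<le> C * d" and ul: "u / (1 + u) \<le> D * K / d" for s u
  proof (cases "s \<ge> 1")
    case True
    have "s \<le> exp (C * d)" using lns su by (metis abs_le_D1 exp_le_cancel_iff exp_ln)
    have "1 + (s - 1) * (u / (1 + u)) = (1 + s * u) / (1 + u)" using su by (simp add: field_simps)
    then have "ln (1 + s * u) - ln (1 + u) = ln (1 + (s - 1) * (u / (1 + u)))"
      using su True mult_pos_pos[of s u] by (simp add: ln_div add_pos_pos less_imp_neq[symmetric])
    also have "\<dots> \<le> (s - 1) * (u / (1 + u))"
      using True su by (intro ln_add_one_self_le_self) auto
    also have "\<dots> \<le> (exp (C * d) - 1) * (D * K / d)"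
      using \<open>s \<le> exp (C * d)\<close> True ul su C d by (intro mult_mono) auto
    also note key
    finally show ?thesis .
  next
    case False
    then have "ln (1 + s * u) \<le> ln (1 + u)" using su by (subst ln_le_cancel_iff) (auto simp: add_pos_pos)
    moreover have "D * C * exp C * K \<ge> 0" using K C by simp
    ultimately show ?thesis by linarith
  qed
  have up: "ln (1 + r * q) - ln (1 + q) \<le> D * C * exp C * K" using gen rq lnr lam by blast
  have lo: "ln (1 + q) - ln (1 + r * q) \<le> D * C * exp C * K"
  proof (cases "r \<le> 1")
    case True
    have "r * q / (1 + r * q) \<le> q / (1 + q)"
      using True rq by (simp add: divide_simps add_pos_pos) (simp add: algebra_simps mult_left_le_one_le split: if_splits)
    then have "r * q / (1 + r * q) \<le> D * K / d" using lam by linarith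
    then have "ln (1 + 1 / r * (r * q)) - ln (1 + r * q) \<le> D * C * exp C * K"
      using rq lnr by (intro gen) (auto simp: ln_div)
    then show ?thesis using rq by simp
  next
    case False
    then have "ln (1 + q) \<le> ln (1 + r * q)" using rq by (subst ln_le_cancel_iff) (auto simp: add_pos_pos)
    moreover have "D * C * exp C * K \<ge> 0" using K C by simp
    ultimately show ?thesis by linarith
  qed
  show ?thesis unfolding e1 e2 using up lo by linarith
qed

text \<open>One gap between consecutive lifts of \<open>U\<close>, with \<open>\<kappa>\<close>
  standing for \<open>\<nu> - 1\<close>. Taking the product of the distances to both ends as weight
  gives the explicit inequality \<open>pp_gm\<close>, which plays the part of a negative Schwarzian
  for a map that is only twice differentiable.\<close>

locale profile =
  fixes b e \<kappa> C :: real and f f' :: "real \<Rightarrow> real"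
  assumes be: "b < e" "e \<le> b + 1" and kappa: "\<kappa> > 0" and C0: "C \<ge> 0"
    and contf: "continuous_on {b..e} f"
    and derf: "\<And>x. b < x \<Longrightarrow> x < e \<Longrightarrow> (f has_real_derivative f' x) (at x)"
    and posf: "\<And>x. b < x \<Longrightarrow> x < e \<Longrightarrow> f' x > 0"
    and lip: "\<And>x y. b < x \<Longrightarrow> x < e \<Longrightarrow> b < y \<Longrightarrow> y < e \<Longrightarrow>
       \<bar>ln (f' x / ((x - b) * (e - x)) powr \<kappa>) - ln (f' y / ((y - b) * (e - y)) powr \<kappa>)\<bar> \<le> C * \<bar>x - y\<bar>"
begin

definition pp where "pp x = ((x - b) * (e - x)) powr \<kappa>"
definition g where "g x = integral {b..x} pp"

lemma pp_pos: "b < x \<Longrightarrow> x < e \<Longrightarrow> pp x > 0"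
  by (simp add: pp_def)

lemma cont_pp: "continuous_on {b..e} pp"
  unfolding pp_def using kappa by (intro continuous_on_powr' continuous_intros) auto

lemma contg: "continuous_on {b..e} g"
  unfolding g_def by (intro indefinite_integral_continuous_1 integrable_continuous_real cont_pp)

lemma derg: "b < x \<Longrightarrow> x < e \<Longrightarrow> (g has_real_derivative pp x) (at x)"
  using integral_has_real_derivative[OF cont_pp, of x] at_within_Icc_at[of b x e]
  by (simp add: g_def[abs_def])

lemma inc_of_der:
  assumes "continuous_on {b..e} h" "\<And>x. b < x \<Longrightarrow> x < e \<Longrightarrow> (h has_real_derivative h' x) (at x)"
    "\<And>x. b < x \<Longrightarrow> x < e \<Longrightarrow> h' x > 0" "b \<le> x" "x < y" "y \<le> e"
  shows "h x < h y"
proof (rule DERIV_pos_imp_increasing_open[of x y h])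
  show "continuous_on {x..y} h" using assms(1) by (rule continuous_on_subset) (use assms in auto)
  show "\<exists>d. (h has_real_derivative d) (at t) \<and> 0 < d" if "x < t" "t < y" for t
    using assms(2)[of t] assms(3)[of t] that assms by (intro exI[of _ "h' t"]) auto
qed (use assms in auto)

lemma incg: "b \<le> x \<Longrightarrow> x < y \<Longrightarrow> y \<le> e \<Longrightarrow> g x < g y"
  using inc_of_der[OF contg derg pp_pos] .

lemma incf: "b \<le> x \<Longrightarrow> x < y \<Longrightarrow> y \<le> e \<Longrightarrow> f x < f y"
  using inc_of_der[OF contf derf posf] .

text \<open>With \<open>m\<close> the midpoint, \<open>pp (m - u) * pp (m + u)\<close> decreases in
  \<open>u\<close>, so it is smallest at the ends \<open>s\<close> and \<open>t\<close>. The
  arithmetic-geometric mean inequality turns this into a lower bound for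
  \<open>pp (m - u) + pp (m + u)\<close>, which is integrated over \<open>u\<close>.\<close>

lemma pp_gm:
  assumes "b < s" "s < t" "t < e"
  shows "pp s * pp t * (t - s)\<^sup>2 \<le> (g t - g s)\<^sup>2"
proof -
  define m h where "m = (s + t) / 2" and "h = (t - s) / 2"
  have st: "s = m - h" "t = m + h" and h: "h > 0" using assms by (auto simp: m_def h_def field_simps)
  define S where "S = sqrt (pp s * pp t)"
  have S0: "S \<ge> 0" by (simp add: S_def pp_def)
  define \<Phi> where "\<Phi> u = g (m + u) - g (m - u) - 2 * u * S" for u
  have "\<Phi> 0 \<le> \<Phi> h"
  proof (rule DERIV_nonneg_imp_increasing_open[of 0 h])
    show "0 \<le> h" using h by simp
  next
    fix u assume u: "0 < u" "u < h"
    have r: "b < m + u" "m + u < e" "b < m - u" "m - u < e" using u assms st by auto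
    have sq: "u * u \<le> h * h" using u by (intro mult_mono) auto
    have "pp s * pp t = (((m - b)\<^sup>2 - h\<^sup>2) * ((e - m)\<^sup>2 - h\<^sup>2)) powr \<kappa>"
      using assms unfolding pp_def st by (subst powr_mult[symmetric]) (auto simp: power2_eq_square algebra_simps)
    also have "\<dots> \<le> (((m - b)\<^sup>2 - u\<^sup>2) * ((e - m)\<^sup>2 - u\<^sup>2)) powr \<kappa>"
    proof (rule powr_mono2)
      have 1: "h\<^sup>2 \<le> (m - b)\<^sup>2" "h\<^sup>2 \<le> (e - m)\<^sup>2" using assms st h by (intro power_mono; simp)+
      have 2: "u\<^sup>2 \<le> h\<^sup>2" using sq by (simp add: power2_eq_square)
      show "0 \<le> ((m - b)\<^sup>2 - h\<^sup>2) * ((e - m)\<^sup>2 - h\<^sup>2)" using 1 by simp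
      show "((m - b)\<^sup>2 - h\<^sup>2) * ((e - m)\<^sup>2 - h\<^sup>2) \<le> ((m - b)\<^sup>2 - u\<^sup>2) * ((e - m)\<^sup>2 - u\<^sup>2)"
        using 1 2 by (intro mult_mono) auto
    qed (use kappa in simp)
    also have "\<dots> = pp (m - u) * pp (m + u)"
      using r unfolding pp_def by (subst powr_mult[symmetric]) (auto simp: power2_eq_square algebra_simps)
    finally have "S \<le> sqrt (pp (m - u) * pp (m + u))" unfolding S_def by simp
    also have "\<dots> \<le> (pp (m - u) + pp (m + u)) / 2"
      by (rule arith_geo_mean_sqrt) (auto simp: pp_def)
    finally have ge: "0 \<le> pp (m + u) + pp (m - u) - 2 * S" by simp
    have "(\<Phi> has_real_derivative pp (m + u) + pp (m - u) - 2 * S) (at u)"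
      unfolding \<Phi>_def
      by (rule derivative_eq_intros DERIV_chain2[OF derg] r | simp)+
    then show "\<exists>d. (\<Phi> has_real_derivative d) (at u) \<and> 0 \<le> d" using ge by blast
  next
    have "continuous_on {0..h} (\<lambda>u. g (m + u))" "continuous_on {0..h} (\<lambda>u. g (m - u))"
      by (rule continuous_on_compose2[OF contg]; use assms st in \<open>auto intro!: continuous_intros\<close>)+
    then show "continuous_on {0..h} \<Phi>" unfolding \<Phi>_def by (intro continuous_intros)
  qed
  then have "(t - s) * S \<le> g t - g s" by (simp add: \<Phi>_def st algebra_simps)
  then have "((t - s) * S)\<^sup>2 \<le> (g t - g s)\<^sup>2" using S0 assms by (intro power_mono) auto
  moreover have "S\<^sup>2 = pp s * pp t" unfolding S_def by (simp add: pp_def)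
  ultimately show ?thesis by (simp add: power_mult_distrib mult.commute)
qed

lemma po_g:
  "b \<le> w \<Longrightarrow> w < x \<Longrightarrow> x < y \<Longrightarrow> y < z \<Longrightarrow> z \<le> e \<Longrightarrow> po w x y z \<le> po (g w) (g x) (g y) (g z)"
  by (rule po_expand[OF contg derg incg pp_gm])

definition vv where "vv x = f' x / pp x"
text \<open>The distance to \<open>b\<close> or to \<open>e\<close> of any point of an interval is
  at most four times that of a point of its middle half, so the weights compare up to
  \<open>(4 * 4) powr \<kappa>\<close>; the factor 2 is the cost of passing to the middle
  half.\<close>

definition D0 where "D0 = 2 * 16 powr \<kappa>"

lemma vv_pos: "b < x \<Longrightarrow> x < e \<Longrightarrow> vv x > 0"
  using posf pp_pos by (simp add: vv_def)

lemma cauchy_mvt: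
  assumes "b \<le> x" "x < y" "y \<le> e"
  shows "\<exists>\<xi>. x < \<xi> \<and> \<xi> < y \<and> f y - f x = vv \<xi> * (g y - g x)"
proof -
  define h where "h t = f t * (g y - g x) - g t * (f y - f x)" for t
  have sub: "{x..y} \<subseteq> {b..e}" using assms by auto
  have "continuous_on {x..y} h" unfolding h_def
    by (intro continuous_intros continuous_on_subset[OF contf sub] continuous_on_subset[OF contg sub])
  moreover have der: "(h has_real_derivative (f' t * (g y - g x) - pp t * (f y - f x))) (at t)"
    if "x < t" "t < y" for t
    unfolding h_def using derf[of t] derg[of t] that assms by (auto intro!: derivative_eq_intros)
  ultimately obtain l z where z: "x < z" "z < y" "(h has_real_derivative l) (at z)" "h y - h x = (y - x) * l"
    using MVT[of x y h] assms(2) by (meson differentiableI real_differentiable_def)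
  have "l = f' z * (g y - g x) - pp z * (f y - f x)" using DERIV_unique[OF z(3) der[OF z(1,2)]] .
  moreover have "h y - h x = 0" by (simp add: h_def algebra_simps)
  ultimately have "f' z * (g y - g x) = pp z * (f y - f x)" using z assms by simp
  then have "f y - f x = vv z * (g y - g x)"
    using pp_pos[of z] z assms by (simp add: vv_def field_simps)
  then show ?thesis using z by blast
qed

lemma mvt_g:
  assumes "b \<le> x" "x < y" "y \<le> e"
  shows "\<exists>\<xi>. x < \<xi> \<and> \<xi> < y \<and> g y - g x = (y - x) * pp \<xi>"
proof -
  have sub: "{x..y} \<subseteq> {b..e}" using assms by auto
  obtain l z where z: "x < z" "z < y" "(g has_real_derivative l) (at z)" "g y - g x = (y - x) * l"
    using MVT[of x y g] assms continuous_on_subset[OF contg sub] derg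
    by (meson differentiableI real_differentiable_def le_less_trans less_le_trans)
  then show ?thesis using DERIV_unique[OF z(3) derg[of z]] assms by auto
qed

lemma D0_pos: "D0 > 0" by (simp add: D0_def)

lemma dbl_g:
  assumes "b \<le> w" "w \<le> x" "x < y" "y \<le> z" "z \<le> e"
  shows "(g y - g x) / (g z - g w) \<le> D0 * (y - x) / (z - w)"
proof -
  define h where "h = (z - w) / 4"
  have h: "h > 0" using assms by (simp add: h_def)
  have zw: "z = w + 4 * h" by (simp add: h_def field_simps)
  obtain \<xi> where xi: "x < \<xi>" "\<xi> < y" "g y - g x = (y - x) * pp \<xi>" using mvt_g[of x y] assms by auto
  obtain \<eta> where eta: "w + h < \<eta>" "\<eta> < z - h" "g (z - h) - g (w + h) = (z - h - (w + h)) * pp \<eta>"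
  proof -
    have "b \<le> w + h" "w + h < z - h" "z - h \<le> e" using assms h zw by auto
    then show ?thesis using mvt_g that by blast
  qed
  have "\<xi> - b \<le> 4 * (\<eta> - b)" "e - \<xi> \<le> 4 * (e - \<eta>)" "0 \<le> 4 * (\<eta> - b)" "0 \<le> e - \<xi>"
    using xi(1,2) eta(1,2) assms h zw by auto
  then have "(\<xi> - b) * (e - \<xi>) \<le> (4 * (\<eta> - b)) * (4 * (e - \<eta>))"
    by (rule mult_mono)
  also have "\<dots> = 16 * ((\<eta> - b) * (e - \<eta>))" by algebra
  finally have "(\<xi> - b) * (e - \<xi>) \<le> 16 * ((\<eta> - b) * (e - \<eta>))" .
  then have "pp \<xi> \<le> (16 * ((\<eta> - b) * (e - \<eta>))) powr \<kappa>"
    unfolding pp_def using kappa xi(1,2) assms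
    by (intro powr_mono2 mult_nonneg_nonneg) auto
  also have "\<dots> = 16 powr \<kappa> * pp \<eta>" using eta assms h by (simp add: pp_def powr_mult)
  finally have 1: "pp \<xi> \<le> 16 powr \<kappa> * pp \<eta>" .
  have "g w \<le> g (w + h)" "g (z - h) \<le> g z" using incg[of w "w + h"] incg[of "z - h" z] assms h zw by auto
  then have "g z - g w \<ge> (z - h - (w + h)) * pp \<eta>" using eta(3) by linarith
  then have 2: "g z - g w \<ge> (z - w) / 2 * pp \<eta>" using zw by (simp add: algebra_simps)
  have pe: "pp \<eta> > 0" using pp_pos[of \<eta>] eta h assms by auto
  have "g y - g x \<le> (y - x) * (16 powr \<kappa> * pp \<eta>)" using xi 1 assms by (simp add: mult_left_mono)
  also have "\<dots> = D0 * (y - x) / (z - w) * ((z - w) / 2 * pp \<eta>)" using assms by (simp add: D0_def)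
  also have "\<dots> \<le> D0 * (y - x) / (z - w) * (g z - g w)" using 2 assms D0_pos by (intro mult_left_mono) auto
  finally show ?thesis using incg[of w z] assms by (simp add: divide_le_eq)
qed

definition C2 where "C2 = D0 * C * exp C"

lemma lip_vv: "b < x \<Longrightarrow> x < e \<Longrightarrow> b < y \<Longrightarrow> y < e \<Longrightarrow> \<bar>ln (vv x) - ln (vv y)\<bar> \<le> C * \<bar>x - y\<bar>"
  using lip by (simp add: vv_def pp_def)

lemma ratio_right:
  assumes "b \<le> x" "x < y" "y < z" "z \<le> e"
  shows "\<bar>ln ((f z - f x) / (f y - f x)) - ln ((g z - g x) / (g y - g x))\<bar> \<le> C2 * (z - y)"
proof -
  obtain \<xi> where xi: "x < \<xi>" "\<xi> < y" "f y - f x = vv \<xi> * (g y - g x)" using cauchy_mvt[of x y] assms by auto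
  obtain \<eta> where eta: "y < \<eta>" "\<eta> < z" "f z - f y = vv \<eta> * (g z - g y)" using cauchy_mvt[of y z] assms by auto
  have "\<bar>ln ((vv \<xi> * (g y - g x) + vv \<eta> * (g z - g y)) / (vv \<xi> * (g y - g x))) - ln (((g y - g x) + (g z - g y)) / (g y - g x))\<bar> \<le> D0 * C * exp C * (z - y)"
  proof (rule lnratio[where d = "z - x"])
    show "\<bar>ln (vv \<xi>) - ln (vv \<eta>)\<bar> \<le> C * (z - x)"
      using lip_vv[of \<xi> \<eta>] xi eta assms C0 mult_left_mono[of "\<bar>\<xi> - \<eta>\<bar>" "z - x" C] by auto
    show "(g z - g y) / (g y - g x + (g z - g y)) \<le> D0 * (z - y) / (z - x)"
      using dbl_g[of x y z z] assms by simp
  qed (use xi eta assms vv_pos incg be C0 D0_pos in auto)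
  moreover have "vv \<xi> * (g y - g x) + vv \<eta> * (g z - g y) = f z - f x" using xi eta by simp
  ultimately show ?thesis using xi by (simp add: C2_def)
qed

lemma ratio_left:
  assumes "b \<le> x" "x < y" "y < z" "z \<le> e"
  shows "\<bar>ln ((f z - f x) / (f z - f y)) - ln ((g z - g x) / (g z - g y))\<bar> \<le> C2 * (y - x)"
proof -
  obtain \<xi> where xi: "x < \<xi>" "\<xi> < y" "f y - f x = vv \<xi> * (g y - g x)" using cauchy_mvt[of x y] assms by auto
  obtain \<eta> where eta: "y < \<eta>" "\<eta> < z" "f z - f y = vv \<eta> * (g z - g y)" using cauchy_mvt[of y z] assms by auto
  have "\<bar>ln ((vv \<eta> * (g z - g y) + vv \<xi> * (g y - g x)) / (vv \<eta> * (g z - g y))) - ln (((g z - g y) + (g y - g x)) / (g z - g y))\<bar> \<le> D0 * C * exp C * (y - x)"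
  proof (rule lnratio[where d = "z - x"])
    show "\<bar>ln (vv \<eta>) - ln (vv \<xi>)\<bar> \<le> C * (z - x)"
      using lip_vv[of \<eta> \<xi>] xi eta assms C0 mult_left_mono[of "\<bar>\<eta> - \<xi>\<bar>" "z - x" C] by auto
    show "(g y - g x) / (g z - g y + (g y - g x)) \<le> D0 * (y - x) / (z - x)"
      using dbl_g[of x x y z] assms by simp
  qed (use xi eta assms vv_pos incg be C0 D0_pos in auto)
  moreover have "vv \<eta> * (g z - g y) + vv \<xi> * (g y - g x) = f z - f x" using xi eta by simp
  ultimately show ?thesis using eta by (simp add: C2_def)
qed

text \<open>The primitive \<open>g\<close> moves both ratios in the favourable direction, so only
  the passage from \<open>g\<close> to \<open>f\<close> costs something. Each cross ratio is a
  combination of two quotients of a whole by a part, and the factorisation can be chosen so that the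
  part left out is the same arc in both. This puts the error on the middle arc for
  \<open>cr\<close>, and on either outer arc for \<open>po\<close>.\<close>

lemma distortion:
  assumes ord: "b \<le> w" "w < x" "x < y" "y < z" "z \<le> e"
  shows "cr (f w) (f x) (f y) (f z) \<le> exp (2 * C2 * (y - x)) * cr w x y z"
    and "po (f w) (f x) (f y) (f z) \<ge> exp (- (2 * C2 * (x - w))) * po w x y z"
    and "po (f w) (f x) (f y) (f z) \<ge> exp (- (2 * C2 * (z - y))) * po w x y z"
proof -
  have F: "f w < f x" "f x < f y" "f y < f z" using incf ord by auto
  have G: "g w < g x" "g x < g y" "g y < g z" using incg ord by auto
  have lnpo: "ln (po p1 p2 p3 p4) = ln ((p4 - p1) / (p3 - p1)) - ln ((p4 - p2) / (p3 - p2))"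
       "ln (po p1 p2 p3 p4) = ln ((p4 - p1) / (p4 - p2)) - ln ((p3 - p1) / (p3 - p2))"
       "ln (cr p1 p2 p3 p4) = - ln ((p3 - p1) / (p2 - p1)) - ln ((p4 - p2) / (p4 - p3))"
    if "p1 < p2" "p2 < p3" "p3 < p4" for p1 p2 p3 p4 :: real
    using that by (simp_all add: po_def cr_def ln_div ln_mult)
  have pos: "po (f w) (f x) (f y) (f z) > 0" "po (g w) (g x) (g y) (g z) > 0" "po w x y z > 0"
    "cr (f w) (f x) (f y) (f z) > 0" "cr (g w) (g x) (g y) (g z) > 0" "cr w x y z > 0"
    using F G ord by (simp_all add: po_def cr_def)
  have pg: "ln (po w x y z) \<le> ln (po (g w) (g x) (g y) (g z))"
    using po_g[OF ord] pos by simp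
  have "cr (g w) (g x) (g y) (g z) \<le> cr w x y z"
    using po_g[OF ord] G ord by (simp add: cr_po)
  then have cg: "ln (cr (g w) (g x) (g y) (g z)) \<le> ln (cr w x y z)" using pos by simp
  have "ln (cr (f w) (f x) (f y) (f z)) \<le> ln (cr (g w) (g x) (g y) (g z)) + 2 * C2 * (y - x)"
    using ratio_right[of w x y] ratio_left[of x y z] ord unfolding lnpo(3)[OF F] lnpo(3)[OF G]
    by (auto simp: abs_le_iff)
  then have "ln (cr (f w) (f x) (f y) (f z)) \<le> ln (exp (2 * C2 * (y - x)) * cr w x y z)"
    using cg pos(6) by (subst ln_mult_pos) (auto simp: ln_exp)
  then show "cr (f w) (f x) (f y) (f z) \<le> exp (2 * C2 * (y - x)) * cr w x y z"
    using pos by (subst (asm) ln_le_cancel_iff) auto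
  have "ln (po (f w) (f x) (f y) (f z)) \<ge> ln (po (g w) (g x) (g y) (g z)) - 2 * C2 * (x - w)"
    using ratio_left[of w x z] ratio_left[of w x y] ord unfolding lnpo(2)[OF F] lnpo(2)[OF G]
    by (auto simp: abs_le_iff)
  then have "ln (po (f w) (f x) (f y) (f z)) \<ge> ln (exp (- (2 * C2 * (x - w))) * po w x y z)"
    using pg pos(3) by (subst ln_mult_pos) (auto simp: ln_exp)
  then show "po (f w) (f x) (f y) (f z) \<ge> exp (- (2 * C2 * (x - w))) * po w x y z"
    using pos by (subst (asm) ln_le_cancel_iff) auto
  have "ln (po (f w) (f x) (f y) (f z)) \<ge> ln (po (g w) (g x) (g y) (g z)) - 2 * C2 * (z - y)"
    using ratio_right[of w y z] ratio_right[of x y z] ord unfolding lnpo(1)[OF F] lnpo(1)[OF G]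
    by (auto simp: abs_le_iff)
  then have "ln (po (f w) (f x) (f y) (f z)) \<ge> ln (exp (- (2 * C2 * (z - y))) * po w x y z)"
    using pg pos(3) by (subst ln_mult_pos) (auto simp: ln_exp)
  then show "po (f w) (f x) (f y) (f z) \<ge> exp (- (2 * C2 * (z - y))) * po w x y z"
    using pos by (subst (asm) ln_le_cancel_iff) auto
qed

text \<open>A cruder comparison of proportions, up to a constant, for the single step from the
  neighbourhood of the flat spot to that of the critical value.\<close>

lemma doubling:
  assumes "b \<le> w" "w \<le> x" "x < y" "y \<le> z" "z \<le> e"
  shows "f y - f x \<le> exp C * D0 * ((y - x) / (z - w)) * (f z - f w)"
proof -
  obtain \<xi> where xi: "x < \<xi>" "\<xi> < y" "f y - f x = vv \<xi> * (g y - g x)" using cauchy_mvt[of x y] assms by auto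
  obtain \<eta> where eta: "w < \<eta>" "\<eta> < z" "f z - f w = vv \<eta> * (g z - g w)" using cauchy_mvt[of w z] assms by auto
  have "\<bar>\<xi> - \<eta>\<bar> \<le> 1" using xi eta assms be by auto
  then have "\<bar>ln (vv \<xi>) - ln (vv \<eta>)\<bar> \<le> C"
    using lip_vv[of \<xi> \<eta>] xi eta assms mult_left_mono[of "\<bar>\<xi> - \<eta>\<bar>" 1 C] C0 by auto
  then have "ln (vv \<xi>) \<le> ln (exp C * vv \<eta>)" using vv_pos[of \<eta>] eta assms by (simp add: ln_mult)
  then have v: "vv \<xi> \<le> exp C * vv \<eta>" using vv_pos xi eta assms by (subst (asm) ln_le_cancel_iff) auto
  have gg: "g y - g x \<le> D0 * (y - x) / (z - w) * (g z - g w)"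
    using dbl_g[OF assms] incg[of w z] assms by (simp add: divide_le_eq)
  have "f y - f x \<le> (exp C * vv \<eta>) * (D0 * (y - x) / (z - w) * (g z - g w))"
    unfolding xi(3) using v gg vv_pos[of \<eta>] incg[of x y] eta assms by (intro mult_mono) auto
  also have "\<dots> = exp C * D0 * ((y - x) / (z - w)) * (vv \<eta> * (g z - g w))" by simp
  finally show ?thesis unfolding eta(3) .
qed

end

section \<open>Iterates of a map with a flat spot\<close>

lemma arcs_sum:
  fixes X Y :: "'i \<Rightarrow> real"
  assumes fin: "finite I" and le: "\<And>i. i \<in> I \<Longrightarrow> X i \<le> Y i \<and> Y i \<le> X i + 1"
    and dis: "\<And>i j k. i \<in> I \<Longrightarrow> j \<in> I \<Longrightarrow> i \<noteq> j \<Longrightarrow> Y i \<le> X j + of_int k \<or> Y j + of_int k \<le> X i"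
  shows "(\<Sum>i\<in>I. Y i - X i) \<le> 1"
proof -
  define K where "K = {i \<in> I. X i < Y i}"
  have finK: "finite K" using fin by (simp add: K_def)
  have sumK: "(\<Sum>i\<in>I. Y i - X i) = (\<Sum>i\<in>K. Y i - X i)"
    by (rule sum.mono_neutral_right) (use fin le in \<open>force simp: K_def\<close>)+
  show ?thesis
  proof (cases "K = {}")
    case True
    then show ?thesis using sumK by simp
  next
    case False
    then obtain i0 where i0: "i0 \<in> K" by blast
    \<comment> \<open>The translation that brings the left end of arc \<open>i\<close> into the unit
      interval starting at \<open>X i0\<close>. Disjointness from the next copy of arc
      \<open>i0\<close> then keeps its right end inside as well.\<close>
    define n where "n i = \<lfloor>X i - X i0\<rfloor>" for i
    define T where "T i = {X i - n i<..<Y i - n i}" for i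
    have n: "of_int (n i) \<le> X i - X i0" "X i - X i0 < of_int (n i) + 1" for i
      unfolding n_def by linarith+
    have sub: "T i \<subseteq> {X i0..X i0 + 1}" if i: "i \<in> K" for i
    proof -
      have "Y i \<le> X i0 + 1 + n i"
      proof (cases "i = i0")
        case True
        then show ?thesis using le[of i0] i0 by (simp add: n_def K_def)
      next
        case False
        then show ?thesis using dis[of i i0 "n i + 1"] i i0 n[of i] by (force simp: K_def)
      qed
      then show ?thesis using n[of i] by (auto simp: T_def)
    qed
    have disj: "disjoint_family_on T K"
      unfolding disjoint_family_on_def
    proof (intro ballI impI)
      fix i j assume ij: "i \<in> K" "j \<in> K" "i \<noteq> j"
      show "T i \<inter> T j = {}" using dis[of i j "n i - n j"] ij by (auto simp: T_def K_def)
    qed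
    have "(\<Sum>i\<in>K. Y i - X i) = (\<Sum>i\<in>K. measure lborel (T i))"
      by (rule sum.cong) (auto simp: T_def K_def)
    also have "\<dots> = measure lborel (\<Union>i\<in>K. T i)"
    proof (rule measure_finite_Union[symmetric])
      show "emeasure lborel (T i) \<noteq> \<infinity>" if "i \<in> K" for i using that by (simp add: T_def K_def)
      show "T ` K \<subseteq> sets lborel" by (auto simp: T_def)
    qed (use finK disj in simp_all)
    also have "\<dots> \<le> measure lborel {X i0..X i0 + 1}"
    proof (rule measure_mono_fmeasurable)
      show "{X i0..X i0 + 1} \<in> fmeasurable lborel" by (rule fmeasurableI) auto
      show "(\<Union>i\<in>K. T i) \<subseteq> {X i0..X i0 + 1}" using sub by blast
      show "(\<Union>i\<in>K. T i) \<in> sets lborel" using finK by (auto simp: T_def)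
    qed
    finally show ?thesis using sumK by simp
  qed
qed

text \<open>\<open>A e\<close> and \<open>B e\<close> are the ends of a lift of \<open>F\<^sup>e(U)\<close>, a point for \<open>e \<ge> 1\<close>; for negative \<open>e\<close> it
  is a component of a preimage. The number \<open>e * \<rho> + k\<close> serves as a coordinate of \<open>A e + k\<close>, as orbits are
  ordered like those of the rotation by \<open>\<rho>\<close>.\<close>

locale flat =
  fixes f :: "real \<Rightarrow> real" and A B :: "int \<Rightarrow> real" and \<rho> \<nu> C C1 r0 :: real
  assumes mono_f: "mono f" and per: "\<And>x. f (x + 1) = f x + 1"
    and AB0: "A 0 < B 0" "B 0 < A 0 + 1"
    and fA: "\<And>e. f (A e) = A (e + 1)" and fB: "\<And>e. f (B e) = B (e + 1)"
    and AB1: "A 1 = B 1" and ABle: "\<And>e. A e \<le> B e"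
    and irr: "\<rho> \<notin> \<rat>" and rot: "\<And>n x. \<bar>(f ^^ n) x - x - real n * \<rho>\<bar> \<le> 2"
    and nu: "\<nu> > 1" and C0: "C \<ge> 0" and C1: "C1 \<ge> 1" and r0: "r0 > 0"
    and incf: "\<And>x y. B 0 \<le> x \<Longrightarrow> x < y \<Longrightarrow> y \<le> A 0 + 1 \<Longrightarrow> f x < f y"
    and surj: "surj f"
    and dist_cr: "\<And>w x y z. B 0 \<le> w \<Longrightarrow> w < x \<Longrightarrow> x < y \<Longrightarrow> y < z \<Longrightarrow> z \<le> A 0 + 1 \<Longrightarrow>
        cr (f w) (f x) (f y) (f z) \<le> exp (C * (y - x)) * cr w x y z"
    and dist_poL: "\<And>w x y z. B 0 \<le> w \<Longrightarrow> w < x \<Longrightarrow> x < y \<Longrightarrow> y < z \<Longrightarrow> z \<le> A 0 + 1 \<Longrightarrow>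
        po (f w) (f x) (f y) (f z) \<ge> exp (- (C * (x - w))) * po w x y z"
    and dist_poR: "\<And>w x y z. B 0 \<le> w \<Longrightarrow> w < x \<Longrightarrow> x < y \<Longrightarrow> y < z \<Longrightarrow> z \<le> A 0 + 1 \<Longrightarrow>
        po (f w) (f x) (f y) (f z) \<ge> exp (- (C * (z - y))) * po w x y z"
    and dbl: "\<And>w x y z. B 0 \<le> w \<Longrightarrow> w \<le> x \<Longrightarrow> x < y \<Longrightarrow> y \<le> z \<Longrightarrow> z \<le> A 0 + 1 \<Longrightarrow>
        f y - f x \<le> C1 * ((y - x) / (z - w)) * (f z - f w)"
    and pw_right: "\<And>s t. 0 < s \<Longrightarrow> s \<le> t \<Longrightarrow> t < r0 \<Longrightarrow>
        exp (- (C * t)) * (s / t) powr \<nu> * (f (B 0 + t) - A 1) \<le> f (B 0 + s) - A 1 \<and>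
        f (B 0 + s) - A 1 \<le> exp (C * t) * (s / t) powr \<nu> * (f (B 0 + t) - A 1)"
    and pw_left: "\<And>s t. 0 < s \<Longrightarrow> s \<le> t \<Longrightarrow> t < r0 \<Longrightarrow>
        exp (- (C * t)) * (s / t) powr \<nu> * (A 1 - f (A 0 - t)) \<le> A 1 - f (A 0 - s) \<and>
        A 1 - f (A 0 - s) \<le> exp (C * t) * (s / t) powr \<nu> * (A 1 - f (A 0 - t))"
begin

section \<open>Order of the orbit of the flat spot\<close>

lemma per_int: "f (x + of_int k) = f x + of_int k"
proof -
  have 1: "f (x + real n) = f x + real n" for x n
  proof (induction n)
    case (Suc n)
    have "f (x + real (Suc n)) = f ((x + real n) + 1)" by (simp add: algebra_simps)
    then show ?case using per[of "x + real n"] Suc by simp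
  qed simp
  show ?thesis
  proof (cases "k \<ge> 0")
    case True
    then show ?thesis using 1[of x "nat k"] by simp
  next
    case False
    then show ?thesis using 1[of "x + of_int k" "nat (- k)"] by simp
  qed
qed

lemma iter_int: "(f ^^ n) (x + of_int k) = (f ^^ n) x + of_int k"
  by (induction n) (auto simp: per_int)

lemma iter_mono: "x \<le> y \<Longrightarrow> (f ^^ n) x \<le> (f ^^ n) y"
  using mono_f by (induction n) (auto dest: monoD)

lemma iterA: "(f ^^ n) (A e + of_int k) = A (e + int n) + of_int k"
proof (induction n)
  case (Suc n)
  have "(f ^^ Suc n) (A e + of_int k) = f (A (e + int n) + of_int k)" using Suc by simp
  also have "\<dots> = A (e + int (Suc n)) + of_int k" unfolding per_int fA by (simp add: ac_simps)
  finally show ?case .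
qed simp

lemma iterB: "(f ^^ n) (B e + of_int k) = B (e + int n) + of_int k"
proof (induction n)
  case (Suc n)
  have "(f ^^ Suc n) (B e + of_int k) = f (B (e + int n) + of_int k)" using Suc by simp
  also have "\<dots> = B (e + int (Suc n)) + of_int k" unfolding per_int fB by (simp add: ac_simps)
  finally show ?case .
qed simp

lemma AB_eq: "e \<ge> 1 \<Longrightarrow> A e = B e"
  using iterA[of "nat (e - 1)" 1 0] iterB[of "nat (e - 1)" 1 0] AB1 by simp

lemma AB_less: "e \<le> 0 \<Longrightarrow> A e < B e"
  using iterA[of "nat (- e)" e 0] iterB[of "nat (- e)" e 0] AB0 ABle[of e]
  by (cases "A e = B e") auto

lemma irr_eq: "of_int e * \<rho> + of_int k = 0 \<Longrightarrow> e = 0 \<and> k = 0"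
proof -
  assume h: "of_int e * \<rho> + of_int k = 0"
  have "e = 0"
  proof (rule ccontr)
    assume "e \<noteq> 0"
    then have "\<rho> = of_int (- k) / of_int e" using h by (simp add: field_simps add_eq_0_iff)
    then show False using irr by (metis Rats_divide Rats_of_int)
  qed
  then show ?thesis using h by simp
qed

lemma irr_inj: "of_int e * \<rho> + of_int k = of_int e' * \<rho> + of_int k' \<Longrightarrow> e = e' \<and> k = k'"
  using irr_eq[of "e - e'" "k - k'"] by (simp add: algebra_simps)

text \<open>If one point were not moved beyond \<open>p\<close>, monotonicity would carry this over
  to all multiples of \<open>n\<close>, and the displacement would fall behind
  \<open>real n * \<rho>\<close> linearly, against \<open>rot\<close>.\<close>

lemma move_up:
  assumes "real n * \<rho> > of_int p"
  shows "(f ^^ n) x > x + of_int p"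
proof (rule ccontr)
  assume "\<not> ?thesis"
  then have le: "(f ^^ n) x \<le> x + of_int p" by simp
  have it: "(f ^^ (n * j)) x \<le> x + real j * of_int p" for j
  proof (induction j)
    case (Suc j)
    have "(f ^^ (n * Suc j)) x = (f ^^ (n * j)) ((f ^^ n) x)"
      by (simp only: mult_Suc_right add.commute[of n "n * j"] funpow_add comp_apply)
    also have "\<dots> \<le> (f ^^ (n * j)) (x + of_int p)" by (rule iter_mono[OF le])
    also have "\<dots> \<le> x + real (Suc j) * of_int p" using Suc by (simp add: iter_int algebra_simps)
    finally show ?case .
  qed simp
  obtain j :: nat where j: "real j * (real n * \<rho> - of_int p) > 2"
    using reals_Archimedean3[of "real n * \<rho> - of_int p"] assms by auto
  have "real (n * j) * \<rho> - 2 \<le> (f ^^ (n * j)) x - x" using rot[of "n * j" x] by linarith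
  then show False using it[of j] j by (simp add: algebra_simps)
qed

lemma move_down:
  assumes "real n * \<rho> < of_int p"
  shows "(f ^^ n) x < x + of_int p"
proof (rule ccontr)
  assume "\<not> ?thesis"
  then have le: "x + of_int p \<le> (f ^^ n) x" by simp
  have it: "x + real j * of_int p \<le> (f ^^ (n * j)) x" for j
  proof (induction j)
    case (Suc j)
    have "x + real (Suc j) * of_int p \<le> (f ^^ (n * j)) (x + of_int p)" using Suc by (simp add: iter_int algebra_simps)
    also have "\<dots> \<le> (f ^^ (n * j)) ((f ^^ n) x)" by (rule iter_mono[OF le])
    also have "\<dots> = (f ^^ (n * Suc j)) x"
      by (simp only: mult_Suc_right add.commute[of n "n * j"] funpow_add comp_apply)
    finally show ?case .
  qed simp
  obtain j :: nat where j: "real j * (of_int p - real n * \<rho>) > 2"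
    using reals_Archimedean3[of "of_int p - real n * \<rho>"] assms by auto
  have "real (n * j) * \<rho> + 2 \<ge> (f ^^ (n * j)) x - x" using rot[of "n * j" x] by linarith
  then show False using it[of j] j by (simp add: algebra_simps)
qed

text \<open>Iterates are monotone, so a wrong order would persist under forward iteration. At
  positive times both sets are points of one orbit, whose order is decided by \<open>move_up\<close>
  and \<open>move_down\<close>.\<close>

lemma ordBA:
  assumes "of_int e1 * \<rho> + of_int k1 < of_int e2 * \<rho> + of_int k2"
  shows "B e1 + of_int k1 < A e2 + of_int k2"
proof (rule ccontr)
  assume "\<not> ?thesis"
  then have le: "A e2 + of_int k2 \<le> B e1 + of_int k1" by simp
  \<comment> \<open>Large enough for both indices to become at least 1, where \<open>A\<close> and
    \<open>B\<close> agree.\<close>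
  define j where "j = nat (1 + \<bar>e1\<bar> + \<bar>e2\<bar>)"
  have j: "e1 + int j \<ge> 1" "e2 + int j \<ge> 1" by (auto simp: j_def)
  have le2: "A (e2 + int j) + of_int k2 \<le> A (e1 + int j) + of_int k1"
    using iter_mono[OF le, of j] AB_eq[OF j(1)] by (simp add: iterA iterB)
  show False
  proof (cases "e1 \<le> e2")
    case True
    have "A (e1 + int j) + of_int (k1 - k2) < (f ^^ nat (e2 - e1)) (A (e1 + int j))"
      by (rule move_up) (use assms True in \<open>simp add: algebra_simps\<close>)
    also have "\<dots> = A (e2 + int j)" using iterA[of "nat (e2 - e1)" "e1 + int j" 0] True by (simp add: algebra_simps)
    finally show False using le2 by simp
  next
    case False
    have "A (e2 + int j) + of_int (k2 - k1) > (f ^^ nat (e1 - e2)) (A (e2 + int j))"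
      by (rule move_down) (use assms False in \<open>simp add: algebra_simps\<close>)
    moreover have "(f ^^ nat (e1 - e2)) (A (e2 + int j)) = A (e1 + int j)"
      using iterA[of "nat (e1 - e2)" "e2 + int j" 0] False by (simp add: algebra_simps)
    ultimately show False using le2 by simp
  qed
qed

lemma ordAB:
  assumes "of_int e1 * \<rho> + of_int k1 \<le> of_int e2 * \<rho> + of_int k2"
  shows "A e1 + of_int k1 \<le> B e2 + of_int k2"
proof (cases "of_int e1 * \<rho> + of_int k1 = of_int e2 * \<rho> + of_int k2")
  case True
  then have "e1 = e2 \<and> k1 = k2" by (rule irr_inj)
  then show ?thesis using ABle[of e2] by simp
next
  case False
  then have "B e1 + of_int k1 < A e2 + of_int k2" using assms by (intro ordBA) simp
  then show ?thesis using ABle[of e1] ABle[of e2] by linarith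
qed

lemma ordAA: "of_int e1 * \<rho> + of_int k1 < of_int e2 * \<rho> + of_int k2 \<Longrightarrow> A e1 + of_int k1 < A e2 + of_int k2"
  using ordBA[of e1 k1 e2 k2] ABle[of e1] by linarith

lemma ordBB: "of_int e1 * \<rho> + of_int k1 < of_int e2 * \<rho> + of_int k2 \<Longrightarrow> B e1 + of_int k1 < B e2 + of_int k2"
  using ordBA[of e1 k1 e2 k2] ABle[of e2] by linarith

lemma ordAB': "of_int e1 * \<rho> + of_int k1 < of_int e2 * \<rho> + of_int k2 \<Longrightarrow> A e1 + of_int k1 < B e2 + of_int k2"
  using ordBA[of e1 k1 e2 k2] ABle[of e1] ABle[of e2] by linarith

text \<open>The interval \<open>(w, z)\<close> is mapped by \<open>f ^^ i\<close> into a gap between two lifts of \<open>U\<close>, so that the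
  distortion estimates apply to the next step.\<close>

definition ok :: "nat \<Rightarrow> real \<Rightarrow> real \<Rightarrow> bool" where
  "ok i w z \<longleftrightarrow> (\<exists>k::int. B 0 + of_int k \<le> (f ^^ i) w \<and> (f ^^ i) z \<le> A 0 + 1 + of_int k)"

lemma okI:
  assumes "\<And>k::int. (f ^^ i) z \<le> A 0 + of_int k \<or> B 0 + of_int k \<le> (f ^^ i) w"
  shows "ok i w z"
  unfolding ok_def
proof (rule exI[of _ "\<lfloor>(f ^^ i) w - B 0\<rfloor>"], intro conjI)
  show "B 0 + of_int \<lfloor>(f ^^ i) w - B 0\<rfloor> \<le> (f ^^ i) w" by linarith
  show "(f ^^ i) z \<le> A 0 + 1 + of_int \<lfloor>(f ^^ i) w - B 0\<rfloor>"
    using assms[of "\<lfloor>(f ^^ i) w - B 0\<rfloor> + 1"] by (smt (verit) floor_correct of_int_add of_int_1)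
qed

lemma ok_mono: "ok i w z \<Longrightarrow> w \<le> w' \<Longrightarrow> z' \<le> z \<Longrightarrow> ok i w' z'"
  unfolding ok_def using iter_mono by (meson order_trans)

lemma ok_strict:
  assumes "ok i w z" "(f ^^ i) w \<le> x" "x < y" "y \<le> (f ^^ i) z"
  shows "f x < f y"
proof -
  obtain k :: int where k: "B 0 + of_int k \<le> (f ^^ i) w" "(f ^^ i) z \<le> A 0 + 1 + of_int k"
    using assms(1) by (auto simp: ok_def)
  have "f (x + of_int (- k)) < f (y + of_int (- k))" using k assms by (intro incf) auto
  then show ?thesis unfolding per_int by simp
qed

lemma iter_strict:
  assumes "\<And>i. i < N \<Longrightarrow> ok i w z" "w \<le> x" "x < y" "y \<le> z"
  shows "(f ^^ N) x < (f ^^ N) y"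
  using assms
proof (induction N)
  case (Suc N)
  then have "(f ^^ N) x < (f ^^ N) y" by simp
  then show ?case using ok_strict[of N w z "(f ^^ N) x" "(f ^^ N) y"] Suc.prems iter_mono by simp
qed simp

section \<open>Cross ratios along iterates\<close>

lemma cr_shift: "cr (w + k) (x + k) (y + k) (z + k) = cr w x y z"
  by (simp add: cr_def)

lemma po_shift: "po (w + k) (x + k) (y + k) (z + k) = po w x y z"
  by (simp add: po_def)

lemma one_step:
  assumes k: "B 0 + of_int k \<le> w" "z \<le> A 0 + 1 + of_int k" and o: "w < x" "x < y" "y < z"
  shows "cr (f w) (f x) (f y) (f z) \<le> exp (C * (y - x)) * cr w x y z"
    "po (f w) (f x) (f y) (f z) \<ge> exp (- (C * (x - w))) * po w x y z"
    "po (f w) (f x) (f y) (f z) \<ge> exp (- (C * (z - y))) * po w x y z"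
proof -
  have e: "f (u + of_int (- k)) = f u + of_int (- k)" for u by (rule per_int)
  have h: "B 0 \<le> w + of_int (- k)" "w + of_int (- k) < x + of_int (- k)" "x + of_int (- k) < y + of_int (- k)"
    "y + of_int (- k) < z + of_int (- k)" "z + of_int (- k) \<le> A 0 + 1"
    using k o by auto
  show "cr (f w) (f x) (f y) (f z) \<le> exp (C * (y - x)) * cr w x y z"
    using dist_cr[OF h] unfolding e cr_shift by simp
  show "po (f w) (f x) (f y) (f z) \<ge> exp (- (C * (x - w))) * po w x y z"
    using dist_poL[OF h] unfolding e po_shift by simp
  show "po (f w) (f x) (f y) (f z) \<ge> exp (- (C * (z - y))) * po w x y z"
    using dist_poR[OF h] unfolding e po_shift by simp
qed

lemma cr_iter:
  assumes "\<And>i. i < N \<Longrightarrow> ok i w z" and o: "w < x" "x < y" "y < z"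
  shows "cr ((f ^^ N) w) ((f ^^ N) x) ((f ^^ N) y) ((f ^^ N) z)
    \<le> exp (C * (\<Sum>i<N. (f ^^ i) y - (f ^^ i) x)) * cr w x y z"
  using assms(1)
proof (induction N)
  case (Suc N)
  have s: "(f ^^ N) w < (f ^^ N) x" "(f ^^ N) x < (f ^^ N) y" "(f ^^ N) y < (f ^^ N) z"
    by (rule iter_strict[where w = w and z = z]; use Suc.prems o in auto)+
  obtain k :: int where k: "B 0 + of_int k \<le> (f ^^ N) w" "(f ^^ N) z \<le> A 0 + 1 + of_int k"
    using Suc.prems[of N] by (auto simp: ok_def)
  have "cr ((f ^^ Suc N) w) ((f ^^ Suc N) x) ((f ^^ Suc N) y) ((f ^^ Suc N) z)
      \<le> exp (C * ((f ^^ N) y - (f ^^ N) x)) * cr ((f ^^ N) w) ((f ^^ N) x) ((f ^^ N) y) ((f ^^ N) z)"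
    using one_step(1)[OF k s] by simp
  also have "\<dots> \<le> exp (C * ((f ^^ N) y - (f ^^ N) x)) * (exp (C * (\<Sum>i<N. (f ^^ i) y - (f ^^ i) x)) * cr w x y z)"
    using Suc by (intro mult_left_mono) auto
  also have "\<dots> = exp (C * (\<Sum>i<Suc N. (f ^^ i) y - (f ^^ i) x)) * cr w x y z"
    by (simp add: exp_add[symmetric] mult.assoc[symmetric] distrib_left add.commute)
  finally show ?case .
qed simp

lemma po_iter:
  assumes "\<And>i. i < N \<Longrightarrow> ok i w z" and o: "w < x" "x < y" "y < z"
  shows "po ((f ^^ N) w) ((f ^^ N) x) ((f ^^ N) y) ((f ^^ N) z)
      \<ge> exp (- (C * (\<Sum>i<N. (f ^^ i) x - (f ^^ i) w))) * po w x y z" (is "?L N")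
    and "po ((f ^^ N) w) ((f ^^ N) x) ((f ^^ N) y) ((f ^^ N) z)
      \<ge> exp (- (C * (\<Sum>i<N. (f ^^ i) z - (f ^^ i) y))) * po w x y z" (is "?R N")
proof -
  have "?L N \<and> ?R N" using assms(1)
  proof (induction N)
    case (Suc N)
    have s: "(f ^^ N) w < (f ^^ N) x" "(f ^^ N) x < (f ^^ N) y" "(f ^^ N) y < (f ^^ N) z"
      by (rule iter_strict[where w = w and z = z]; use Suc.prems o in auto)+
    obtain k :: int where k: "B 0 + of_int k \<le> (f ^^ N) w" "(f ^^ N) z \<le> A 0 + 1 + of_int k"
      using Suc.prems[of N] by (auto simp: ok_def)
    let ?p = "po ((f ^^ N) w) ((f ^^ N) x) ((f ^^ N) y) ((f ^^ N) z)"
    have IH: "?L N" "?R N" using Suc by auto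
    have "exp (- (C * ((f ^^ N) x - (f ^^ N) w))) * (exp (- (C * (\<Sum>i<N. (f ^^ i) x - (f ^^ i) w))) * po w x y z)
        \<le> exp (- (C * ((f ^^ N) x - (f ^^ N) w))) * ?p"
      using IH(1) by (intro mult_left_mono) auto
    then have "exp (- (C * ((f ^^ N) x - (f ^^ N) w))) * (exp (- (C * (\<Sum>i<N. (f ^^ i) x - (f ^^ i) w))) * po w x y z)
        \<le> po ((f ^^ Suc N) w) ((f ^^ Suc N) x) ((f ^^ Suc N) y) ((f ^^ Suc N) z)"
      using order_trans[OF _ one_step(2)[OF k s]] by simp
    then have 1: "?L (Suc N)"
      by (simp add: exp_add[symmetric] mult.assoc[symmetric] distrib_left add.commute minus_add_distrib[symmetric] del: funpow.simps)
    have "exp (- (C * ((f ^^ N) z - (f ^^ N) y))) * (exp (- (C * (\<Sum>i<N. (f ^^ i) z - (f ^^ i) y))) * po w x y z)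
        \<le> exp (- (C * ((f ^^ N) z - (f ^^ N) y))) * ?p"
      using IH(2) by (intro mult_left_mono) auto
    then have "exp (- (C * ((f ^^ N) z - (f ^^ N) y))) * (exp (- (C * (\<Sum>i<N. (f ^^ i) z - (f ^^ i) y))) * po w x y z)
        \<le> po ((f ^^ Suc N) w) ((f ^^ Suc N) x) ((f ^^ Suc N) y) ((f ^^ Suc N) z)"
      using order_trans[OF _ one_step(3)[OF k s]] by simp
    then have 2: "?R (Suc N)"
      by (simp add: exp_add[symmetric] mult.assoc[symmetric] distrib_left add.commute minus_add_distrib[symmetric] del: funpow.simps)
    show ?case using 1 2 by blast
  qed simp
  then show "?L N" "?R N" by auto
qed

text \<open>Lifts of \<open>U\<close> are the sets with integer coordinate, so one of them can
  obstruct only if an integer lies between the coordinates of the two ends. If an integer equals one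
  of these coordinates, then the end belongs to that lift of \<open>U\<close> and has to be the one
  facing inwards; this explains the side conditions on \<open>e1 + int i\<close> and
  \<open>e2 + int i\<close>.\<close>

lemma ok_crit:
  assumes w: "w = B e1 + of_int k1 \<or> (w = A e1 + of_int k1 \<and> e1 + int i \<noteq> 0)"
    and z: "z = A e2 + of_int k2 \<or> (z = B e2 + of_int k2 \<and> e2 + int i \<noteq> 0)"
    and no: "\<And>k::int. \<not> (of_int (e1 + int i) * \<rho> + of_int k1 < of_int k \<and> of_int k < of_int (e2 + int i) * \<rho> + of_int k2)"
  shows "ok i w z"
proof (rule okI)
  fix k :: int
  consider "of_int k \<le> of_int (e1 + int i) * \<rho> + of_int k1" | "of_int (e2 + int i) * \<rho> + of_int k2 \<le> of_int k"
    using no[of k] by linarith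
  then show "(f ^^ i) z \<le> A 0 + of_int k \<or> B 0 + of_int k \<le> (f ^^ i) w"
  proof cases
    case 1
    show ?thesis
    proof (cases "of_int k = of_int (e1 + int i) * \<rho> + of_int k1")
      case True
      then have "e1 + int i = 0 \<and> k = k1" using irr_inj[of 0 k "e1 + int i" k1] by simp
      then show ?thesis using w iterB[of i e1 k1] by auto
    next
      case False
      then have "B 0 + of_int k < A (e1 + int i) + of_int k1" using 1 ordBA[of 0 k "e1 + int i" k1] by simp
      then show ?thesis using w iterA[of i e1 k1] iterB[of i e1 k1] ABle[of "e1 + int i"] by auto
    qed
  next
    case 2
    show ?thesis
    proof (cases "of_int k = of_int (e2 + int i) * \<rho> + of_int k2")
      case True
      then have "e2 + int i = 0 \<and> k = k2" using irr_inj[of 0 k "e2 + int i" k2] by simp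
      then show ?thesis using z iterA[of i e2 k2] by auto
    next
      case False
      then have "B (e2 + int i) + of_int k2 < A 0 + of_int k" using 2 ordBA[of "e2 + int i" k2 0 k] by simp
      then show ?thesis using z iterA[of i e2 k2] iterB[of i e2 k2] ABle[of "e2 + int i"] by auto
    qed
  qed
qed

section \<open>Length shared by disjoint arcs and preimages of the flat spot\<close>

definition hole :: "nat \<Rightarrow> real" where "hole j = B (- int j) - A (- int j)"

lemma hole_pos: "hole j > 0"
  using AB_less[of "- int j"] by (simp add: hole_def)

text \<open>The arc is bounded by the inner ends \<open>B\<close> and \<open>A\<close>, so that its
  images stay disjoint even if their coordinates abut (\<open>sep\<close> is not strict). By
  \<open>hol\<close> they also avoid the preimages of order below \<open>J\<close>, and all these
  sets share one unit of length. The remainder left by the preimages is the quantity later shown to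
  vanish.\<close>

lemma sumBA:
  fixes e1 e2 k1 k2 :: int and N J :: nat
  defines "x \<equiv> B e1 + of_int k1" and "y \<equiv> A e2 + of_int k2"
  defines "d \<equiv> (of_int e2 * \<rho> + of_int k2) - (of_int e1 * \<rho> + of_int k1)"
  assumes d0: "0 < d" "d \<le> 1"
    and sep: "\<And>j k. 0 < j \<Longrightarrow> j < N \<Longrightarrow> d \<le> \<bar>real j * \<rho> - of_int k\<bar>"
    and hol: "\<And>i j k. i < N \<Longrightarrow> j < J \<Longrightarrow>
      \<not> (of_int (e1 + int i + int j) * \<rho> + of_int k1 < of_int k \<and> of_int k < of_int (e2 + int i + int j) * \<rho> + of_int k2)"
  shows "(\<Sum>i<N. (f ^^ i) y - (f ^^ i) x) + (\<Sum>j<J. hole j) \<le> 1"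
proof -
  define X where "X = case_sum (\<lambda>i. B (e1 + int i) + of_int k1) (\<lambda>j. A (- int j))"
  define Y where "Y = case_sum (\<lambda>i. A (e2 + int i) + of_int k2) (\<lambda>j. B (- int j))"
  define I :: "(nat + nat) set" where "I = {..<N} <+> {..<J}"
  have le: "X i \<le> Y i \<and> Y i \<le> X i + 1" if "i \<in> I" for i
  proof (cases i)
    case (Inl n)
    have "B (e1 + int n) + of_int k1 < A (e2 + int n) + of_int k2"
      by (rule ordBA) (use d0 in \<open>simp add: d_def algebra_simps\<close>)
    moreover have "A (e2 + int n) + of_int k2 \<le> B (e1 + int n) + of_int (k1 + 1)"
      by (rule ordAB) (use d0 in \<open>simp add: d_def algebra_simps\<close>)
    ultimately show ?thesis using Inl by (simp add: X_def Y_def)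
  next
    case (Inr n)
    have "B (- int n) + of_int 0 < A (- int n) + of_int 1" by (rule ordBA) simp
    then show ?thesis using Inr ABle by (simp add: X_def Y_def)
  qed
  have dHL: "B (- int j) + of_int k \<le> X (Inl i) \<or> Y (Inl i) \<le> A (- int j) + of_int k" if ij: "i < N" "j < J" for i j k
  proof -
    consider "of_int k \<le> of_int (e1 + int i + int j) * \<rho> + of_int k1" | "of_int (e2 + int i + int j) * \<rho> + of_int k2 \<le> of_int k"
      using hol[OF ij, of k] by linarith
    then show ?thesis
    proof cases
      case 1
      show ?thesis
      proof (cases "of_int k = of_int (e1 + int i + int j) * \<rho> + of_int k1")
        case True
        then have "e1 + int i + int j = 0 \<and> k = k1" using irr_inj[of 0 k "e1 + int i + int j" k1] by simp
        then have "e1 + int i = - int j" "k = k1" by auto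
        then show ?thesis by (simp add: X_def)
      next
        case False
        then show ?thesis using 1 ordBB[of "- int j" k "e1 + int i" k1] by (simp add: X_def algebra_simps)
      qed
    next
      case 2
      show ?thesis
      proof (cases "of_int k = of_int (e2 + int i + int j) * \<rho> + of_int k2")
        case True
        then have "e2 + int i + int j = 0 \<and> k = k2" using irr_inj[of 0 k "e2 + int i + int j" k2] by simp
        then have "e2 + int i = - int j" "k = k2" by auto
        then show ?thesis by (simp add: Y_def)
      next
        case False
        then show ?thesis using 2 ordAA[of "e2 + int i" k2 "- int j" k] by (simp add: Y_def algebra_simps)
      qed
    qed
  qed
  have dis: "Y i \<le> X j + of_int k \<or> Y j + of_int k \<le> X i" if ij: "i \<in> I" "j \<in> I" "i \<noteq> j" for i j k
  proof (cases i)
    case (Inl m)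
    show ?thesis
    proof (cases j)
      case j: (Inl n)
      have mn: "m < N" "n < N" "m \<noteq> n" using ij Inl j by (auto simp: I_def)
      have "d \<le> \<bar>(real m - real n) * \<rho> - of_int k\<bar>"
      proof (cases "n < m")
        case True
        then show ?thesis using sep[of "m - n" k] mn by (simp add: of_nat_diff)
      next
        case False
        then have "d \<le> \<bar>real (n - m) * \<rho> - of_int (- k)\<bar>" using sep[of "n - m" "- k"] mn by simp
        also have "\<dots> = \<bar>(real m - real n) * \<rho> - of_int k\<bar>"
          using False mn by (simp add: of_nat_diff algebra_simps abs_if)
        finally show ?thesis .
      qed
      then consider "(real m - real n) * \<rho> - of_int k \<le> - d" | "d \<le> (real m - real n) * \<rho> - of_int k" by linarith
      then show ?thesis
      proof cases
        case 1
        have "A (e2 + int m) + of_int k2 \<le> B (e1 + int n) + of_int (k1 + k)"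
          by (rule ordAB) (use 1 in \<open>simp add: d_def algebra_simps\<close>)
        then show ?thesis using Inl j by (simp add: X_def Y_def)
      next
        case 2
        have "A (e2 + int n) + of_int (k2 + k) \<le> B (e1 + int m) + of_int k1"
          by (rule ordAB) (use 2 in \<open>simp add: d_def algebra_simps\<close>)
        then show ?thesis using Inl j by (simp add: X_def Y_def)
      qed
    next
      case j: (Inr n)
      then show ?thesis using dHL[of m n k] ij Inl by (auto simp: I_def X_def Y_def)
    qed
  next
    case (Inr m)
    show ?thesis
    proof (cases j)
      case j: (Inl n)
      then show ?thesis using dHL[of n m "- k"] ij Inr by (auto simp: I_def X_def Y_def)
    next
      case j: (Inr n)
      have mn: "m \<noteq> n" using ij Inr j by auto
      have "of_int (- int m) * \<rho> + of_int 0 \<noteq> of_int (- int n) * \<rho> + of_int k"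
        using irr_inj[of "- int m" 0 "- int n" k] mn by auto
      then consider "of_int (- int m) * \<rho> + of_int 0 < of_int (- int n) * \<rho> + of_int k" |
         "of_int (- int n) * \<rho> + of_int k < of_int (- int m) * \<rho> + of_int 0" by linarith
      then show ?thesis
        by cases (use ordBA[of "- int m" 0 "- int n" k] ordBA[of "- int n" k "- int m" 0] Inr j in \<open>auto simp: X_def Y_def\<close>)
    qed
  qed
  have "(\<Sum>i\<in>I. Y i - X i) \<le> 1"
    by (rule arcs_sum) (use le dis in \<open>auto simp: I_def\<close>)
  moreover have "(\<Sum>i\<in>I. Y i - X i) = (\<Sum>i<N. (f ^^ i) y - (f ^^ i) x) + (\<Sum>j<J. hole j)"
    unfolding I_def by (subst sum.Plus) (auto simp: X_def Y_def x_def y_def iterA iterB hole_def)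
  ultimately show ?thesis by simp
qed

text \<open>Outer ends are allowed here, at the price of strict separation: if two coordinates
  abutted, two images of the arc could both contain the preimage of \<open>U\<close> at the common
  coordinate.\<close>

lemma sum_strict:
  fixes e1 e2 k1 k2 :: int and N :: nat
  assumes x: "x = A e1 + of_int k1 \<or> x = B e1 + of_int k1" and y: "y = A e2 + of_int k2 \<or> y = B e2 + of_int k2" and xy: "x \<le> y"
    and d1: "(of_int e2 * \<rho> + of_int k2) - (of_int e1 * \<rho> + of_int k1) < 1"
    and sep: "\<And>j k. 0 < j \<Longrightarrow> j < N \<Longrightarrow> (of_int e2 * \<rho> + of_int k2) - (of_int e1 * \<rho> + of_int k1) < \<bar>real j * \<rho> - of_int k\<bar>"
  shows "(\<Sum>i<N. (f ^^ i) y - (f ^^ i) x) \<le> 1"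
proof (rule arcs_sum)
  have X: "A (e1 + int i) + of_int k1 \<le> (f ^^ i) x" for i using x iterA iterB ABle[of "e1 + int i"] by auto
  have Y: "(f ^^ i) y \<le> B (e2 + int i) + of_int k2" for i using y iterA iterB ABle[of "e2 + int i"] by auto
  show "(f ^^ i) x \<le> (f ^^ i) y \<and> (f ^^ i) y \<le> (f ^^ i) x + 1" for i
  proof
    show "(f ^^ i) x \<le> (f ^^ i) y" using iter_mono xy .
    have "B (e2 + int i) + of_int k2 < A (e1 + int i) + of_int (k1 + 1)"
      by (rule ordBA) (use d1 in \<open>simp add: algebra_simps\<close>)
    then show "(f ^^ i) y \<le> (f ^^ i) x + 1" using X[of i] Y[of i] by simp
  qed
  fix m n :: nat and k :: int assume mn: "m \<in> {..<N}" "n \<in> {..<N}" "m \<noteq> n"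
  define d where "d = (of_int e2 * \<rho> + of_int k2) - (of_int e1 * \<rho> + of_int k1)"
  have "d < \<bar>(real m - real n) * \<rho> - of_int k\<bar>"
  proof (cases "n < m")
    case True
    then show ?thesis using sep[of "m - n" k] mn by (simp add: of_nat_diff d_def)
  next
    case False
    then have "d < \<bar>real (n - m) * \<rho> - of_int (- k)\<bar>" using sep[of "n - m" "- k"] mn by (simp add: d_def)
    also have "\<dots> = \<bar>(real m - real n) * \<rho> - of_int k\<bar>"
      using False mn by (simp add: of_nat_diff algebra_simps abs_if)
    finally show ?thesis .
  qed
  then consider "(real m - real n) * \<rho> - of_int k < - d" | "d < (real m - real n) * \<rho> - of_int k" by linarith
  then show "(f ^^ m) y \<le> (f ^^ n) x + of_int k \<or> (f ^^ n) y + of_int k \<le> (f ^^ m) x"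
  proof cases
    case 1
    have "B (e2 + int m) + of_int k2 < A (e1 + int n) + of_int (k1 + k)"
      by (rule ordBA) (use 1 in \<open>simp add: d_def algebra_simps\<close>)
    then show ?thesis using X[of n] Y[of m] by simp
  next
    case 2
    have "B (e2 + int n) + of_int (k2 + k) < A (e1 + int m) + of_int k1"
      by (rule ordBA) (use 2 in \<open>simp add: d_def algebra_simps\<close>)
    then show ?thesis using X[of m] Y[of n] by simp
  qed
qed simp

lemma hole_sum: "(\<Sum>j<J. hole j) \<le> 1"
proof -
  have "(\<Sum>i\<in>{..<J}. B (- int i) - A (- int i)) \<le> 1"
  proof (rule arcs_sum)
    show "A (- int i) \<le> B (- int i) \<and> B (- int i) \<le> A (- int i) + 1" for i
      using ordBA[of "- int i" 0 "- int i" 1] ABle by simp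
    fix m n :: nat and k :: int assume "m \<noteq> n"
    then have "of_int (- int m) * \<rho> + of_int 0 \<noteq> of_int (- int n) * \<rho> + of_int k"
      using irr_inj[of "- int m" 0 "- int n" k] by auto
    then consider "of_int (- int m) * \<rho> + of_int 0 < of_int (- int n) * \<rho> + of_int k" |
       "of_int (- int n) * \<rho> + of_int k < of_int (- int m) * \<rho> + of_int 0" by linarith
    then show "B (- int m) \<le> A (- int n) + of_int k \<or> B (- int n) + of_int k \<le> A (- int m)"
      by cases (use ordBA[of "- int m" 0 "- int n" k] ordBA[of "- int n" k "- int m" 0] in auto)
  qed simp
  then show ?thesis by (simp add: hole_def)
qed

end

text \<open>Reflection exchanges the ends of \<open>U\<close> and the two outer-arc estimates for
  \<open>po\<close>, and it negates the rotation number; this is why the locale admits any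
  irrational real \<open>\<rho>\<close>. Every estimate proved on one side of the flat spot thereby
  holds on the other.\<close>

lemma (in flat) reflect:
  "flat (\<lambda>x. - f (- x)) (\<lambda>e. - B e) (\<lambda>e. - A e) (- \<rho>) \<nu> C C1 r0"
proof -
  have crr: "cr (- z) (- y) (- x) (- w) = cr w x y z" for w x y z
    by (simp add: cr_def mult.commute)
  have por: "po (- z) (- y) (- x) (- w) = po w x y z" for w x y z
    by (simp add: po_def algebra_simps)
  have it: "((\<lambda>x. - f (- x)) ^^ n) x = - (f ^^ n) (- x)" for n x
    by (induction n) auto
  have p1: "f (x - 1) = f x - 1" for x using per[of "x - 1"] by simp
  have sh: "f (x - 1) = f x - 1" for x using p1 .
  show ?thesis
  proof
    show "mono (\<lambda>x. - f (- x))" using mono_f by (simp add: mono_def)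
    show "- f (- (x + 1)) = - f (- x) + 1" for x using p1[of "- x"] unfolding minus_add_distrib diff_conv_add_uminus by simp
    show "- B 0 < - A 0" "- A 0 < - B 0 + 1" using AB0 by auto
    show "- f (- (- B e)) = - B (e + 1)" "- f (- (- A e)) = - A (e + 1)" for e by (simp_all add: fA fB)
    show "- B 1 = - A 1" "- B e \<le> - A e" for e using AB1 ABle by simp_all
    show "- \<rho> \<notin> \<rat>" using irr Rats_minus_iff by blast
    show "\<bar>((\<lambda>x. - f (- x)) ^^ n) x - x - real n * - \<rho>\<bar> \<le> 2" for n x
      using rot[of n "- x"] unfolding it by (simp add: abs_if split: if_splits)
    show "1 < \<nu>" "0 \<le> C" "1 \<le> C1" "0 < r0" using nu C0 C1 r0 by auto
    show "- f (- x) < - f (- y)" if "- A 0 \<le> x" "x < y" "y \<le> - B 0 + 1" for x y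
    proof -
      have "f (- y + 1) < f (- x + 1)" using that by (intro incf) auto
      then show ?thesis unfolding per by simp
    qed
    show "surj (\<lambda>x. - f (- x))" using surj by (metis (no_types, lifting) surj_def minus_minus)
    fix w x y z assume o: "- A 0 \<le> w" "w < x" "x < y" "y < z" "z \<le> - B 0 + 1"
    have e: "f (- u + 1) = f (- u) + 1" for u by (rule per)
    have h: "B 0 \<le> - z + 1" "- z + 1 < - y + 1" "- y + 1 < - x + 1" "- x + 1 < - w + 1" "- w + 1 \<le> A 0 + 1"
      using o by auto
    show "cr (- f (- w)) (- f (- x)) (- f (- y)) (- f (- z)) \<le> exp (C * (y - x)) * cr w x y z"
      using dist_cr[OF h] unfolding e cr_shift crr by simp
    show "exp (- (C * (x - w))) * po w x y z \<le> po (- f (- w)) (- f (- x)) (- f (- y)) (- f (- z))"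
      using dist_poR[OF h] unfolding e po_shift por by simp
    show "exp (- (C * (z - y))) * po w x y z \<le> po (- f (- w)) (- f (- x)) (- f (- y)) (- f (- z))"
      using dist_poL[OF h] unfolding e po_shift por by simp
  next
    fix w x y z assume o: "- A 0 \<le> w" "w \<le> x" "x < y" "y \<le> z" "z \<le> - B 0 + 1"
    have "f (- x + 1) - f (- y + 1) \<le> C1 * (((- x + 1) - (- y + 1)) / ((- w + 1) - (- z + 1))) * (f (- w + 1) - f (- z + 1))"
      by (rule dbl) (use o in auto)
    then show "- f (- y) - - f (- x) \<le> C1 * ((y - x) / (z - w)) * (- f (- z) - - f (- w))"
      unfolding per by simp
  next
    fix s t :: real assume o: "0 < s" "s \<le> t" "t < r0"
    show "exp (- (C * t)) * (s / t) powr \<nu> * (- f (- (- A 0 + t)) - - B 1) \<le> - f (- (- A 0 + s)) - - B 1 \<and>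
         - f (- (- A 0 + s)) - - B 1 \<le> exp (C * t) * (s / t) powr \<nu> * (- f (- (- A 0 + t)) - - B 1)"
      using pw_left[OF o] AB1 by (simp add: algebra_simps)
    show "exp (- (C * t)) * (s / t) powr \<nu> * (- B 1 - - f (- (- B 0 - t))) \<le> - B 1 - - f (- (- B 0 - s)) \<and>
         - B 1 - - f (- (- B 0 - s)) \<le> exp (C * t) * (s / t) powr \<nu> * (- B 1 - - f (- (- B 0 - t)))"
      using pw_right[OF o] AB1 by (simp add: algebra_simps)
  qed
qed

section \<open>Farey pairs and return times\<close>

context flat
begin

text \<open>\<open>rd\<close> and \<open>rdf\<close> are the distances from \<open>U\<close> of the near and the far end of \<open>F\<^sup>e(U)\<close>, translated by \<open>k\<close>;
  \<open>near\<close> and \<open>far\<close> are the distances from the critical value of the ends of its image. The sign of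
  \<open>e * \<rho> + k\<close> tells the side.\<close>

definition rd where "rd e k = (if of_int e * \<rho> + of_int k > 0 then A e + of_int k - B 0 else A 0 - B e - of_int k)"
definition rdf where "rdf e k = (if of_int e * \<rho> + of_int k > 0 then B e + of_int k - B 0 else A 0 - A e - of_int k)"
definition near where "near e k = (if of_int e * \<rho> + of_int k > 0 then A (e + 1) + of_int k - A 1 else A 1 - B (e + 1) - of_int k)"
definition far where "far e k = (if of_int e * \<rho> + of_int k > 0 then B (e + 1) + of_int k - A 1 else A 1 - A (e + 1) - of_int k)"

text \<open>Farey pairs: \<open>P / p < \<rho> < Q / N\<close> with determinant one.\<close>

definition fp :: "int \<Rightarrow> int \<Rightarrow> int \<Rightarrow> int \<Rightarrow> bool" where
  "fp p P N Q \<longleftrightarrow> 1 \<le> p \<and> 1 \<le> N \<and> 0 < of_int p * \<rho> - of_int P \<and> of_int p * \<rho> - of_int P < 1 \<and>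
     0 < of_int Q - of_int N * \<rho> \<and> of_int Q - of_int N * \<rho> < 1 \<and> p * Q - N * P = 1"

text \<open>Determinant one makes the two pairs a basis of the integer lattice; the coefficients
  come from Cramer's rule.\<close>

lemma fp_rep:
  assumes "fp p P N Q"
  obtains x y :: int where "e = x * p + y * N"
    "of_int e * \<rho> - of_int k = of_int x * (of_int p * \<rho> - of_int P) - of_int y * (of_int Q - of_int N * \<rho>)"
proof
  have d: "p * Q - N * P = 1" using assms by (simp add: fp_def)
  have "(e * Q - k * N) * p + (k * p - e * P) * N = e * (p * Q - N * P)" by algebra
  then show e: "e = (e * Q - k * N) * p + (k * p - e * P) * N" using d by simp
  have "(e * Q - k * N) * P + (k * p - e * P) * Q = k * (p * Q - N * P)" by algebra
  then have k: "k = (e * Q - k * N) * P + (k * p - e * P) * Q" using d by simp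
  have "of_int e * \<rho> - of_int k = of_int ((e * Q - k * N) * p + (k * p - e * P) * N) * \<rho> - of_int ((e * Q - k * N) * P + (k * p - e * P) * Q)"
    using e k by simp
  then show "of_int e * \<rho> - of_int k = of_int (e * Q - k * N) * (of_int p * \<rho> - of_int P) - of_int (k * p - e * P) * (of_int Q - of_int N * \<rho>)"
    by (simp add: algebra_simps)
qed

lemma int_mult_ge: "1 \<le> (x::int) \<Longrightarrow> 0 < d \<Longrightarrow> d \<le> of_int x * (d::real)"
  using mult_right_mono[of 1 "of_int x" d] by simp

lemma int_mult_le: "(x::int) \<le> 0 \<Longrightarrow> 0 < d \<Longrightarrow> of_int x * (d::real) \<le> 0"
  by (simp add: mult_le_0_iff)

text \<open>Unless both lattice coefficients are positive, either the time is not positive or the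
  displacement is at least one full basic step to one side. So a positive time strictly inside the
  window contains each of \<open>p\<close> and \<open>N\<close> at least once.\<close>

lemma fp_window:
  assumes F: "fp p P N Q" and e: "0 < e" and v: "- (of_int Q - of_int N * \<rho>) < of_int e * \<rho> - of_int k" "of_int e * \<rho> - of_int k < of_int p * \<rho> - of_int P"
  shows "e \<ge> p + N"
proof -
  define dp dN where "dp = of_int p * \<rho> - of_int P" and "dN = of_int Q - of_int N * \<rho>"
  obtain x y :: int where xy: "e = x * p + y * N" "of_int e * \<rho> - of_int k = of_int x * dp - of_int y * dN"
    using fp_rep[OF F, of e k] unfolding dp_def dN_def by metis
  have pos: "dp > 0" "dN > 0" "p \<ge> 1" "N \<ge> 1" using F by (auto simp: fp_def dp_def dN_def)
  consider "x \<ge> 1 \<and> y \<ge> 1" | "x \<ge> 1 \<and> y \<le> 0" | "x \<le> 0 \<and> y \<ge> 1" | "x \<le> 0 \<and> y \<le> 0" by linarith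
  then show ?thesis
  proof cases
    case 1
    then have "x * p \<ge> p" "y * N \<ge> N" using pos by (auto simp: mult_le_cancel_right1)
    then show ?thesis using xy by linarith
  next
    case 2
    then show ?thesis using int_mult_ge[of x dp] int_mult_le[of y dN] pos xy(2) v[folded dp_def dN_def] by linarith
  next
    case 3
    then show ?thesis using int_mult_ge[of y dN] int_mult_le[of x dp] pos xy(2) v[folded dp_def dN_def] by linarith
  next
    case 4
    then have "x * p \<le> 0" "y * N \<le> 0" using pos by (auto simp: mult_le_0_iff)
    then show ?thesis using xy e by linarith
  qed
qed

text \<open>The window is wider by one step on the left, which admits a vanishing coefficient of
  \<open>p\<close>; the time still contains \<open>N\<close> once. The next lemma is the mirror
  case.\<close>

lemma fp_window_N:
  assumes F: "fp p P N Q" and e: "0 < e"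
    and v: "- (of_int Q - of_int N * \<rho>) - (of_int p * \<rho> - of_int P) < of_int e * \<rho> - of_int k" "of_int e * \<rho> - of_int k < of_int p * \<rho> - of_int P"
  shows "e \<ge> N"
proof -
  define dp dN where "dp = of_int p * \<rho> - of_int P" and "dN = of_int Q - of_int N * \<rho>"
  obtain x y :: int where xy: "e = x * p + y * N" "of_int e * \<rho> - of_int k = of_int x * dp - of_int y * dN"
    using fp_rep[OF F, of e k] unfolding dp_def dN_def by metis
  have pos: "dp > 0" "dN > 0" "p \<ge> 1" "N \<ge> 1" using F by (auto simp: fp_def dp_def dN_def)
  consider "x \<ge> 0 \<and> y \<ge> 1" | "x \<ge> 1 \<and> y \<le> 0" | "x \<le> -1 \<and> y \<ge> 1" | "x \<le> 0 \<and> y \<le> 0" by linarith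
  then show ?thesis
  proof cases
    case 1
    then have "x * p \<ge> 0" "y * N \<ge> N" using pos by (auto simp: mult_le_cancel_right1)
    then show ?thesis using xy by linarith
  next
    case 2
    then show ?thesis using int_mult_ge[of x dp] int_mult_le[of y dN] pos xy(2) v[folded dp_def dN_def] by linarith
  next
    case 3
    then have "dN \<le> of_int y * dN" "dp \<le> of_int (- x) * dp" using int_mult_ge[of y dN] int_mult_ge[of "-x" dp] pos by auto
    then show ?thesis using xy(2) v[folded dp_def dN_def] by simp
  next
    case 4
    then have "x * p \<le> 0" "y * N \<le> 0" using pos by (auto simp: mult_le_0_iff)
    then show ?thesis using xy e by linarith
  qed
qed

lemma fp_window_p:
  assumes F: "fp p P N Q" and e: "0 < e"
    and v: "- (of_int Q - of_int N * \<rho>) < of_int e * \<rho> - of_int k" "of_int e * \<rho> - of_int k < of_int p * \<rho> - of_int P + (of_int Q - of_int N * \<rho>)"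
  shows "e \<ge> p"
proof -
  define dp dN where "dp = of_int p * \<rho> - of_int P" and "dN = of_int Q - of_int N * \<rho>"
  obtain x y :: int where xy: "e = x * p + y * N" "of_int e * \<rho> - of_int k = of_int x * dp - of_int y * dN"
    using fp_rep[OF F, of e k] unfolding dp_def dN_def by metis
  have pos: "dp > 0" "dN > 0" "p \<ge> 1" "N \<ge> 1" using F by (auto simp: fp_def dp_def dN_def)
  consider "x \<ge> 1 \<and> y \<ge> 0" | "x \<ge> 1 \<and> y \<le> -1" | "x \<le> 0 \<and> y \<ge> 1" | "x \<le> 0 \<and> y \<le> 0" by linarith
  then show ?thesis
  proof cases
    case 1
    then have "x * p \<ge> p" "y * N \<ge> 0" using pos by (auto simp: mult_le_cancel_right1)
    then show ?thesis using xy by linarith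
  next
    case 2
    then have "dN \<le> of_int (- y) * dN" "dp \<le> of_int x * dp" using int_mult_ge[of "-y" dN] int_mult_ge[of x dp] pos by auto
    then show ?thesis using xy(2) v[folded dp_def dN_def] by simp
  next
    case 3
    then show ?thesis using int_mult_ge[of y dN] int_mult_le[of x dp] pos xy(2) v[folded dp_def dN_def] by linarith
  next
    case 4
    then have "x * p \<le> 0" "y * N \<le> 0" using pos by (auto simp: mult_le_0_iff)
    then show ?thesis using xy e by linarith
  qed
qed

lemma fp_sep_N: "fp p P N Q \<Longrightarrow> 0 < j \<Longrightarrow> j < N \<Longrightarrow> of_int p * \<rho> - of_int P \<le> \<bar>of_int j * \<rho> - of_int k\<bar>"
  using fp_window_N[of p P N Q j k] by (auto simp: fp_def abs_if split: if_splits) (smt (verit))+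

lemma fp_sep_p: "fp p P N Q \<Longrightarrow> 0 < j \<Longrightarrow> j < p \<Longrightarrow> of_int Q - of_int N * \<rho> \<le> \<bar>of_int j * \<rho> - of_int k\<bar>"
  using fp_window_p[of p P N Q j k] by (auto simp: fp_def abs_if split: if_splits) (smt (verit))+

section \<open>Cross ratio estimates for one Farey pair\<close>

abbreviation U where "U \<equiv> B 0 - A 0"

lemma U_pos: "0 < U" "U < 1" using AB0 by auto

lemma expC_mono: "S \<le> 1 \<Longrightarrow> exp (C * S) \<le> exp C"
  using C0 mult_left_mono[of S 1 C] by simp

lemma cr_iter1:
  assumes "\<And>i. i < n \<Longrightarrow> ok i w z" and "w < x" "x < y" "y < z" and "(\<Sum>i<n. (f ^^ i) y - (f ^^ i) x) \<le> 1"
  shows "cr ((f ^^ n) w) ((f ^^ n) x) ((f ^^ n) y) ((f ^^ n) z) \<le> exp C * cr w x y z"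
proof -
  have "cr w x y z \<ge> 0" using assms(2-4) by (simp add: cr_def)
  then show ?thesis
    using cr_iter[OF assms(1-4)] expC_mono[OF assms(5)] by (meson mult_right_mono order_trans)
qed

lemma cr_lower:
  assumes o: "w' < x'" "x' < y'" "y' < z'" and z: "z' - x' \<le> 1" "z' - y' \<ge> u" "u \<ge> 0"
  shows "u * ((x' - w') / (y' - w')) \<le> cr w' x' y' z'"
proof -
  have "u \<le> (z' - y') / (z' - x')" using o z by (simp add: pos_le_divide_eq) (smt (verit) mult_right_le_one_le)
  then have "u * ((x' - w') / (y' - w')) \<le> (z' - y') / (z' - x') * ((x' - w') / (y' - w'))"
    using o by (intro mult_right_mono) auto
  then show ?thesis by (simp add: cr_def mult.commute)
qed

lemma cr_upper:
  assumes o: "w < x" "x < y" "y < z"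
  shows "cr w x y z \<le> (z - y) / (z - x)" "cr w x y z \<le> (x - w) / (y - w)"
proof -
  have e: "cr w x y z = ((x - w) / (y - w)) * ((z - y) / (z - x))" by (simp add: cr_def)
  have 1: "(x - w) / (y - w) \<le> 1" "(z - y) / (z - x) \<le> 1" "0 \<le> (x - w) / (y - w)" "0 \<le> (z - y) / (z - x)"
    using o by auto
  show "cr w x y z \<le> (z - y) / (z - x)" unfolding e using 1 by (rule_tac mult_left_le_one_le) auto
  show "cr w x y z \<le> (x - w) / (y - w)" unfolding e using 1 by (rule_tac mult_right_le_one_le) auto
qed

lemma dbl_int:
  assumes "B 0 + of_int k \<le> w" "w \<le> x" "x < y" "y \<le> z" "z \<le> A 0 + 1 + of_int k"
  shows "f y - f x \<le> C1 * ((y - x) / (z - w)) * (f z - f w)"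
proof -
  have "f (y + of_int (-k)) - f (x + of_int (-k)) \<le> C1 * (((y + of_int (-k)) - (x + of_int (-k))) / ((z + of_int (-k)) - (w + of_int (-k)))) * (f (z + of_int (-k)) - f (w + of_int (-k)))"
    using assms by (intro dbl) auto
  then show ?thesis unfolding per_int by simp
qed

lemma incf_int: "B 0 + of_int k \<le> x \<Longrightarrow> x < y \<Longrightarrow> y \<le> A 0 + 1 + of_int k \<Longrightarrow> f x < f y"
  using incf[of "x + of_int (-k)" "y + of_int (-k)"] unfolding per_int by simp

text \<open>After \<open>N - 1\<close> steps \<open>z\<close> becomes the far end of a lift of
  \<open>U\<close>, so one factor of the image cross ratio is at least \<open>U\<close> and the
  other is the proportion formed by \<open>X1\<close>, \<open>y1\<close> and \<open>y1'\<close>.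
  Before iteration the cross ratio is bounded by a proportion near the critical value, which
  \<open>dbl\<close> compares with one at the flat spot, on the other side of it.\<close>

lemma step_long:
  fixes p' P' N Q p P n :: int
  assumes F: "fp p' P' N Q" and Np: "p' < N" and pn: "p = p' + n * N" "P = P' + n * Q" "n \<ge> 1"
    and pos: "0 < of_int p * \<rho> - of_int P" and lt: "of_int p * \<rho> - of_int P < of_int Q - of_int N * \<rho>"
  defines "X1 \<equiv> A 0 - B (N - p') - of_int (P' - Q)" and "y1 \<equiv> A 0 - B N - of_int (- Q)"
    and "y1' \<equiv> A 0 - B (N + p) - of_int (- Q - P)"
    and "y2 \<equiv> A p + of_int (- P) - B 0" and "X2 \<equiv> A (p - N) + of_int (Q - P) - B 0"
  shows "U * ((X1 - y1) / ((X1 - y1) + (y1 - y1'))) \<le> exp C * C1 * (1 - y2 / X2)"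
proof -
  define d' dN d where "d' = of_int p' * \<rho> - of_int P'" and "dN = of_int Q - of_int N * \<rho>" and "d = of_int p * \<rho> - of_int P"
  have ds: "0 < d'" "d' < 1" "0 < dN" "dN < 1" "0 < d" "d < dN" "1 \<le> N" "1 \<le> p'" using F pos lt by (auto simp: fp_def d'_def dN_def d_def)
  have "d = d' - of_int n * dN" by (simp add: d_def d'_def dN_def pn algebra_simps)
  moreover have "of_int n * dN \<ge> dN" using int_mult_ge pn ds by auto
  ultimately have dd: "d \<le> d' - dN" by linarith
  define w x y z where "w = B (1 - p') + of_int P'" and "x = A 1 + of_int 0" and "y = A (1 + p) + of_int (- P)" and "z = B (1 - N) + of_int Q"
  have wx: "w < x" unfolding w_def x_def by (rule ordBA) (use ds in \<open>simp add: d'_def algebra_simps\<close>)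
  have xy: "x < y" unfolding x_def y_def by (rule ordAA) (use ds in \<open>simp add: d_def algebra_simps\<close>)
  have yz: "y < z" unfolding y_def z_def by (rule ordAB') (use ds in \<open>simp add: d_def dN_def algebra_simps\<close>)
  define m where "m = nat (N - 1)"
  have m: "int m = N - 1" using ds by (simp add: m_def)
  \<comment> \<open>A lift of \<open>U\<close> in the way would give the return time
    \<open>1 + i\<close> inside the window of the Farey pair, and \<open>1 + i\<close> is too small
    for that. The other estimates of this kind argue likewise, with a window suited to their
    arcs.\<close>
  have okm: "ok i w z" if i: "i < m" for i
    unfolding w_def z_def
  proof (rule ok_crit)
    show "B (1 - p') + of_int P' = B (1 - p') + of_int P' \<or> B (1 - p') + of_int P' = A (1 - p') + of_int P' \<and> 1 - p' + int i \<noteq> 0" by simp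
    show "B (1 - N) + of_int Q = A (1 - N) + of_int Q \<or> B (1 - N) + of_int Q = B (1 - N) + of_int Q \<and> 1 - N + int i \<noteq> 0"
      using i m by auto
    fix k
    show "\<not> (of_int (1 - p' + int i) * \<rho> + of_int P' < of_int k \<and> of_int k < of_int (1 - N + int i) * \<rho> + of_int Q)"
      using fp_window[OF F, of "1 + int i" k] i m ds by (force simp: algebra_simps)
  qed
  have S: "(\<Sum>i<m. (f ^^ i) y - (f ^^ i) x) \<le> 1"
  proof (rule sum_strict[where ?e1.0 = 1 and ?k1.0 = 0 and ?e2.0 = "1 + p" and ?k2.0 = "- P"])
    show "of_int (1 + p) * \<rho> + of_int (- P) - (of_int 1 * \<rho> + of_int 0) < 1" using ds dd by (simp add: d_def algebra_simps)
    fix j :: nat and k :: int assume j: "0 < j" "j < m"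
    have "d' \<le> \<bar>real j * \<rho> - of_int k\<bar>" using fp_sep_N[OF F, of "int j" k] j m by (simp add: d'_def)
    then show "of_int (1 + p) * \<rho> + of_int (- P) - (of_int 1 * \<rho> + of_int 0) < \<bar>real j * \<rho> - of_int k\<bar>"
      using dd ds by (simp add: d_def algebra_simps)
  qed (use xy in \<open>auto simp: x_def y_def\<close>)
  note CR = cr_iter1[OF okm wx xy yz S]
  have im: "(f ^^ m) w = B (N - p') + of_int P'" "(f ^^ m) x = A N" "(f ^^ m) y = A (N + p) + of_int (- P)" "(f ^^ m) z = B 0 + of_int Q"
    unfolding w_def x_def y_def z_def iterA iterB m by (simp_all add: algebra_simps)
  have "0 \<le> n * N" using pn ds by simp
  then have p1: "1 \<le> p" using pn ds by linarith
  have AN: "A N = B N" "A (N + p) = B (N + p)" using AB_eq ds p1 by auto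
  have o': "(f ^^ m) w < (f ^^ m) x" "(f ^^ m) x < (f ^^ m) y" "(f ^^ m) y < (f ^^ m) z"
    by (rule iter_strict[OF okm]; use wx xy yz in simp)+
  have z1: "(f ^^ m) z - (f ^^ m) x \<le> 1"
  proof -
    have "B 0 + of_int (Q - 1) < A N + of_int 0" by (rule ordBA) (use ds in \<open>simp add: dN_def algebra_simps\<close>)
    then show ?thesis unfolding im by simp
  qed
  have z2: "(f ^^ m) z - (f ^^ m) y \<ge> U"
  proof -
    have "A (N + p) + of_int (- P) < A 0 + of_int Q" by (rule ordAA) (use ds in \<open>simp add: dN_def d_def algebra_simps\<close>)
    then show ?thesis unfolding im by simp
  qed
  have "U * ((X1 - y1) / ((X1 - y1) + (y1 - y1'))) \<le> cr ((f ^^ m) w) ((f ^^ m) x) ((f ^^ m) y) ((f ^^ m) z)"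
    using cr_lower[OF o' z1 z2] U_pos unfolding im X1_def y1_def y1'_def using AN by (simp add: algebra_simps)
  also note CR
  also have "cr w x y z \<le> C1 * (1 - y2 / X2)"
  proof -
    define y0 z0 where "y0 = A p + of_int (- P)" and "z0 = B (- N) + of_int Q"
    have fy: "f y0 = y" "f z0 = z" "f (B 0) = x" unfolding y0_def z0_def y_def z_def x_def per_int fA fB using AB1 fB[of 0] by (simp_all add: algebra_simps)
    have o0: "B 0 < y0" using ordBA[of 0 0 p "-P"] ds by (simp add: y0_def d_def)
    have o1: "y0 < z0" unfolding y0_def z0_def by (rule ordAB') (use ds in \<open>simp add: d_def dN_def\<close>)
    have o2: "z0 \<le> A 0 + 1" using ordBA[of "-N" Q 0 1] ds by (simp add: z0_def dN_def)
    have o3: "z0 < B 0 + X2" using ordBA[of "-N" Q "p - N" "Q - P"] ds by (simp add: z0_def X2_def dN_def d_def algebra_simps)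
    have "z - y \<le> C1 * ((z0 - y0) / (z0 - B 0)) * (z - x)"
      using dbl[of "B 0" y0 z0 z0] o0 o1 o2 fy by simp
    then have "(z - y) / (z - x) \<le> C1 * ((z0 - y0) / (z0 - B 0))" using xy yz by (simp add: pos_divide_le_eq)
    also have "(z0 - y0) / (z0 - B 0) = 1 - y2 / (z0 - B 0)" using o0 o1 by (simp add: y2_def y0_def field_simps)
    also have "\<dots> \<le> 1 - y2 / X2" using o0 o1 o3 by (simp add: y2_def y0_def frac_le)
    finally show ?thesis using cr_upper(1)[OF wx xy yz] C1 by (simp add: mult_left_mono)
  qed
  finally show ?thesis by (simp add: mult.assoc mult_left_mono)
qed

text \<open>Here \<open>[y, z]\<close> is the image of the preimage of \<open>U\<close> of order
  \<open>p\<close>, and \<open>p - 1\<close> steps carry it onto \<open>U\<close>. The size of that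
  preimage, relative to its distance from the return of order \<open>N\<close>, therefore bounds
  \<open>(y1 - y1') / y1\<close>.\<close>

lemma step_cross:
  fixes p P N Q :: int
  assumes F: "fp p P N Q" and Np: "N < p" and lt: "of_int p * \<rho> - of_int P < of_int Q - of_int N * \<rho>"
  defines "y1 \<equiv> A 0 - B N - of_int (- Q)" and "y1' \<equiv> A 0 - B (N + p) - of_int (- Q - P)"
    and "l \<equiv> A 0 - B (- p) - of_int P" and "r \<equiv> A 0 - A (- p) - of_int P"
  shows "U * ((y1 - y1') / y1) \<le> exp C * C1 * ((r - l) / (y1 - l))"
proof -
  define dN d where "dN = of_int Q - of_int N * \<rho>" and "d = of_int p * \<rho> - of_int P"
  have ds: "0 < dN" "dN < 1" "0 < d" "d < dN" "1 \<le> N" "1 \<le> p" using F lt by (auto simp: fp_def dN_def d_def)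
  define w x y z where "w = B (1 - (p - N)) + of_int (P - Q)" and "x = A (1 + N) + of_int (- Q)" and "y = A (1 - p) + of_int P" and "z = B (1 - p) + of_int P"
  have wx: "w < x" unfolding w_def x_def by (rule ordBA) (use ds in \<open>simp add: d_def dN_def algebra_simps\<close>)
  have xy: "x < y" unfolding x_def y_def by (rule ordAA) (use ds in \<open>simp add: d_def dN_def algebra_simps\<close>)
  have yz: "y < z" unfolding y_def z_def using AB_less[of "1 - p"] ds by simp
  define m where "m = nat (p - 1)"
  have m: "int m = p - 1" using ds by (simp add: m_def)
  have okm: "ok i w z" if i: "i < m" for i
    unfolding w_def z_def
  proof (rule ok_crit)
    show "B (1 - (p - N)) + of_int (P - Q) = B (1 - (p - N)) + of_int (P - Q) \<or> B (1 - (p - N)) + of_int (P - Q) = A (1 - (p - N)) + of_int (P - Q) \<and> 1 - (p - N) + int i \<noteq> 0" by simp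
    show "B (1 - p) + of_int P = A (1 - p) + of_int P \<or> B (1 - p) + of_int P = B (1 - p) + of_int P \<and> 1 - p + int i \<noteq> 0"
      using i m by auto
    fix k
    show "\<not> (of_int (1 - (p - N) + int i) * \<rho> + of_int (P - Q) < of_int k \<and> of_int k < of_int (1 - p + int i) * \<rho> + of_int P)"
      using fp_window_p[OF F, of "1 + int i" k] i m ds by (force simp: d_def dN_def algebra_simps)
  qed
  have S: "(\<Sum>i<m. (f ^^ i) y - (f ^^ i) x) \<le> 1"
  proof (rule sum_strict[where ?e1.0 = "1 + N" and ?k1.0 = "- Q" and ?e2.0 = "1 - p" and ?k2.0 = "P"])
    show "of_int (1 - p) * \<rho> + of_int P - (of_int (1 + N) * \<rho> + of_int (- Q)) < 1" using ds by (simp add: d_def dN_def algebra_simps)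
    fix j :: nat and k :: int assume j: "0 < j" "j < m"
    have "dN \<le> \<bar>real j * \<rho> - of_int k\<bar>" using fp_sep_p[OF F, of "int j" k] j m by (simp add: dN_def)
    then show "of_int (1 - p) * \<rho> + of_int P - (of_int (1 + N) * \<rho> + of_int (- Q)) < \<bar>real j * \<rho> - of_int k\<bar>"
      using ds by (simp add: d_def dN_def algebra_simps)
  qed (use xy in \<open>auto simp: x_def y_def\<close>)
  note CR = cr_iter1[OF okm wx xy yz S]
  have im: "(f ^^ m) w = B N + of_int (P - Q)" "(f ^^ m) x = A (N + p) + of_int (- Q)" "(f ^^ m) y = A 0 + of_int P" "(f ^^ m) z = B 0 + of_int P"
    unfolding w_def x_def y_def z_def iterA iterB m by (simp_all add: algebra_simps)
  have AN: "A N = B N" "A (N + p) = B (N + p)" using AB_eq ds by auto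
  have o': "(f ^^ m) w < (f ^^ m) x" "(f ^^ m) x < (f ^^ m) y" "(f ^^ m) y < (f ^^ m) z"
    by (rule iter_strict[OF okm]; use wx xy yz in simp)+
  have z1: "(f ^^ m) z - (f ^^ m) x \<le> 1"
  proof -
    have "B 0 + of_int (P - 1) < A (N + p) + of_int (- Q)" by (rule ordBA) (use ds in \<open>simp add: d_def dN_def algebra_simps\<close>)
    then show ?thesis unfolding im by simp
  qed
  have z2: "(f ^^ m) z - (f ^^ m) y \<ge> U" unfolding im by simp
  have "U * ((y1 - y1') / y1) \<le> cr ((f ^^ m) w) ((f ^^ m) x) ((f ^^ m) y) ((f ^^ m) z)"
    using cr_lower[OF o' z1 z2] U_pos unfolding im y1_def y1'_def using AN by (simp add: algebra_simps)
  also note CR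
  also have "cr w x y z \<le> C1 * ((r - l) / (y1 - l))"
  proof -
    define x0 y0 z0 where "x0 = A N + of_int (- Q)" and "y0 = A (- p) + of_int P" and "z0 = B (- p) + of_int P"
    have fy: "f x0 = x" "f y0 = y" "f z0 = z" unfolding x0_def y0_def z0_def y_def z_def x_def per_int fA fB by (simp_all add: algebra_simps)
    have o0: "B 0 + of_int (-1) < x0" unfolding x0_def by (rule ordBA) (use ds in \<open>simp add: dN_def\<close>)
    have o1: "x0 < y0" unfolding y0_def x0_def by (rule ordAA) (use ds in \<open>simp add: d_def dN_def\<close>)
    have o2: "y0 < z0" unfolding y0_def z0_def using AB_less[of "-p"] ds by simp
    have o3: "z0 < A 0 + of_int 0" unfolding z0_def by (rule ordBA) (use ds in \<open>simp add: d_def\<close>)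
    have "z - y \<le> C1 * ((z0 - y0) / (z0 - x0)) * (z - x)"
      using dbl_int[of "-1" x0 y0 z0 z0] o0 o1 o2 o3 fy by simp
    then have "(z - y) / (z - x) \<le> C1 * ((z0 - y0) / (z0 - x0))" using xy yz by (simp add: pos_divide_le_eq)
    also have "(z0 - y0) / (z0 - x0) = (r - l) / (y1 - l)" using AN by (simp add: y0_def z0_def x0_def r_def l_def y1_def)
    finally show ?thesis using cr_upper(1)[OF wx xy yz] by simp
  qed
  finally show ?thesis by (simp add: mult.assoc mult_left_mono)
qed

text \<open>Now the image of the preimage of order \<open>p\<close> is the left arc
  \<open>[w, x]\<close>, which becomes \<open>U\<close>. On the right-hand side both fractions are
  at most one, so a lower bound for the product yields two facts: the image is large compared with
  its distance from the critical value, and \<open>m\<close> is not much larger than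
  \<open>m'\<close>.\<close>

lemma hole_fat_image:
  fixes p P N Q :: int
  assumes F: "fp p P N Q" and Np: "N < p" and lt: "of_int p * \<rho> - of_int P < of_int Q - of_int N * \<rho>"
  defines "y \<equiv> A p + of_int (- P) - B 0" and "X \<equiv> A (p - N) + of_int (Q - P) - B 0"
    and "m \<equiv> A 1 - B (- p + 1) - of_int P" and "t \<equiv> A 1 - A (- p + 1) - of_int P" and "m' \<equiv> A (- N + 1) + of_int Q - A 1"
  shows "U * (1 - y / X) \<le> exp C * ((t - m) / t * (m' / (m' + m)))"
proof -
  define dN d where "dN = of_int Q - of_int N * \<rho>" and "d = of_int p * \<rho> - of_int P"
  have ds: "0 < dN" "dN < 1" "0 < d" "d < 1" "1 \<le> N" "1 \<le> p" using F by (auto simp: fp_def dN_def d_def)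
  define w x y' z where "w = A (1 - p) + of_int P" and "x = B (1 - p) + of_int P" and "y' = A 1 + of_int 0" and "z = A (1 - N) + of_int Q"
  have wx: "w < x" unfolding w_def x_def using AB_less[of "1 - p"] ds by simp
  have xy: "x < y'" unfolding x_def y'_def by (rule ordBA) (use ds in \<open>simp add: d_def algebra_simps\<close>)
  have yz: "y' < z" unfolding y'_def z_def by (rule ordAA) (use ds in \<open>simp add: dN_def algebra_simps\<close>)
  define n where "n = nat (p - 1)"
  have n: "int n = p - 1" using ds by (simp add: n_def)
  have okn: "ok i w z" if i: "i < n" for i
    unfolding w_def z_def
  proof (rule ok_crit)
    show "A (1 - p) + of_int P = B (1 - p) + of_int P \<or> A (1 - p) + of_int P = A (1 - p) + of_int P \<and> 1 - p + int i \<noteq> 0"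
      using i n by auto
    fix k
    show "\<not> (of_int (1 - p + int i) * \<rho> + of_int P < of_int k \<and> of_int k < of_int (1 - N + int i) * \<rho> + of_int Q)"
      using fp_window[OF F, of "1 + int i" k] i n ds by (force simp: d_def dN_def algebra_simps)
  qed simp
  have S: "(\<Sum>i<n. (f ^^ i) y' - (f ^^ i) x) \<le> 1"
  proof (rule sum_strict[where ?e1.0 = "1 - p" and ?k1.0 = P and ?e2.0 = 1 and ?k2.0 = 0])
    show "of_int 1 * \<rho> + of_int 0 - (of_int (1 - p) * \<rho> + of_int P) < 1" using ds by (simp add: d_def algebra_simps)
    fix j :: nat and k :: int assume j: "0 < j" "j < n"
    have "dN \<le> \<bar>real j * \<rho> - of_int k\<bar>" using fp_sep_p[OF F, of "int j" k] j n by (simp add: dN_def)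
    then show "of_int 1 * \<rho> + of_int 0 - (of_int (1 - p) * \<rho> + of_int P) < \<bar>real j * \<rho> - of_int k\<bar>"
      using lt by (simp add: d_def dN_def algebra_simps)
  qed (use xy in \<open>auto simp: x_def y'_def\<close>)
  note CR = cr_iter1[OF okn wx xy yz S]
  have im: "(f ^^ n) w = A 0 + of_int P" "(f ^^ n) x = B 0 + of_int P" "(f ^^ n) y' = A p" "(f ^^ n) z = A (p - N) + of_int Q"
    unfolding w_def x_def y'_def z_def iterA iterB n by (simp_all add: algebra_simps)
  have o': "(f ^^ n) w < (f ^^ n) x" "(f ^^ n) x < (f ^^ n) y'" "(f ^^ n) y' < (f ^^ n) z"
    by (rule iter_strict[OF okn]; use wx xy yz in simp)+
  have yX: "0 < y" "y < X" using o' unfolding im y_def X_def by simp_all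
  have le1: "A p < A 0 + of_int (P + 1)"
  proof -
    have "A p + of_int 0 < A 0 + of_int (P + 1)" by (rule ordAA) (use ds in \<open>simp add: d_def\<close>)
    then show ?thesis by simp
  qed
  have "U * (1 - y / X) \<le> cr ((f ^^ n) w) ((f ^^ n) x) ((f ^^ n) y') ((f ^^ n) z)"
  proof -
    have "cr ((f ^^ n) w) ((f ^^ n) x) ((f ^^ n) y') ((f ^^ n) z) = U / (U + y) * ((X - y) / X)"
      unfolding cr_def im y_def X_def by (simp add: algebra_simps)
    moreover have "U \<le> U / (U + y)" using yX U_pos le1 by (simp add: pos_le_divide_eq y_def mult_left_le)
    moreover have "(X - y) / X = 1 - y / X" "0 \<le> 1 - y / X" using yX by (simp_all add: field_simps)
    ultimately show ?thesis using mult_right_mono[of U "U / (U + y)" "1 - y / X"] by simp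
  qed
  also note CR
  also have "cr w x y' z = (t - m) / t * (m' / (m' + m))"
    unfolding cr_def w_def x_def y'_def z_def t_def m_def m'_def by (simp add: algebra_simps)
  finally show ?thesis .
qed

lemma po_iterL:
  assumes "\<And>i. i < n \<Longrightarrow> ok i w z" and "w < x" "x < y" "y < z" and "(\<Sum>i<n. (f ^^ i) x - (f ^^ i) w) \<le> S"
  shows "po ((f ^^ n) w) ((f ^^ n) x) ((f ^^ n) y) ((f ^^ n) z) \<ge> exp (- (C * S)) * po w x y z"
proof -
  have "po w x y z \<ge> 0" using assms(2-4) by (simp add: po_def)
  moreover have "exp (- (C * S)) \<le> exp (- (C * (\<Sum>i<n. (f ^^ i) x - (f ^^ i) w)))"
    using assms(5) C0 by (simp add: mult_left_mono)
  ultimately show ?thesis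
    using po_iter(1)[OF assms(1-4)] by (meson mult_right_mono order_trans)
qed

lemma fp_dsum:
  assumes "fp p P N Q" "N < p \<or> p < N"
  shows "(of_int p * \<rho> - of_int P) + (of_int Q - of_int N * \<rho>) < 1"
proof -
  define dN d where "dN = of_int Q - of_int N * \<rho>" and "d = of_int p * \<rho> - of_int P"
  have ds: "0 < dN" "0 < d" "1 \<le> N" "1 \<le> p" "p * Q - N * P = 1" using assms by (auto simp: fp_def dN_def d_def)
  have "of_int p * dN + of_int N * d = of_int (p * Q - N * P)" by (simp add: dN_def d_def algebra_simps)
  then have 1: "of_int p * dN + of_int N * d = 1" using ds by simp
  have le: "dN \<le> of_int p * dN" "d \<le> of_int N * d" using int_mult_ge ds by auto
  show ?thesis
  proof (cases "N < p")
    case True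
    then have "2 * dN \<le> of_int p * dN" using ds by (intro mult_right_mono) auto
    then show ?thesis using 1 le ds unfolding dN_def[symmetric] d_def[symmetric] by linarith
  next
    case False
    then have "2 * d \<le> of_int N * d" using ds assms(2) by (intro mult_right_mono) auto
    then show ?thesis using 1 le ds unfolding dN_def[symmetric] d_def[symmetric] by linarith
  qed
qed

text \<open>\<open>f ^^ j\<close> carries the preimage of order \<open>p + j\<close>, the gap beside
  it and the preimage of order \<open>j\<close> to the same configuration with \<open>j = 0\<close>,
  where the last set is \<open>U\<close> itself. Since \<open>j\<close> stays below
  \<open>N\<close>, no lift of \<open>U\<close> interferes, and the constant does not depend on
  \<open>j\<close>.\<close>

lemma hole_vs_gap:
  fixes p P N Q :: int and j :: nat
  assumes F: "fp p P N Q" and j: "int j < N"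
  defines "l \<equiv> A 0 - B (- p) - of_int P" and "r \<equiv> A 0 - A (- p) - of_int P"
    and "g \<equiv> A (- int j) - B (- (p + int j)) - of_int P"
  shows "U * ((r - l) / r) \<le> exp C * (hole (nat p + j) / (hole (nat p + j) + g))" "g > 0"
proof -
  define d where "d = of_int p * \<rho> - of_int P"
  have ds: "0 < d" "d < 1" "1 \<le> N" "1 \<le> p" using F by (auto simp: fp_def d_def)
  define w x y z where "w = A (- (p + int j)) + of_int P" and "x = B (- (p + int j)) + of_int P"
    and "y = A (- int j) + of_int 0" and "z = B (- int j) + of_int 0"
  have wx: "w < x" unfolding w_def x_def using AB_less[of "- (p + int j)"] ds by simp
  have xy: "x < y" unfolding x_def y_def by (rule ordBA) (use ds in \<open>simp add: d_def algebra_simps\<close>)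
  have yz: "y < z" unfolding y_def z_def using AB_less[of "- int j"] by simp
  have okj: "ok i w z" if i: "i < j" for i
    unfolding w_def z_def
  proof (rule ok_crit)
    show "A (- (p + int j)) + of_int P = B (- (p + int j)) + of_int P \<or>
       A (- (p + int j)) + of_int P = A (- (p + int j)) + of_int P \<and> - (p + int j) + int i \<noteq> 0" using i ds by auto
    show "B (- int j) + of_int 0 = A (- int j) + of_int 0 \<or> B (- int j) + of_int 0 = B (- int j) + of_int 0 \<and> - int j + int i \<noteq> 0"
      using i by auto
    fix k
    show "\<not> (of_int (- (p + int j) + int i) * \<rho> + of_int P < of_int k \<and> of_int k < of_int (- int j + int i) * \<rho> + of_int 0)"
      using fp_window_N[OF F, of "int j - int i" "- k"] i j F by (force simp: fp_def algebra_simps)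
  qed
  have S: "(\<Sum>i<j. (f ^^ i) y - (f ^^ i) x) + (\<Sum>j<0. hole j) \<le> 1"
    unfolding x_def y_def
  proof (rule sumBA)
    show "0 < of_int (- int j) * \<rho> + of_int 0 - (of_int (- (p + int j)) * \<rho> + of_int P)"
      "of_int (- int j) * \<rho> + of_int 0 - (of_int (- (p + int j)) * \<rho> + of_int P) \<le> 1"
      using ds by (simp_all add: d_def algebra_simps)
    fix j' :: nat and k :: int assume j': "0 < j'" "j' < j"
    have "d \<le> \<bar>real j' * \<rho> - of_int k\<bar>" using fp_sep_N[OF F, of "int j'" k] j j' by (simp add: d_def)
    then show "of_int (- int j) * \<rho> + of_int 0 - (of_int (- (p + int j)) * \<rho> + of_int P) \<le> \<bar>real j' * \<rho> - of_int k\<bar>"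
      by (simp add: d_def algebra_simps)
  qed simp
  then have "(\<Sum>i<j. (f ^^ i) y - (f ^^ i) x) \<le> 1" by simp
  note CR = cr_iter1[OF okj wx xy yz this]
  have im: "(f ^^ j) w = A (- p) + of_int P" "(f ^^ j) x = B (- p) + of_int P" "(f ^^ j) y = A 0" "(f ^^ j) z = B 0"
    unfolding w_def x_def y_def z_def iterA iterB by (simp_all add: algebra_simps)
  have o': "(f ^^ j) w < (f ^^ j) x" "(f ^^ j) x < (f ^^ j) y" "(f ^^ j) y < (f ^^ j) z"
    by (rule iter_strict[OF okj]; use wx xy yz in simp)+
  have z1: "(f ^^ j) z - (f ^^ j) x \<le> 1"
  proof -
    have "B 0 + of_int (- 1) < B (- p) + of_int P" by (rule ordBB) (use ds in \<open>simp add: d_def\<close>)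
    then show ?thesis unfolding im by simp
  qed
  have "U * ((r - l) / r) \<le> cr ((f ^^ j) w) ((f ^^ j) x) ((f ^^ j) y) ((f ^^ j) z)"
    using cr_lower[OF o' z1, of U] U_pos unfolding im r_def l_def by (simp add: algebra_simps)
  also note CR
  also have "cr w x y z \<le> hole (nat p + j) / (hole (nat p + j) + g)"
    using cr_upper(2)[OF wx xy yz] ds unfolding hole_def g_def w_def x_def y_def by (simp add: algebra_simps)
  finally show "U * ((r - l) / r) \<le> exp C * (hole (nat p + j) / (hole (nat p + j) + g))" by simp
  show "g > 0" using xy by (simp add: g_def x_def y_def)
qed

text \<open>\<open>f ^^ p\<close> moves every point by more than \<open>P\<close>, so the image
  \<open>Z\<close> of \<open>x0\<close> lies beyond \<open>x0\<close> and it suffices to bound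
  \<open>Z\<close>. The Poincare ratio of the points ending at \<open>A 0\<close>,
  \<open>B 0\<close>, \<open>A p\<close> and \<open>Z\<close> does this in terms of the return of
  order \<open>p\<close>.\<close>

lemma fixed_free:
  fixes p P N Q :: int
  assumes F: "fp p P N Q" and Np: "N < p"
    and u: "0 < u" "u \<le> A (1 - N) + of_int Q - A 1" and x0: "f x0 = A 1 + u"
  defines "m \<equiv> A 1 - B (1 - p) - of_int P"
  shows "x0 - B 0 \<le> exp C / U * (1 + u / m) * (A p - of_int P - B 0)"
proof -
  define dN d where "dN = of_int Q - of_int N * \<rho>" and "d = of_int p * \<rho> - of_int P"
  have ds: "0 < dN" "dN < 1" "0 < d" "d < 1" "1 \<le> N" "1 \<le> p" using F by (auto simp: fp_def dN_def d_def)
  have dsum: "d + dN < 1" using fp_dsum[OF F] Np by (simp add: d_def dN_def)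
  define w x y z where "w = A (1 - p) + of_int P" and "x = B (1 - p) + of_int P" and "y = A 1 + of_int 0" and "z = A 1 + u"
  have wx: "w < x" unfolding w_def x_def using AB_less[of "1 - p"] ds by simp
  have xy: "x < y" unfolding x_def y_def by (rule ordBA) (use ds in \<open>simp add: d_def algebra_simps\<close>)
  have yz: "y < z" unfolding y_def z_def using u by simp
  define n where "n = nat (p - 1)"
  have n: "int n = p - 1" using ds by (simp add: n_def)
  have okn: "ok i w z" if i: "i < n" for i
  proof -
    have "ok i w (A (1 - N) + of_int Q)"
      unfolding w_def
    proof (rule ok_crit)
      show "A (1 - p) + of_int P = B (1 - p) + of_int P \<or> A (1 - p) + of_int P = A (1 - p) + of_int P \<and> 1 - p + int i \<noteq> 0"
        using i n by auto
      fix k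
      show "\<not> (of_int (1 - p + int i) * \<rho> + of_int P < of_int k \<and> of_int k < of_int (1 - N + int i) * \<rho> + of_int Q)"
        using fp_window[OF F, of "1 + int i" k] i n ds by (force simp: d_def dN_def algebra_simps)
    qed simp
    then show ?thesis using u by (auto intro: ok_mono simp: z_def)
  qed
  have S: "(\<Sum>i<n. (f ^^ i) x - (f ^^ i) w) \<le> 1"
  proof (rule sum_strict[where ?e1.0 = "1 - p" and ?k1.0 = P and ?e2.0 = "1 - p" and ?k2.0 = P])
    fix j :: nat and k :: int assume j: "0 < j" "j < n"
    then show "of_int (1 - p) * \<rho> + of_int P - (of_int (1 - p) * \<rho> + of_int P) < \<bar>real j * \<rho> - of_int k\<bar>"
      using irr_eq[of "int j" "- k"] by auto
  qed (use wx in \<open>auto simp: x_def w_def\<close>)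
  note PO = po_iterL[OF okn wx xy yz S]
  define Z where "Z = (f ^^ n) z - of_int P"
  have Zp: "(f ^^ n) z = (f ^^ nat p) x0"
  proof -
    have "nat p = Suc n" using n ds by simp
    then show ?thesis unfolding z_def x0[symmetric] by (simp add: funpow_swap1)
  qed
  have x0Z: "x0 < Z" unfolding Z_def Zp using move_up[of P "nat p" x0] ds by (simp add: d_def)
  have im: "(f ^^ n) w = A 0 + of_int P" "(f ^^ n) x = B 0 + of_int P" "(f ^^ n) y = A p"
    unfolding w_def x_def y_def iterA iterB n by (simp_all add: algebra_simps)
  have o': "(f ^^ n) w < (f ^^ n) x" "(f ^^ n) x < (f ^^ n) y" "(f ^^ n) y < (f ^^ n) z"
    by (rule iter_strict[OF okn]; use wx xy yz in simp)+
  define Y where "Y = A p - of_int P - B 0"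
  have YZ: "0 < Y" "Y < Z - B 0" using o' by (simp_all add: Y_def Z_def im)
  have Z1: "Z - A 0 \<le> 1"
  proof -
    have "(f ^^ n) z \<le> (f ^^ n) (A (1 - N) + of_int Q)" by (rule iter_mono) (use u in \<open>simp add: z_def\<close>)
    also have "\<dots> = A (p - N) + of_int Q" unfolding iterA n by (simp add: algebra_simps)
    also have "\<dots> < A 0 + of_int (P + 1)" by (rule ordAA) (use dsum in \<open>simp add: d_def dN_def algebra_simps\<close>)
    finally show ?thesis by (simp add: Z_def)
  qed
  define t where "t = A 1 - A (1 - p) - of_int P"
  have mt: "0 < m" "m < t" using xy wx by (simp_all add: m_def t_def x_def y_def w_def)
  have "m / (m + u) \<le> po w x y z"
  proof -
    have "po w x y z = m / (m + u) * ((t + u) / t)"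
      unfolding po_def w_def x_def y_def z_def m_def t_def by (simp add: algebra_simps)
    moreover have "1 \<le> (t + u) / t" using mt u by simp
    ultimately show ?thesis using mult_left_mono[of 1 "(t + u) / t" "m / (m + u)"] mt u by simp
  qed
  then have "exp (- C) * (m / (m + u)) \<le> po ((f ^^ n) w) ((f ^^ n) x) ((f ^^ n) y) ((f ^^ n) z)"
    using PO mult_left_mono[of "m / (m + u)" "po w x y z" "exp (- C)"] by simp
  also have "\<dots> = Y / (Z - B 0) * ((Z - A 0) / (Y + U))"
    unfolding po_def im Y_def Z_def by (simp add: algebra_simps)
  also have "\<dots> \<le> Y / (Z - B 0) * (1 / U)"
    using YZ Z1 U_pos by (intro mult_left_mono frac_le) auto
  also have "\<dots> = Y / U / (Z - B 0)" by simp
  finally have "exp (- C) * (m / (m + u)) * (Z - B 0) \<le> Y / U" using YZ by (subst (asm) pos_le_divide_eq) auto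
  moreover have "q \<le> exp C / V * ((m + u) / m) * Y" if h: "exp (- C) * (m / (m + u)) * q \<le> Y / V" for q V
  proof -
    have "q = (exp (- C) * (m / (m + u)) * q) * (exp C * ((m + u) / m))" using mt u by (simp add: exp_minus)
    also have "\<dots> \<le> (Y / V) * (exp C * ((m + u) / m))" by (rule mult_right_mono[OF h]) (use mt u in simp)
    finally show ?thesis by (simp add: ac_simps)
  qed
  ultimately have "Z - B 0 \<le> exp C / U * ((m + u) / m) * Y" by blast
  moreover have "(m + u) / m = 1 + u / m" using mt by (simp add: field_simps)
  ultimately show ?thesis using x0Z by (simp add: Y_def)
qed

text \<open>For up to \<open>N\<close> steps the gap next to the critical value meets neither its
  own images nor a preimage of order below \<open>p\<close>. This supplies the small exponent for
  \<open>step_ratio\<close>.\<close>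

lemma gap_sum:
  fixes p P N Q :: int and n :: nat
  assumes F: "fp p P N Q" and n: "int n \<le> N"
  shows "(\<Sum>i<n. (f ^^ i) (A 1 + of_int 0) - (f ^^ i) (B (1 - p) + of_int P)) \<le> 1 - (\<Sum>j<nat p. hole j)"
proof -
  define d where "d = of_int p * \<rho> - of_int P"
  have ds: "0 < d" "d < 1" "1 \<le> N" "1 \<le> p" using F by (auto simp: fp_def d_def)
  have "(\<Sum>i<n. (f ^^ i) (A 1 + of_int 0) - (f ^^ i) (B (1 - p) + of_int P)) + (\<Sum>j<nat p. hole j) \<le> 1"
  proof (rule sumBA)
    show "0 < of_int 1 * \<rho> + of_int 0 - (of_int (1 - p) * \<rho> + of_int P)" "of_int 1 * \<rho> + of_int 0 - (of_int (1 - p) * \<rho> + of_int P) \<le> 1"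
      using ds by (simp_all add: d_def algebra_simps)
    fix j :: nat and k :: int assume j: "0 < j" "j < n"
    have "d \<le> \<bar>real j * \<rho> - of_int k\<bar>" using fp_sep_N[OF F, of "int j" k] j n by (simp add: d_def)
    then show "of_int 1 * \<rho> + of_int 0 - (of_int (1 - p) * \<rho> + of_int P) \<le> \<bar>real j * \<rho> - of_int k\<bar>"
      by (simp add: d_def algebra_simps)
  next
    fix i j :: nat and k :: int assume ij: "i < n" "j < nat p"
    show "\<not> (of_int (1 - p + int i + int j) * \<rho> + of_int P < of_int k \<and> of_int k < of_int (1 + int i + int j) * \<rho> + of_int 0)"
      using fp_window[OF F, of "1 + int i + int j" k] ij n F by (force simp: fp_def algebra_simps)
  qed
  then show ?thesis by simp
qed

text \<open>The error is charged to the arc \<open>[w, x]\<close>, whose iterates are summed by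
  \<open>gap_sum\<close>. In the image the Poincare ratio is the ratio of two successive returns,
  apart from a factor that tends to one as these approach \<open>U\<close>. The result compares
  returns with an error that tends to zero, not merely up to a constant.\<close>

lemma step_ratio:
  fixes p P N Q :: int
  assumes F: "fp p P N Q" and Np: "p < N" and S: "(\<Sum>i<nat (N - 1). (f ^^ i) (A 1 + of_int 0) - (f ^^ i) (B (1 - p) + of_int P)) \<le> S"
  defines "y \<equiv> A 0 - B N - of_int (- Q)" and "y' \<equiv> A 0 - B (N - p) - of_int (P - Q)"
    and "m \<equiv> A 1 - B (1 - p) - of_int P" and "m' \<equiv> A (1 - N) + of_int Q - A 1" and "t' \<equiv> B (1 - N) + of_int Q - A 1"
  shows "exp (- (C * S)) * (m' * (t' + m) / ((m' + m) * t')) \<le> y / y' * ((y' + U) / (y + U))"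
proof -
  define dN d where "dN = of_int Q - of_int N * \<rho>" and "d = of_int p * \<rho> - of_int P"
  have ds: "0 < dN" "dN < 1" "0 < d" "d < 1" "1 \<le> N" "1 \<le> p" using F by (auto simp: fp_def dN_def d_def)
  define w x u z where "w = B (1 - p) + of_int P" and "x = A 1 + of_int 0" and "u = A (1 - N) + of_int Q" and "z = B (1 - N) + of_int Q"
  have wx: "w < x" unfolding w_def x_def by (rule ordBA) (use ds in \<open>simp add: d_def algebra_simps\<close>)
  have xu: "x < u" unfolding x_def u_def by (rule ordAA) (use ds in \<open>simp add: dN_def algebra_simps\<close>)
  have uz: "u < z" unfolding u_def z_def using AB_less[of "1 - N"] ds by simp
  define n where "n = nat (N - 1)"
  have n: "int n = N - 1" using ds by (simp add: n_def)
  have okn: "ok i w z" if i: "i < n" for i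
    unfolding w_def z_def
  proof (rule ok_crit)
    show "B (1 - p) + of_int P = B (1 - p) + of_int P \<or> B (1 - p) + of_int P = A (1 - p) + of_int P \<and> 1 - p + int i \<noteq> 0" by simp
    show "B (1 - N) + of_int Q = A (1 - N) + of_int Q \<or> B (1 - N) + of_int Q = B (1 - N) + of_int Q \<and> 1 - N + int i \<noteq> 0"
      using i n by auto
    fix k
    show "\<not> (of_int (1 - p + int i) * \<rho> + of_int P < of_int k \<and> of_int k < of_int (1 - N + int i) * \<rho> + of_int Q)"
      using fp_window[OF F, of "1 + int i" k] i n ds by (force simp: d_def dN_def algebra_simps)
  qed
  have "(\<Sum>i<n. (f ^^ i) x - (f ^^ i) w) \<le> S" using S by (simp add: n_def x_def w_def)
  note PO = po_iterL[OF okn wx xu uz this]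
  have im: "(f ^^ n) w = B (N - p) + of_int P" "(f ^^ n) x = A N" "(f ^^ n) u = A 0 + of_int Q" "(f ^^ n) z = B 0 + of_int Q"
    unfolding w_def x_def u_def z_def iterA iterB n by (simp_all add: algebra_simps)
  have AN: "A N = B N" using AB_eq ds by auto
  have "po w x u z = m' * (t' + m) / ((m' + m) * t')"
    unfolding po_def w_def x_def u_def z_def m_def m'_def t'_def by (simp add: algebra_simps)
  moreover have "po ((f ^^ n) w) ((f ^^ n) x) ((f ^^ n) u) ((f ^^ n) z) = y / y' * ((y' + U) / (y + U))"
    unfolding po_def im y_def y'_def AN by (simp add: algebra_simps)
  ultimately show ?thesis using PO by simp
qed

text \<open>The last arc \<open>[y, z]\<close> is carried onto the arc between the preimage of order
  \<open>p\<close> and the flat spot, of length \<open>l\<close>. So a definite \<open>l\<close>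
  forces definite room between the preimages of order \<open>N + p\<close> and \<open>N\<close>,
  seen from the critical value.\<close>

lemma first_gap:
  fixes p' P' N Q p P n :: int
  assumes F: "fp p' P' N Q" and Np: "p' < N" and pn: "p = p' + n * N" "P = P' + n * Q" "n \<ge> 1"
    and pos: "0 < of_int p * \<rho> - of_int P" and lt: "of_int p * \<rho> - of_int P < of_int Q - of_int N * \<rho>"
  defines "X1 \<equiv> A 0 - B (N - p') - of_int (P' - Q)" and "y1 \<equiv> A 0 - B N - of_int (- Q)"
    and "l \<equiv> A 0 - B (- p) - of_int P"
    and "m' \<equiv> A (1 - N) + of_int Q - A 1" and "t1 \<equiv> B (1 - (N + p)) + of_int (Q + P) - A 1"
  shows "l / y1 * (1 - y1 / X1) \<le> exp C * (1 - t1 / m')"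
proof -
  define d' dN d where "d' = of_int p' * \<rho> - of_int P'" and "dN = of_int Q - of_int N * \<rho>" and "d = of_int p * \<rho> - of_int P"
  have ds: "0 < d'" "d' < 1" "0 < dN" "dN < 1" "0 < d" "d < dN" "1 \<le> N" "1 \<le> p'" using F pos lt by (auto simp: fp_def d'_def dN_def d_def)
  have "d = d' - of_int n * dN" by (simp add: d_def d'_def dN_def pn algebra_simps)
  moreover have "of_int n * dN \<ge> dN" using int_mult_ge pn ds by auto
  ultimately have dd: "d \<le> d' - dN" by linarith
  have "0 \<le> n * N" using pn ds by simp
  then have p1: "1 \<le> p" using pn ds by linarith
  define w x y z where "w = B (1 - p') + of_int P'" and "x = A 1 + of_int 0" and "y = B (1 - (N + p)) + of_int (Q + P)" and "z = A (1 - N) + of_int Q"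
  have wx: "w < x" unfolding w_def x_def by (rule ordBA) (use ds in \<open>simp add: d'_def algebra_simps\<close>)
  have xy: "x < y" unfolding x_def y_def by (rule ordAB') (use ds in \<open>simp add: d_def dN_def algebra_simps\<close>)
  have yz: "y < z" unfolding y_def z_def by (rule ordBA) (use ds in \<open>simp add: d_def dN_def algebra_simps\<close>)
  define m where "m = nat (N - 1)"
  have m: "int m = N - 1" using ds by (simp add: m_def)
  have okm: "ok i w z" if i: "i < m" for i
    unfolding w_def z_def
  proof (rule ok_crit)
    show "B (1 - p') + of_int P' = B (1 - p') + of_int P' \<or> B (1 - p') + of_int P' = A (1 - p') + of_int P' \<and> 1 - p' + int i \<noteq> 0" by simp
    fix k
    show "\<not> (of_int (1 - p' + int i) * \<rho> + of_int P' < of_int k \<and> of_int k < of_int (1 - N + int i) * \<rho> + of_int Q)"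
      using fp_window[OF F, of "1 + int i" k] i m ds by (force simp: algebra_simps)
  qed simp
  have S: "(\<Sum>i<m. (f ^^ i) y - (f ^^ i) x) \<le> 1"
  proof (rule sum_strict[where ?e1.0 = 1 and ?k1.0 = 0 and ?e2.0 = "1 - (N + p)" and ?k2.0 = "Q + P"])
    show "of_int (1 - (N + p)) * \<rho> + of_int (Q + P) - (of_int 1 * \<rho> + of_int 0) < 1" using ds by (simp add: d_def dN_def algebra_simps)
    fix j :: nat and k :: int assume j: "0 < j" "j < m"
    have "d' \<le> \<bar>real j * \<rho> - of_int k\<bar>" using fp_sep_N[OF F, of "int j" k] j m by (simp add: d'_def)
    then show "of_int (1 - (N + p)) * \<rho> + of_int (Q + P) - (of_int 1 * \<rho> + of_int 0) < \<bar>real j * \<rho> - of_int k\<bar>"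
      using dd ds by (simp add: d_def dN_def algebra_simps)
  qed (use xy in \<open>auto simp: x_def y_def\<close>)
  note CR = cr_iter1[OF okm wx xy yz S]
  have im: "(f ^^ m) w = B (N - p') + of_int P'" "(f ^^ m) x = A N" "(f ^^ m) y = B (- p) + of_int (Q + P)" "(f ^^ m) z = A 0 + of_int Q"
    unfolding w_def x_def y_def z_def iterA iterB m by (simp_all add: algebra_simps)
  have AN: "A N = B N" using AB_eq ds by auto
  have o': "(f ^^ m) w < (f ^^ m) x" "(f ^^ m) x < (f ^^ m) y" "(f ^^ m) y < (f ^^ m) z"
    by (rule iter_strict[OF okm]; use wx xy yz in simp)+
  have oo: "0 < l" "l < y1" "y1 < X1" using o' unfolding im X1_def y1_def l_def using AN by simp_all
  have "l / y1 * (1 - y1 / X1) \<le> l / y1 * ((X1 - y1) / (X1 - l))"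
  proof (rule mult_left_mono)
    have "1 - y1 / X1 = (X1 - y1) / X1" using oo by (simp add: field_simps)
    also have "\<dots> \<le> (X1 - y1) / (X1 - l)" using oo by (intro divide_left_mono) auto
    finally show "1 - y1 / X1 \<le> (X1 - y1) / (X1 - l)" .
  qed (use oo in simp)
  also have "\<dots> = cr ((f ^^ m) w) ((f ^^ m) x) ((f ^^ m) y) ((f ^^ m) z)"
    unfolding cr_def im X1_def y1_def l_def using AN by (simp add: algebra_simps)
  also note CR
  also have "cr w x y z \<le> 1 - t1 / m'"
    using cr_upper(1)[OF wx xy yz] xy yz unfolding w_def x_def y_def z_def t1_def m'_def by (simp add: field_simps)
  finally show ?thesis by simp
qed

lemma fp_window_mid:
  assumes F: "fp p P N Q" and Np: "N < p" and e: "0 < e"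
    and v: "of_int p * \<rho> - of_int P < of_int e * \<rho> - of_int k" "of_int e * \<rho> - of_int k < of_int Q - of_int N * \<rho>"
  shows "e \<ge> p + N"
proof -
  define dp dN where "dp = of_int p * \<rho> - of_int P" and "dN = of_int Q - of_int N * \<rho>"
  obtain x y :: int where xy: "e = x * p + y * N" "of_int e * \<rho> - of_int k = of_int x * dp - of_int y * dN"
    using fp_rep[OF F, of e k] unfolding dp_def dN_def by metis
  have pos: "dp > 0" "dN > 0" "p \<ge> 1" "N \<ge> 1" using F by (auto simp: fp_def dp_def dN_def)
  note v' = v[folded dp_def dN_def]
  consider "x \<ge> 2 \<and> y \<ge> 0" | "x \<ge> 1 \<and> y \<ge> 1" | "x = 1 \<and> y = 0" | "x \<ge> 1 \<and> y \<le> -1" | "x \<le> 0 \<and> y \<ge> 1" | "x \<le> 0 \<and> y \<le> 0" by linarith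
  then show ?thesis
  proof cases
    case 1
    then have "2 * p \<le> x * p" "0 \<le> y * N" using pos by (auto intro: mult_right_mono)
    then show ?thesis using xy Np by linarith
  next
    case 2
    then have "x * p \<ge> p" "y * N \<ge> N" using pos by (auto simp: mult_le_cancel_right1)
    then show ?thesis using xy by linarith
  next
    case 3
    then show ?thesis using v' xy(2) by simp
  next
    case 4
    then have "dN \<le> of_int (- y) * dN" "dp \<le> of_int x * dp" using int_mult_ge[of "-y" dN] int_mult_ge[of x dp] pos by auto
    then show ?thesis using xy(2) v' pos by simp
  next
    case 5
    then show ?thesis using int_mult_ge[of y dN] int_mult_le[of x dp] pos xy(2) v' by linarith
  next
    case 6
    then have "x * p \<le> 0" "y * N \<le> 0" using pos by (auto simp: mult_le_0_iff)
    then show ?thesis using xy e by linarith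
  qed
qed

text \<open>The interval spans a whole chain of intermediate returns, seen from the critical value,
  and \<open>f ^^ (p - 1)\<close> moves each of them to the next one, seen from \<open>U\<close>.
  The images of the first arc avoid all preimages of order below \<open>N\<close>, which makes the
  exponent small.\<close>

lemma return_po:
  fixes p P N Q :: int
  assumes F: "fp p P N Q" and Np: "N < p" and lt: "of_int p * \<rho> - of_int P < of_int Q - of_int N * \<rho>"
    and o: "A (1 + N) + of_int (- Q) \<le> w" "w < x" "x < y" "y < z" "z \<le> A (1 - p) + of_int P"
  defines "n \<equiv> nat (p - 1)"
  shows "exp (- (C * (1 - (\<Sum>j<nat N. hole j)))) * po w x y z \<le> po ((f ^^ n) w) ((f ^^ n) x) ((f ^^ n) y) ((f ^^ n) z)"
    "(f ^^ n) w < (f ^^ n) x" "(f ^^ n) x < (f ^^ n) y" "(f ^^ n) y < (f ^^ n) z"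
proof -
  define dN d where "dN = of_int Q - of_int N * \<rho>" and "d = of_int p * \<rho> - of_int P"
  have ds: "0 < dN" "dN < 1" "0 < d" "d < dN" "1 \<le> N" "1 \<le> p" using F lt by (auto simp: fp_def dN_def d_def)
  have n: "int n = p - 1" using ds by (simp add: n_def)
  have A1: "A (1 + N) = B (1 + N)" using AB_eq ds by auto
  have okT: "ok i (B (1 + N) + of_int (- Q)) (A (1 - p) + of_int P)" if i: "i < n" for i
  proof (rule ok_crit)
    show "B (1 + N) + of_int (- Q) = B (1 + N) + of_int (- Q) \<or> B (1 + N) + of_int (- Q) = A (1 + N) + of_int (- Q) \<and> 1 + N + int i \<noteq> 0" by simp
    fix k
    show "\<not> (of_int (1 + N + int i) * \<rho> + of_int (- Q) < of_int k \<and> of_int k < of_int (1 - p + int i) * \<rho> + of_int P)"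
      using fp_window_p[OF F, of "1 + int i" k] i n ds by (force simp: d_def dN_def algebra_simps)
  qed simp
  have okn: "ok i w z" if "i < n" for i using ok_mono[OF okT[OF that]] o A1 by simp
  have "(\<Sum>i<n. (f ^^ i) (A (1 - p) + of_int P) - (f ^^ i) (B (1 + N) + of_int (- Q))) + (\<Sum>j<nat N. hole j) \<le> 1"
  proof (rule sumBA)
    show "0 < of_int (1 - p) * \<rho> + of_int P - (of_int (1 + N) * \<rho> + of_int (- Q))"
      "of_int (1 - p) * \<rho> + of_int P - (of_int (1 + N) * \<rho> + of_int (- Q)) \<le> 1"
      using ds by (simp_all add: d_def dN_def algebra_simps)
    fix j :: nat and k :: int assume j: "0 < j" "j < n"
    have "dN \<le> \<bar>real j * \<rho> - of_int k\<bar>" using fp_sep_p[OF F, of "int j" k] j n by (simp add: dN_def)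
    then show "of_int (1 - p) * \<rho> + of_int P - (of_int (1 + N) * \<rho> + of_int (- Q)) \<le> \<bar>real j * \<rho> - of_int k\<bar>"
      using ds by (simp add: d_def dN_def algebra_simps)
  next
    fix i j :: nat and k :: int assume ij: "i < n" "j < nat N"
    show "\<not> (of_int (1 + N + int i + int j) * \<rho> + of_int (- Q) < of_int k \<and> of_int k < of_int (1 - p + int i + int j) * \<rho> + of_int P)"
      using fp_window_mid[OF F Np, of "1 + int i + int j" k] ij n by (force simp: algebra_simps)
  qed
  moreover have "(\<Sum>i<n. (f ^^ i) x - (f ^^ i) w) \<le> (\<Sum>i<n. (f ^^ i) (A (1 - p) + of_int P) - (f ^^ i) (B (1 + N) + of_int (- Q)))"
    using o A1 by (intro sum_mono diff_mono iter_mono) auto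
  ultimately have "(\<Sum>i<n. (f ^^ i) x - (f ^^ i) w) \<le> 1 - (\<Sum>j<nat N. hole j)" by linarith
  from po_iterL[OF okn o(2-4) this]
  show "exp (- (C * (1 - (\<Sum>j<nat N. hole j)))) * po w x y z \<le> po ((f ^^ n) w) ((f ^^ n) x) ((f ^^ n) y) ((f ^^ n) z)" .
  show "(f ^^ n) w < (f ^^ n) x" "(f ^^ n) x < (f ^^ n) y" "(f ^^ n) y < (f ^^ n) z"
    by (rule iter_strict[OF okn]; use o in simp)+
qed

text \<open>Entry into the chain: after \<open>p' - 1\<close> steps the critical value and its image
  of order \<open>n * N\<close> become the returns of order \<open>p'\<close> and \<open>p\<close>.
  The proportion \<open>y / y'\<close> therefore bounds from below the room between that image and
  the preimage of order \<open>p'\<close>.\<close>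

lemma chain_start:
  fixes p' P' N Q N'' Q'' p P n :: int
  assumes F: "fp p' P' N'' Q''" and Np: "N'' < p'" and pn: "p = p' + n * N" "P = P' + n * Q" "n \<ge> 1" and N1: "1 \<le> N"
    and pos: "0 < of_int p * \<rho> - of_int P" and dN0: "0 < of_int Q - of_int N * \<rho>"
    and lt: "of_int p' * \<rho> - of_int P' < of_int Q'' - of_int N'' * \<rho>"
  defines "y \<equiv> A p - of_int P - B 0" and "y' \<equiv> A p' - of_int P' - B 0" and "X' \<equiv> A (p' - N'') + of_int (Q'' - P') - B 0"
    and "m' \<equiv> A 1 - B (1 - p') - of_int P'" and "W \<equiv> A 1 - A (1 + n * N) + of_int (n * Q)"
  shows "y / y' * (1 - y' / X') \<le> exp C * (1 - W / m')"
proof -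
  define d' dN d d'' where "d' = of_int p' * \<rho> - of_int P'" and "dN = of_int Q - of_int N * \<rho>" and "d = of_int p * \<rho> - of_int P"
    and "d'' = of_int Q'' - of_int N'' * \<rho>"
  have ds: "0 < d'" "d' < 1" "0 < dN" "0 < d" "d' < d''" "1 \<le> N" "1 \<le> p'" "d'' < 1" "1 \<le> N''" using F pos lt N1 dN0
    by (auto simp: fp_def d'_def dN_def d_def d''_def)
  have dd: "d = d' - of_int n * dN" by (simp add: d_def d'_def dN_def pn algebra_simps)
  have nd: "0 < of_int n * dN" using pn ds by simp
  define w x u z where "w = B (1 - p') + of_int P'" and "x = A (1 + n * N) + of_int (- (n * Q))" and "u = A 1 + of_int 0" and "z = A (1 - N'') + of_int Q''"
  have wx: "w < x" unfolding w_def x_def by (rule ordBA) (use ds dd in \<open>simp add: d'_def dN_def algebra_simps\<close>)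
  have xu: "x < u" unfolding x_def u_def by (rule ordAA) (use nd in \<open>simp add: dN_def algebra_simps\<close>)
  have uz: "u < z" unfolding u_def z_def by (rule ordAA) (use ds in \<open>simp add: d''_def algebra_simps\<close>)
  define m where "m = nat (p' - 1)"
  have m: "int m = p' - 1" using ds by (simp add: m_def)
  have okm: "ok i w z" if i: "i < m" for i
    unfolding w_def z_def
  proof (rule ok_crit)
    show "B (1 - p') + of_int P' = B (1 - p') + of_int P' \<or> B (1 - p') + of_int P' = A (1 - p') + of_int P' \<and> 1 - p' + int i \<noteq> 0" by simp
    fix k
    show "\<not> (of_int (1 - p' + int i) * \<rho> + of_int P' < of_int k \<and> of_int k < of_int (1 - N'' + int i) * \<rho> + of_int Q'')"
      using fp_window[OF F, of "1 + int i" k] i m ds by (force simp: algebra_simps)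
  qed simp
  have S: "(\<Sum>i<m. (f ^^ i) u - (f ^^ i) x) \<le> 1"
  proof (rule sum_strict[where ?e1.0 = "1 + n * N" and ?k1.0 = "- (n * Q)" and ?e2.0 = 1 and ?k2.0 = 0])
    show "of_int 1 * \<rho> + of_int 0 - (of_int (1 + n * N) * \<rho> + of_int (- (n * Q))) < 1" using ds dd by (simp add: dN_def algebra_simps)
    fix j :: nat and k :: int assume j: "0 < j" "j < m"
    have "d'' \<le> \<bar>real j * \<rho> - of_int k\<bar>" using fp_sep_p[OF F, of "int j" k] j m by (simp add: d''_def)
    then show "of_int 1 * \<rho> + of_int 0 - (of_int (1 + n * N) * \<rho> + of_int (- (n * Q))) < \<bar>real j * \<rho> - of_int k\<bar>"
      using dd ds by (simp add: dN_def algebra_simps)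
  qed (use xu in \<open>auto simp: x_def u_def\<close>)
  note CR = cr_iter1[OF okm wx xu uz S]
  have im: "(f ^^ m) w = B 0 + of_int P'" "(f ^^ m) x = A p + of_int (P' - P)" "(f ^^ m) u = A p'" "(f ^^ m) z = A (p' - N'') + of_int Q''"
    unfolding w_def x_def u_def z_def iterA iterB m pn by (simp_all add: algebra_simps)
  have o': "(f ^^ m) w < (f ^^ m) x" "(f ^^ m) x < (f ^^ m) u" "(f ^^ m) u < (f ^^ m) z"
    by (rule iter_strict[OF okm]; use wx xu uz in simp)+
  have oo: "0 < y" "y < y'" "y' < X'" using o' unfolding im X'_def y_def y'_def by simp_all
  have "y / y' * (1 - y' / X') \<le> y / y' * ((X' - y') / (X' - y))"
  proof (rule mult_left_mono)
    have "1 - y' / X' = (X' - y') / X'" using oo by (simp add: field_simps)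
    also have "\<dots> \<le> (X' - y') / (X' - y)" using oo by (intro divide_left_mono) auto
    finally show "1 - y' / X' \<le> (X' - y') / (X' - y)" .
  qed (use oo in simp)
  also have "\<dots> = cr ((f ^^ m) w) ((f ^^ m) x) ((f ^^ m) u) ((f ^^ m) z)"
    unfolding cr_def im X'_def y_def y'_def by (simp add: algebra_simps)
  also note CR
  also have "cr w x u z \<le> 1 - W / m'"
    using cr_upper(2)[OF wx xu uz] wx xu unfolding w_def x_def u_def W_def m'_def by (simp add: field_simps)
  finally show ?thesis by simp
qed

text \<open>One link of the chain: \<open>f ^^ N\<close> moves the forward image behind
  \<open>W j\<close> to the one behind \<open>W (j + 1)\<close>, and the preimage behind
  \<open>\<mu> j\<close> to the one behind \<open>\<mu> (j + 1)\<close>. A constant is lost per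
  link, so a whole chain costs a power whose exponent is the partial quotient.\<close>

lemma chain_step:
  fixes p' P' N Q p P n j :: int
  assumes F: "fp p' P' N Q" and pn: "p = p' + n * N" "P = P' + n * Q" and j: "0 \<le> j" "j < n"
    and pos: "0 < of_int p * \<rho> - of_int P" and lt: "of_int p * \<rho> - of_int P < of_int Q - of_int N * \<rho>"
  defines "\<mu> \<equiv> \<lambda>j. A 1 - B (1 - (p - j * N)) - of_int (P - j * Q)" and "W \<equiv> \<lambda>j. A 1 - A (1 + j * N) + of_int (j * Q)"
    and "m' \<equiv> A (1 - N) + of_int Q - A 1"
  shows "U * (1 - W (j + 1) / \<mu> (j + 1)) \<le> exp C * C1 * ((\<mu> j - W j) / (\<mu> j + m'))" "0 < \<mu> j" "0 < m'" "W j < \<mu> j"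
proof -
  define d' dN d where "d' = of_int p' * \<rho> - of_int P'" and "dN = of_int Q - of_int N * \<rho>" and "d = of_int p * \<rho> - of_int P"
  have ds: "0 < d'" "d' < 1" "0 < dN" "dN < 1" "0 < d" "d < dN" "1 \<le> N" "1 \<le> p'" using F pos lt by (auto simp: fp_def d'_def dN_def d_def)
  have dd: "d = d' - of_int n * dN" by (simp add: d_def d'_def dN_def pn algebra_simps)
  have jd: "0 \<le> of_int j * dN" "of_int (j + 1) * dN \<le> of_int n * dN" using j ds by (auto intro: mult_right_mono)
  have jd': "of_int j * dN + dN \<le> of_int n * dN" using jd by (simp add: algebra_simps)
  have jN: "0 \<le> j * N" "(j + 1) * N \<le> n * N" using j ds by (auto intro: mult_right_mono)
  have e1: "p - (j + 1) * N \<ge> 1" using jN pn ds by linarith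
  define w x y z where "w = B (1 - (p - j * N)) + of_int (P - j * Q)" and "x = A (1 + j * N) + of_int (- (j * Q))"
    and "y = A (1 - N) + of_int Q" and "z = B (1 - N) + of_int Q"
  have wx: "w < x" unfolding w_def x_def by (rule ordBA) (use ds in \<open>simp add: d_def algebra_simps\<close>)
  have xy: "x < y" unfolding x_def y_def by (rule ordAA) (use ds jd in \<open>simp add: dN_def algebra_simps\<close>)
  have yz: "y < z" unfolding y_def z_def using AB_less[of "1 - N"] ds by simp
  define m where "m = nat (N - 1)"
  have m: "int m = N - 1" using ds by (simp add: m_def)
  have okm: "ok i w z" if i: "i < m" for i
    unfolding w_def z_def
  proof (rule ok_crit)
    show "B (1 - (p - j * N)) + of_int (P - j * Q) = B (1 - (p - j * N)) + of_int (P - j * Q) \<or>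
      B (1 - (p - j * N)) + of_int (P - j * Q) = A (1 - (p - j * N)) + of_int (P - j * Q) \<and> 1 - (p - j * N) + int i \<noteq> 0" by simp
    show "B (1 - N) + of_int Q = A (1 - N) + of_int Q \<or> B (1 - N) + of_int Q = B (1 - N) + of_int Q \<and> 1 - N + int i \<noteq> 0"
      using i m by auto
    fix k
    show "\<not> (of_int (1 - (p - j * N) + int i) * \<rho> + of_int (P - j * Q) < of_int k \<and> of_int k < of_int (1 - N + int i) * \<rho> + of_int Q)"
    proof
      assume h: "of_int (1 - (p - j * N) + int i) * \<rho> + of_int (P - j * Q) < of_int k \<and> of_int k < of_int (1 - N + int i) * \<rho> + of_int Q"
      have "of_int (1 + int i) * \<rho> - of_int k < d + of_int j * dN" using h by (simp add: d_def dN_def algebra_simps)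
      then have 1: "of_int (1 + int i) * \<rho> - of_int k < of_int p' * \<rho> - of_int P'" using dd jd' ds by (simp add: d'_def[symmetric])
      have 2: "- (of_int Q - of_int N * \<rho>) < of_int (1 + int i) * \<rho> - of_int k" using h by (simp add: algebra_simps)
      show False using fp_window[OF F _ 2 1] i m ds by simp
    qed
  qed
  have S: "(\<Sum>i<m. (f ^^ i) y - (f ^^ i) x) \<le> 1"
  proof (rule sum_strict[where ?e1.0 = "1 + j * N" and ?k1.0 = "- (j * Q)" and ?e2.0 = "1 - N" and ?k2.0 = Q])
    have e: "of_int (1 - N) * \<rho> + of_int Q - (of_int (1 + j * N) * \<rho> + of_int (- (j * Q))) = of_int j * dN + dN"
      by (simp add: dN_def algebra_simps)
    show "of_int (1 - N) * \<rho> + of_int Q - (of_int (1 + j * N) * \<rho> + of_int (- (j * Q))) < 1" unfolding e using ds dd jd' by simp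
    fix i :: nat and k :: int assume i: "0 < i" "i < m"
    have "d' \<le> \<bar>real i * \<rho> - of_int k\<bar>" using fp_sep_N[OF F, of "int i" k] i m by (simp add: d'_def)
    then show "of_int (1 - N) * \<rho> + of_int Q - (of_int (1 + j * N) * \<rho> + of_int (- (j * Q))) < \<bar>real i * \<rho> - of_int k\<bar>"
      unfolding e using dd jd' ds by simp
  qed (use xy in \<open>auto simp: x_def y_def\<close>)
  note CR = cr_iter1[OF okm wx xy yz S]
  define w0 x0 where "w0 = B (- (p - (j + 1) * N)) + of_int (P - (j + 1) * Q)" and "x0 = A ((j + 1) * N) + of_int (- ((j + 1) * Q))"
  have im: "(f ^^ m) w = w0 + of_int Q" "(f ^^ m) x = x0 + of_int Q" "(f ^^ m) y = A 0 + of_int Q" "(f ^^ m) z = B 0 + of_int Q"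
    unfolding w_def x_def y_def z_def iterA iterB m w0_def x0_def by (simp_all add: algebra_simps)
  have o': "(f ^^ m) w < (f ^^ m) x" "(f ^^ m) x < (f ^^ m) y" "(f ^^ m) y < (f ^^ m) z"
    by (rule iter_strict[OF okm]; use wx xy yz in simp)+
  have x0': "B 0 + of_int (- 1) < x0" unfolding x0_def by (rule ordBA) (use ds dd jd' in \<open>simp add: dN_def algebra_simps\<close>)
  have w0': "B 0 + of_int (- 1) < w0" unfolding w0_def
    by (rule ordBB) (use ds dd jd' in \<open>simp add: dN_def d_def algebra_simps\<close>)
  have oo: "w0 < x0" "x0 < A 0" using o' unfolding im by simp_all
  have "U * ((x0 - w0) / (A 0 - w0)) \<le> cr ((f ^^ m) w) ((f ^^ m) x) ((f ^^ m) y) ((f ^^ m) z)"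
    using cr_lower[OF o', of U] x0' U_pos unfolding im by simp
  also note CR
  also have "cr w x y z \<le> (\<mu> j - W j) / (\<mu> j + m')"
    using cr_upper(2)[OF wx xy yz] unfolding \<mu>_def W_def m'_def w_def x_def y_def by (simp add: algebra_simps)
  finally have main: "U * ((x0 - w0) / (A 0 - w0)) \<le> exp C * ((\<mu> j - W j) / (\<mu> j + m'))" by simp
  have fx: "f x0 = A 1 - W (j + 1)" "f w0 = A 1 - \<mu> (j + 1)" "f (A 0) = A 1"
    unfolding x0_def w0_def per_int fA fB W_def \<mu>_def using fA[of 0] by (simp_all add: algebra_simps)
  have "f x0 - f w0 \<le> C1 * ((x0 - w0) / (A 0 - w0)) * (f (A 0) - f w0)"
    using dbl_int[of "-1" w0 w0 x0 "A 0"] oo w0' by simp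
  moreover have "f w0 < f (A 0)" using incf_int[of "-1" w0 "A 0"] oo w0' by simp
  ultimately have "1 - W (j + 1) / \<mu> (j + 1) \<le> C1 * ((x0 - w0) / (A 0 - w0))"
    unfolding fx by (simp add: field_simps)
  then have "U * (1 - W (j + 1) / \<mu> (j + 1)) \<le> C1 * (U * ((x0 - w0) / (A 0 - w0)))"
    using U_pos mult_left_mono[of "1 - W (j + 1) / \<mu> (j + 1)" "C1 * ((x0 - w0) / (A 0 - w0))" U] by (simp only: mult.left_commute less_imp_le)
  also have "\<dots> \<le> C1 * (exp C * ((\<mu> j - W j) / (\<mu> j + m')))" using main C1 by (intro mult_left_mono) auto
  finally show "U * (1 - W (j + 1) / \<mu> (j + 1)) \<le> exp C * C1 * ((\<mu> j - W j) / (\<mu> j + m'))" by (simp add: ac_simps)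
  show "W j < \<mu> j" using wx by (simp add: \<mu>_def W_def w_def x_def)
  show "0 < m'" using ordAA[of 1 0 "1 - N" Q] ds by (simp add: m'_def dN_def algebra_simps)
  show "0 < \<mu> j" using ordBA[of "1 - (p - j * N)" "P - j * Q" 1 0] ds jd by (simp add: \<mu>_def dN_def d_def algebra_simps)
qed

section \<open>Sides of the flat spot and the power law\<close>

abbreviation co :: "int \<Rightarrow> int \<Rightarrow> real" where "co e k \<equiv> of_int e * \<rho> + of_int k"

lemma side_lt:
  assumes "co e k * co e' k' > 0" "\<bar>co e k\<bar> < \<bar>co e' k'\<bar>"
  shows "rdf e k < rd e' k'" "far e k < near e' k'"
proof -
  consider "0 < co e k" "co e k < co e' k'" | "co e k < 0" "co e' k' < co e k"
    using assms by (auto simp: zero_less_mult_iff)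
  then have "rdf e k < rd e' k' \<and> far e k < near e' k'"
  proof cases
    case 1
    then show ?thesis using ordBA[of e k e' k'] ordBA[of "e + 1" k "e' + 1" k'] by (simp add: rdf_def rd_def far_def near_def algebra_simps)
  next
    case 2
    then show ?thesis using ordBA[of e' k' e k] ordBA[of "e' + 1" k' "e + 1" k] by (simp add: rdf_def rd_def far_def near_def algebra_simps)
  qed
  then show "rdf e k < rd e' k'" "far e k < near e' k'" by auto
qed

lemma near_le_far: "rd e k \<le> rdf e k \<or> co e k = 0" "near e k \<le> far e k"
  using ABle[of e] ABle[of "e + 1"] by (auto simp: rdf_def rd_def far_def near_def)

lemma side_pos:
  assumes "co e k \<noteq> 0"
  shows "0 < rd e k" "0 < near e k"
  using ordBA[of 0 0 e k] ordBA[of 1 0 "e + 1" k] ordBA[of e k 0 0] ordBA[of "e + 1" k 1 0] assms AB1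
  by (auto simp: rd_def near_def algebra_simps)

lemma hole_side: "e \<le> 0 \<Longrightarrow> co e k \<noteq> 0 \<Longrightarrow> rd e k < rdf e k" "e \<le> -1 \<Longrightarrow> near e k < far e k"
  using AB_less[of e] AB_less[of "e + 1"] by (auto simp: rdf_def rd_def far_def near_def)

lemma near_pw:
  assumes s: "co e k * co e' k' > 0" and le: "rd e k \<le> rd e' k'" and r: "rd e' k' < r0"
  shows "exp (- (C * rd e' k')) * (rd e k / rd e' k') powr \<nu> * near e' k' \<le> near e k"
    "near e k \<le> exp (C * rd e' k') * (rd e k / rd e' k') powr \<nu> * near e' k'"
proof -
  have "co e k \<noteq> 0" using s by (metis less_irrefl mult_zero_left)
  then have p: "0 < rd e k" by (rule side_pos)
  consider "0 < co e k" "0 < co e' k'" | "co e k < 0" "co e' k' < 0"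
    using s by (auto simp: zero_less_mult_iff)
  then have "exp (- (C * rd e' k')) * (rd e k / rd e' k') powr \<nu> * near e' k' \<le> near e k \<and>
    near e k \<le> exp (C * rd e' k') * (rd e k / rd e' k') powr \<nu> * near e' k'"
  proof cases
    case 1
    have "f (B 0 + rd e k) - A 1 = near e k" "f (B 0 + rd e' k') - A 1 = near e' k'"
      using 1 per_int fA by (simp_all add: rd_def near_def)
    then show ?thesis using pw_right[OF p le r] by simp
  next
    case 2
    have "A 0 - rd e k = B e + of_int k" "A 0 - rd e' k' = B e' + of_int k'"
      using 2 by (simp_all add: rd_def)
    then have "A 1 - f (A 0 - rd e k) = near e k" "A 1 - f (A 0 - rd e' k') = near e' k'"
      using 2 per_int fB by (simp_all add: near_def)
    then show ?thesis using pw_left[OF p le r] by simp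
  qed
  then show "exp (- (C * rd e' k')) * (rd e k / rd e' k') powr \<nu> * near e' k' \<le> near e k"
    "near e k \<le> exp (C * rd e' k') * (rd e k / rd e' k') powr \<nu> * near e' k'" by auto
qed

text \<open>Transfers a lower bound on the relative size of a preimage of \<open>U\<close> from the
  critical value side, where iteration provides it, to the flat spot.\<close>

lemma hole_dbl:
  assumes "e \<le> -1" "co e k \<noteq> 0" "\<bar>co e k\<bar> < 1"
  shows "far e k - near e k \<le> C1 * ((rdf e k - rd e k) / rdf e k) * far e k"
proof (cases "co e k > 0")
  case True
  have "co e k < 1" using assms(3) by linarith
  then have "B e + of_int k \<le> A 0 + 1" using ordBA[of e k 0 1] by simp
  moreover have "B 0 \<le> A e + of_int k" using ordBA[of 0 0 e k] True by simp
  ultimately have "f (B e + of_int k) - f (A e + of_int k) \<le> C1 * (((B e + of_int k) - (A e + of_int k)) / ((B e + of_int k) - B 0)) * (f (B e + of_int k) - f (B 0))"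
    using AB_less[of e] assms by (intro dbl) auto
  then show ?thesis using True fB[of 0] AB1 unfolding per_int fA fB by (simp add: far_def near_def rd_def rdf_def)
next
  case False
  then have neg: "co e k < 0" using assms by auto
  have "- 1 < co e k" using assms(3) by linarith
  then have "B 0 + of_int (-1) \<le> A e + of_int k" using ordBA[of 0 "-1" e k] by simp
  moreover have "B e + of_int k \<le> A 0" using ordBA[of e k 0 0] neg by simp
  ultimately have "f (B e + of_int k) - f (A e + of_int k) \<le> C1 * (((B e + of_int k) - (A e + of_int k)) / (A 0 - (A e + of_int k))) * (f (A 0) - f (A e + of_int k))"
    using AB_less[of e] assms by (intro dbl_int[of "-1"]) auto
  then show ?thesis using False fA[of 0] unfolding per_int fA fB by (simp add: far_def near_def rd_def rdf_def algebra_simps)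
qed

end

section \<open>Closest returns\<close>

text \<open>From continued fractions only the recursion, the alternating signs and the determinant
  are kept. All three survive the replacement of \<open>P\<close> by its negative, so the reflected
  map is again an instance.\<close>

locale cfflat = flat +
  fixes q P aa :: "nat \<Rightarrow> int"
  assumes q_rec: "\<And>n. q (Suc (Suc n)) = aa n * q (Suc n) + q n"
    and P_rec: "\<And>n. P (Suc (Suc n)) = aa n * P (Suc n) + P n"
    and aa1: "\<And>n. 1 \<le> aa n" and q0: "1 \<le> q 0" and q1: "1 \<le> q 1"
    and alt: "\<And>n. (of_int (q n) * \<rho> - of_int (P n)) * (of_int (q (Suc n)) * \<rho> - of_int (P (Suc n))) < 0"
    and det: "\<And>n. \<bar>q n * P (Suc n) - q (Suc n) * P n\<bar> = 1"
    and d0: "\<bar>of_int (q 0) * \<rho> - of_int (P 0)\<bar> < 1"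
begin

section \<open>Arithmetic of the closest returns\<close>

definition v where "v n = of_int (q n) * \<rho> - of_int (P n)"
definition \<delta> where "\<delta> n = \<bar>v n\<bar>"
definition right where "right n \<longleftrightarrow> v n > 0"

lemma q_pos: "1 \<le> q n"
proof (induction n rule: less_induct)
  case (less n)
  consider "n = 0" | "n = 1" | m where "n = Suc (Suc m)" by (metis One_nat_def not0_implies_Suc)
  then show ?case
  proof cases
    case 3
    have "1 * 1 \<le> aa m * q (Suc m)" using less[of "Suc m"] aa1[of m] 3 by (intro mult_mono) auto
    then show ?thesis using less[of m] 3 q_rec[of m] by simp
  qed (use q0 q1 in auto)
qed

lemma q_less: "q (Suc n) < q (Suc (Suc n))"
proof -
  have "1 * q (Suc n) \<le> aa n * q (Suc n)" using aa1[of n] q_pos[of "Suc n"] by (intro mult_right_mono) auto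
  then show ?thesis using q_rec[of n] q_pos[of n] by simp
qed

lemma v_alt: "v n * v (Suc n) < 0"
  using alt[of n] by (simp add: v_def)

lemma v_ne: "v n \<noteq> 0" using v_alt[of n] by auto

lemma \<delta>_pos: "0 < \<delta> n" using v_ne by (simp add: \<delta>_def)

lemma v_rec: "v (Suc (Suc n)) = of_int (aa n) * v (Suc n) + v n"
  by (simp add: v_def q_rec P_rec algebra_simps)

lemma right_alt: "right (Suc n) \<longleftrightarrow> \<not> right n"
  using v_alt[of n] by (auto simp: right_def mult_less_0_iff)

lemma v_right: "right n \<Longrightarrow> v n = \<delta> n" "\<not> right n \<Longrightarrow> v n = - \<delta> n"
  by (auto simp: right_def \<delta>_def)

lemma \<delta>_rec: "\<delta> n = of_int (aa n) * \<delta> (Suc n) + \<delta> (Suc (Suc n))"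
  using v_rec[of n] right_alt[of n] right_alt[of "Suc n"] v_right[of n] v_right[of "Suc n"] v_right[of "Suc (Suc n)"]
  by (cases "right n") auto

lemma \<delta>_k: "k \<le> aa n \<Longrightarrow> \<delta> (Suc (Suc n)) \<le> \<delta> n - of_int k * \<delta> (Suc n)"
  using \<delta>_rec[of n] \<delta>_pos[of "Suc n"] mult_right_mono[of "of_int k" "of_int (aa n)" "\<delta> (Suc n)"] by simp

lemma \<delta>_sum: "\<delta> (Suc n) + \<delta> (Suc (Suc n)) \<le> \<delta> n"
  using \<delta>_k[of 1 n] aa1[of n] by simp

lemma \<delta>_less: "\<delta> (Suc n) < \<delta> n"
  using \<delta>_sum[of n] \<delta>_pos[of "Suc (Suc n)"] by linarith

lemma \<delta>_lt1: "\<delta> n < 1"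
  by (induction n) (use d0 \<delta>_less in \<open>auto simp: \<delta>_def v_def intro: less_trans\<close>)

lemma co_k: "co (q n + k * q (Suc n)) (- P n - k * P (Suc n)) = v n + of_int k * v (Suc n)"
  by (simp add: v_def algebra_simps)

lemma fp_k:
  assumes r: "right (Suc n)" and k: "0 \<le> k" "k \<le> aa n"
  shows "fp (q (Suc n)) (P (Suc n)) (q n + k * q (Suc n)) (P n + k * P (Suc n))"
proof -
  have vn: "v (Suc n) = \<delta> (Suc n)" "v n = - \<delta> n" using r right_alt v_right by auto
  define dN where "dN = of_int (P n + k * P (Suc n)) - of_int (q n + k * q (Suc n)) * \<rho>"
  have "dN = - v n - of_int k * v (Suc n)" by (simp add: dN_def v_def algebra_simps)
  then have dN: "dN = \<delta> n - of_int k * \<delta> (Suc n)" using vn by simp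
  have d1: "0 < dN" using \<delta>_k[OF k(2)] \<delta>_pos[of "Suc (Suc n)"] dN by linarith
  have "0 \<le> of_int k * \<delta> (Suc n)" using k \<delta>_pos[of "Suc n"] by simp
  then have d2: "dN < 1" using dN \<delta>_lt1[of n] by linarith
  have kq: "0 \<le> k * q (Suc n)" using k q_pos[of "Suc n"] by simp
  have "of_int (q (Suc n) * (P n + k * P (Suc n)) - (q n + k * q (Suc n)) * P (Suc n)) = of_int (q (Suc n)) * dN + of_int (q n + k * q (Suc n)) * v (Suc n)"
    by (simp add: dN_def v_def algebra_simps)
  also have "\<dots> > 0" using d1 q_pos[of "Suc n"] q_pos[of n] kq \<delta>_pos[of "Suc n"] unfolding vn
    by (intro add_pos_pos mult_pos_pos) (auto simp del: of_int_add of_int_mult)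
  finally have "0 < q (Suc n) * (P n + k * P (Suc n)) - (q n + k * q (Suc n)) * P (Suc n)" by linarith
  moreover have "q (Suc n) * (P n + k * P (Suc n)) - (q n + k * q (Suc n)) * P (Suc n) = - (q n * P (Suc n) - q (Suc n) * P n)" by algebra
  ultimately have "q (Suc n) * (P n + k * P (Suc n)) - (q n + k * q (Suc n)) * P (Suc n) = 1" using det[of n] by linarith
  then show ?thesis
    unfolding fp_def using d1 d2 q_pos[of n] q_pos[of "Suc n"] kq vn \<delta>_pos[of "Suc n"] \<delta>_lt1[of "Suc n"]
    by (auto simp: dN_def[symmetric] v_def[symmetric] simp del: of_int_add of_int_mult)
qed

lemma fp_prev: "right (Suc n) \<Longrightarrow> fp (q (Suc n)) (P (Suc n)) (q n) (P n)"
  using fp_k[of n 0] aa1[of n] by simp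

lemma fp_next:
  assumes "right n"
  shows "fp (q n) (P n) (q (Suc n)) (P (Suc n))"
proof -
  have vn: "v (Suc n) = - \<delta> (Suc n)" "v n = \<delta> n" using assms right_alt v_right by auto
  have "of_int (q n * P (Suc n) - q (Suc n) * P n) = of_int (q n) * (- v (Suc n)) + of_int (q (Suc n)) * v n"
    by (simp add: v_def algebra_simps)
  also have "\<dots> > 0" using q_pos[of "Suc n"] q_pos[of n] \<delta>_pos unfolding vn by (intro add_pos_pos mult_pos_pos) auto
  finally have "0 < q n * P (Suc n) - q (Suc n) * P n" by linarith
  then have "q n * P (Suc n) - q (Suc n) * P n = 1" using det[of n] by linarith
  then show ?thesis
    unfolding fp_def using q_pos[of n] q_pos[of "Suc n"] vn \<delta>_pos[of n] \<delta>_pos[of "Suc n"] \<delta>_lt1[of n] \<delta>_lt1[of "Suc n"]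
    by (auto simp: v_def)
qed

text \<open>Distances at level \<open>n\<close>: \<open>yy\<close> is that of the image of order \<open>q n\<close> of \<open>U\<close> from \<open>U\<close>, \<open>ll\<close> and \<open>rr\<close> are those of the ends of the preimage
  of order \<open>q n\<close>; \<open>Yn\<close>, \<open>mm\<close>, \<open>tt\<close> are their images, measured from the critical value. The
  intermediate returns, with \<open>k\<close> from \<open>0\<close> (level \<open>n\<close>) to \<open>aa n\<close> (level \<open>n + 2\<close>), are \<open>rk\<close>, \<open>Yk\<close>,
  \<open>mk\<close>, \<open>tk\<close>.\<close>

definition yy where "yy n = rd (q n) (- P n)"
definition XX where "XX n = rd (q n - q (n - 1)) (- P n + P (n - 1))"
definition y1 where "y1 n = rd (q n + q (Suc n)) (- P n - P (Suc n))"
definition ll where "ll n = rd (- q n) (P n)"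
definition rr where "rr n = rdf (- q n) (P n)"
definition Yn where "Yn n = near (q n) (- P n)"
definition mm where "mm n = near (- q n) (P n)"
definition tt where "tt n = far (- q n) (P n)"
definition Yk where "Yk n k = near (q n + k * q (Suc n)) (- P n - k * P (Suc n))"
definition mk where "mk n k = near (- (q n + k * q (Suc n))) (P n + k * P (Suc n))"
definition tk where "tk n k = far (- (q n + k * q (Suc n))) (P n + k * P (Suc n))"
definition rk where "rk n k = rd (q n + k * q (Suc n)) (- P n - k * P (Suc n))"
definition tail where "tail n = 1 - (\<Sum>j<nat (q n). hole j)"
text \<open>The arc between the preimage of order \<open>j\<close> and its neighbour of order
  \<open>q n + j\<close>; on which side the neighbour lies depends on the parity of
  \<open>n\<close>.\<close>

definition gap where "gap n j = (if right n then A (- int j) - B (- (q n + int j)) - of_int (P n) else A (- (q n + int j)) + of_int (P n) - B (- int j))"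

text \<open>The estimates are named as predicates because they are proved for one orientation only and carry
  over to the other by reflection.\<close>

definition "long_step n \<longleftrightarrow> U * ((XX (Suc n) - yy (Suc n)) / ((XX (Suc n) - yy (Suc n)) + (yy (Suc n) - y1 (Suc n))))
   \<le> exp C * C1 * (1 - yy (Suc (Suc n)) / XX (Suc (Suc n)))"
definition "cross_step n \<longleftrightarrow> U * ((yy n - y1 n) / yy n) \<le> exp C * C1 * ((rr (Suc n) - ll (Suc n)) / (yy n - ll (Suc n)))"
definition "image_fatness n \<longleftrightarrow> U * (1 - yy (Suc n) / XX (Suc n)) \<le> exp C * ((tt (Suc n) - mm (Suc n)) / tt (Suc n) * (mm n / (mm n + mm (Suc n))))"
definition "hole_fills_gap n \<longleftrightarrow> (\<forall>j. int j < q (Suc n) \<longrightarrow> 0 < gap n j \<and>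
   U * ((rr n - ll n) / rr n) \<le> exp C * (hole (nat (q n) + j) / (hole (nat (q n) + j) + gap n j)))"
definition "return_height n \<longleftrightarrow> 2 * exp C / U * yy (Suc n) < r0 \<longrightarrow>
   min (mm n) (mm (Suc n)) \<le> exp (C * r0) * (2 * exp C / U) powr \<nu> * Yn (Suc n)"
definition "return_ratio n \<longleftrightarrow> (\<forall>k. 1 \<le> k \<and> k \<le> aa n \<longrightarrow>
   exp (- (C * tail (Suc n))) * (mk n k * (tk n k + mm (Suc n)) / ((mk n k + mm (Suc n)) * tk n k))
     \<le> rk n k / rk n (k - 1) * ((rk n (k - 1) + U) / (rk n k + U)))"
definition "first_return_gain n \<longleftrightarrow> ll (Suc (Suc n)) / yy (Suc n) * (1 - yy (Suc n) / XX (Suc n)) \<le> exp C * (1 - tk (Suc n) 1 / mm (Suc n))"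
definition "returns_contract n \<longleftrightarrow> (\<forall>k1 k2 k3 k4. 0 \<le> k1 \<and> k1 < k2 \<and> k2 < k3 \<and> k3 < k4 \<and> k4 < aa n \<longrightarrow>
   exp (- (C * tail n)) * po (- Yk n k1) (- Yk n k2) (- Yk n k3) (- Yk n k4)
    \<le> po (- rk n (k1 + 1)) (- rk n (k2 + 1)) (- rk n (k3 + 1)) (- rk n (k4 + 1)))"
definition "chain_bound n \<longleftrightarrow> (U / (exp C * C1)) ^ nat (aa (Suc n)) * (exp (- C) * (yy (Suc (Suc (Suc n))) / yy (Suc n) * (1 - yy (Suc n) / XX (Suc n))))
   \<le> mm (Suc (Suc (Suc n))) / (mm (Suc (Suc (Suc n))) + mm (Suc (Suc n)))"

lemma reflect_cf: "cfflat (\<lambda>x. - f (- x)) (\<lambda>e. - B e) (\<lambda>e. - A e) (- \<rho>) \<nu> C C1 r0 q (\<lambda>n. - P n) aa"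
proof -
  interpret R: flat "\<lambda>x. - f (- x)" "\<lambda>e. - B e" "\<lambda>e. - A e" "- \<rho>" \<nu> C C1 r0 by (rule reflect)
  show ?thesis
  proof
    show "(of_int (q n) * - \<rho> - of_int (- P n)) * (of_int (q (Suc n)) * - \<rho> - of_int (- P (Suc n))) < 0" for n
      using v_alt[of n] by (simp add: v_def algebra_simps)
    show "\<bar>q n * - P (Suc n) - q (Suc n) * - P n\<bar> = 1" for n using det[of n] by (simp add: abs_minus_commute)
    show "\<bar>of_int (q 0) * - \<rho> - of_int (- P 0)\<bar> < 1" using d0 by (simp add: abs_minus_commute)
  qed (use q_rec P_rec aa1 q0 q1 in auto)
qed

section \<open>Estimates at one level, in one orientation\<close>

lemma rdR: "co e k > 0 \<Longrightarrow> rd e k = A e + of_int k - B 0" by (simp add: rd_def)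
lemma rdL: "co e k < 0 \<Longrightarrow> rd e k = A 0 - B e - of_int k" by (simp add: rd_def)
lemma rdfL: "co e k < 0 \<Longrightarrow> rdf e k = A 0 - A e - of_int k" by (simp add: rdf_def)
lemma nearR: "co e k > 0 \<Longrightarrow> near e k = A (e + 1) + of_int k - A 1" by (simp add: near_def)
lemma nearL: "co e k < 0 \<Longrightarrow> near e k = A 1 - B (e + 1) - of_int k" by (simp add: near_def)
lemma farR: "co e k > 0 \<Longrightarrow> far e k = B (e + 1) + of_int k - A 1" by (simp add: far_def)
lemma farL: "co e k < 0 \<Longrightarrow> far e k = A 1 - A (e + 1) - of_int k" by (simp add: far_def)

lemma co_q: "co (q n) (- P n) = v n" "co (- q n) (P n) = - v n"
  by (simp_all add: v_def)

lemma co_X: "co (q n - q m) (- P n + P m) = v n - v m"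
  by (simp add: v_def algebra_simps)

lemma co_y1: "co (q n + q (Suc n)) (- P n - P (Suc n)) = v n + v (Suc n)"
  by (simp add: v_def algebra_simps)

lemma co_mk: "co (- (q n + k * q (Suc n))) (P n + k * P (Suc n)) = - v n - of_int k * v (Suc n)"
  by (simp add: v_def algebra_simps)

lemma seq_pos: "0 < yy n" "0 < Yn n" "0 < ll n" "0 < mm n"
proof -
  have "co (q n) (- P n) \<noteq> 0" "co (- q n) (P n) \<noteq> 0" unfolding co_q using v_ne by auto
  then show "0 < yy n" "0 < Yn n" "0 < ll n" "0 < mm n"
    unfolding yy_def Yn_def ll_def mm_def using side_pos by blast+
qed

text \<open>The level is a successor because denominators increase strictly only from index 1 on:
  the first two may coincide.\<close>

lemma long_step_right:
  assumes r: "right n" and n: "n = Suc n'"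
  shows "long_step n"
proof -
  have vs: "v n = \<delta> n" "v (Suc n) = - \<delta> (Suc n)" "v (Suc (Suc n)) = \<delta> (Suc (Suc n))"
    using r right_alt v_right by auto
  note dp = \<delta>_pos[of n] \<delta>_pos[of "Suc n"] \<delta>_pos[of "Suc (Suc n)"] \<delta>_less[of n] \<delta>_less[of "Suc n"]
  have e: "XX (Suc n) = A 0 - B (q (Suc n) - q n) - of_int (P n - P (Suc n))"
    "yy (Suc n) = A 0 - B (q (Suc n)) - of_int (- P (Suc n))"
    "y1 (Suc n) = A 0 - B (q (Suc n) + q (Suc (Suc n))) - of_int (- P (Suc n) - P (Suc (Suc n)))"
    "yy (Suc (Suc n)) = A (q (Suc (Suc n))) + of_int (- P (Suc (Suc n))) - B 0"
    "XX (Suc (Suc n)) = A (q (Suc (Suc n)) - q (Suc n)) + of_int (P (Suc n) - P (Suc (Suc n))) - B 0"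
    unfolding XX_def yy_def y1_def
    by (subst rdL rdR, use co_q co_X co_y1 vs dp in \<open>simp; fail\<close>, simp)+
  have "U * ((XX (Suc n) - yy (Suc n)) / ((XX (Suc n) - yy (Suc n)) + (yy (Suc n) - y1 (Suc n))))
     \<le> exp C * C1 * (1 - yy (Suc (Suc n)) / XX (Suc (Suc n)))"
    unfolding e
  proof (rule step_long[OF fp_next[OF r]])
    show "q n < q (Suc n)" using q_less n by simp
    show "q (Suc (Suc n)) = q n + aa n * q (Suc n)" "P (Suc (Suc n)) = P n + aa n * P (Suc n)" "1 \<le> aa n"
      using q_rec P_rec aa1 by auto
    show "0 < of_int (q (Suc (Suc n))) * \<rho> - of_int (P (Suc (Suc n)))"
      "of_int (q (Suc (Suc n))) * \<rho> - of_int (P (Suc (Suc n))) < of_int (P (Suc n)) - of_int (q (Suc n)) * \<rho>"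
      using vs dp by (simp_all add: v_def)
  qed
  then show ?thesis by (simp add: long_step_def)
qed

lemma cross_step_right:
  assumes r: "right (Suc n)" and n: "n = Suc n'"
  shows "cross_step n"
proof -
  have vs: "v n = - \<delta> n" "v (Suc n) = \<delta> (Suc n)"
    using r right_alt v_right by auto
  note dp = \<delta>_pos[of n] \<delta>_pos[of "Suc n"] \<delta>_less[of n]
  have e: "yy n = A 0 - B (q n) - of_int (- P n)"
    "y1 n = A 0 - B (q n + q (Suc n)) - of_int (- P n - P (Suc n))"
    unfolding yy_def y1_def by (subst rdL, use co_q co_y1 vs dp in \<open>simp; fail\<close>, simp)+
  have e2: "ll (Suc n) = A 0 - B (- q (Suc n)) - of_int (P (Suc n))" "rr (Suc n) = A 0 - A (- q (Suc n)) - of_int (P (Suc n))"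
    unfolding ll_def rr_def by (subst rdL rdfL, use co_q vs dp in \<open>simp; fail\<close>, simp)+
  show ?thesis unfolding cross_step_def e e2
    by (rule step_cross[OF fp_prev[OF r]]) (use q_less n vs dp in \<open>auto simp: v_def\<close>)
qed

lemma image_fatness_right:
  assumes r: "right (Suc n)" and n: "n = Suc n'"
  shows "image_fatness n"
proof -
  have vs: "v n = - \<delta> n" "v (Suc n) = \<delta> (Suc n)"
    using r right_alt v_right by auto
  note dp = \<delta>_pos[of n] \<delta>_pos[of "Suc n"] \<delta>_less[of n]
  have e: "yy (Suc n) = A (q (Suc n)) + of_int (- P (Suc n)) - B 0"
    "XX (Suc n) = A (q (Suc n) - q n) + of_int (P n - P (Suc n)) - B 0"
    unfolding yy_def XX_def by (subst rdR, use co_q co_X vs dp in \<open>simp; fail\<close>, simp)+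
  have e2: "mm (Suc n) = A 1 - B (- q (Suc n) + 1) - of_int (P (Suc n))" "tt (Suc n) = A 1 - A (- q (Suc n) + 1) - of_int (P (Suc n))"
    "mm n = A (- q n + 1) + of_int (P n) - A 1"
    unfolding mm_def tt_def by (subst nearL farL nearR, use co_q vs dp in \<open>simp; fail\<close>, simp)+
  show ?thesis unfolding image_fatness_def e e2
    by (rule hole_fat_image[OF fp_prev[OF r]]) (use q_less n vs dp in \<open>auto simp: v_def\<close>)
qed

lemma hole_fills_gap_right:
  assumes r: "right n"
  shows "hole_fills_gap n"
proof -
  have vs: "v n = \<delta> n" using r v_right by auto
  note dp = \<delta>_pos[of n]
  have e2: "ll n = A 0 - B (- q n) - of_int (P n)" "rr n = A 0 - A (- q n) - of_int (P n)"
    unfolding ll_def rr_def by (subst rdL rdfL, use co_q vs dp in \<open>simp; fail\<close>, simp)+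
  have e: "gap n j = A (- int j) - B (- (q n + int j)) - of_int (P n)" for j
    using r by (simp add: gap_def)
  show ?thesis unfolding hole_fills_gap_def e e2 using hole_vs_gap[OF fp_next[OF r]] by blast
qed

text \<open>A preimage \<open>x0\<close> of the point at height \<open>u\<close> lies, by
  \<open>fixed_free\<close>, at distance at most a constant times \<open>yy\<close> from
  \<open>U\<close>; the power law turns this into a bound for \<open>u\<close> by the height of the
  return. Taking the minimum for \<open>u\<close> meets the hypothesis of \<open>fixed_free\<close>
  and bounds the quotient in its conclusion.\<close>

lemma return_height_right:
  assumes r: "right (Suc n)" and n: "n = Suc n'"
  shows "return_height n"
  unfolding return_height_def
proof
  assume small: "2 * exp C / U * yy (Suc n) < r0"
  have vs: "v n = - \<delta> n" "v (Suc n) = \<delta> (Suc n)"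
    using r right_alt v_right by auto
  note dp = \<delta>_pos[of n] \<delta>_pos[of "Suc n"] \<delta>_less[of n]
  have e: "yy (Suc n) = A (q (Suc n)) - of_int (P (Suc n)) - B 0" "Yn (Suc n) = A (q (Suc n) + 1) - of_int (P (Suc n)) - A 1"
    unfolding yy_def Yn_def by (subst rdR nearR, use co_q co_X vs dp in \<open>simp; fail\<close>, simp)+
  have e2: "mm (Suc n) = A 1 - B (1 - q (Suc n)) - of_int (P (Suc n))"
    "mm n = A (1 - q n) + of_int (P n) - A 1"
    unfolding mm_def by (subst nearL nearR, use co_q vs dp in \<open>simp; fail\<close>, simp)+
  define u where "u = min (mm n) (mm (Suc n))"
  have mp: "0 < mm n" "0 < mm (Suc n)" by (rule seq_pos)+
  have u: "0 < u" "u \<le> A (1 - q n) + of_int (P n) - A 1" "u / mm (Suc n) \<le> 1" using mp e2 by (auto simp: u_def)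
  obtain x0 where x0: "f x0 = A 1 + u" using surj by (metis surjE)
  have xb: "B 0 < x0"
  proof (rule ccontr)
    assume "\<not> ?thesis"
    then have "f x0 \<le> f (B 0)" using mono_f by (simp add: monoD)
    then show False using x0 u fB[of 0] AB1 by simp
  qed
  have y0: "0 < yy (Suc n)" by (rule seq_pos)
  \<comment> \<open>The 2 bounds \<open>1 + u / mm (Suc n)\<close>.\<close>
  define K where "K = 2 * exp C / U"
  have "1 \<le> exp C" using C0 by simp
  then have "U \<le> 2 * exp C" using U_pos by linarith
  then have K1: "1 \<le> K" using U_pos by (simp add: K_def pos_le_divide_eq)
  have "x0 - B 0 \<le> exp C / U * (1 + u / mm (Suc n)) * yy (Suc n)"
    using fixed_free[OF fp_prev[OF r] _ u(1,2) x0] q_less n e e2 by simp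
  also have "\<dots> \<le> exp C / U * 2 * yy (Suc n)"
    using u y0 U_pos by (intro mult_right_mono mult_left_mono) auto
  finally have s: "x0 - B 0 \<le> K * yy (Suc n)" by (simp add: K_def mult.commute)
  have fy: "f (B 0 + yy (Suc n)) - A 1 = Yn (Suc n)"
    using per_int[of "A (q (Suc n))" "- P (Suc n)"] fA by (simp add: e)
  have fx: "f (B 0 + (x0 - B 0)) - A 1 = u" using x0 by simp
  have Y0: "0 < Yn (Suc n)" by (rule seq_pos)
  have K0: "1 \<le> exp (C * r0) * K powr \<nu>" using C0 r0 K1 nu mult_mono[of 1 "exp (C * r0)" 1 "K powr \<nu>"] by (simp add: ge_one_powr_ge_zero)
  have "u \<le> exp (C * r0) * K powr \<nu> * Yn (Suc n)"
  proof (cases "x0 - B 0 \<le> yy (Suc n)")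
    case True
    then have "f x0 \<le> f (B 0 + yy (Suc n))" using mono_f by (simp add: monoD)
    then have "u \<le> Yn (Suc n)" using fy x0 by simp
    also have "\<dots> \<le> exp (C * r0) * K powr \<nu> * Yn (Suc n)" using K0 Y0 by (simp add: mult_le_cancel_right1)
    finally show ?thesis .
  next
    case False
    then have "exp (- (C * (x0 - B 0))) * (yy (Suc n) / (x0 - B 0)) powr \<nu> * u \<le> Yn (Suc n)"
      using pw_right[of "yy (Suc n)" "x0 - B 0"] y0 s small fx fy by (simp add: K_def)
    then have "u \<le> exp (C * (x0 - B 0)) * ((x0 - B 0) / yy (Suc n)) powr \<nu> * Yn (Suc n)"
    proof -
      define E R where "E = exp (C * (x0 - B 0))" and "R = ((x0 - B 0) / yy (Suc n)) powr \<nu>"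
      have "E > 0" "R > 0" using y0 xb by (auto simp: E_def R_def)
      moreover have "exp (- (C * (x0 - B 0))) = 1 / E" by (simp only: E_def exp_minus inverse_eq_divide)
      moreover have "(yy (Suc n) / (x0 - B 0)) powr \<nu> = 1 / R" using y0 xb by (simp add: R_def powr_divide)
      ultimately have "1 / E * (1 / R) * u \<le> Yn (Suc n)" "E > 0" "R > 0"
        using \<open>exp (- (C * (x0 - B 0))) * (yy (Suc n) / (x0 - B 0)) powr \<nu> * u \<le> Yn (Suc n)\<close> by simp_all
      then have "u \<le> E * R * Yn (Suc n)" by (simp add: divide_simps mult.commute)
      then show ?thesis by (simp only: E_def R_def)
    qed
    also have "\<dots> \<le> exp (C * r0) * K powr \<nu> * Yn (Suc n)"
    proof (intro mult_right_mono mult_mono)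
      show "exp (C * (x0 - B 0)) \<le> exp (C * r0)" using s small C0 by (simp add: K_def mult_left_mono)
      show "((x0 - B 0) / yy (Suc n)) powr \<nu> \<le> K powr \<nu>"
        using s y0 xb nu by (intro powr_mono2) (auto simp: pos_divide_le_eq)
    qed (use Y0 in auto)
    finally show ?thesis .
  qed
  then show "min (mm n) (mm (Suc n)) \<le> exp (C * r0) * (2 * exp C / U) powr \<nu> * Yn (Suc n)" by (simp add: u_def K_def)
qed

lemma return_ratio_right:
  assumes r: "right (Suc n)"
  shows "return_ratio n"
  unfolding return_ratio_def
proof (intro allI impI)
  fix k assume k: "1 \<le> k \<and> k \<le> aa n"
  have vs: "v n = - \<delta> n" "v (Suc n) = \<delta> (Suc n)"
    using r right_alt v_right by auto
  have dk: "of_int k * \<delta> (Suc n) < \<delta> n" "of_int (k - 1) * \<delta> (Suc n) < \<delta> n"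
    using \<delta>_k[of k n] \<delta>_k[of "k - 1" n] k \<delta>_pos[of "Suc (Suc n)"] by auto
  note dp = \<delta>_pos[of n] \<delta>_pos[of "Suc n"] dk
  define N Q where "N = q n + k * q (Suc n)" and "Q = P n + k * P (Suc n)"
  have F: "fp (q (Suc n)) (P (Suc n)) N Q" unfolding N_def Q_def by (rule fp_k[OF r]) (use k in auto)
  have kq: "1 * q (Suc n) \<le> k * q (Suc n)" "k * q (Suc n) \<le> aa n * q (Suc n)" using k q_pos[of "Suc n"] by (auto intro: mult_right_mono)
  have e: "rk n k = A 0 - B N - of_int (- Q)"
    "rk n (k - 1) = A 0 - B (N - q (Suc n)) - of_int (P (Suc n) - Q)"
    unfolding rk_def N_def Q_def by (subst rdL, use co_k[of n k] co_k[of n "k - 1"] vs dp in \<open>simp; fail\<close>, simp add: algebra_simps)+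
  have e2: "mm (Suc n) = A 1 - B (1 - q (Suc n)) - of_int (P (Suc n))"
    "mk n k = A (1 - N) + of_int Q - A 1" "tk n k = B (1 - N) + of_int Q - A 1"
    unfolding mm_def mk_def tk_def N_def Q_def by (subst nearL nearR farR, use co_q co_mk[of n k] vs dp in \<open>simp; fail\<close>, simp add: algebra_simps)+
  show "exp (- (C * tail (Suc n))) * (mk n k * (tk n k + mm (Suc n)) / ((mk n k + mm (Suc n)) * tk n k))
     \<le> rk n k / rk n (k - 1) * ((rk n (k - 1) + U) / (rk n k + U))"
    unfolding e e2
  proof (rule step_ratio[OF F])
    show "q (Suc n) < N" using kq q_pos[of n] by (simp add: N_def)
    have r2: "right (Suc (Suc n)) \<longleftrightarrow> False" using r right_alt by simp
    have "(\<Sum>i<nat (N - 1). (f ^^ i) (A 1 + of_int 0) - (f ^^ i) (B (1 - q (Suc n)) + of_int (P (Suc n)))) \<le> 1 - (\<Sum>j<nat (q (Suc n)). hole j)"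
      by (rule gap_sum[OF fp_next[OF r]]) (use kq q_rec[of n] q_pos[of n] q_pos[of "Suc n"] in \<open>simp add: N_def; linarith\<close>)
    then show "(\<Sum>i<nat (N - 1). (f ^^ i) (A 1 + of_int 0) - (f ^^ i) (B (1 - q (Suc n)) + of_int (P (Suc n)))) \<le> tail (Suc n)"
      by (simp add: tail_def)
  qed
qed

lemma first_return_gain_right:
  assumes r: "right n" and n: "n = Suc n'"
  shows "first_return_gain n"
proof -
  have vs: "v n = \<delta> n" "v (Suc n) = - \<delta> (Suc n)" "v (Suc (Suc n)) = \<delta> (Suc (Suc n))"
    using r right_alt v_right by auto
  note dp = \<delta>_pos[of n] \<delta>_pos[of "Suc n"] \<delta>_pos[of "Suc (Suc n)"] \<delta>_less[of n] \<delta>_less[of "Suc n"]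
  have e: "XX (Suc n) = A 0 - B (q (Suc n) - q n) - of_int (P n - P (Suc n))"
    "yy (Suc n) = A 0 - B (q (Suc n)) - of_int (- P (Suc n))"
    "ll (Suc (Suc n)) = A 0 - B (- q (Suc (Suc n))) - of_int (P (Suc (Suc n)))"
    unfolding XX_def yy_def ll_def
    by (subst rdL, use co_q co_X vs dp in \<open>simp; fail\<close>, simp)+
  have e2: "mm (Suc n) = A (1 - q (Suc n)) + of_int (P (Suc n)) - A 1"
    "tk (Suc n) 1 = B (1 - (q (Suc n) + q (Suc (Suc n)))) + of_int (P (Suc n) + P (Suc (Suc n))) - A 1"
    unfolding mm_def tk_def by (subst nearR farR, use co_q co_mk[of "Suc n" 1] vs dp in \<open>simp; fail\<close>, simp add: algebra_simps)+
  show ?thesis unfolding first_return_gain_def e e2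
  proof (rule first_gap[OF fp_next[OF r]])
    show "q n < q (Suc n)" using q_less n by simp
    show "q (Suc (Suc n)) = q n + aa n * q (Suc n)" "P (Suc (Suc n)) = P n + aa n * P (Suc n)" "1 \<le> aa n"
      using q_rec P_rec aa1 by auto
    show "0 < of_int (q (Suc (Suc n))) * \<rho> - of_int (P (Suc (Suc n)))"
      "of_int (q (Suc (Suc n))) * \<rho> - of_int (P (Suc (Suc n))) < of_int (P (Suc n)) - of_int (q (Suc n)) * \<rho>"
      using vs dp by (simp_all add: v_def)
  qed
qed

lemma returns_contract_right:
  assumes r: "right (Suc n)" and n: "n = Suc n'"
  shows "returns_contract n"
  unfolding returns_contract_def
proof (intro allI impI)
  fix k1 k2 k3 k4 assume k: "0 \<le> k1 \<and> k1 < k2 \<and> k2 < k3 \<and> k3 < k4 \<and> k4 < aa n"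
  have vs: "v n = - \<delta> n" "v (Suc n) = \<delta> (Suc n)"
    using r right_alt v_right by auto
  note dp = \<delta>_pos[of n] \<delta>_pos[of "Suc n"] \<delta>_less[of n]
  define p where "p = q (Suc n)"
  have F: "fp p (P (Suc n)) (q n) (P n)" unfolding p_def by (rule fp_prev[OF r])
  have dk: "of_int k * \<delta> (Suc n) < \<delta> n" if "k \<le> aa n" for k
    using \<delta>_k[of k n] that \<delta>_pos[of "Suc (Suc n)"] by auto
  have Y: "Yk n k = A 1 - (A (1 + q n + k * p) + of_int (- P n - k * P (Suc n)))" if "0 \<le> k" "k \<le> aa n" for k
  proof -
    have "co (q n + k * q (Suc n)) (- P n - k * P (Suc n)) < 0" unfolding co_k using vs dk[of k] that by simp
    moreover have "B (q n + k * q (Suc n) + 1) = A (q n + k * q (Suc n) + 1)"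
      using AB_eq[of "q n + k * q (Suc n) + 1"] that q_pos[of n] q_pos[of "Suc n"] by simp
    ultimately show ?thesis unfolding Yk_def by (simp add: nearL p_def algebra_simps)
  qed
  have Rk: "rk n k = A 0 - (A (q n + k * p) + of_int (- P n - k * P (Suc n)))" if "0 \<le> k" "k \<le> aa n" for k
  proof -
    have "co (q n + k * q (Suc n)) (- P n - k * P (Suc n)) < 0" unfolding co_k using vs dk[of k] that by simp
    moreover have "0 \<le> k * q (Suc n)" using that q_pos[of "Suc n"] by simp
    then have "B (q n + k * q (Suc n)) = A (q n + k * q (Suc n))"
      using AB_eq[of "q n + k * q (Suc n)"] q_pos[of n] by simp
    ultimately show ?thesis unfolding rk_def by (simp add: rdL p_def algebra_simps)
  qed
  define X where "X k = A (1 + q n + k * p) + of_int (- P n - k * P (Suc n))" for k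
  define m where "m = nat (p - 1)"
  have m: "int m = p - 1" using q_pos[of "Suc n"] by (simp add: m_def p_def)
  have co_X: "co (1 + q n + k * p) (- P n - k * P (Suc n)) = \<rho> + v n + of_int k * v (Suc n)" for k
    by (simp add: v_def p_def algebra_simps)
  have lt: "X i < X j" if "i < j" for i j
  proof -
    have "of_int i * \<delta> (Suc n) < of_int j * \<delta> (Suc n)" using that dp by simp
    then show ?thesis unfolding X_def using vs by (intro ordAA) (simp only: co_X)
  qed
  have X0: "A (1 + q n) + of_int (- P n) \<le> X k1"
    using lt[of 0 k1] k by (cases "k1 = 0") (auto simp: X_def)
  have X4: "X k4 \<le> A (1 - p) + of_int (P (Suc n))"
  proof -
    have "of_int (k4 + 1) * \<delta> (Suc n) < \<delta> n" using dk[of "k4 + 1"] k by simp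
    moreover have "co (1 - p) (P (Suc n)) = \<rho> - v (Suc n)" by (simp add: v_def p_def algebra_simps)
    ultimately have "X k4 < A (1 - p) + of_int (P (Suc n))" unfolding X_def
      by (intro ordAA) (simp only: co_X, simp add: vs algebra_simps)
    then show ?thesis by simp
  qed
  have im: "(f ^^ m) (X k) = A (q n + (k + 1) * p) + of_int (- P n - k * P (Suc n))" for k
    unfolding X_def iterA m by (simp add: algebra_simps)
  have "exp (- (C * tail n)) * po (X k1) (X k2) (X k3) (X k4) \<le> po ((f ^^ m) (X k1)) ((f ^^ m) (X k2)) ((f ^^ m) (X k3)) ((f ^^ m) (X k4))"
    unfolding tail_def m_def
    by (rule return_po(1)[OF F _ _ X0 _ _ _ X4]) (use k lt q_less n vs dp in \<open>auto simp: p_def v_def\<close>)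
  moreover have "po (X k1) (X k2) (X k3) (X k4) = po (- Yk n k1) (- Yk n k2) (- Yk n k3) (- Yk n k4)"
  proof -
    have "X j = - Yk n j + A 1" if "0 \<le> j" "j \<le> aa n" for j using Y[OF that] by (simp add: X_def)
    then show ?thesis using k po_shift[of "- Yk n k1" "A 1" "- Yk n k2" "- Yk n k3" "- Yk n k4"] by simp
  qed
  moreover have "po ((f ^^ m) (X k1)) ((f ^^ m) (X k2)) ((f ^^ m) (X k3)) ((f ^^ m) (X k4))
    = po (- rk n (k1 + 1)) (- rk n (k2 + 1)) (- rk n (k3 + 1)) (- rk n (k4 + 1))"
  proof -
    have "(f ^^ m) (X j) = - rk n (j + 1) + (A 0 + of_int (P (Suc n)))" if "0 \<le> j" "j < aa n" for j
      using Rk[of "j + 1"] that by (simp add: im algebra_simps)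
    then show ?thesis using k po_shift[of "- rk n (k1 + 1)" "A 0 + of_int (P (Suc n))" "- rk n (k2 + 1)" "- rk n (k3 + 1)" "- rk n (k4 + 1)"] by simp
  qed
  ultimately show "exp (- (C * tail n)) * po (- Yk n k1) (- Yk n k2) (- Yk n k3) (- Yk n k4)
    \<le> po (- rk n (k1 + 1)) (- rk n (k2 + 1)) (- rk n (k3 + 1)) (- rk n (k4 + 1))" by simp
qed

lemma chain_bound_right:
  assumes r: "right (Suc n)" and n: "n = Suc n'"
  shows "chain_bound n"
proof -
  define p' P' N Q p Pp a where "p' = q (Suc n)" and "P' = P (Suc n)" and "N = q (Suc (Suc n))" and "Q = P (Suc (Suc n))"
    and "p = q (Suc (Suc (Suc n)))" and "Pp = P (Suc (Suc (Suc n)))" and "a = aa (Suc n)"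
  have vs: "v n = - \<delta> n" "v (Suc n) = \<delta> (Suc n)" "v (Suc (Suc n)) = - \<delta> (Suc (Suc n))" "v (Suc (Suc (Suc n))) = \<delta> (Suc (Suc (Suc n)))"
    using r right_alt v_right by auto
  note dp = \<delta>_pos[of n] \<delta>_pos[of "Suc n"] \<delta>_pos[of "Suc (Suc n)"] \<delta>_pos[of "Suc (Suc (Suc n))"] \<delta>_less[of n] \<delta>_less[of "Suc n"] \<delta>_less[of "Suc (Suc n)"]
  have pn: "p = p' + a * N" "Pp = P' + a * Q" "1 \<le> a" using q_rec P_rec aa1 by (auto simp: p_def p'_def a_def N_def Pp_def P'_def Q_def)
  have F: "fp p' P' N Q" unfolding p'_def P'_def N_def Q_def by (rule fp_next[OF r])
  have pos: "0 < of_int p * \<rho> - of_int Pp" and lt: "of_int p * \<rho> - of_int Pp < of_int Q - of_int N * \<rho>"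
    using vs dp by (simp_all add: p_def Pp_def N_def Q_def v_def)
  define \<mu> W m' where "\<mu> j = A 1 - B (1 - (p - j * N)) - of_int (Pp - j * Q)" and "W j = A 1 - A (1 + j * N) + of_int (j * Q)"
    and "m' = A (1 - N) + of_int Q - A 1" for j
  define \<kappa> where "\<kappa> = U / (exp C * C1)"
  have \<kappa>: "0 < \<kappa>" using U_pos C1 by (simp add: \<kappa>_def)
  have step: "\<kappa> * (1 - W (j + 1) / \<mu> (j + 1)) \<le> (\<mu> j - W j) / (\<mu> j + m')" "0 < \<mu> j" "0 < m'" "W j < \<mu> j" if "0 \<le> j" "j < a" for j
  proof -
    have "U * (1 - W (j + 1) / \<mu> (j + 1)) \<le> exp C * C1 * ((\<mu> j - W j) / (\<mu> j + m'))" "0 < \<mu> j" "0 < m'" "W j < \<mu> j"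
      unfolding W_def \<mu>_def m'_def by (rule chain_step[OF F pn(1,2) that pos lt])+
    moreover have "0 < exp C * C1" using C1 by simp
    ultimately show "\<kappa> * (1 - W (j + 1) / \<mu> (j + 1)) \<le> (\<mu> j - W j) / (\<mu> j + m')" "0 < \<mu> j" "0 < m'" "W j < \<mu> j"
      unfolding \<kappa>_def by (simp_all add: pos_divide_le_eq mult.commute)
  qed
  \<comment> \<open>Descent from the last link to link 1 with one factor \<open>\<kappa>\<close>
    each. Link 0, where \<open>W\<close> vanishes, is handled separately so that \<open>m'\<close>
    survives in the denominator.\<close>
  have it: "\<kappa> ^ i * (1 - W a / \<mu> a) \<le> 1 - W (a - int i) / \<mu> (a - int i)" if "int i \<le> a - 1" for i
    using that
  proof (induction i)
    case (Suc i)
    define j where "j = a - int (Suc i)"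
    have j: "0 \<le> j" "j < a" "j + 1 = a - int i" using Suc.prems by (auto simp: j_def)
    have "\<kappa> ^ Suc i * (1 - W a / \<mu> a) \<le> \<kappa> * (1 - W (j + 1) / \<mu> (j + 1))"
      using Suc j \<kappa> by (simp add: mult.assoc mult_left_mono)
    also have "\<dots> \<le> (\<mu> j - W j) / (\<mu> j + m')" by (rule step[OF j(1,2)])
    also have "\<dots> \<le> (\<mu> j - W j) / \<mu> j" using step(2-4)[OF j(1,2)] by (intro divide_left_mono) auto
    also have "\<dots> = 1 - W j / \<mu> j" using step(2)[OF j(1,2)] by (simp add: field_simps)
    finally show ?case by (simp add: j_def)
  qed simp
  have "\<kappa> ^ nat a * (1 - W a / \<mu> a) = \<kappa> * (\<kappa> ^ nat (a - 1) * (1 - W a / \<mu> a))"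
    using pn(3) by (simp add: nat_diff_distrib flip: power_Suc)
  also have "\<dots> \<le> \<kappa> * (1 - W 1 / \<mu> 1)" using it[of "nat (a - 1)"] pn(3) \<kappa> by (intro mult_left_mono) auto
  also have "\<dots> \<le> (\<mu> 0 - W 0) / (\<mu> 0 + m')" using step(1)[of 0] pn(3) by simp
  finally have c: "\<kappa> ^ nat a * (1 - W a / \<mu> a) \<le> \<mu> 0 / (\<mu> 0 + m')" by (simp add: W_def)
  define y y' X' where "y = A p - of_int Pp - B 0" and "y' = A p' - of_int P' - B 0" and "X' = A (p' - q n) + of_int (P n - P') - B 0"
  have st: "y / y' * (1 - y' / X') \<le> exp C * (1 - W a / (A 1 - B (1 - p') - of_int P'))"
    unfolding y_def y'_def X'_def W_def
  proof (rule chain_start[OF _ _ pn])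
    show "fp p' P' (q n) (P n)" unfolding p'_def P'_def by (rule fp_prev[OF r])
    show "q n < p'" using q_less n by (simp add: p'_def)
    show "1 \<le> N" using q_pos by (simp add: N_def)
    show "0 < of_int Q - of_int N * \<rho>" using pos lt by simp
    show "of_int p' * \<rho> - of_int P' < of_int (P n) - of_int (q n) * \<rho>" using vs dp by (simp add: p'_def P'_def v_def)
  qed (rule pos)
  have "\<mu> a = A 1 - B (1 - p') - of_int P'" using pn by (simp add: \<mu>_def)
  with st have st: "y / y' * (1 - y' / X') \<le> exp C * (1 - W a / \<mu> a)" by simp
  have ee: "exp (- C) * (exp C * z) = z" for z by (simp add: exp_minus)
  have st: "exp (- C) * (y / y' * (1 - y' / X')) \<le> 1 - W a / \<mu> a"
    using mult_left_mono[OF st, of "exp (- C)"] unfolding ee by simp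
  have fin: "\<kappa> ^ nat a * (exp (- C) * (y / y' * (1 - y' / X'))) \<le> \<mu> 0 / (\<mu> 0 + m')"
    using mult_left_mono[OF st, of "\<kappa> ^ nat a"] \<kappa> c by simp
  have e: "yy (Suc (Suc (Suc n))) = y" "yy (Suc n) = y'" "XX (Suc n) = X'"
    unfolding XX_def yy_def y_def y'_def X'_def p_def p'_def P'_def Pp_def
    by (subst rdR, use co_q co_X vs dp in \<open>simp; fail\<close>, simp)+
  have e2: "mm (Suc (Suc (Suc n))) = \<mu> 0" "mm (Suc (Suc n)) = m'"
    unfolding mm_def \<mu>_def m'_def p_def N_def Pp_def Q_def
    by (subst nearL nearR, use co_q vs dp in \<open>simp; fail\<close>, simp add: algebra_simps)+
  show ?thesis unfolding chain_bound_def e e2 using fin by (simp add: \<kappa>_def a_def)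
qed

end

text \<open>Smallness propagates backwards: if \<open>t m\<close> is at most
  \<open>\<theta>\<close>, then going down from \<open>m - 1\<close> each term is at most half of
  its successor, because of the square root factor. For \<open>m\<close> far out this would push the
  fixed positive number \<open>t n0\<close> below any bound.\<close>

lemma tau_lower:
  fixes t :: "nat \<Rightarrow> real" and K :: real
  assumes pos: "\<And>n. n \<ge> n0 \<Longrightarrow> 0 < t n" and K: "K \<ge> 1"
    and st: "\<And>n. n \<ge> n0 \<Longrightarrow> K * t (Suc n) \<le> 1 \<Longrightarrow> t n \<le> K * t (Suc n) \<and> t n \<le> K * t (Suc n) * sqrt (t (Suc (Suc n)))"
  shows "\<exists>\<eta>>0. \<forall>n\<ge>n0. \<eta> \<le> t n"
proof -
  \<comment> \<open>Chosen so that \<open>K * sqrt (K * \<theta>)\<close> is exactly one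
    half.\<close>
  define \<theta> where "\<theta> = 1 / (4 * K ^ 3)"
  have th: "0 < \<theta>" "K * \<theta> = 1 / (4 * K\<^sup>2)" using K by (auto simp: \<theta>_def power2_eq_square power3_eq_cube)
  have th2: "K * \<theta> \<ge> \<theta>" using K th(1) mult_right_mono[of 1 K \<theta>] by simp
  have th1: "K * (K * \<theta>) \<le> 1"
  proof -
    have "K * (K * \<theta>) = 1 / (4 * K)" using K by (simp add: th(2) power2_eq_square)
    also have "\<dots> \<le> 1" using K by simp
    finally show ?thesis .
  qed
  have thr: "K * sqrt (K * \<theta>) = 1 / 2"
    using K by (simp add: th(2) real_sqrt_divide real_sqrt_mult)
  have down: "t (m - 1 - i) \<le> (1 / 2) ^ i * (K * \<theta>) \<and> t (m - i) \<le> K * \<theta>"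
    if m: "m \<ge> Suc n0" "t m \<le> \<theta>" and i: "i \<le> m - 1 - n0" for m i
    using i
  proof (induction i)
    case 0
    have "t m \<le> K * \<theta>" using m(2) th2 by linarith
    then have "K * t m \<le> K * (K * \<theta>)" using K by (intro mult_left_mono) auto
    then have "K * t m \<le> 1" using th1 by linarith
    then have "t (m - 1) \<le> K * t m" using st[of "m - 1"] m by simp
    also have "\<dots> \<le> K * \<theta>" using m K by (intro mult_left_mono) auto
    finally show ?case using m th2 by simp
  next
    case (Suc i)
    define j where "j = m - 1 - Suc i"
    have j: "m - 1 - i = Suc j" "m - i = Suc (Suc j)" "m - Suc i = Suc j" "n0 \<le> j" using Suc.prems m by (auto simp: j_def)
    have IH: "t (Suc j) \<le> (1 / 2) ^ i * (K * \<theta>)" "t (Suc (Suc j)) \<le> K * \<theta>" using Suc j by auto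
    have "(1 / 2 :: real) ^ i * (K * \<theta>) \<le> K * \<theta>" using th K by (intro mult_left_le_one_le) (auto simp: power_le_one)
    then have 1: "t (Suc j) \<le> K * \<theta>" using IH by linarith
    have "K * t (Suc j) \<le> 1" using mult_left_mono[OF 1, of K] K th1 by linarith
    then have "t j \<le> K * t (Suc j) * sqrt (t (Suc (Suc j)))" using st[OF j(4)] by blast
    also have "\<dots> \<le> K * t (Suc j) * sqrt (K * \<theta>)" using IH K pos[of "Suc j"] j by (intro mult_left_mono) auto
    also have "\<dots> = 1 / 2 * t (Suc j)" using thr by (simp add: mult.assoc mult.commute mult.left_commute)
    also have "\<dots> \<le> 1 / 2 * ((1 / 2) ^ i * (K * \<theta>))" using IH by simp
    finally have "t j \<le> (1 / 2) ^ Suc i * (K * \<theta>)" by simp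
    then show ?case using 1 j(3) unfolding j_def by simp
  qed
  obtain M where M: "(1 / 2 :: real) ^ M * (K * \<theta>) < t n0"
  proof -
    obtain M where "(1 / 2 :: real) ^ M < t n0 / (K * \<theta>)"
      using real_arch_pow_inv[of "t n0 / (K * \<theta>)" "1/2"] pos[of n0] th K by auto
    then have "(1 / 2 :: real) ^ M * (K * \<theta>) < t n0" using th(1) K by (subst (asm) pos_less_divide_eq) auto
    then show ?thesis by (rule that)
  qed
  have big: "\<theta> < t m" if "m \<ge> Suc (n0 + M)" for m
  proof (rule ccontr)
    assume "\<not> ?thesis"
    then have "t (m - 1 - (m - 1 - n0)) \<le> (1 / 2) ^ (m - 1 - n0) * (K * \<theta>)" using down[of m "m - 1 - n0"] that by simp
    moreover have "m - 1 - (m - 1 - n0) = n0" using that by simp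
    moreover have "(1 / 2 :: real) ^ (m - 1 - n0) * (K * \<theta>) \<le> (1 / 2) ^ M * (K * \<theta>)"
      using that th K by (intro mult_right_mono power_decreasing) auto
    ultimately show False using M by simp
  qed
  define \<eta> where "\<eta> = Min (insert \<theta> (t ` {n0..Suc (n0 + M)}))"
  have "0 < \<eta>" unfolding \<eta>_def using th pos by (subst Min_gr_iff) auto
  moreover have "\<eta> \<le> t n" if "n \<ge> n0" for n
  proof (cases "n \<le> Suc (n0 + M)")
    case True
    then show ?thesis unfolding \<eta>_def using that by (intro Min_le) auto
  next
    case False
    have "\<eta> \<le> \<theta>" unfolding \<eta>_def by (intro Min_le) auto
    then show ?thesis using big[of n] False by simp
  qed
  ultimately show ?thesis by blast
qed

section \<open>Definite size of the preimages of the flat spot\<close>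

context cfflat
begin

text \<open>The orientation alternates with the level, so each estimate is proved for half of the
  levels only. For the others it is read off in the reflected system, in which all the distances are
  the same.\<close>

lemma levels: "long_step (Suc n)" "cross_step (Suc n)" "image_fatness (Suc n)" "hole_fills_gap n" "return_height (Suc n)" "return_ratio n" "first_return_gain (Suc n)" "returns_contract (Suc n)" "chain_bound (Suc n)"
proof -
  interpret R: cfflat "\<lambda>x. - f (- x)" "\<lambda>e. - B e" "\<lambda>e. - A e" "- \<rho>" \<nu> C C1 r0 q "\<lambda>n. - P n" aa
    by (rule reflect_cf)
  have v: "R.v n = - v n" for n by (simp add: R.v_def v_def)
  have r: "R.right n \<longleftrightarrow> \<not> right n" for n using v_ne[of n] by (auto simp: R.right_def right_def v)
  have irr0: "e = 0 \<and> k = 0" if "of_int e * \<rho> = - of_int k" for e k using irr_eq[of e k] that by simp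
  have rd: "R.rd e k = rd e (- k)" "R.rdf e k = rdf e (- k)" "R.near e k = near e (- k)" "R.far e k = far e (- k)" for e k
    unfolding R.rd_def rd_def R.rdf_def rdf_def R.near_def near_def R.far_def far_def using irr0[of e "- k"] AB1
    by (auto simp: not_less order.order_iff_strict)
  have hole: "R.hole j = hole j" for j by (simp add: R.hole_def hole_def)
  have sk: "R.Yk m k = Yk m k" "R.mk m k = mk m k" "R.tk m k = tk m k" "R.rk m k = rk m k" for m k
    unfolding R.Yk_def Yk_def R.mk_def mk_def R.tk_def tk_def R.rk_def rk_def rd
    by (rule arg_cong[where f = "near _"] arg_cong[where f = "far _"] arg_cong[where f = "rd _"], simp)+
  have s1: "R.yy m = yy m" "R.XX m = XX m" "R.y1 m = y1 m" "R.ll m = ll m" "R.rr m = rr m" "R.Yn m = Yn m" "R.mm m = mm m"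
    "R.tt m = tt m" for m
    unfolding R.yy_def yy_def R.XX_def XX_def R.y1_def y1_def R.ll_def ll_def R.rr_def rr_def R.Yn_def Yn_def R.mm_def mm_def
      R.tt_def tt_def rd
    by (rule arg_cong[where f = "near _"] arg_cong[where f = "far _"] arg_cong[where f = "rd _"] arg_cong[where f = "rdf _"], simp)+
  have s2: "R.tail m = tail m" "R.gap m j = gap m j" for m j
    unfolding R.tail_def tail_def R.gap_def gap_def hole r by simp_all
  note seqs = sk s1 s2
  have U': "- A 0 - - B 0 = U" by simp
  have eqs: "R.long_step m = long_step m" "R.cross_step m = cross_step m" "R.image_fatness m = image_fatness m" "R.hole_fills_gap m = hole_fills_gap m" "R.return_height m = return_height m" "R.return_ratio m = return_ratio m" "R.first_return_gain m = first_return_gain m" "R.returns_contract m = returns_contract m" "R.chain_bound m = chain_bound m" for m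
    unfolding R.long_step_def long_step_def R.cross_step_def cross_step_def R.image_fatness_def image_fatness_def R.hole_fills_gap_def hole_fills_gap_def R.return_height_def return_height_def R.return_ratio_def return_ratio_def R.first_return_gain_def first_return_gain_def
      R.returns_contract_def returns_contract_def R.chain_bound_def chain_bound_def seqs hole U' by simp_all
  show "long_step (Suc n)"
  proof (cases "right (Suc n)")
    case True
    show ?thesis by (rule long_step_right[OF True refl])
  next
    case False
    then have "R.right (Suc n)" by (simp only: r not_False_eq_True)
    from R.long_step_right[OF this refl] show ?thesis by (simp only: eqs)
  qed
  show "cross_step (Suc n)"
  proof (cases "right (Suc (Suc n))")
    case True
    show ?thesis by (rule cross_step_right[OF True refl])
  next
    case False
    then have "R.right (Suc (Suc n))" by (simp only: r not_False_eq_True)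
    from R.cross_step_right[OF this refl] show ?thesis by (simp only: eqs)
  qed
  show "image_fatness (Suc n)"
  proof (cases "right (Suc (Suc n))")
    case True
    show ?thesis by (rule image_fatness_right[OF True refl])
  next
    case False
    then have "R.right (Suc (Suc n))" by (simp only: r not_False_eq_True)
    from R.image_fatness_right[OF this refl] show ?thesis by (simp only: eqs)
  qed
  show "hole_fills_gap n"
  proof (cases "right (n)")
    case True
    show ?thesis by (rule hole_fills_gap_right[OF True])
  next
    case False
    then have "R.right (n)" by (simp only: r not_False_eq_True)
    from R.hole_fills_gap_right[OF this] show ?thesis by (simp only: eqs)
  qed
  show "return_height (Suc n)"
  proof (cases "right (Suc (Suc n))")
    case True
    show ?thesis by (rule return_height_right[OF True refl])
  next
    case False
    then have "R.right (Suc (Suc n))" by (simp only: r not_False_eq_True)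
    from R.return_height_right[OF this refl] show ?thesis by (simp only: eqs)
  qed
  show "return_ratio n"
  proof (cases "right (Suc n)")
    case True
    show ?thesis by (rule return_ratio_right[OF True])
  next
    case False
    then have "R.right (Suc n)" by (simp only: r not_False_eq_True)
    from R.return_ratio_right[OF this] show ?thesis by (simp only: eqs)
  qed
  show "first_return_gain (Suc n)"
  proof (cases "right (Suc n)")
    case True
    show ?thesis by (rule first_return_gain_right[OF True refl])
  next
    case False
    then have "R.right (Suc n)" by (simp only: r not_False_eq_True)
    from R.first_return_gain_right[OF this refl] show ?thesis by (simp only: eqs)
  qed
  show "returns_contract (Suc n)"
  proof (cases "right (Suc (Suc n))")
    case True
    show ?thesis by (rule returns_contract_right[OF True refl])
  next
    case False
    then have "R.right (Suc (Suc n))" by (simp only: r not_False_eq_True)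
    from R.returns_contract_right[OF this refl] show ?thesis by (simp only: eqs)
  qed
  show "chain_bound (Suc n)"
  proof (cases "right (Suc (Suc n))")
    case True
    show ?thesis by (rule chain_bound_right[OF True refl])
  next
    case False
    then have "R.right (Suc (Suc n))" by (simp only: r not_False_eq_True)
    from R.chain_bound_right[OF this refl] show ?thesis by (simp only: eqs)
  qed
qed

lemma abs_vk:
  assumes "0 \<le> k" "k \<le> aa n"
  shows "\<bar>v n + of_int k * v (Suc n)\<bar> = \<delta> n - of_int k * \<delta> (Suc n)" "(v n + of_int k * v (Suc n)) * v n > 0"
    "\<bar>v n + of_int k * v (Suc n)\<bar> > 0" "\<bar>- v n - of_int k * v (Suc n)\<bar> = \<delta> n - of_int k * \<delta> (Suc n)"
proof -
  have d: "0 < \<delta> n - of_int k * \<delta> (Suc n)" using \<delta>_k[OF assms(2)] \<delta>_pos[of "Suc (Suc n)"] by linarith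
  have "v n = \<delta> n \<and> v (Suc n) = - \<delta> (Suc n) \<or> v n = - \<delta> n \<and> v (Suc n) = \<delta> (Suc n)"
    using v_right right_alt by blast
  then show "\<bar>v n + of_int k * v (Suc n)\<bar> = \<delta> n - of_int k * \<delta> (Suc n)" "(v n + of_int k * v (Suc n)) * v n > 0"
    "\<bar>v n + of_int k * v (Suc n)\<bar> > 0" "\<bar>- v n - of_int k * v (Suc n)\<bar> = \<delta> n - of_int k * \<delta> (Suc n)"
    using d \<delta>_pos[of n] by (auto simp: algebra_simps)
qed

lemma sign2: "v n * v (Suc (Suc n)) > 0" "v n * (- v (Suc n)) > 0"
  using v_alt[of n] v_alt[of "Suc n"] by (auto simp: mult_less_0_iff zero_less_mult_iff)

lemma rk_0: "rk n 0 = yy n" "Yk n 0 = Yn n" "mk n 0 = mm n" "tk n 0 = tt n"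
  by (simp_all add: rk_def Yk_def mk_def tk_def yy_def Yn_def mm_def tt_def)

lemma rk_top: "rk n (aa n) = yy (Suc (Suc n))" "Yk n (aa n) = Yn (Suc (Suc n))" "mk n (aa n) = mm (Suc (Suc n))"
   "tk n (aa n) = tt (Suc (Suc n))" "rk n (aa n - 1) = XX (Suc (Suc n))" "rk n 1 = y1 n"
proof -
  have e: "q n + aa n * q (Suc n) = q (Suc (Suc n))" "- P n - aa n * P (Suc n) = - P (Suc (Suc n))" "P n + aa n * P (Suc n) = P (Suc (Suc n))"
    "q n + (aa n - 1) * q (Suc n) = q (Suc (Suc n)) - q (Suc n)" "- P n - (aa n - 1) * P (Suc n) = - P (Suc (Suc n)) + P (Suc n)"
    by (simp_all add: q_rec P_rec algebra_simps)
  show "rk n (aa n) = yy (Suc (Suc n))" "Yk n (aa n) = Yn (Suc (Suc n))" "mk n (aa n) = mm (Suc (Suc n))"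
   "tk n (aa n) = tt (Suc (Suc n))" "rk n (aa n - 1) = XX (Suc (Suc n))" "rk n 1 = y1 n"
    unfolding rk_def Yk_def mk_def tk_def yy_def Yn_def mm_def tt_def XX_def y1_def e by simp_all
qed

lemma rk_less:
  assumes "0 \<le> k" "k < k'" "k' \<le> aa n"
  shows "rk n k' < rk n k" "Yk n k' < Yk n k" "tk n k' < mk n k"
proof -
  have kk: "0 \<le> k" "k \<le> aa n" "0 \<le> k'" "k' \<le> aa n" using assms by auto
  have less: "of_int k * \<delta> (Suc n) < of_int k' * \<delta> (Suc n)" using assms \<delta>_pos by simp
  define V V' where "V = v n + of_int k * v (Suc n)" and "V' = v n + of_int k' * v (Suc n)"
  have V: "0 < V' * V" "\<bar>V'\<bar> < \<bar>V\<bar>" "0 < (- V') * (- V)"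
    using abs_vk(1,2)[OF kk(1,2)] abs_vk(1,2)[OF kk(3,4)] less unfolding V_def[symmetric] V'_def[symmetric]
    by (auto simp: zero_less_mult_iff)
  have 1: "rdf (q n + k' * q (Suc n)) (- P n - k' * P (Suc n)) < rk n k \<and> far (q n + k' * q (Suc n)) (- P n - k' * P (Suc n)) < Yk n k"
    unfolding rk_def Yk_def using side_lt[of "q n + k' * q (Suc n)" "- P n - k' * P (Suc n)" "q n + k * q (Suc n)" "- P n - k * P (Suc n)"] V
    unfolding co_k V_def[symmetric] V'_def[symmetric] by blast
  have ne: "co (q n + k' * q (Suc n)) (- P n - k' * P (Suc n)) \<noteq> 0" unfolding co_k using abs_vk(3)[OF kk(3,4)] by auto
  show "rk n k' < rk n k" "Yk n k' < Yk n k"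
    using 1 near_le_far[of "q n + k' * q (Suc n)" "- P n - k' * P (Suc n)"] ne by (auto simp: rk_def Yk_def)
  have e: "- v n - of_int k * v (Suc n) = - V" "- v n - of_int k' * v (Suc n) = - V'" by (simp_all add: V_def V'_def)
  show "tk n k' < mk n k"
    unfolding tk_def mk_def using side_lt(2)[of "- (q n + k' * q (Suc n))" "P n + k' * P (Suc n)" "- (q n + k * q (Suc n))" "P n + k * P (Suc n)"] V
    unfolding co_mk e by simp
qed

lemma rk_pos:
  assumes "0 \<le> k" "k \<le> aa n"
  shows "0 < rk n k" "0 < Yk n k" "0 < mk n k" "mk n k < tk n k"
proof -
  have ne: "co (q n + k * q (Suc n)) (- P n - k * P (Suc n)) \<noteq> 0" "co (- (q n + k * q (Suc n))) (P n + k * P (Suc n)) \<noteq> 0"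
    unfolding co_k co_mk using abs_vk(3,4)[OF assms] abs_vk(1)[OF assms] by auto
  show "0 < rk n k" "0 < Yk n k" "0 < mk n k" unfolding rk_def Yk_def mk_def using side_pos ne by blast+
  have "0 \<le> k * q (Suc n)" using assms q_pos[of "Suc n"] by simp
  then show "mk n k < tk n k" unfolding mk_def tk_def using q_pos[of n] by (intro hole_side) auto
qed

lemma hole_between:
  assumes "0 \<le> k" "k < aa n"
  shows "yy (Suc (Suc n)) < ll (Suc n)" "ll (Suc n) < rr (Suc n)" "rr (Suc n) < rk n k"
    "Yn (Suc (Suc n)) < mm (Suc n)" "mm (Suc n) < tt (Suc n)" "tt (Suc n) < Yk n k"
proof -
  have ne: "co (- q (Suc n)) (P (Suc n)) \<noteq> 0" "co (q (Suc (Suc n))) (- P (Suc (Suc n))) \<noteq> 0" unfolding co_q using v_ne by auto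
  have "co (q (Suc (Suc n))) (- P (Suc (Suc n))) * co (- q (Suc n)) (P (Suc n)) > 0 \<and> \<bar>co (q (Suc (Suc n))) (- P (Suc (Suc n)))\<bar> < \<bar>co (- q (Suc n)) (P (Suc n))\<bar>"
    unfolding co_q using v_alt[of "Suc n"] \<delta>_less[of "Suc n"] by (simp add: \<delta>_def mult.commute)
  then have "rdf (q (Suc (Suc n))) (- P (Suc (Suc n))) < ll (Suc n) \<and> far (q (Suc (Suc n))) (- P (Suc (Suc n))) < mm (Suc n)"
    unfolding ll_def mm_def using side_lt by blast
  then show "yy (Suc (Suc n)) < ll (Suc n)" "Yn (Suc (Suc n)) < mm (Suc n)"
    using near_le_far[of "q (Suc (Suc n))" "- P (Suc (Suc n))"] ne by (auto simp: yy_def Yn_def)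
  show "ll (Suc n) < rr (Suc n)" "mm (Suc n) < tt (Suc n)" unfolding ll_def rr_def mm_def tt_def using hole_side q_pos[of "Suc n"] ne by auto
  have kk: "0 \<le> k" "k \<le> aa n" using assms by auto
  have "\<delta> (Suc n) < \<delta> n - of_int k * \<delta> (Suc n)"
    using \<delta>_k[of "k + 1" n] assms \<delta>_pos[of "Suc (Suc n)"] by (simp add: algebra_simps)
  then have "(- v (Suc n)) * (v n + of_int k * v (Suc n)) > 0 \<and> \<bar>- v (Suc n)\<bar> < \<bar>v n + of_int k * v (Suc n)\<bar>"
    using abs_vk(1,2)[OF kk] v_alt[of n] by (auto simp: \<delta>_def zero_less_mult_iff mult_less_0_iff)
  then have "rdf (- q (Suc n)) (P (Suc n)) < rk n k \<and> far (- q (Suc n)) (P (Suc n)) < Yk n k"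
    unfolding rk_def Yk_def using side_lt[of "- q (Suc n)" "P (Suc n)" "q n + k * q (Suc n)" "- P n - k * P (Suc n)"] unfolding co_q co_k by blast
  then show "rr (Suc n) < rk n k" "tt (Suc n) < Yk n k" by (auto simp: rr_def tt_def)
qed

lemma basic_ord:
  shows "yy (Suc (Suc n)) < XX (Suc (Suc n))" "XX (Suc (Suc n)) \<le> yy n" "0 < y1 n" "y1 n < yy n" "yy (Suc (Suc n)) \<le> y1 n"
    "rr (Suc n) < XX (Suc (Suc n))" "yy (Suc (Suc n)) < ll (Suc n)" "ll (Suc n) < rr (Suc n)"
    "Yn (Suc (Suc n)) < mm (Suc n)" "mm (Suc n) < tt (Suc n)" "tt (Suc n) < Yn n"
proof -
  show "yy (Suc (Suc n)) < XX (Suc (Suc n))" using rk_less(1)[of "aa n - 1" "aa n" n] aa1[of n] rk_top[of n] by simp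
  show "XX (Suc (Suc n)) \<le> yy n" using rk_less(1)[of 0 "aa n - 1" n] aa1[of n] rk_top[of n] rk_0[of n] by (cases "aa n = 1") auto
  show "y1 n < yy n" "0 < y1 n" using rk_less(1)[of 0 1 n] aa1[of n] rk_top[of n] rk_0[of n] rk_pos(1)[of 1 n] by auto
  show "yy (Suc (Suc n)) \<le> y1 n" using rk_less(1)[of 1 "aa n" n] aa1[of n] rk_top[of n] by (cases "aa n = 1") auto
  show "rr (Suc n) < XX (Suc (Suc n))" using hole_between(3)[of "aa n - 1" n] aa1[of n] rk_top[of n] by simp
  show "yy (Suc (Suc n)) < ll (Suc n)" "ll (Suc n) < rr (Suc n)" "Yn (Suc (Suc n)) < mm (Suc n)" "mm (Suc n) < tt (Suc n)" "tt (Suc n) < Yn n"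
    using hole_between[of 0 n] aa1[of n] rk_0[of n] by auto
qed

text \<open>For \<open>n\<close> at least 2, \<open>XX n\<close> belongs to the last intermediate
  return before level \<open>n\<close>, so \<open>\<tau> n\<close> is the relative progress made by
  the final step of the level.\<close>

definition \<tau> where "\<tau> n = 1 - yy n / XX n"

lemma \<tau>_01: "0 < \<tau> (Suc (Suc n))" "\<tau> (Suc (Suc n)) < 1"
  using basic_ord(1)[of n] seq_pos(1)[of "Suc (Suc n)"] by (auto simp: \<tau>_def)

text \<open>The square root comes from balancing two cases at the scale \<open>s\<close>, the root
  of the third \<open>\<tau>\<close>. Either \<open>D\<close> is at most \<open>2 * s * y\<close>;
  or the hole squeezed between \<open>yy\<close> and \<open>XX\<close> of the later level, hence no
  longer than \<open>s * s * y\<close>, lies at distance at least \<open>s * y\<close> from the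
  return, and \<open>cross_step\<close> makes \<open>D / y\<close> at most
  \<open>c * s\<close>.\<close>

lemma tau_steps:
  defines "c \<equiv> exp C * C1 / U"
  assumes small: "2 * c * \<tau> (Suc (Suc (Suc n))) \<le> 1"
  shows "\<tau> (Suc (Suc n)) \<le> 2 * c * \<tau> (Suc (Suc (Suc n)))"
    "\<tau> (Suc (Suc n)) \<le> 2 * c * \<tau> (Suc (Suc (Suc n))) * ((2 + c) * sqrt (\<tau> (Suc (Suc (Suc (Suc n))))))"
proof -
  let ?n1 = "Suc (Suc n)" and ?n2 = "Suc (Suc (Suc n))" and ?n3 = "Suc (Suc (Suc (Suc n)))"
  have c: "0 < c" using C1 U_pos by (simp add: c_def)
  define x D y where "x = XX ?n1 - yy ?n1" and "D = yy ?n1 - y1 ?n1" and "y = yy ?n1"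
  have pos: "0 < x" "0 < D" "0 < y" "D \<le> y" using basic_ord(1)[of n] basic_ord(3,4)[of ?n1] seq_pos(1)[of ?n1] by (auto simp: x_def D_def y_def)
  have "U * (x / (x + D)) \<le> exp C * C1 * \<tau> ?n2" using levels(1)[of n] by (simp add: long_step_def x_def D_def \<tau>_def)
  then have "x / (x + D) \<le> c * \<tau> ?n2" using U_pos by (simp add: c_def pos_le_divide_eq mult.commute)
  then have "x \<le> c * \<tau> ?n2 * (x + D)" using pos by (simp add: pos_divide_le_eq)
  moreover have "c * \<tau> ?n2 * x \<le> 1 / 2 * x" using small pos by (intro mult_right_mono) auto
  ultimately have xD: "x \<le> 2 * c * \<tau> ?n2 * D" by (simp add: algebra_simps)
  have t1: "\<tau> ?n1 \<le> x / y"
  proof -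
    have "\<tau> ?n1 = x / XX ?n1" using basic_ord(1)[of n] pos by (simp add: \<tau>_def x_def y_def field_simps)
    also have "\<dots> \<le> x / y" using basic_ord(1)[of n] pos by (intro divide_left_mono) (auto simp: y_def)
    finally show ?thesis .
  qed
  have t2: "x / y \<le> 2 * c * \<tau> ?n2 * (D / y)" using xD pos by (simp add: divide_right_mono)
  have ct: "0 < 2 * c * \<tau> ?n2" using c \<tau>_01[of "Suc n"] by simp
  have "D / y \<le> 1" using pos by simp
  then have "2 * c * \<tau> ?n2 * (D / y) \<le> 2 * c * \<tau> ?n2 * 1" using ct by (intro mult_left_mono) auto
  then show "\<tau> ?n1 \<le> 2 * c * \<tau> ?n2" using t1 t2 by linarith
  define s where "s = sqrt (\<tau> ?n3)"
  have s: "0 < s" "s < 1" "s * s = \<tau> ?n3" using \<tau>_01[of ?n1] by (auto simp: s_def)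
  have "D / y \<le> (2 + c) * s"
  proof (cases "D \<le> 2 * s * y")
    case True
    then have "D / y \<le> 2 * s" using pos by (simp add: pos_divide_le_eq)
    then show ?thesis using c s by (simp add: distrib_right add_increasing2)
  next
    case False
    define l r where "l = ll ?n2" and "r = rr ?n2"
    have o: "yy ?n3 < l" "l < r" "r < XX ?n3" "XX ?n3 \<le> y" "yy ?n3 \<le> y1 ?n1"
      using basic_ord[of ?n1] by (auto simp: l_def r_def y_def)
    have X: "XX ?n3 - yy ?n3 = s * s * XX ?n3" using o seq_pos(1)[of ?n3] by (simp add: s(3) \<tau>_def field_simps)
    have X2: "s * s * XX ?n3 \<le> s * s * y" using o by (intro mult_left_mono zero_le_square) auto
    have "s * s \<le> s * 1" using s(1,2) by (intro mult_left_mono) auto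
    then have "s * s * y \<le> s * 1 * y" by (rule mult_right_mono) (use pos in auto)
    then have ssy: "s * s * y \<le> s * y" by simp
    have "y - yy ?n3 \<ge> D" using o by (simp add: D_def y_def)
    then have yl: "s * y \<le> y - l" using False X X2 ssy o by linarith
    have rl: "r - l \<le> s * s * y" using X X2 o by linarith
    have sy: "0 < s * y" using s pos by simp
    have "U * (D / y) \<le> exp C * C1 * ((r - l) / (y - l))"
      using levels(2)[of "Suc n"] by (simp add: cross_step_def D_def y_def l_def r_def)
    also have "(r - l) / (y - l) \<le> (s * s * y) / (s * y)" using rl yl sy o by (intro frac_le) auto
    also have "\<dots> = s" using s(1) pos(3) by simp
    finally have "U * (D / y) \<le> exp C * C1 * s" using C1 by simp
    then have "D / y \<le> c * s" using U_pos by (simp add: c_def pos_le_divide_eq mult.commute)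
    then show ?thesis using s by (simp add: distrib_right add_increasing)
  qed
  then have "2 * c * \<tau> ?n2 * (D / y) \<le> 2 * c * \<tau> ?n2 * ((2 + c) * s)" using ct by (intro mult_left_mono) auto
  then show "\<tau> ?n1 \<le> 2 * c * \<tau> ?n2 * ((2 + c) * sqrt (\<tau> ?n3))" using t1 t2 by (simp add: s_def)
qed

lemma tau_bound: "\<exists>\<eta>>0. \<forall>n\<ge>2. \<eta> \<le> \<tau> n"
proof -
  define c where "c = exp C * C1 / U"
  have c: "0 < c" using C1 U_pos by (simp add: c_def)
  define K where "K = 2 * c * (2 + c) + 1"
  have K: "2 * c \<le> K" "2 * c * (2 + c) \<le> K" "1 \<le> K" using c by (auto simp: K_def algebra_simps)
  show ?thesis
  proof (rule tau_lower[of 2 \<tau> K])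
    show "0 < \<tau> n" if "2 \<le> n" for n using \<tau>_01[of "n - 2"] that by (simp add: numeral_2_eq_2 Suc_diff_Suc)
    fix n :: nat assume n: "2 \<le> n" and sm: "K * \<tau> (Suc n) \<le> 1"
    obtain m where m: "n = Suc (Suc m)" using n by (metis add_2_eq_Suc le_Suc_ex)
    have tp: "0 < \<tau> (Suc n)" using \<tau>_01[of "Suc m"] m by simp
    have "2 * c * \<tau> (Suc n) \<le> K * \<tau> (Suc n)" using K tp by (intro mult_right_mono) auto
    then have sm': "2 * c * \<tau> (Suc n) \<le> 1" using sm by linarith
    note st = tau_steps[of m, folded c_def, folded m, OF sm']
    have 1: "\<tau> n \<le> K * \<tau> (Suc n)" using st(1) \<open>2 * c * \<tau> (Suc n) \<le> K * \<tau> (Suc n)\<close> by linarith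
    have "2 * c * \<tau> (Suc n) * ((2 + c) * sqrt (\<tau> (Suc (Suc n)))) = (2 * c * (2 + c)) * (\<tau> (Suc n) * sqrt (\<tau> (Suc (Suc n))))"
      by (simp only: ac_simps)
    then have "\<tau> n \<le> (2 * c * (2 + c)) * (\<tau> (Suc n) * sqrt (\<tau> (Suc (Suc n))))" using st(2) by linarith
    also have "\<dots> \<le> K * (\<tau> (Suc n) * sqrt (\<tau> (Suc (Suc n))))"
      using K tp \<tau>_01[of n] by (intro mult_right_mono) auto
    finally show "\<tau> n \<le> K * \<tau> (Suc n) \<and> \<tau> n \<le> K * \<tau> (Suc n) * sqrt (\<tau> (Suc (Suc n)))" using 1 by (simp add: mult.assoc)
  qed (use K in auto)
qed

text \<open>By \<open>image_fatness\<close> a lower bound for \<open>\<tau>\<close> bounds a product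
  of two factors that are at most one, hence each of them; \<open>hole_dbl\<close> carries the first
  one back to the flat spot.\<close>

lemma fatness:
  "\<exists>\<kappa>>0. \<kappa> < 1 \<and> (\<forall>n\<ge>2. \<kappa> \<le> (tt n - mm n) / tt n \<and> \<kappa> * (mm (n - 1) + mm n) \<le> mm (n - 1) \<and> \<kappa> \<le> (rr n - ll n) / rr n \<and> \<kappa> \<le> \<tau> n)"
proof -
  obtain \<eta> where eta: "\<eta> > 0" "\<forall>n\<ge>2. \<eta> \<le> \<tau> n" using tau_bound by blast
  define \<kappa>1 \<kappa> where "\<kappa>1 = U * \<eta> / exp C" and "\<kappa> = min (\<kappa>1 / C1) \<eta>"
  have k1: "0 < \<kappa>1" using eta U_pos by (simp add: \<kappa>1_def)
  have k: "0 < \<kappa>" "\<kappa> \<le> \<kappa>1" "\<kappa> \<le> \<eta>" using k1 eta C1 by (auto simp: \<kappa>_def min_le_iff_disj pos_divide_le_eq mult_le_cancel_left1)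
  have "\<eta> \<le> \<tau> 2" using eta by simp
  then have "\<kappa> < 1" using k \<tau>_01[of 0] by (simp add: numeral_2_eq_2)
  moreover have "\<kappa> \<le> (tt n - mm n) / tt n \<and> \<kappa> * (mm (n - 1) + mm n) \<le> mm (n - 1) \<and> \<kappa> \<le> (rr n - ll n) / rr n \<and> \<kappa> \<le> \<tau> n"
    if n: "n \<ge> 2" for n
  proof -
    obtain m where m: "n = Suc (Suc m)" using n by (metis add_2_eq_Suc le_Suc_ex)
    define a b where "a = (tt n - mm n) / tt n" and "b = mm (n - 1) / (mm (n - 1) + mm n)"
    have p: "0 < mm n" "mm n < tt n" "0 < mm (n - 1)" using seq_pos basic_ord(10)[of "Suc m"] m by auto
    have ab: "0 \<le> a" "a \<le> 1" "0 \<le> b" "b \<le> 1" using p by (auto simp: a_def b_def)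
    have "U * \<tau> n \<le> exp C * (a * b)" using levels(3)[of m] m by (simp add: image_fatness_def \<tau>_def a_def b_def)
    moreover have "U * \<eta> \<le> U * \<tau> n" using eta n U_pos by simp
    ultimately have "\<kappa>1 \<le> a * b" unfolding \<kappa>1_def by (simp add: pos_divide_le_eq mult.commute)
    moreover have "a * b \<le> a" "a * b \<le> b" using ab by (auto simp: mult_left_le mult_left_le_one_le)
    ultimately have ab1: "\<kappa>1 \<le> a" "\<kappa>1 \<le> b" by linarith+
    have ne: "co (- q n) (P n) \<noteq> 0" "\<bar>co (- q n) (P n)\<bar> < 1" unfolding co_q using v_ne \<delta>_lt1[of n] by (auto simp: \<delta>_def)
    have "tt n - mm n \<le> C1 * ((rr n - ll n) / rr n) * tt n"
      unfolding tt_def mm_def rr_def ll_def using ne q_pos[of n] by (intro hole_dbl) auto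
    then have "a \<le> C1 * ((rr n - ll n) / rr n)" unfolding a_def using p by (subst pos_divide_le_eq) auto
    then have "\<kappa>1 / C1 \<le> (rr n - ll n) / rr n" using ab1 C1 by (simp add: pos_divide_le_eq mult.commute)
    then have "\<kappa> \<le> (rr n - ll n) / rr n" by (simp add: \<kappa>_def)
    moreover have "\<kappa> * (mm (n - 1) + mm n) \<le> mm (n - 1)" using ab1 k p unfolding b_def by (subst (asm) pos_le_divide_eq, simp) (smt (verit) mult_right_mono)
    ultimately show ?thesis using ab1 k eta n by (auto simp: a_def intro: order_trans)
  qed
  ultimately show ?thesis using k by blast
qed

lemma yy_lim: "yy \<longlonglongrightarrow> 0"
proof -
  obtain \<kappa> where k: "0 < \<kappa>" "\<kappa> < 1" "\<forall>n\<ge>2. \<kappa> \<le> \<tau> n" using fatness by blast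
  have st: "yy (Suc (Suc n)) \<le> (1 - \<kappa>) * yy n" for n
  proof -
    have X: "0 < XX (Suc (Suc n))" "XX (Suc (Suc n)) \<le> yy n" using basic_ord[of n] seq_pos(1)[of "Suc (Suc n)"] by auto
    have "\<kappa> \<le> 1 - yy (Suc (Suc n)) / XX (Suc (Suc n))" using k by (simp add: \<tau>_def)
    then have "yy (Suc (Suc n)) / XX (Suc (Suc n)) \<le> 1 - \<kappa>" by simp
    then have "yy (Suc (Suc n)) \<le> (1 - \<kappa>) * XX (Suc (Suc n))" using X by (simp add: pos_divide_le_eq)
    also have "\<dots> \<le> (1 - \<kappa>) * yy n" using X k by (intro mult_left_mono) auto
    finally show ?thesis .
  qed
  define M where "M = max (yy 0) (yy 1)"
  have "yy (2 * j) \<le> (1 - \<kappa>) ^ j * M \<and> yy (Suc (2 * j)) \<le> (1 - \<kappa>) ^ j * M" for j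
  proof (induction j)
    case (Suc j)
    have "(1 - \<kappa>) * yy (2 * j) \<le> (1 - \<kappa>) * ((1 - \<kappa>) ^ j * M)" "(1 - \<kappa>) * yy (Suc (2 * j)) \<le> (1 - \<kappa>) * ((1 - \<kappa>) ^ j * M)"
      using Suc k by (intro mult_left_mono; simp)+
    then have "yy (2 * Suc j) \<le> (1 - \<kappa>) * ((1 - \<kappa>) ^ j * M)" "yy (Suc (2 * Suc j)) \<le> (1 - \<kappa>) * ((1 - \<kappa>) ^ j * M)"
      using order_trans[OF st[of "2 * j"]] order_trans[OF st[of "Suc (2 * j)"]] by simp_all
    then show ?case by (simp add: mult.assoc)
  qed (simp add: M_def)
  note eo = this
  have bd: "yy n \<le> (1 - \<kappa>) ^ (n div 2) * M" for n
  proof -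
    have "n = 2 * (n div 2) \<or> n = Suc (2 * (n div 2))" by presburger
    then show ?thesis using eo[of "n div 2"] by metis
  qed
  have "filterlim (\<lambda>n::nat. n div 2) at_top sequentially"
    unfolding filterlim_at_top eventually_sequentially
  proof
    fix Z :: nat
    show "\<exists>N. \<forall>n\<ge>N. Z \<le> n div 2" by (rule exI[of _ "2 * Z"]) auto
  qed
  then have "(\<lambda>n. (1 - \<kappa>) ^ (n div 2)) \<longlonglongrightarrow> 0"
    by (rule filterlim_compose[OF LIMSEQ_power_zero, rotated]) (use k in auto)
  then have L: "(\<lambda>n. (1 - \<kappa>) ^ (n div 2) * M) \<longlonglongrightarrow> 0" using tendsto_mult_left_zero by blast
  show ?thesis
  proof (rule tendsto_sandwich[OF _ _ tendsto_const L])
    show "\<forall>\<^sub>F n in sequentially. 0 \<le> yy n" using seq_pos(1) by (simp add: less_imp_le)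
    show "\<forall>\<^sub>F n in sequentially. yy n \<le> (1 - \<kappa>) ^ (n div 2) * M" using bd by simp
  qed
qed

section \<open>The preimages of the flat spot have full length\<close>

lemma q_ge: "int n \<le> q n"
proof (induction n)
  case (Suc n)
  note ih = Suc.IH
  show ?case
  proof (cases n)
    case 0
    then show ?thesis using q_pos[of 1] by simp
  next
    case (Suc m)
    then show ?thesis using q_less[of m] ih by simp
  qed
qed (use q_pos[of 0] in simp)

text \<open>The preimages of order below \<open>q n + q (Suc n)\<close> cut the circle into gaps of
  exactly two kinds. In the total all ends \<open>A\<close> and \<open>B\<close> cancel, and the
  translations add up to the determinant, which is one.\<close>

lemma tiling:
  assumes "right n"
  shows "(\<Sum>j<nat (q (Suc n)). gap n j) + (\<Sum>j<nat (q n). gap (Suc n) j) + (\<Sum>j<nat (q n) + nat (q (Suc n)). hole j) = 1"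
proof -
  define x y where "x = nat (q n)" and "y = nat (q (Suc n))"
  have xy: "q n = int x" "q (Suc n) = int y" using q_pos[of n] q_pos[of "Suc n"] by (auto simp: x_def y_def)
  define a b where "a j = A (- int j)" and "b j = B (- int j)" for j :: nat
  have sh: "(\<Sum>j<n. g (m + j)) = (\<Sum>j<m + n. g j) - (\<Sum>j<m. g j)" for g :: "nat \<Rightarrow> real" and m n
    by (induction n) (auto simp: add.commute)
  have "(\<Sum>j<y. gap n j) = (\<Sum>j<y. a j) - ((\<Sum>j<x + y. b j) - (\<Sum>j<x. b j)) - real y * of_int (P n)"
    using assms sh[of b x y] unfolding gap_def xy by (simp add: a_def b_def sum_subtractf)
  moreover have "(\<Sum>j<x. gap (Suc n) j) = ((\<Sum>j<x + y. a j) - (\<Sum>j<y. a j)) + real x * of_int (P (Suc n)) - (\<Sum>j<x. b j)"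
    using assms right_alt sh[of a y x] unfolding gap_def xy by (simp add: a_def b_def sum_subtractf sum.distrib add.commute)
  moreover have "(\<Sum>j<x + y. hole j) = (\<Sum>j<x + y. b j) - (\<Sum>j<x + y. a j)" by (simp add: hole_def a_def b_def sum_subtractf)
  moreover have "real x * of_int (P (Suc n)) - real y * of_int (P n) = 1"
  proof -
    have "q n * P (Suc n) - q (Suc n) * P n = 1" using fp_next[OF assms] by (simp add: fp_def)
    then have "of_int (q n * P (Suc n) - q (Suc n) * P n) = (1 :: real)" by simp
    then show ?thesis unfolding xy by simp
  qed
  ultimately show ?thesis unfolding x_def[symmetric] y_def[symmetric] by linarith
qed

text \<open>Every gap of the tiling is at most a constant times a preimage of order at least
  \<open>q n\<close>. The gaps together are thus bounded by a remainder of the convergent series of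
  hole lengths and vanish in the limit, so by \<open>tiling\<close> the series sums to one.\<close>

lemma tail_lim: "tail \<longlonglongrightarrow> 0"
proof -
  obtain \<kappa> where k: "0 < \<kappa>" "\<forall>n\<ge>2. \<kappa> \<le> (rr n - ll n) / rr n" using fatness by blast
  define K where "K = exp C / (U * \<kappa>)"
  have K: "0 < K" using U_pos k by (simp add: K_def)
  have g: "gap n j \<le> K * hole (nat (q n) + j)" if n: "n \<ge> 2" and j: "int j < q (Suc n)" for n j
  proof -
    let ?h = "hole (nat (q n) + j)"
    have S: "0 < gap n j" "U * ((rr n - ll n) / rr n) \<le> exp C * (?h / (?h + gap n j))" using levels(4)[of n] j by (auto simp: hole_fills_gap_def)
    have h: "0 < ?h" by (rule hole_pos)
    have "U * \<kappa> \<le> exp C * (?h / (?h + gap n j))" using S k n U_pos mult_left_mono[of \<kappa> "(rr n - ll n) / rr n" U] by auto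
    then have "U * \<kappa> * (?h + gap n j) \<le> exp C * ?h" using S h by (simp add: pos_le_divide_eq)
    then have "?h + gap n j \<le> K * ?h" using U_pos k by (simp add: K_def pos_le_divide_eq mult.commute)
    then show ?thesis using h by linarith
  qed
  define S where "S N = (\<Sum>j<N. hole j)" for N
  have Smono: "S M \<le> S N" if "M \<le> N" for M N unfolding S_def using that hole_pos by (intro sum_mono2) (auto simp: less_imp_le)
  have "convergent S"
  proof (rule Bseq_mono_convergent)
    have "norm (S n) \<le> 1" for n
    proof -
      have "0 \<le> S n" unfolding S_def by (rule sum_nonneg) (simp add: less_imp_le hole_pos)
      then show ?thesis using hole_sum[of n] by (simp add: S_def)
    qed
    then show "Bseq S" by (rule BseqI')
  qed (use Smono in auto)
  then obtain s where s: "S \<longlonglongrightarrow> s" by (auto simp: convergent_def)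
  have Ss: "S N \<le> s" for N by (rule LIMSEQ_le_const[OF s]) (use Smono in auto)
  have s1: "s \<le> 1" by (rule LIMSEQ_le_const2[OF s]) (use hole_sum in \<open>auto simp: S_def\<close>)
  have "s = 1"
  proof (rule ccontr)
    assume "s \<noteq> 1"
    then have s1': "s < 1" using s1 by simp
    \<comment> \<open>Each kind of gap then covers at most a quarter of the missing length
      \<open>1 - s\<close>.\<close>
    define e where "e = (1 - s) / (4 * K)"
    have e: "0 < e" using s1' K by (simp add: e_def)
    obtain N where N: "\<forall>n\<ge>N. \<bar>S n - s\<bar> < e" using s e unfolding LIMSEQ_iff real_norm_def by blast
    \<comment> \<open>\<open>tiling\<close> is stated for one orientation, and of two consecutive
      levels one has it.\<close>
    obtain n where n: "right n" "n \<ge> 2" "n \<ge> N"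
    proof (cases "right (max 2 N)")
      case True
      show ?thesis by (rule that[OF True]) auto
    next
      case False
      then have "right (Suc (max 2 N))" using right_alt by blast
      then show ?thesis by (rule that) auto
    qed
    obtain n' where n': "n = Suc n'" using n(2) by (cases n) auto
    define x y where "x = nat (q n)" and "y = nat (q (Suc n))"
    have xN: "N \<le> x" using q_ge[of n] n by (simp add: x_def)
    have xy: "x \<le> y" unfolding x_def y_def using q_less[of n'] n' by (intro nat_mono) simp
    have yN: "N \<le> y" using xN xy by simp
    have sh: "(\<Sum>j<n. hole (m + j)) = S (m + n) - S m" for m n
      unfolding S_def by (induction n) (auto simp: add.commute)
    have "(\<Sum>j<y. gap n j) \<le> (\<Sum>j<y. K * hole (x + j))"
      by (rule sum_mono) (use g[of n] n in \<open>auto simp: x_def y_def\<close>)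
    moreover have "(\<Sum>j<x. gap (Suc n) j) \<le> (\<Sum>j<x. K * hole (y + j))"
    proof (rule sum_mono)
      fix j assume "j \<in> {..<x}"
      moreover have "q n \<le> q (Suc (Suc n))" using q_less[of n] q_less[of n'] n' by simp
      ultimately show "gap (Suc n) j \<le> K * hole (y + j)" using g[of "Suc n" j] n by (simp add: x_def y_def)
    qed
    moreover have "(\<Sum>j<y. gap n j) + (\<Sum>j<x. gap (Suc n) j) + S (x + y) = 1"
      using tiling[OF n(1)] by (simp add: x_def y_def S_def)
    ultimately have "1 \<le> K * (S (x + y) - S x) + K * (S (y + x) - S y) + S (x + y)"
      by (simp add: sum_distrib_left[symmetric] sh)
    moreover have "\<bar>S x - s\<bar> < e" "\<bar>S y - s\<bar> < e" using N xN yN by auto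
    then have "S (x + y) - S x \<le> e" "S (y + x) - S y \<le> e" using Ss[of "x + y"] Ss[of "y + x"] by linarith+
    then have "K * (S (x + y) - S x) \<le> K * e" "K * (S (y + x) - S y) \<le> K * e" using K by (auto intro: mult_left_mono)
    moreover have "K * e = (1 - s) / 4" using K by (simp add: e_def)
    moreover have "1 \<le> p + r + u \<Longrightarrow> p \<le> w \<Longrightarrow> r \<le> w \<Longrightarrow> w = (1 - s) / 4 \<Longrightarrow> u \<le> s \<Longrightarrow> False" for p r u w :: real
      using s1' by argo
    ultimately show False using Ss[of "x + y"] by blast
  qed
  have "filterlim (\<lambda>n. nat (q n)) at_top sequentially"
  proof (rule filterlim_at_top_mono[OF filterlim_ident])
    have "n \<le> nat (q n)" for n using q_ge[of n] by linarith
    then show "\<forall>\<^sub>F n in sequentially. n \<le> nat (q n)" by simp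
  qed
  then have "(\<lambda>n. S (nat (q n))) \<longlonglongrightarrow> 1" using s \<open>s = 1\<close> filterlim_compose by blast
  then have "(\<lambda>n. 1 - S (nat (q n))) \<longlonglongrightarrow> 1 - 1" by (intro tendsto_intros)
  then show ?thesis by (simp add: tail_def[abs_def] S_def)
qed

end

section \<open>Contraction of Poincare ratios by powers\<close>

lemma sinh_ratio_less:
  fixes p x y :: real
  assumes p: "0 < p" "p < 1" and xy: "0 < x" "x < y"
  shows "sinh (p * y) / sinh y < sinh (p * x) / sinh x"
proof (rule DERIV_neg_imp_decreasing[OF xy(2)])
  fix z assume z: "x \<le> z" "z \<le> y"
  then have z0: "0 < z" using xy by simp
  \<comment> \<open>Minus the numerator of the derivative; it vanishes at \<open>0\<close> and is
    increasing.\<close>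
  have "0 < sinh (p * z) * cosh z - p * cosh (p * z) * sinh z"
  proof -
    have "sinh (p * 0) * cosh 0 - p * cosh (p * 0) * sinh 0 < sinh (p * z) * cosh z - p * cosh (p * z) * sinh z"
    proof (rule DERIV_pos_imp_increasing_open[OF z0])
      fix w assume w: "0 < w" "w < z"
      have "((\<lambda>w. sinh (p * w) * cosh w - p * cosh (p * w) * sinh w) has_real_derivative ((1 - p * p) * (sinh (p * w) * sinh w))) (at w)"
        by (auto intro!: derivative_eq_intros simp: algebra_simps)
      moreover have "0 < (1 - p * p) * (sinh (p * w) * sinh w)"
        using p w mult_strict_mono[of p 1 p 1] by (intro mult_pos_pos) auto
      ultimately show "\<exists>y. ((\<lambda>w. sinh (p * w) * cosh w - p * cosh (p * w) * sinh w) has_real_derivative y) (at w) \<and> y > 0" by blast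
    qed (intro continuous_intros)
    then show ?thesis by simp
  qed
  moreover have "((\<lambda>z. sinh (p * z) / sinh z) has_real_derivative (p * cosh (p * z) * sinh z - sinh (p * z) * cosh z) / (sinh z * sinh z)) (at z)"
    using z0 by (auto intro!: derivative_eq_intros simp: algebra_simps)
  moreover have "0 < sinh z * sinh z" using z0 by simp
  ultimately show "\<exists>y. ((\<lambda>z. sinh (p * z) / sinh z) has_real_derivative y) (at z) \<and> y < 0"
    by (intro exI[of _ "(p * cosh (p * z) * sinh z - sinh (p * z) * cosh z) / (sinh z * sinh z)"] conjI divide_neg_pos) auto
qed

text \<open>\<^const>\<open>po\<close> as a function of the logarithmic gaps of its four points.\<close>

definition lpo :: "real \<Rightarrow> real \<Rightarrow> real \<Rightarrow> real" where
  "lpo a b c = 1 - sinh (a / 2) / sinh ((a + b) / 2) * (sinh (c / 2) / sinh ((c + b) / 2))"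

text \<open>A difference \<open>exp x - exp y\<close> is \<open>2 * sinh ((x - y) / 2)\<close> times
  the exponential of the mean of \<open>x\<close> and \<open>y\<close>, and these exponentials
  cancel in a cross ratio. The minus signs put the points in increasing order.\<close>

lemma po_exp:
  assumes "u1 > u2" "u2 > u3" "u3 > u4"
  shows "po (- exp u1) (- exp u2) (- exp u3) (- exp u4) = lpo (u1 - u2) (u2 - u3) (u3 - u4)"
proof -
  have d: "exp x - exp y = 2 * exp ((x + y) / 2) * sinh ((x - y) / 2)" for x y :: real
  proof -
    have "exp x = exp ((x + y) / 2) * exp ((x - y) / 2)" "exp y = exp ((x + y) / 2) * exp (- ((x - y) / 2))"
      unfolding exp_add[symmetric] by (simp_all add: field_simps)
    then show ?thesis by (simp add: sinh_def algebra_simps)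
  qed
  have "po (- exp u1) (- exp u2) (- exp u3) (- exp u4) = 1 - cr (- exp u1) (- exp u2) (- exp u3) (- exp u4)"
    using assms by (subst cr_po) auto
  moreover have "cr (- exp u1) (- exp u2) (- exp u3) (- exp u4) = (exp u1 - exp u2) * (exp u3 - exp u4) / ((exp u1 - exp u3) * (exp u2 - exp u4))"
    by (simp add: cr_def)
  moreover have "\<dots> = sinh ((u1 - u2) / 2) / sinh ((u1 - u3) / 2) * (sinh ((u3 - u4) / 2) / sinh ((u2 - u4) / 2)) *
      (exp ((u1 + u2) / 2) * exp ((u3 + u4) / 2) / (exp ((u1 + u3) / 2) * exp ((u2 + u4) / 2)))"
    unfolding d by (simp add: field_simps)
  moreover have "exp ((u1 + u2) / 2) * exp ((u3 + u4) / 2) = exp ((u1 + u3) / 2) * exp ((u2 + u4) / 2)"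
    unfolding exp_add[symmetric] by (simp add: field_simps)
  ultimately show ?thesis by (simp add: lpo_def)
qed

lemma lpo_bounds:
  assumes "0 < a" "0 < b" "0 < c"
  shows "0 \<le> lpo a b c" "lpo a b c \<le> 1"
proof -
  have "0 \<le> sinh (a / 2) / sinh ((a + b) / 2)" "sinh (a / 2) / sinh ((a + b) / 2) \<le> 1"
    "0 \<le> sinh (c / 2) / sinh ((c + b) / 2)" "sinh (c / 2) / sinh ((c + b) / 2) \<le> 1"
    using assms by simp_all
  then show "0 \<le> lpo a b c" "lpo a b c \<le> 1" unfolding lpo_def
    using mult_le_one[of "sinh (a / 2) / sinh ((a + b) / 2)" "sinh (c / 2) / sinh ((c + b) / 2)"]
      mult_nonneg_nonneg[of "sinh (a / 2) / sinh ((a + b) / 2)" "sinh (c / 2) / sinh ((c + b) / 2)"] by linarith+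
qed

text \<open>Dividing the logarithmic gaps by \<open>\<nu>\<close> is the effect of the map
  \<open>x powr (1 / \<nu>)\<close>, so this is its strict contraction of Poincare ratios.\<close>

lemma lpo_scale:
  assumes nu: "\<nu> > 1" and p: "0 < a" "0 < b" "0 < c"
  shows "lpo (a / \<nu>) (b / \<nu>) (c / \<nu>) < lpo a b c"
proof -
  have s: "sinh (x / 2) / sinh ((x + b) / 2) < sinh (x / \<nu> / 2) / sinh ((x / \<nu> + b / \<nu>) / 2)" if "0 < x" for x
  proof -
    have "sinh (1 / \<nu> * ((x + b) / 2)) / sinh ((x + b) / 2) < sinh (1 / \<nu> * (x / 2)) / sinh (x / 2)"
      by (rule sinh_ratio_less) (use nu p that in auto)
    moreover have "1 / \<nu> * ((x + b) / 2) = (x / \<nu> + b / \<nu>) / 2" "1 / \<nu> * (x / 2) = x / \<nu> / 2"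
      using nu by (simp_all add: add_divide_distrib)
    moreover have "0 < sinh ((x + b) / 2)" "0 < sinh (x / 2)" "0 < sinh ((x / \<nu> + b / \<nu>) / 2)"
      using p that nu by (auto intro!: add_pos_pos divide_pos_pos)
    moreover have "g / p < r / h \<Longrightarrow> 0 < h \<Longrightarrow> 0 < p \<Longrightarrow> 0 < g \<Longrightarrow> h / p < r / g" for g p r h :: real
      by (simp add: field_simps)
    ultimately show ?thesis by metis
  qed
  have "sinh (a / 2) / sinh ((a + b) / 2) * (sinh (c / 2) / sinh ((c + b) / 2))
     < sinh (a / \<nu> / 2) / sinh ((a / \<nu> + b / \<nu>) / 2) * (sinh (c / \<nu> / 2) / sinh ((c / \<nu> + b / \<nu>) / 2))"
    using s[OF p(1)] s[OF p(3)] p by (intro mult_strict_mono') simp_all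
  then show ?thesis by (simp add: lpo_def)
qed

text \<open>Strictness becomes a definite factor by compactness once the logarithmic gaps stay
  between \<open>\<alpha>\<close> and \<open>M\<close>; uniform continuity absorbs a map that is a
  power only up to \<open>\<epsilon>\<close>.\<close>

lemma lpo_gap:
  assumes nu: "\<nu> > 1" and al: "0 < \<alpha>" "\<alpha> \<le> M"
  shows "\<exists>\<epsilon>>0. \<forall>a\<in>{\<alpha>..M}. \<forall>b\<in>{\<alpha>..M}. \<forall>c\<in>{\<alpha>..M}. \<forall>a' b' c'.
     \<bar>\<nu> * a' - a\<bar> \<le> \<epsilon> \<longrightarrow> \<bar>\<nu> * b' - b\<bar> \<le> \<epsilon> \<longrightarrow> \<bar>\<nu> * c' - c\<bar> \<le> \<epsilon> \<longrightarrow> lpo a' b' c' < exp (- \<epsilon>) * lpo a b c"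
proof -
  define G where "G t = lpo (fst t) (fst (snd t)) (snd (snd t))" for t
  define K0 where "K0 = {\<alpha>..M} \<times> {\<alpha>..M} \<times> {\<alpha>..M}"
  define K1 where "K1 = {\<alpha> / (2 * \<nu>)..2 * M} \<times> {\<alpha> / (2 * \<nu>)..2 * M} \<times> {\<alpha> / (2 * \<nu>)..2 * M}"
  have al1: "0 < \<alpha> / (2 * \<nu>)" using al nu by simp
  have cp: "compact K0" "compact K1" unfolding K0_def K1_def by (intro compact_Times compact_Icc)+
  have cont: "continuous_on {t. 0 < fst t \<and> 0 < fst (snd t) \<and> 0 < snd (snd t)} G"
    unfolding G_def lpo_def by (intro continuous_intros) auto
  have "continuous_on K1 G" by (rule continuous_on_subset[OF cont]) (use al1 in \<open>auto simp: K1_def\<close>)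
  then have uc: "uniformly_continuous_on K1 G" using cp by (intro compact_uniformly_continuous)
  define H where "H t = G t - G ((1 / \<nu>) *\<^sub>R t)" for t
  have cH: "continuous_on K0 H" unfolding H_def
  proof (intro continuous_on_diff)
    show "continuous_on K0 G" by (rule continuous_on_subset[OF cont]) (use al in \<open>auto simp: K0_def\<close>)
    show "continuous_on K0 (\<lambda>t. G ((1 / \<nu>) *\<^sub>R t))"
      by (rule continuous_on_compose2[OF cont]) (use al nu in \<open>auto simp: K0_def intro!: continuous_intros\<close>)
  qed
  have ne: "K0 \<noteq> {}" using al by (auto simp: K0_def)
  obtain t0 where t0: "t0 \<in> K0" "\<forall>t\<in>K0. H t0 \<le> H t" using continuous_attains_inf[OF cp(1) ne cH] by blast
  define \<zeta> where "\<zeta> = H t0"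
  have z: "0 < \<zeta>" unfolding \<zeta>_def H_def G_def using t0(1) al lpo_scale[OF nu, of "fst t0" "fst (snd t0)" "snd (snd t0)"]
    by (auto simp: K0_def)
  have zG: "lpo (a / \<nu>) (b / \<nu>) (c / \<nu>) + \<zeta> \<le> lpo a b c" if "a \<in> {\<alpha>..M}" "b \<in> {\<alpha>..M}" "c \<in> {\<alpha>..M}" for a b c
    using t0(2)[folded \<zeta>_def, rule_format, of "(a, b, c)"] that by (auto simp: K0_def H_def G_def)
  obtain d where d: "d > 0" "\<forall>s\<in>K1. \<forall>t\<in>K1. dist t s < d \<longrightarrow> dist (G t) (G s) < \<zeta> / 2"
    using uc z unfolding uniformly_continuous_on_def by (meson half_gt_zero)
  \<comment> \<open>With \<open>d / 4\<close> the three perturbations together stay within the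
    modulus of continuity, with \<open>\<alpha> / 2\<close> they stay in \<open>K1\<close>, and
    \<open>\<zeta> / 2\<close> is the part of the strict gain that is left for the factor
    \<open>exp (- \<epsilon>)\<close>.\<close>
  define \<epsilon> where "\<epsilon> = min (min (d / 4) (\<alpha> / 2)) (\<zeta> / 2)"
  have e: "0 < \<epsilon>" "\<epsilon> \<le> d / 4" "\<epsilon> \<le> \<alpha> / 2" "\<epsilon> \<le> \<zeta> / 2" using d z al by (auto simp: \<epsilon>_def)
  have main: "lpo a' b' c' < exp (- \<epsilon>) * lpo a b c"
    if abc: "a \<in> {\<alpha>..M}" "b \<in> {\<alpha>..M}" "c \<in> {\<alpha>..M}" and cl: "\<bar>\<nu> * a' - a\<bar> \<le> \<epsilon>" "\<bar>\<nu> * b' - b\<bar> \<le> \<epsilon>" "\<bar>\<nu> * c' - c\<bar> \<le> \<epsilon>" for a b c a' b' c'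
  proof -
    have near: "\<bar>x' - x / \<nu>\<bar> \<le> \<epsilon> \<and> x' \<in> {\<alpha> / (2 * \<nu>)..2 * M} \<and> x / \<nu> \<in> {\<alpha> / (2 * \<nu>)..2 * M}"
      if x: "x \<in> {\<alpha>..M}" "\<bar>\<nu> * x' - x\<bar> \<le> \<epsilon>" for x x'
    proof -
      have "\<bar>x' - x / \<nu>\<bar> = \<bar>\<nu> * x' - x\<bar> / \<nu>" using nu by (simp add: abs_if field_simps)
      also have "\<dots> \<le> \<epsilon> / \<nu>" using x nu by (simp add: divide_right_mono)
      also have "\<dots> \<le> \<epsilon>" using e nu by (simp add: pos_divide_le_eq)
      finally have 1: "\<bar>x' - x / \<nu>\<bar> \<le> \<epsilon>" .
      have "\<alpha> / 2 \<le> x - \<epsilon>" using x e by auto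
      moreover have "1 * M \<le> \<nu> * M" using nu al by (intro mult_right_mono) auto
      then have "x \<le> \<nu> * M" using x by simp
      ultimately have "\<alpha> / 2 \<le> \<nu> * x'" "\<nu> * x' \<le> 2 * M" "x \<le> \<nu> * M" "0 \<le> M" using x(2) x(1) e al nu by (simp_all add: abs_le_iff)
      moreover have "1 * (2 * M) \<le> \<nu> * (2 * M)" using nu al by (intro mult_right_mono) auto
      then have "\<nu> * x' \<le> \<nu> * (2 * M)" using \<open>\<nu> * x' \<le> 2 * M\<close> by simp
      then have "x' \<le> 2 * M" using nu by simp
      ultimately show ?thesis using 1 x nu al by (auto simp: field_simps)
    qed
    have n: "\<bar>a' - a / \<nu>\<bar> \<le> \<epsilon>" "\<bar>b' - b / \<nu>\<bar> \<le> \<epsilon>" "\<bar>c' - c / \<nu>\<bar> \<le> \<epsilon>" "(a', b', c') \<in> K1" "(a / \<nu>, b / \<nu>, c / \<nu>) \<in> K1"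
      using near[OF abc(1) cl(1)] near[OF abc(2) cl(2)] near[OF abc(3) cl(3)] by (auto simp: K1_def)
    have "dist (a', b', c') (a / \<nu>, b / \<nu>, c / \<nu>) \<le> dist a' (a / \<nu>) + (dist b' (b / \<nu>) + dist c' (c / \<nu>))"
      unfolding dist_Pair_Pair by (intro order_trans[OF sqrt_sum_squares_le_sum] add_mono order_trans[OF sqrt_sum_squares_le_sum] order_refl) auto
    also have "\<dots> < d" using n e by (simp add: dist_real_def)
    finally have "dist (G (a', b', c')) (G (a / \<nu>, b / \<nu>, c / \<nu>)) < \<zeta> / 2" using d n by blast
    then have "\<bar>lpo a' b' c' - lpo (a / \<nu>) (b / \<nu>) (c / \<nu>)\<bar> < \<zeta> / 2" by (simp only: G_def dist_real_def fst_conv snd_conv)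
    then have "lpo a' b' c' < lpo (a / \<nu>) (b / \<nu>) (c / \<nu>) + \<zeta> / 2" by linarith
    also have "\<dots> \<le> lpo a b c - \<epsilon>" using zG[OF abc] e by simp
    also have "\<dots> \<le> (1 - \<epsilon>) * lpo a b c"
      using lpo_bounds[of a b c] abc al e mult_left_mono[of "lpo a b c" 1 \<epsilon>] by (simp add: algebra_simps)
    also have "\<dots> \<le> exp (- \<epsilon>) * lpo a b c"
      using lpo_bounds[of a b c] abc al exp_ge_add_one_self[of "- \<epsilon>"] by (intro mult_right_mono) auto
    finally show ?thesis .
  qed
  show ?thesis using e(1) main by blast
qed

text \<open>The partial sums of weights of size at most \<open>t\<close> pass each level
  \<open>i * \<alpha>\<close> with an overshoot of at most \<open>t\<close>, and the index at which
  a level is passed carries a positive weight.\<close>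

lemma four_spread:
  fixes w :: "nat \<Rightarrow> real" and \<alpha> t :: real
  assumes w: "\<And>k. 0 \<le> w k" "\<And>k. w k \<le> t" and t: "0 < t" "2 * t < \<alpha>"
    and big: "4 * \<alpha> < (\<Sum>k\<in>{k0..<N}. w k)"
  obtains k1 k2 k3 k4 where "k0 \<le> k1" "k1 < k2" "k2 < k3" "k3 < k4" "k4 < N" "0 < w k1" "0 < w k2" "0 < w k3" "0 < w k4"
    "\<alpha> - t \<le> (\<Sum>k\<in>{k1..<k2}. w k)" "\<alpha> - t \<le> (\<Sum>k\<in>{k2..<k3}. w k)" "\<alpha> - t \<le> (\<Sum>k\<in>{k3..<k4}. w k)"
proof -
  define W where "W n = (\<Sum>k\<in>{k0..<n}. w k)" for n
  have Wm: "W m \<le> W n" if "m \<le> n" for m n unfolding W_def using that w by (intro sum_mono2) auto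
  have WS: "W (Suc n) \<le> W n + t" "W (Suc n) = (if k0 \<le> n then W n + w n else W n)" for n
    using w(2)[of n] t by (auto simp: W_def)
  have Wd: "(\<Sum>k\<in>{m..<n}. w k) = W n - W m" if "k0 \<le> m" "m \<le> n" for m n
    using sum.atLeastLessThan_concat[of k0 m n w] that by (simp add: W_def)
  define K where "K i = (LEAST k. real i * \<alpha> < W (Suc k))" for i :: nat
  have "k0 < N" using big t by (cases "k0 < N") auto
  then obtain N' where N': "N = Suc N'" by (cases N) auto
  have al: "0 < \<alpha>" using t by simp
  have Kp: "real i * \<alpha> < W (Suc (K i)) \<and> K i \<le> N'" if "i < 4" for i
  proof -
    have "real i * \<alpha> \<le> 4 * \<alpha>" using that al by (intro mult_right_mono) auto
    then have "real i * \<alpha> < W (Suc N')" using big N' by (simp add: W_def)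
    then show ?thesis unfolding K_def by (auto intro: LeastI Least_le)
  qed
  have Kl: "W (K i) \<le> real i * \<alpha>" if "i < 4" for i
  proof (cases "K i")
    case 0
    then show ?thesis using al by (simp add: W_def)
  next
    case (Suc j)
    have "\<not> real i * \<alpha> < W (Suc j)" unfolding K_def using Suc by (intro not_less_Least) (simp add: K_def)
    then show ?thesis using Suc by simp
  qed
  have Kk: "k0 \<le> K i \<and> 0 < w (K i)" if "i < 4" for i
    using Kp[OF that] Kl[OF that] WS(2)[of "K i"] by (auto split: if_splits)
  have Kless: "K i < K (Suc i) \<and> \<alpha> - t \<le> (\<Sum>k\<in>{K i..<K (Suc i)}. w k)" if "Suc i < 4" for i
  proof -
    have i: "i < 4" using that by simp
    have 1: "real i * \<alpha> + \<alpha> < W (K (Suc i)) + t" using Kp[OF that] WS(1)[of "K (Suc i)"] by (simp add: algebra_simps)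
    have 2: "W (Suc (K i)) \<le> real i * \<alpha> + t" using Kl[OF i] WS(1)[of "K i"] by simp
    have "K i < K (Suc i)"
    proof (rule ccontr)
      assume "\<not> ?thesis"
      then have "W (K (Suc i)) \<le> W (K i)" by (intro Wm) simp
      then show False using 1 Kl[OF i] t by linarith
    qed
    then show ?thesis using Wd[of "K i" "K (Suc i)"] Kk[OF i] 1 Kl[OF i] by simp
  qed
  show ?thesis
    by (rule that[of "K 0" "K 1" "K 2" "K 3"])
      (use Kk Kless[of 0] Kless[of 1] Kless[of 2] Kp[of 3] N' in \<open>auto simp: eval_nat_numeral\<close>)
qed

text \<open>\<open>u\<close> stands for the logarithms of the distances to the critical value along a run of
  returns, \<open>x\<close> for those of their preimages, and \<open>L\<close> for the logarithm of the quantity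
  to be bounded from below; \<open>\<epsilon>\<close> is the distortion.\<close>

definition parabolic_run where
  "parabolic_run \<nu> M \<epsilon> k0 N u x L \<longleftrightarrow> k0 \<le> N \<and>
     (\<forall>k\<in>{k0..<N}. u (Suc k) < u k) \<and> u k0 - u N \<le> M \<and>
     (\<forall>k\<in>{k0..<N}. L (Suc k) \<ge> L k - \<epsilon> \<and> L (Suc k) \<ge> L k - (u k - u (Suc k)) / 2) \<and>
     (\<forall>i\<in>{k0..<N}. \<forall>j\<in>{k0..<N}. i < j \<longrightarrow> \<bar>\<nu> * (x i - x j) - (u (Suc i) - u (Suc j))\<bar> \<le> \<epsilon>) \<and>
     (\<forall>k1 k2 k3 k4. k0 \<le> k1 \<longrightarrow> k1 < k2 \<longrightarrow> k2 < k3 \<longrightarrow> k3 < k4 \<longrightarrow> k4 < N \<longrightarrow>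
        exp (- \<epsilon>) * lpo (u k1 - u k2) (u k2 - u k3) (u k3 - u k4) \<le> lpo (x k1 - x k2) (x k2 - x k3) (x k3 - x k4))"
  for \<nu> M \<epsilon> :: real and k0 N :: nat and u x L :: "nat \<Rightarrow> real"

text \<open>Steps of \<open>u\<close> longer than \<open>t\<close> lose \<open>\<epsilon>\<close>
  each and are few, since the total drop is at most \<open>M\<close>. A step of length at most
  \<open>t\<close> loses half its length, so only a large total length of such steps is harmful. But
  then four of them lie far apart, at these the shift of index in the power law hardly matters, the
  \<open>x\<close> are nearly \<open>u / \<nu>\<close>, and \<open>lpo_gap\<close> contradicts the
  last condition of the run.\<close>

lemma parabolic_run_loss:
  fixes \<nu> M \<kappa> :: real
  assumes nu: "\<nu> > 1" and ka: "\<kappa> > 0"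
  shows "\<exists>\<epsilon>>0. \<forall>k0 N u x L. parabolic_run \<nu> M \<epsilon> k0 N u x L \<longrightarrow> L k0 - \<kappa> \<le> L N"
proof -
  define \<alpha> where "\<alpha> = \<kappa> / 4"
  define M' where "M' = max M \<alpha>"
  have al: "0 < \<alpha> / 2" "\<alpha> / 2 \<le> M'" using ka by (auto simp: \<alpha>_def M'_def)
  obtain e where e: "e > 0" and gap: "\<forall>a\<in>{\<alpha> / 2..M'}. \<forall>b\<in>{\<alpha> / 2..M'}. \<forall>c\<in>{\<alpha> / 2..M'}. \<forall>a' b' c'.
     \<bar>\<nu> * a' - a\<bar> \<le> e \<longrightarrow> \<bar>\<nu> * b' - b\<bar> \<le> e \<longrightarrow> \<bar>\<nu> * c' - c\<bar> \<le> e \<longrightarrow> lpo a' b' c' < exp (- e) * lpo a b c"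
    using lpo_gap[OF nu al] by blast
  define t where "t = min (e / 2) (\<alpha> / 4)"
  have t: "0 < t" "t \<le> e / 2" "2 * t < \<alpha>" "\<alpha> / 2 \<le> \<alpha> - t" using e al by (auto simp: t_def)
  \<comment> \<open>The first bound serves the contradiction with \<open>lpo_gap\<close>; the second
    limits the loss in all long steps together to \<open>\<kappa> / 2\<close>.\<close>
  define \<epsilon> where "\<epsilon> = min (e / 2) (\<kappa> / 2 * t / M')"
  have M': "M \<le> M'" "0 < M'" using al by (auto simp: M'_def)
  have ep: "0 < \<epsilon>" "\<epsilon> \<le> e / 2" "\<epsilon> / t * M' \<le> \<kappa> / 2" using e t ka M'
    by (auto simp: \<epsilon>_def min_le_iff_disj field_simps) (auto simp: min_def field_simps)
  have main: "L k0 - \<kappa> \<le> L N" if run: "parabolic_run \<nu> M \<epsilon> k0 N u x L" for k0 N u x L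
  proof -
    have kN: "k0 \<le> N" and dec: "\<forall>k\<in>{k0..<N}. u (Suc k) < u k" and uM: "u k0 - u N \<le> M"
      and L: "\<forall>k\<in>{k0..<N}. L (Suc k) \<ge> L k - \<epsilon> \<and> L (Suc k) \<ge> L k - (u k - u (Suc k)) / 2"
      and x: "\<forall>i\<in>{k0..<N}. \<forall>j\<in>{k0..<N}. i < j \<longrightarrow> \<bar>\<nu> * (x i - x j) - (u (Suc i) - u (Suc j))\<bar> \<le> \<epsilon>"
      and po: "\<forall>k1 k2 k3 k4. k0 \<le> k1 \<longrightarrow> k1 < k2 \<longrightarrow> k2 < k3 \<longrightarrow> k3 < k4 \<longrightarrow> k4 < N \<longrightarrow>
        exp (- \<epsilon>) * lpo (u k1 - u k2) (u k2 - u k3) (u k3 - u k4) \<le> lpo (x k1 - x k2) (x k2 - x k3) (x k3 - x k4)"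
      using run unfolding parabolic_run_def by simp_all
    define w where "w k = (if k \<in> {k0..<N} \<and> u k - u (Suc k) \<le> t then u k - u (Suc k) else 0)" for k
    have w: "0 \<le> w k" "w k \<le> t" for k using dec t by (auto simp: w_def less_imp_le)
    have tel: "(\<Sum>k\<in>{m..<n}. (u k - u (Suc k))) = u m - u n" if "m \<le> n" for m n
      using sum_Suc_diff'[OF that, of "\<lambda>k. - u k"] by simp
    have wu: "(\<Sum>k\<in>{m..<n}. w k) \<le> u m - u n" if "k0 \<le> m" "m \<le> n" "n \<le> N" for m n
    proof -
      have "(\<Sum>k\<in>{m..<n}. w k) \<le> (\<Sum>k\<in>{m..<n}. (u k - u (Suc k)))"
        using that dec by (intro sum_mono) (auto simp: w_def less_imp_le)
      then show ?thesis using tel that by simp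
    qed
    have W: "(\<Sum>k\<in>{k0..<N}. w k) \<le> \<kappa>"
    proof (rule ccontr)
      assume "\<not> ?thesis"
      then have "4 * \<alpha> < (\<Sum>k\<in>{k0..<N}. w k)" by (simp add: \<alpha>_def)
      from four_spread[OF w t(1,3) this]
      obtain k1 k2 k3 k4 where k: "k0 \<le> k1" "k1 < k2" "k2 < k3" "k3 < k4" "k4 < N" "0 < w k1" "0 < w k2" "0 < w k3" "0 < w k4"
        "\<alpha> - t \<le> (\<Sum>k\<in>{k1..<k2}. w k)" "\<alpha> - t \<le> (\<Sum>k\<in>{k2..<k3}. w k)" "\<alpha> - t \<le> (\<Sum>k\<in>{k3..<k4}. w k)" by blast
      have um: "u n \<le> u m" if "k0 \<le> m" "m \<le> n" "n \<le> N" for m n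
        using wu[OF that] sum_nonneg[of "{m..<n}" w] w by (meson diff_ge_0_iff_ge order_trans)
      \<comment> \<open>The steps at \<open>i\<close> and at \<open>j\<close> have length between
        \<open>0\<close> and \<open>t\<close>, so replacing \<open>u (Suc i) - u (Suc j)\<close> by
        \<open>u i - u j\<close> costs at most \<open>t\<close>.\<close>
      have bound: "u i - u j \<in> {\<alpha> / 2..M'} \<and> \<bar>\<nu> * (x i - x j) - (u i - u j)\<bar> \<le> e"
        if ij: "k0 \<le> i" "i < j" "j < N" "0 < w i" "0 < w j" "\<alpha> - t \<le> (\<Sum>k\<in>{i..<j}. w k)" for i j
      proof -
        have "u i - u j \<le> u k0 - u N" using um[of k0 i] um[of j N] ij by simp
        then have "u i - u j \<le> M'" using uM M' by simp
        moreover have "\<alpha> / 2 \<le> u i - u j" using wu[of i j] ij t by simp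
        moreover have "0 \<le> u i - u (Suc i)" "u i - u (Suc i) \<le> t" "0 \<le> u j - u (Suc j)" "u j - u (Suc j) \<le> t"
          using w[of i] w[of j] ij by (auto simp: w_def split: if_splits)
        moreover have "\<bar>\<nu> * (x i - x j) - (u (Suc i) - u (Suc j))\<bar> \<le> \<epsilon>" using x ij by auto
        ultimately show ?thesis using t ep by (auto simp: abs_le_iff)
      qed
      have kk: "k3 < N" "k2 < N" "k0 \<le> k2" "k0 \<le> k3" using k(1-5) by auto
      have b: "u k1 - u k2 \<in> {\<alpha> / 2..M'} \<and> \<bar>\<nu> * (x k1 - x k2) - (u k1 - u k2)\<bar> \<le> e"
        "u k2 - u k3 \<in> {\<alpha> / 2..M'} \<and> \<bar>\<nu> * (x k2 - x k3) - (u k2 - u k3)\<bar> \<le> e"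
        "u k3 - u k4 \<in> {\<alpha> / 2..M'} \<and> \<bar>\<nu> * (x k3 - x k4) - (u k3 - u k4)\<bar> \<le> e"
        using bound[OF k(1,2) kk(2) k(6,7,10)] bound[OF kk(3) k(3) kk(1) k(7,8,11)] bound[OF kk(4) k(4,5,8,9,12)] by blast+
      have "lpo (x k1 - x k2) (x k2 - x k3) (x k3 - x k4) < exp (- e) * lpo (u k1 - u k2) (u k2 - u k3) (u k3 - u k4)"
        using gap b by blast
      also have "\<dots> \<le> exp (- \<epsilon>) * lpo (u k1 - u k2) (u k2 - u k3) (u k3 - u k4)"
        using b al ep e by (intro mult_right_mono lpo_bounds) auto
      finally show False using po k by (meson linorder_not_le)
    qed
    have aux: "0 \<le> z \<Longrightarrow> y = d \<Longrightarrow> p - d / 2 \<le> p' \<Longrightarrow> - (y / 2 + z) \<le> p' - p"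
      "e' \<le> z \<Longrightarrow> p - e' \<le> p' \<Longrightarrow> 0 \<le> y \<Longrightarrow> - (y / 2 + z) \<le> p' - p" for z y d p p' e' :: real
      by argo+
    have "L (Suc k) - L k \<ge> - (w k / 2 + \<epsilon> / t * (u k - u (Suc k)))" if "k \<in> {k0..<N}" for k
    proof (cases "u k - u (Suc k) \<le> t")
      case True
      have "0 \<le> \<epsilon> / t * (u k - u (Suc k))" using ep t dec that by (auto simp: less_imp_le)
      moreover have "w k = u k - u (Suc k)" using True that by (simp add: w_def)
      moreover have "L k - (u k - u (Suc k)) / 2 \<le> L (Suc k)" using L that by blast
      ultimately show ?thesis by (rule aux)
    next
      case False
      have "\<epsilon> / t * t \<le> \<epsilon> / t * (u k - u (Suc k))" using False ep t by (intro mult_left_mono) auto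
      then have "\<epsilon> \<le> \<epsilon> / t * (u k - u (Suc k))" using t by simp
      moreover have "L k - \<epsilon> \<le> L (Suc k)" using L that by blast
      ultimately show ?thesis using w(1)[of k] by (rule aux)
    qed
    then have "(\<Sum>k\<in>{k0..<N}. - (w k / 2 + \<epsilon> / t * (u k - u (Suc k)))) \<le> (\<Sum>k\<in>{k0..<N}. L (Suc k) - L k)" by (intro sum_mono) auto
    also have "\<dots> = L N - L k0" by (rule sum_Suc_diff'[OF kN])
    finally have "- ((\<Sum>k\<in>{k0..<N}. w k) / 2 + \<epsilon> / t * (u k0 - u N)) \<le> L N - L k0"
      by (simp only: sum_negf sum.distrib sum_divide_distrib[symmetric] sum_distrib_left[symmetric] tel[OF kN])
    moreover have "\<epsilon> / t * (u k0 - u N) \<le> \<epsilon> / t * M'" using uM M' ep t by (intro mult_left_mono) auto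
    ultimately show ?thesis using W ep by linarith
  qed
  show ?thesis using ep(1) main by blast
qed

text \<open>By \<open>h1\<close> the quantity \<open>p\<close> changes by at most
  \<open>- (\<nu> - 2)\<close> times the increment of \<open>l\<close>, up to a constant. By
  \<open>h2\<close> a large \<open>p\<close> forces a large increment of \<open>l\<close> over two
  steps. So \<open>p\<close> is damped by the factor \<open>1 + s\<close> every two steps and stays
  bounded above, and by \<open>h4\<close> it dominates the increments of \<open>b\<close>.\<close>

lemma quadratic_growth_bound:
  fixes l b :: "nat \<Rightarrow> real" and \<nu> K :: real
  assumes nu: "\<nu> > 2" and K: "K \<ge> 0"
    and h1: "\<And>n. n \<ge> n0 \<Longrightarrow> b (n + 2) - b n \<ge> \<nu> * (l (n + 2) - l (n + 1)) - K"
    and h2: "\<And>n. n \<ge> n0 \<Longrightarrow> l n \<le> b (n + 1)"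
    and h3: "\<And>n. n \<ge> n0 \<Longrightarrow> l n - K \<le> l (n + 1)"
    and h4: "\<And>n. n \<ge> n0 \<Longrightarrow> b n \<le> l n + K"
  shows "\<exists>D. \<forall>n\<ge>n0. b (n + 2) - b n \<le> D"
proof -
  \<comment> \<open>For \<open>b = - ln Y\<close> and \<open>l = - ln m\<close> this is the
    logarithm of \<open>Y (n + 1) * Y n\<close> over the square of \<open>m (n + 1)\<close>.\<close>
  define p where "p n = 2 * l (n + 1) - b (n + 1) - b n" for n
  define s where "s = (\<nu> - 2) / 2"
  have s: "0 < s" using nu by (simp add: s_def)
  define K3 where "K3 = 2 * K + s * K"
  have K3: "0 \<le> K3" using K s by (simp add: K3_def)
  have st: "(1 + s) * p (n + 2) \<le> p n + K3" if n: "n \<ge> n0 + 2" for n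
  proof -
    define A1 A2 where "A1 = l (n + 2) - l (n + 1)" and "A2 = l (n + 3) - l (n + 2)"
    have 1: "p (n + 1) \<le> p n - (\<nu> - 2) * A1 + K" using h1[of n] n by (simp add: p_def A1_def algebra_simps)
    have 2: "p (n + 2) \<le> p (n + 1) - (\<nu> - 2) * A2 + K" using h1[of "n + 1"] n
      by (simp add: p_def A2_def algebra_simps eval_nat_numeral)
    have "p (n + 2) \<le> 2 * A2 + A1" using h2[of "n + 1"] h2[of "n + 2"] n by (simp add: p_def A1_def A2_def eval_nat_numeral)
    moreover have "- K \<le> A1" using h3[of "n + 1"] n by (simp add: A1_def eval_nat_numeral)
    ultimately have "p (n + 2) - K \<le> 2 * (A1 + A2)" by simp
    then have "s * (p (n + 2) - K) \<le> s * (2 * (A1 + A2))" using s by (intro mult_left_mono) auto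
    also have "\<dots> = (\<nu> - 2) * A1 + (\<nu> - 2) * A2" by (simp add: s_def field_simps)
    finally show ?thesis using 1 2 by (simp add: K3_def algebra_simps)
  qed
  \<comment> \<open>\<open>K3 / s\<close> is the fixed point of the recursion; the other entries are
    its initial values and the two terms before it starts.\<close>
  define \<Phi> where "\<Phi> = max (max (p (n0 + 2)) (p (n0 + 3))) (max (K3 / s) (max (p n0) (p (n0 + 1))))"
  have ph: "K3 \<le> s * \<Phi>"
  proof -
    have "K3 / s \<le> \<Phi>" by (simp add: \<Phi>_def)
    then show ?thesis using s by (simp add: pos_divide_le_eq mult.commute)
  qed
  have p2: "p (n0 + 2 + n) \<le> \<Phi>" for n
  proof (induction n rule: less_induct)
    case (less n)
    consider "n = 0" | "n = 1" | m where "n = Suc (Suc m)" by (metis One_nat_def not0_implies_Suc)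
    then show ?case
    proof cases
      case 3
      have "(1 + s) * p (n0 + 2 + n) \<le> p (n0 + 2 + m) + K3" using st[of "n0 + 2 + m"] 3 by (simp add: eval_nat_numeral)
      also have "\<dots> \<le> (1 + s) * \<Phi>" using less[of m] 3 ph by (simp add: algebra_simps)
      finally show ?thesis using s by simp
    qed (simp_all add: \<Phi>_def le_max_iff_disj eval_nat_numeral)
  qed
  have pb: "p n \<le> \<Phi>" if "n \<ge> n0" for n
  proof -
    define m where "m = n - n0"
    have m: "n = n0 + m" using that by (simp add: m_def)
    have "p n0 \<le> \<Phi>" "p (Suc n0) \<le> \<Phi>" by (simp_all add: \<Phi>_def le_max_iff_disj)
    moreover have "p (n0 + Suc (Suc m')) \<le> \<Phi>" for m' using p2[of m'] by simp
    moreover have "m = 0 \<or> m = Suc 0 \<or> m = Suc (Suc (m - 2))" by presburger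
    ultimately show ?thesis using m by (metis add.right_neutral add_Suc_right)
  qed
  have d: "b (n + 1) - b n \<le> \<Phi> + 2 * K" if "n \<ge> n0" for n
    using pb[OF that] h4[of "n + 1"] h4[OF that] that by (simp add: p_def)
  have "b (n + 2) - b n \<le> 2 * (\<Phi> + 2 * K)" if "n \<ge> n0" for n
    using d[OF that] d[of "n + 1"] that by (simp add: eval_nat_numeral)
  then show ?thesis by blast
qed

section \<open>Comparison of heights, and the case of bounded type\<close>

context cfflat
begin

lemma rk_ratio:
  assumes ij: "0 \<le> i" "i < j" "j \<le> aa n" and r: "yy n < r0"
  shows "\<bar>\<nu> * (ln (rk n i) - ln (rk n j)) - (ln (Yk n i) - ln (Yk n j))\<bar> \<le> C * yy n"
proof -
  have p: "0 < rk n i" "0 < rk n j" "0 < Yk n i" "0 < Yk n j" using rk_pos[of i n] rk_pos[of j n] ij by auto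
  have le: "rk n j < rk n i" "rk n i \<le> yy n" using rk_less(1)[OF ij] rk_less(1)[of 0 i n] ij rk_0(1)[of n] by (cases "i = 0"; force)+
  have "(v n + of_int j * v (Suc n)) * v n > 0" "(v n + of_int i * v (Suc n)) * v n > 0"
    using abs_vk(2)[of j n] abs_vk(2)[of i n] ij by auto
  then have "(v n + of_int j * v (Suc n)) * (v n + of_int i * v (Suc n)) > 0" by (auto simp: zero_less_mult_iff)
  then have s: "co (q n + j * q (Suc n)) (- P n - j * P (Suc n)) * co (q n + i * q (Suc n)) (- P n - i * P (Suc n)) > 0"
    unfolding co_k .
  have nr: "near (q n + j * q (Suc n)) (- P n - j * P (Suc n)) = Yk n j" "near (q n + i * q (Suc n)) (- P n - i * P (Suc n)) = Yk n i"
    "rd (q n + j * q (Suc n)) (- P n - j * P (Suc n)) = rk n j" "rd (q n + i * q (Suc n)) (- P n - i * P (Suc n)) = rk n i"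
    by (simp_all add: Yk_def rk_def)
  note pw = near_pw[OF s, unfolded nr, OF less_imp_le[OF le(1)] le_less_trans[OF le(2) r]]
  have "ln (exp (- (C * rk n i)) * (rk n j / rk n i) powr \<nu> * Yk n i) \<le> ln (Yk n j)"
    "ln (Yk n j) \<le> ln (exp (C * rk n i) * (rk n j / rk n i) powr \<nu> * Yk n i)"
    using pw p by (subst ln_le_cancel_iff; simp)+
  moreover have "ln (exp c * (rk n j / rk n i) powr \<nu> * Yk n i) = c + \<nu> * (ln (rk n j) - ln (rk n i)) + ln (Yk n i)" for c
    using p by (simp add: ln_mult ln_powr ln_div)
  ultimately have "- (C * rk n i) + \<nu> * (ln (rk n j) - ln (rk n i)) + ln (Yk n i) \<le> ln (Yk n j)"
    "ln (Yk n j) \<le> C * rk n i + \<nu> * (ln (rk n j) - ln (rk n i)) + ln (Yk n i)" by (simp_all only:)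
  moreover have "C * rk n i \<le> C * yy n" using le C0 by (intro mult_left_mono) auto
  ultimately show ?thesis by (simp add: abs_le_iff algebra_simps)
qed

text \<open>\<open>return_height\<close> bounds only the smaller of two consecutive
  \<open>mm\<close>; the comparison between consecutive \<open>mm\<close>, contained in
  \<open>fatness\<close>, removes the minimum.\<close>

lemma image_bounds: "\<exists>K\<ge>1. \<exists>N. \<forall>n\<ge>N. mm (Suc n) \<le> K * mm n \<and> mm n \<le> K * Yn n"
proof -
  obtain \<kappa> where k: "0 < \<kappa>" "\<kappa> < 1" "\<forall>n\<ge>2. \<kappa> * (mm (n - 1) + mm n) \<le> mm (n - 1)" using fatness by blast
  define K0 where "K0 = 1 / \<kappa>"
  have K0: "1 \<le> K0" using k by (simp add: K0_def)
  have m: "mm (Suc n) \<le> K0 * mm n" if "n \<ge> 1" for n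
  proof -
    have "\<kappa> * mm n + \<kappa> * mm (Suc n) \<le> mm n" using k(3)[rule_format, of "Suc n"] that by (simp add: distrib_left)
    moreover have "0 \<le> \<kappa> * mm n" using seq_pos(4)[of n] k(1) by simp
    ultimately have "\<kappa> * mm (Suc n) \<le> mm n" by linarith
    then show ?thesis using k by (simp add: K0_def pos_le_divide_eq mult.commute)
  qed
  define D where "D = 2 * exp C / U"
  define K5 where "K5 = exp (C * r0) * D powr \<nu>"
  have D: "0 < D" using U_pos by (simp add: D_def)
  have "eventually (\<lambda>n. yy n < r0 / D) sequentially" using yy_lim r0 D by (intro order_tendstoD) auto
  then obtain N where N: "\<forall>n\<ge>N. yy n < r0 / D" by (auto simp: eventually_sequentially)
  define K where "K = max K0 (K0 * K5)"
  have "mm (Suc n) \<le> K * mm n \<and> mm n \<le> K * Yn n" if n: "n \<ge> max 2 N" for n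
  proof
    have "K0 * mm n \<le> K * mm n" using seq_pos(4)[of n] by (intro mult_right_mono) (auto simp: K_def)
    then show "mm (Suc n) \<le> K * mm n" using m[of n] n by simp
    obtain j where j: "n = Suc (Suc j)" using n by (metis add_2_eq_Suc le_Suc_ex max.bounded_iff)
    have "D * yy n < r0" using N n D by (simp add: pos_less_divide_eq mult.commute)
    then have "min (mm (Suc j)) (mm n) \<le> K5 * Yn n"
      using levels(5)[of j] j by (simp add: return_height_def D_def K5_def mult.assoc)
    moreover have "mm n \<le> K0 * min (mm (Suc j)) (mm n)"
      using m[of "Suc j"] j K0 seq_pos(4)[of n] mult_right_mono[of 1 K0 "mm n"] by (auto simp: min_def)
    ultimately have "mm n \<le> K0 * (K5 * Yn n)" using K0 mult_left_mono[of "min (mm (Suc j)) (mm n)" "K5 * Yn n" K0] by linarith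
    also have "\<dots> \<le> K * Yn n" using seq_pos(2)[of n] by (simp add: K_def mult.assoc[symmetric])
    finally show "mm n \<le> K * Yn n" .
  qed
  moreover have "1 \<le> K" using K0 by (simp add: K_def)
  ultimately show ?thesis by blast
qed

lemma Yn_less_mm: "n \<ge> 1 \<Longrightarrow> Yn (Suc n) < mm n"
  using basic_ord(9)[of "n - 1"] by simp

text \<open>The chain bound carries a constant to the power of a partial quotient. The bound
  \<open>a\<close> makes it the uniform constant \<open>c0\<close>, so that its logarithm becomes an
  additive error in the recursion, and \<open>quadratic_growth_bound\<close> applies to
  \<open>- ln Yn\<close> and \<open>- ln mm\<close>.\<close>

theorem bounded_type_ratio:
  assumes nu2: "\<nu> > 2" and bd: "\<And>n. aa n \<le> a"
  shows "\<exists>c>0. \<exists>N. \<forall>n\<ge>N. c * yy n \<le> yy (Suc (Suc n))"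
proof -
  obtain K1 N1 where K1: "K1 \<ge> 1" and N1: "\<forall>n\<ge>N1. mm (Suc n) \<le> K1 * mm n \<and> mm n \<le> K1 * Yn n" using image_bounds by blast
  obtain \<kappa> where k: "0 < \<kappa>" "\<kappa> < 1" "\<forall>n\<ge>2. \<kappa> \<le> \<tau> n" using fatness by blast
  have "eventually (\<lambda>n. yy n < r0) sequentially" using yy_lim r0 by (intro order_tendstoD) auto
  then obtain N2 where N2: "\<forall>n\<ge>N2. yy n < r0" by (auto simp: eventually_sequentially)
  define u0 where "u0 = U / (exp C * C1)"
  have "1 * 1 \<le> exp C * C1" using C0 C1 by (intro mult_mono) auto
  then have u0: "0 < u0" "u0 \<le> 1" using U_pos C1 by (auto simp: u0_def)
  define c0 where "c0 = u0 ^ nat a * exp (- C) * \<kappa>"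
  have c0: "0 < c0" using u0 k by (simp add: c0_def)
  define n0 where "n0 = max 2 (max N1 N2)"
  have yr: "ln c0 + (ln (mm (n + 1)) - ln (mm (n + 2))) \<le> ln (yy n) - ln (yy (n + 2))" if n: "n \<ge> n0" for n
  proof -
    obtain j where j: "n = Suc (Suc j)" using n by (metis add_2_eq_Suc le_Suc_ex max.bounded_iff n0_def)
    let ?r = "yy (n + 2) / yy n" and ?m = "mm (n + 2)" and ?m1 = "mm (n + 1)"
    have p: "0 < ?r" "0 < ?m" "0 < ?m1" using seq_pos by simp_all
    have "u0 ^ nat a \<le> u0 ^ nat (aa (Suc (Suc j)))" using u0 bd by (intro power_decreasing nat_mono) auto
    moreover have "\<kappa> \<le> \<tau> n" using k n by (simp add: n0_def)
    ultimately have "u0 ^ nat a * (exp (- C) * (?r * \<kappa>)) \<le> u0 ^ nat (aa (Suc (Suc j))) * (exp (- C) * (?r * \<tau> n))"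
      using u0 p k by (intro mult_mono mult_nonneg_nonneg order_refl) auto
    also have "\<dots> \<le> ?m / (?m + ?m1)" using levels(9)[of j] j by (simp add: chain_bound_def u0_def \<tau>_def)
    also have "\<dots> \<le> ?m / ?m1" using p by (intro divide_left_mono) auto
    finally have "c0 * ?r \<le> ?m / ?m1" by (simp add: c0_def mult_ac)
    then have "ln (c0 * ?r) \<le> ln (?m / ?m1)"
      by (rule iffD2[OF ln_le_cancel_iff[OF mult_pos_pos[OF c0 p(1)] divide_pos_pos[OF p(2,3)]]])
    then show ?thesis using p c0 seq_pos(1)[of n] seq_pos(1)[of "n + 2"] by (simp add: ln_mult ln_div)
  qed
  have Yr: "\<bar>\<nu> * (ln (yy n) - ln (yy (n + 2))) - (ln (Yn n) - ln (Yn (n + 2)))\<bar> \<le> C * r0" if n: "n \<ge> n0" for n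
  proof -
    have y: "yy n < r0" using N2 n by (simp add: n0_def)
    have "\<bar>\<nu> * (ln (rk n 0) - ln (rk n (aa n))) - (ln (Yk n 0) - ln (Yk n (aa n)))\<bar> \<le> C * yy n"
      using aa1[of n] y by (intro rk_ratio) auto
    also have "\<dots> \<le> C * r0" using y C0 by (intro mult_left_mono) auto
    finally show ?thesis by (simp add: rk_0 rk_top)
  qed
  define K where "K = \<bar>C * r0 - \<nu> * ln c0\<bar> + ln K1"
  have lK: "0 \<le> ln K1" using K1 by simp
  have "\<exists>D. \<forall>n\<ge>n0. - ln (Yn (n + 2)) - - ln (Yn n) \<le> D"
  proof (rule quadratic_growth_bound[OF nu2, where l = "\<lambda>n. - ln (mm n)" and K = K])
    show "0 \<le> K" using lK by (simp add: K_def)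
    fix n assume n: "n0 \<le> n"
    have p: "0 < mm n" "0 < mm (Suc n)" "0 < Yn n" "0 < Yn (Suc n)" using seq_pos by auto
    have "\<nu> * (ln c0 + (ln (mm (n + 1)) - ln (mm (n + 2)))) \<le> \<nu> * (ln (yy n) - ln (yy (n + 2)))"
      using yr[OF n] nu2 by (intro mult_left_mono) auto
    then show "\<nu> * (- ln (mm (n + 2)) - - ln (mm (n + 1))) - K \<le> - ln (Yn (n + 2)) - - ln (Yn n)"
      using Yr[OF n] lK abs_ge_self[of "C * r0 - \<nu> * ln c0"] by (simp add: K_def algebra_simps abs_le_iff)
    show "- ln (mm n) \<le> - ln (Yn (n + 1))" using Yn_less_mm[of n] n p by (simp add: n0_def)
    have "ln (mm (Suc n)) \<le> ln (K1 * mm n)" "ln (mm n) \<le> ln (K1 * Yn n)"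
      using N1 n p K1 by (auto simp: n0_def)
    then have "ln (mm (Suc n)) \<le> ln K1 + ln (mm n)" "ln (mm n) \<le> ln K1 + ln (Yn n)"
      using p K1 by (auto simp: ln_mult)
    then show "- ln (mm n) - K \<le> - ln (mm (n + 1))" "- ln (Yn n) \<le> - ln (mm n) + K" by (auto simp: K_def)
  qed
  then obtain D where D: "\<And>n. n \<ge> n0 \<Longrightarrow> ln (Yn n) - ln (Yn (n + 2)) \<le> D" by auto
  define c where "c = exp (- ((D + C * r0) / \<nu>))"
  have "c * yy n \<le> yy (Suc (Suc n))" if n: "n \<ge> n0" for n
  proof -
    have "\<nu> * (ln (yy n) - ln (yy (n + 2))) \<le> D + C * r0" using D[OF n] Yr[OF n] by simp
    then have "ln (yy n) - ln (yy (n + 2)) \<le> (D + C * r0) / \<nu>" using nu2 by (simp add: pos_le_divide_eq mult.commute)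
    then have "ln (c * yy n) \<le> ln (yy (n + 2))" using seq_pos(1)[of n] by (simp add: c_def ln_mult)
    then show ?thesis using seq_pos(1)[of n] seq_pos(1)[of "n + 2"] by (subst (asm) ln_le_cancel_iff) (auto simp: c_def)
  qed
  moreover have "0 < c" by (simp add: c_def)
  ultimately show ?thesis by blast
qed

text \<open>Invariant under passing from level \<open>n\<close> to level \<open>n + 1\<close>, and almost increasing along the
  intermediate returns as soon as \<open>\<nu> \<le> 2\<close>.\<close>

definition QQ where "QQ n k = sqrt (Yn (Suc n) * Yk n k) * (1 / mm (Suc n) + 1 / mk n k)"

text \<open>The loss in one intermediate step: from the distortion of the Poincare ratio, from the
  deviation from an exact power at \<open>U\<close>, and from the factor containing \<open>U\<close>
  in \<open>return_ratio\<close>.\<close>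

definition err where "err n = C * tail (Suc n) + C * yy n + yy n / U"

lemma QQ_top: "QQ n (aa n) = QQ (Suc n) 0"
  by (simp add: QQ_def rk_top rk_0 mult.commute add.commute)

lemma QQ_pos: "0 \<le> k \<Longrightarrow> k \<le> aa n \<Longrightarrow> 0 < QQ n k"
  unfolding QQ_def using rk_pos[of k n] seq_pos by (intro mult_pos_pos add_pos_pos) auto

lemma ln_QQ:
  assumes "0 \<le> k" "k \<le> aa n"
  shows "ln (QQ n k) = (ln (Yn (Suc n)) + ln (Yk n k)) / 2 + ln (1 + mm (Suc n) / mk n k) - ln (mm (Suc n))"
proof -
  have p: "0 < Yk n k" "0 < mk n k" "0 < Yn (Suc n)" "0 < mm (Suc n)" using rk_pos[OF assms] seq_pos by auto
  have "1 / mm (Suc n) + 1 / mk n k = (1 + mm (Suc n) / mk n k) / mm (Suc n)" using p by (simp add: field_simps)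
  moreover have "0 < 1 + mm (Suc n) / mk n k" using p by (simp add: add_pos_pos)
  ultimately show ?thesis using p unfolding QQ_def by (simp add: ln_mult ln_div ln_sqrt)
qed

lemma err_lim: "err \<longlonglongrightarrow> 0"
proof -
  have "(\<lambda>n. tail (Suc n)) \<longlonglongrightarrow> 0" using tail_lim by (rule LIMSEQ_Suc)
  then have "(\<lambda>n. C * tail (Suc n) + C * yy n + yy n / U) \<longlonglongrightarrow> C * 0 + C * 0 + 0 / U"
    using yy_lim U_pos by (intro tendsto_intros) auto
  then show ?thesis by (simp add: err_def[abs_def])
qed

section \<open>The case \<open>\<nu> \<le> 2\<close>\<close>

context
  assumes nu2: "\<nu> \<le> 2"
begin

text \<open>\<open>return_ratio\<close> limits the drop of \<open>rk\<close> by the growth of the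
  second factor of \<open>QQ\<close>, and the power law turns this into a limit for the drop of the
  square root of \<open>Yk\<close>. The first form retains the gain due to the length of the
  preimage between \<open>mk\<close> and \<open>tk\<close>. The third follows from monotonicity of
  \<open>mk\<close> alone; it is the useful one for very short steps, where \<open>err\<close> would
  accumulate.\<close>

lemma QQ_step:
  assumes k: "1 \<le> k" "k \<le> aa n" and r: "yy n < r0"
  shows "ln (QQ n k) \<ge> ln (QQ n (k - 1)) - err n + (ln (1 + mm (Suc n) / tk n k) - ln (1 + mm (Suc n) / mk n (k - 1)))"
    "ln (QQ n k) \<ge> ln (QQ n (k - 1)) - err n"
    "ln (QQ n k) \<ge> ln (QQ n (k - 1)) - (ln (Yk n (k - 1)) - ln (Yk n k)) / 2"
proof -
  define m where "m = mm (Suc n)"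
  have m: "0 < m" using seq_pos by (simp add: m_def)
  have kk: "0 \<le> k" "k \<le> aa n" "0 \<le> k - 1" "k - 1 \<le> aa n" "k - 1 < k" using k by auto
  note p = rk_pos[OF kk(1,2)] rk_pos[OF kk(3,4)] and ls = rk_less[OF kk(3,5,2)]
  have tp: "0 < tk n k" using p by linarith
  have "mk n k * (tk n k + m) / ((mk n k + m) * tk n k) = (1 + m / tk n k) / (1 + m / mk n k)"
    using p tp m by (simp add: field_simps)
  then have "exp (- (C * tail (Suc n))) * ((1 + m / tk n k) / (1 + m / mk n k)) \<le> rk n k / rk n (k - 1) * ((rk n (k - 1) + U) / (rk n k + U))"
    using levels(6)[of n, unfolded return_ratio_def, folded m_def] k by metis
  also have "\<dots> \<le> rk n k / rk n (k - 1) * ((rk n (k - 1) + U) / U)"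
    using p U_pos by (intro mult_left_mono divide_left_mono) (auto intro!: mult_pos_pos)
  also have "(rk n (k - 1) + U) / U = 1 + rk n (k - 1) / U" using U_pos by (simp add: field_simps)
  also have "rk n k / rk n (k - 1) * (1 + rk n (k - 1) / U) \<le> rk n k / rk n (k - 1) * exp (rk n (k - 1) / U)"
    using p exp_ge_add_one_self[of "rk n (k - 1) / U"] by (intro mult_left_mono) auto
  finally have 1: "exp (- (C * tail (Suc n))) * ((1 + m / tk n k) / (1 + m / mk n k)) \<le> rk n k / rk n (k - 1) * exp (rk n (k - 1) / U)" .
  have q: "0 < 1 + m / tk n k" "0 < 1 + m / mk n k" "0 < 1 + m / mk n (k - 1)" using p tp m by (auto intro!: add_pos_pos)
  have lm: "0 < x \<Longrightarrow> 0 < z \<Longrightarrow> ln (x * z) = ln x + ln z" "0 < x \<Longrightarrow> 0 < z \<Longrightarrow> ln (x / z) = ln x - ln z" for x z :: real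
    by (simp_all add: ln_mult ln_div)
  have "ln (exp (- (C * tail (Suc n))) * ((1 + m / tk n k) / (1 + m / mk n k))) \<le> ln (rk n k / rk n (k - 1) * exp (rk n (k - 1) / U))"
    by (rule ln_mono[OF 1]) (use q in auto)
  moreover have "ln (exp (- (C * tail (Suc n))) * ((1 + m / tk n k) / (1 + m / mk n k))) = - (C * tail (Suc n)) + (ln (1 + m / tk n k) - ln (1 + m / mk n k))"
    using q by (simp only: lm exp_gt_zero divide_pos_pos ln_exp)
  moreover have "ln (rk n k / rk n (k - 1) * exp (rk n (k - 1) / U)) = ln (rk n k) - ln (rk n (k - 1)) + rk n (k - 1) / U"
    using p by (simp only: lm exp_gt_zero divide_pos_pos ln_exp)
  moreover have "rk n (k - 1) / U \<le> yy n / U"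
    using rk_less(1)[of 0 "k - 1" n] kk rk_0(1)[of n] U_pos by (cases "k = 1") (auto simp: divide_right_mono)
  ultimately have 2: "- (C * tail (Suc n)) + (ln (1 + m / tk n k) - ln (1 + m / mk n k)) \<le> ln (rk n k) - ln (rk n (k - 1)) + yy n / U" by linarith
  have 3: "ln (rk n k) - ln (rk n (k - 1)) \<le> (ln (Yk n k) - ln (Yk n (k - 1))) / 2 + C * yy n"
  proof -
    define a b where "a = ln (rk n (k - 1)) - ln (rk n k)" and "b = ln (Yk n (k - 1)) - ln (Yk n k)"
    have "\<bar>\<nu> * a - b\<bar> \<le> C * yy n" unfolding a_def b_def using kk r by (intro rk_ratio) auto
    moreover have "0 \<le> a" using ls p by (simp add: a_def)
    \<comment> \<open>Here \<open>\<nu> \<le> 2\<close> enters, against the square root in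
      \<open>QQ\<close>.\<close>
    then have "\<nu> * a \<le> 2 * a" using nu2 by (intro mult_right_mono) auto
    moreover have "0 \<le> C * yy n" using C0 seq_pos(1)[of n] by simp
    moreover have "\<bar>x - b\<bar> \<le> c \<Longrightarrow> x \<le> 2 * z \<Longrightarrow> 0 \<le> c \<Longrightarrow> - z \<le> - b / 2 + c" for x c z :: real by linarith
    ultimately have "- a \<le> - b / 2 + C * yy n" by blast
    then show ?thesis unfolding a_def b_def by (simp add: field_simps)
  qed
  have 4: "ln (QQ n k) - ln (QQ n (k - 1)) = (ln (Yk n k) - ln (Yk n (k - 1))) / 2 + ln (1 + m / mk n k) - ln (1 + m / mk n (k - 1))"
    unfolding ln_QQ[OF kk(1,2)] ln_QQ[OF kk(3,4)] m_def by (simp add: field_simps)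
  show A: "ln (QQ n k) \<ge> ln (QQ n (k - 1)) - err n + (ln (1 + mm (Suc n) / tk n k) - ln (1 + mm (Suc n) / mk n (k - 1)))"
    using 2 3 4 unfolding m_def[symmetric] err_def by argo
  have "m / mk n (k - 1) \<le> m / tk n k" using ls p tp m by (intro divide_left_mono) auto
  then have "ln (1 + m / mk n (k - 1)) \<le> ln (1 + m / tk n k)" using q by simp
  then show "ln (QQ n k) \<ge> ln (QQ n (k - 1)) - err n" using A unfolding m_def[symmetric] by linarith
  have "m / mk n (k - 1) \<le> m / mk n k" using ls p tp m by (intro divide_left_mono) auto
  then have "ln (1 + m / mk n (k - 1)) \<le> ln (1 + m / mk n k)" using q by simp
  then show "ln (QQ n k) \<ge> ln (QQ n (k - 1)) - (ln (Yk n (k - 1)) - ln (Yk n k)) / 2" using 4 by argo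
qed

text \<open>Dropping either summand of the second factor of \<open>QQ\<close> leaves the square root
  of the product of heights bounded by \<open>R\<close> times \<open>mk\<close>, or by
  \<open>R\<close> times \<open>mm (Suc n)\<close>.\<close>

lemma low_bounds:
  assumes K: "1 \<le> K" "mm (Suc n) \<le> K * Yn (Suc n)" and k: "0 \<le> k" "k \<le> aa n" and R: "QQ n k \<le> R"
  shows "Yk n k \<le> R\<^sup>2 * K * mm (Suc n)" "Yn (Suc n) * Yk n k \<le> R\<^sup>2 * (mk n k)\<^sup>2"
proof -
  define m where "m = mm (Suc n)"
  have p: "0 < Yk n k" "0 < mk n k" "0 < Yn (Suc n)" "0 < m" using rk_pos[OF k] seq_pos by (auto simp: m_def)
  let ?s = "sqrt (Yn (Suc n) * Yk n k)"
  have s: "0 \<le> ?s" "?s * ?s = Yn (Suc n) * Yk n k" using p by auto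
  have h: "Yn (Suc n) * Yk n k \<le> R\<^sup>2 * z\<^sup>2" if z: "0 < z" "1 / z \<le> 1 / m + 1 / mk n k" for z
  proof -
    have "?s * (1 / z) \<le> R" using mult_left_mono[OF z(2) s(1)] R by (simp add: QQ_def m_def)
    then have "?s \<le> R * z" using z by (simp add: pos_divide_le_eq)
    then have "?s * ?s \<le> (R * z) * (R * z)" using s(1) by (intro mult_mono) linarith+
    then show ?thesis using s by (simp add: power2_eq_square algebra_simps)
  qed
  show "Yn (Suc n) * Yk n k \<le> R\<^sup>2 * (mk n k)\<^sup>2" by (rule h) (use p in auto)
  have "Yn (Suc n) * Yk n k \<le> R\<^sup>2 * m\<^sup>2" by (rule h) (use p in auto)
  also have "\<dots> = (R\<^sup>2 * m) * m" by (simp add: power2_eq_square)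
  also have "\<dots> \<le> (R\<^sup>2 * m) * (K * Yn (Suc n))" using K p by (intro mult_left_mono) (auto simp: m_def)
  finally have "Yn (Suc n) * Yk n k \<le> Yn (Suc n) * (R\<^sup>2 * K * m)" by (simp add: mult_ac)
  then show "Yk n k \<le> R\<^sup>2 * K * mm (Suc n)" using p by (simp add: m_def)
qed

text \<open>While \<open>QQ\<close> stays below \<open>R\<close>, \<open>low_bounds\<close> at the
  start and at the end of the level confines \<open>ln Yk\<close> to a range of length
  \<open>M\<close>, which depends neither on \<open>n\<close> nor on the number of intermediate
  returns. Hence the total loss over the rest of the level is small, however large
  \<open>aa n\<close> is.\<close>

lemma trap:
  assumes R: "R \<ge> 1" and ka: "\<kappa> > 0"
  shows "\<exists>N. \<forall>n\<ge>N. \<forall>k0. 0 \<le> k0 \<longrightarrow> k0 \<le> aa n \<longrightarrow> (\<forall>k. k0 \<le> k \<longrightarrow> k \<le> aa n \<longrightarrow> QQ n k \<le> R) \<longrightarrow>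
     ln (QQ n k0) - \<kappa> \<le> ln (QQ n (aa n))"
proof -
  obtain K N1 where K: "K \<ge> 1" and N1: "\<forall>n\<ge>N1. mm (Suc n) \<le> K * mm n \<and> mm n \<le> K * Yn n" using image_bounds by blast
  define M where "M = ln (R\<^sup>2 * K * K * (R\<^sup>2 * K\<^sup>2))"
  obtain \<epsilon> where e: "\<epsilon> > 0" and run: "\<forall>k0 N u x L. parabolic_run \<nu> M \<epsilon> k0 N u x L \<longrightarrow> L k0 - \<kappa> \<le> L N"
    using parabolic_run_loss[OF nu ka, of M] by blast
  have "(\<lambda>n. C * tail n) \<longlonglongrightarrow> C * 0" "(\<lambda>n. C * yy n) \<longlonglongrightarrow> C * 0" by (rule tendsto_mult[OF tendsto_const tail_lim], rule tendsto_mult[OF tendsto_const yy_lim])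
  then have "eventually (\<lambda>n. err n < \<epsilon> \<and> C * tail n < \<epsilon> \<and> C * yy n < \<epsilon> \<and> yy n < r0) sequentially"
    using err_lim yy_lim r0 e by (intro eventually_conj order_tendstoD) auto
  then obtain N2 where N2: "\<forall>n\<ge>N2. err n < \<epsilon> \<and> C * tail n < \<epsilon> \<and> C * yy n < \<epsilon> \<and> yy n < r0"
    by (auto simp: eventually_sequentially)
  have "ln (QQ n k0) - \<kappa> \<le> ln (QQ n (aa n))"
    if n: "n \<ge> max 1 (max N1 N2)" and k0: "0 \<le> k0" "k0 \<le> aa n" and low: "\<forall>k. k0 \<le> k \<longrightarrow> k \<le> aa n \<longrightarrow> QQ n k \<le> R" for n k0
  proof -
    have sm: "err n < \<epsilon>" "C * tail n < \<epsilon>" "C * yy n < \<epsilon>" "yy n < r0" using N2 n by auto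
    have m: "mm (Suc n) \<le> K * Yn (Suc n)" "mm (Suc (Suc n)) \<le> K * Yn (Suc (Suc n))" using N1 n by auto
    \<comment> \<open>The return map sends the height of index \<open>i\<close> to the distance of
      index \<open>i + 1\<close>; hence the shift by one in \<open>x\<close>, and the comparison of
      \<open>x i\<close> with \<open>u (Suc i)\<close> in the power law.\<close>
    define u x L where "u i = ln (Yk n (int i))" and "x i = ln (rk n (int i + 1))" and "L i = ln (QQ n (int i))" for i
    define N where "N = nat (aa n)"
    have N: "int N = aa n" using aa1[of n] by (simp add: N_def)
    have Yp: "0 < Yk n k" if "0 \<le> k" "k \<le> aa n" for k using rk_pos[OF that] by simp
    have kN: "nat k0 \<le> N" using k0 by (simp add: N_def nat_mono)
    have 1: "u (Suc i) < u i" if "i \<in> {nat k0..<N}" for i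
      using rk_less(2)[of "int i" "int i + 1" n] Yp[of "int i + 1"] that N by (simp add: u_def add.commute)
    have 2: "u (nat k0) - u N \<le> M"
    proof -
      have "Yk n k0 \<le> R\<^sup>2 * K * mm (Suc n)" using low_bounds(1)[OF K m(1) k0] low k0 by simp
      also have "\<dots> \<le> R\<^sup>2 * K * (K * Yn (Suc n))" using m K by (intro mult_left_mono) auto
      finally have A: "Yk n k0 \<le> R\<^sup>2 * K * (K * Yn (Suc n))" .
      have "Yn (Suc n) * Yn (Suc (Suc n)) \<le> R\<^sup>2 * (mm (Suc (Suc n)))\<^sup>2"
        using low_bounds(2)[OF K m(1), of "aa n" R] low k0 aa1[of n] by (simp add: rk_top)
      also have "\<dots> \<le> R\<^sup>2 * (K * Yn (Suc (Suc n)))\<^sup>2"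
        using m seq_pos(4)[of "Suc (Suc n)"] by (intro mult_left_mono power_mono) auto
      finally have "Yn (Suc n) * Yn (Suc (Suc n)) \<le> (R\<^sup>2 * K\<^sup>2 * Yn (Suc (Suc n))) * Yn (Suc (Suc n))"
        by (simp add: power2_eq_square mult_ac)
      then have "Yn (Suc n) \<le> R\<^sup>2 * K\<^sup>2 * Yn (Suc (Suc n))" using seq_pos(2)[of "Suc (Suc n)"] by simp
      then have "R\<^sup>2 * K * (K * Yn (Suc n)) \<le> R\<^sup>2 * K * (K * (R\<^sup>2 * K\<^sup>2 * Yn (Suc (Suc n))))"
        using K by (intro mult_left_mono) auto
      then have B: "Yk n k0 \<le> (R\<^sup>2 * K * K * (R\<^sup>2 * K\<^sup>2)) * Yn (Suc (Suc n))" using A by (simp only: mult.assoc)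
      have c: "0 < R\<^sup>2 * K * K * (R\<^sup>2 * K\<^sup>2)" using R K by simp
      have "ln (Yk n k0) \<le> ln ((R\<^sup>2 * K * K * (R\<^sup>2 * K\<^sup>2)) * Yn (Suc (Suc n)))"
        by (rule ln_mono[OF B]) (use Yp k0 in auto)
      then have "ln (Yk n k0) \<le> M + ln (Yn (Suc (Suc n)))" using c seq_pos(2)[of "Suc (Suc n)"] unfolding M_def
        by (metis ln_mult_pos)
      then show ?thesis using k0 by (simp add: u_def N rk_top)
    qed
    have 3: "L (Suc i) \<ge> L i - \<epsilon> \<and> L (Suc i) \<ge> L i - (u i - u (Suc i)) / 2" if "i \<in> {nat k0..<N}" for i
      using QQ_step(2,3)[of "int i + 1" n] sm that N by (auto simp: L_def u_def add.commute)
    have 4: "\<bar>\<nu> * (x i - x j) - (u (Suc i) - u (Suc j))\<bar> \<le> \<epsilon>" if "i \<in> {nat k0..<N}" "j \<in> {nat k0..<N}" "i < j" for i j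
      using rk_ratio[of "int i + 1" "int j + 1" n] sm that N by (simp add: x_def u_def add.commute)
    have 5: "exp (- \<epsilon>) * lpo (u k1 - u k2) (u k2 - u k3) (u k3 - u k4) \<le> lpo (x k1 - x k2) (x k2 - x k3) (x k3 - x k4)"
      if k: "nat k0 \<le> k1" "k1 < k2" "k2 < k3" "k3 < k4" "k4 < N" for k1 k2 k3 k4
    proof -
      have ud: "u k1 > u k2" "u k2 > u k3" "u k3 > u k4"
        using rk_less(2)[of "int k1" "int k2" n] rk_less(2)[of "int k2" "int k3" n] rk_less(2)[of "int k3" "int k4" n] k N Yp[of "int k2"] Yp[of "int k3"] Yp[of "int k4"]
        by (simp_all add: u_def)
      have rp: "0 < rk n k" if "0 \<le> k" "k \<le> aa n" for k using rk_pos[OF that] by simp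
      have xd: "x k1 > x k2" "x k2 > x k3" "x k3 > x k4"
        using rk_less(1)[of "int k1 + 1" "int k2 + 1" n] rk_less(1)[of "int k2 + 1" "int k3 + 1" n] rk_less(1)[of "int k3 + 1" "int k4 + 1" n] k N
          rp[of "int k2 + 1"] rp[of "int k3 + 1"] rp[of "int k4 + 1"]
        by (simp_all add: x_def)
      have ue: "exp (u i) = Yk n (int i)" if "i \<le> N" for i using Yp[of "int i"] that N by (simp add: u_def)
      have xe: "exp (x i) = rk n (int i + 1)" if "i < N" for i using rp[of "int i + 1"] that N by (simp add: x_def)
      obtain n' where n': "n = Suc n'" using n by (cases n) auto
      have "exp (- (C * tail n)) * po (- Yk n (int k1)) (- Yk n (int k2)) (- Yk n (int k3)) (- Yk n (int k4))
         \<le> po (- rk n (int k1 + 1)) (- rk n (int k2 + 1)) (- rk n (int k3 + 1)) (- rk n (int k4 + 1))"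
        using levels(8)[of n'] k N n' by (simp add: returns_contract_def)
      then have "exp (- (C * tail n)) * lpo (u k1 - u k2) (u k2 - u k3) (u k3 - u k4) \<le> lpo (x k1 - x k2) (x k2 - x k3) (x k3 - x k4)"
        using po_exp[OF ud] po_exp[OF xd] k by (simp add: ue xe)
      moreover have "exp (- \<epsilon>) * lpo (u k1 - u k2) (u k2 - u k3) (u k3 - u k4) \<le> exp (- (C * tail n)) * lpo (u k1 - u k2) (u k2 - u k3) (u k3 - u k4)"
        using sm ud by (intro mult_right_mono lpo_bounds) auto
      ultimately show ?thesis by linarith
    qed
    have "parabolic_run \<nu> M \<epsilon> (nat k0) N u x L"
      unfolding parabolic_run_def using kN 1 2 3 4 5 by simp
    then have "L (nat k0) - \<kappa> \<le> L N" using run by blast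
    then show ?thesis using k0 by (simp add: L_def N)
  qed
  then show ?thesis by blast
qed

text \<open>A bound on \<open>QQ\<close> makes \<open>Yn n\<close> at most a constant times
  \<open>mm (Suc n)\<close>. By the power law the hole of the next level is then not much closer to
  \<open>U\<close> than the return, and \<open>first_return_gain\<close> separates
  \<open>tk n 1\<close> from \<open>mk n 0\<close> by a definite proportion.\<close>

lemma gain:
  assumes R: "R \<ge> 1"
  shows "\<exists>g>0. \<exists>N. \<forall>n\<ge>N. QQ n 0 \<le> R \<longrightarrow> g \<le> ln (1 + mm (Suc n) / tk n 1) - ln (1 + mm (Suc n) / mk n 0)"
proof -
  obtain K N1 where K: "K \<ge> 1" and N1: "\<forall>n\<ge>N1. mm (Suc n) \<le> K * mm n \<and> mm n \<le> K * Yn n" using image_bounds by blast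
  obtain \<kappa> where k: "0 < \<kappa>" "\<kappa> < 1" "\<forall>n\<ge>2. \<kappa> \<le> \<tau> n" using fatness by blast
  have "eventually (\<lambda>n. yy n < r0) sequentially" using yy_lim r0 by (intro order_tendstoD) auto
  then obtain N2 where N2: "\<forall>n\<ge>N2. yy n < r0" by (auto simp: eventually_sequentially)
  \<comment> \<open>\<open>s\<close> bounds \<open>(l / y) powr \<nu>\<close> from below,
    \<open>h\<close> the relative separation of \<open>tk n 1\<close> from \<open>mm n\<close>, and
    \<open>w\<close> the quotient of \<open>mm (Suc n)\<close> by \<open>mm n\<close>.\<close>
  define s where "s = exp (- (C * r0)) / (R\<^sup>2 * K)"
  define h where "h = exp (- C) * \<kappa> * s powr (1 / \<nu>)"
  define w where "w = 1 / (R\<^sup>2 * K\<^sup>2)"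
  have RK: "0 < R\<^sup>2 * K" "0 < R\<^sup>2 * K\<^sup>2" using R K by auto
  have s0: "0 < s" unfolding s_def by (rule divide_pos_pos[OF exp_gt_zero RK(1)])
  then have p: "0 < s" "0 < h" "0 < w" using RK(2) k by (auto simp: h_def w_def)
  define g where "g = ln (1 + h * w / (1 + w))"
  have hw: "0 < h * w / (1 + w)" using p by simp
  have "g \<le> ln (1 + mm (Suc n) / tk n 1) - ln (1 + mm (Suc n) / mk n 0)"
    if n: "n \<ge> max 2 (max N1 N2)" and low: "QQ n 0 \<le> R" for n
  proof -
    obtain j where j: "n = Suc (Suc j)" using n by (metis add_2_eq_Suc le_Suc_ex max.bounded_iff)
    have b: "mm n \<le> K * Yn n" "mm (Suc n) \<le> K * Yn (Suc n)" "yy n < r0" "\<kappa> \<le> \<tau> n" using N1 N2 n k by auto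
    define m y l where "m = mm (Suc n)" and "y = yy n" and "l = ll (Suc n)"
    have q: "0 < m" "0 < y" "0 < l" "0 < Yn n" "0 < mm n" using seq_pos by (auto simp: m_def y_def l_def)
    have ly: "l < y" using hole_between[of 0 n] aa1[of n] by (simp add: l_def y_def rk_0)
    have Ym: "Yn n \<le> R\<^sup>2 * K * m" using low_bounds(1)[OF K b(2), of 0 R] low aa1[of n] by (simp add: rk_0 m_def)
    have "co (- q (Suc n)) (P (Suc n)) * co (q n) (- P n) > 0" unfolding co_q using sign2(2)[of n] by (simp add: mult.commute)
    then have "m \<le> exp (C * y) * (l / y) powr \<nu> * Yn n"
      using near_pw(2)[of "- q (Suc n)" "P (Suc n)" "q n" "- P n"] b ly by (simp add: m_def y_def l_def mm_def ll_def yy_def Yn_def)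
    also have "\<dots> \<le> exp (C * r0) * (l / y) powr \<nu> * (R\<^sup>2 * K * m)"
      using Ym b q C0 by (intro mult_mono mult_nonneg_nonneg) (auto simp: y_def mult_left_mono)
    finally have "1 * m \<le> (exp (C * r0) * (l / y) powr \<nu> * (R\<^sup>2 * K)) * m" by (simp add: mult_ac)
    then have "1 \<le> exp (C * r0) * (l / y) powr \<nu> * (R\<^sup>2 * K)" using q by (subst (asm) mult_le_cancel_right_pos) auto
    then have "1 / (exp (C * r0) * (R\<^sup>2 * K)) \<le> (l / y) powr \<nu>" using mult_pos_pos[OF exp_gt_zero RK(1), of "C * r0"]
      by (simp only: pos_divide_le_eq) (simp only: mult_ac)
    moreover have "s = 1 / (exp (C * r0) * (R\<^sup>2 * K))" by (simp add: s_def exp_minus inverse_eq_divide)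
    ultimately have "s \<le> (l / y) powr \<nu>" by simp
    then have "s powr (1 / \<nu>) \<le> ((l / y) powr \<nu>) powr (1 / \<nu>)" using p nu by (intro powr_mono2) auto
    also have "\<dots> = l / y" using q nu by (simp add: powr_powr)
    finally have sl: "s powr (1 / \<nu>) \<le> l / y" .
    have "s powr (1 / \<nu>) * \<kappa> \<le> l / y * \<tau> n" using sl b k q by (intro mult_mono) auto
    also have "\<dots> \<le> exp C * (1 - tk n 1 / mm n)" using levels(7)[of j] j by (simp add: first_return_gain_def l_def y_def \<tau>_def)
    finally have "exp (- C) * (s powr (1 / \<nu>) * \<kappa>) \<le> exp (- C) * (exp C * (1 - tk n 1 / mm n))" by (rule mult_left_mono) simp
    also have "\<dots> = 1 - tk n 1 / mm n" by (simp add: exp_minus)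
    finally have h: "h \<le> 1 - tk n 1 / mm n" by (simp add: h_def mult_ac)
    define t where "t = tk n 1"
    have t: "0 < t" using rk_pos[of 1 n] aa1[of n] by (simp add: t_def)
    have th: "t \<le> (1 - h) * mm n" using h q pos_divide_le_eq[of "mm n" t "1 - h"] by (simp add: t_def algebra_simps)
    then have h1: "h < 1" using t q less_le_trans[OF t th] by (simp add: zero_less_mult_iff)
    define z where "z = m / mm n"
    have "m / ((1 - h) * mm n) \<le> m / t" using th t q h1 by (intro divide_left_mono) auto
    moreover have "(1 + h) * z \<le> m / ((1 - h) * mm n)"
    proof -
      have "(1 + h) * (1 - h) \<le> 1" by (simp add: algebra_simps)
      then have "1 + h \<le> 1 / (1 - h)" using h1 by (simp add: pos_le_divide_eq)
      then have "(1 + h) * z \<le> 1 / (1 - h) * z" using q by (intro mult_right_mono) (auto simp: z_def)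
      then show ?thesis by (simp add: z_def)
    qed
    ultimately have mt: "(1 + h) * z \<le> m / t" by linarith
    have "mm n \<le> K * (R\<^sup>2 * K * m)" using b(1) Ym K by (meson mult_left_mono order_trans zero_le_one)
    then have "mm n \<le> (R\<^sup>2 * K\<^sup>2) * m" by (simp add: power2_eq_square mult_ac)
    then have wz: "w \<le> z" using RK q by (simp add: w_def z_def field_simps)
    have z0: "0 < z" using q by (simp add: z_def)
    have "w / (1 + w) \<le> z / (1 + z)" using wz p z0 by (simp add: field_simps)
    then have "h * (w / (1 + w)) \<le> h * (z / (1 + z))" using p by (intro mult_left_mono) auto
    then have "(1 + h * w / (1 + w)) * (1 + z) \<le> (1 + h * (z / (1 + z))) * (1 + z)" using z0 by (intro mult_right_mono) auto
    also have "\<dots> = 1 + (1 + h) * z" using z0 by (simp add: field_simps)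
    also have "\<dots> \<le> 1 + m / t" using mt by simp
    finally have "ln ((1 + h * w / (1 + w)) * (1 + z)) \<le> ln (1 + m / t)"
      by (rule ln_mono) (use hw z0 in auto)
    then have "g + ln (1 + z) \<le> ln (1 + m / t)" using hw z0 unfolding g_def by (subst (asm) ln_mult) auto
    then show ?thesis by (simp add: z_def m_def t_def rk_0)
  qed
  moreover have "0 < g" using hw by (simp add: g_def)
  ultimately show ?thesis by blast
qed

text \<open>If \<open>QQ\<close> stays below \<open>R'\<close> during a level, the gain of the first
  step outweighs the later losses. Otherwise what follows the last excursion above \<open>R'\<close>
  costs at most one step and a trapped run, so the level still ends above \<open>R\<close>. The
  first alternative cannot recur forever below \<open>R\<close>, and once above \<open>R\<close> the
  sequence stays there.\<close>

lemma QQ_unbounded: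
  assumes R: "R \<ge> 1"
  shows "eventually (\<lambda>n. R \<le> QQ n 0) sequentially"
proof -
  \<comment> \<open>The factor \<open>exp 1\<close> leaves room for a loss of \<open>2 * g\<close>,
    at most 1, after the last excursion.\<close>
  define R' where "R' = exp 1 * R"
  have R': "1 \<le> R'" "ln R' = 1 + ln R" using R mult_mono[of 1 "exp 1" 1 R] by (auto simp: R'_def ln_mult)
  obtain g' N1 where g': "g' > 0" and N1: "\<forall>n\<ge>N1. QQ n 0 \<le> R' \<longrightarrow> g' \<le> ln (1 + mm (Suc n) / tk n 1) - ln (1 + mm (Suc n) / mk n 0)"
    using gain[OF R'(1)] by blast
  \<comment> \<open>One third of \<open>g'\<close> pays for \<open>err\<close> in the first step,
    one third for the rest of the level, and one third remains.\<close>
  define g where "g = min (g' / 3) (1 / 2)"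
  have g: "0 < g" "3 * g \<le> g'" "2 * g \<le> 1" using g' by (auto simp: g_def)
  obtain N2 where N2: "\<forall>n\<ge>N2. \<forall>k0. 0 \<le> k0 \<longrightarrow> k0 \<le> aa n \<longrightarrow> (\<forall>k. k0 \<le> k \<longrightarrow> k \<le> aa n \<longrightarrow> QQ n k \<le> R') \<longrightarrow>
     ln (QQ n k0) - g \<le> ln (QQ n (aa n))" using trap[OF R'(1) g(1)] by blast
  have "eventually (\<lambda>n. err n < g \<and> yy n < r0) sequentially" using err_lim yy_lim r0 g by (intro eventually_conj order_tendstoD) auto
  then obtain N3 where N3: "\<forall>n\<ge>N3. err n < g \<and> yy n < r0" by (auto simp: eventually_sequentially)
  define N where "N = max N1 (max N2 N3)"
  have step: "ln (QQ n 0) + g \<le> ln (QQ (Suc n) 0) \<or> ln R \<le> ln (QQ (Suc n) 0)" if n: "n \<ge> N" for n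
  proof (cases "\<forall>k. 0 \<le> k \<longrightarrow> k \<le> aa n \<longrightarrow> QQ n k \<le> R'")
    case True
    have e: "err n < g" "yy n < r0" using N3 n by (auto simp: N_def)
    have "QQ n 0 \<le> R'" using True aa1[of n] by simp
    then have "g' \<le> ln (1 + mm (Suc n) / tk n 1) - ln (1 + mm (Suc n) / mk n 0)" using N1 n by (simp add: N_def)
    then have "ln (QQ n 0) + 2 * g \<le> ln (QQ n 1)" using QQ_step(1)[of 1 n] aa1[of n] e g by simp
    moreover have "ln (QQ n 1) - g \<le> ln (QQ n (aa n))" using N2 True aa1[of n] n by (simp add: N_def)
    ultimately show ?thesis by (simp add: QQ_top)
  next
    case False
    define T where "T = {k. 0 \<le> k \<and> k \<le> aa n \<and> R' < QQ n k}"
    have T: "finite T" "T \<noteq> {}"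
      using False unfolding not_all not_imp not_le by (auto simp: T_def intro: finite_subset[of _ "{0..aa n}"])
    define k where "k = Max T"
    have k: "0 \<le> k" "k \<le> aa n" "R' < QQ n k" using Max_in[OF T] by (auto simp: k_def T_def)
    have kmax: "QQ n k' \<le> R'" if "k < k'" "k' \<le> aa n" for k'

    proof (rule ccontr)
      assume "\<not> ?thesis"
      then have "k' \<in> T" using that k by (simp add: T_def)
      then show False using Max_ge[OF T(1), of k'] that by (simp add: k_def)
    qed
    have lk: "ln R' \<le> ln (QQ n k)" by (rule ln_mono) (use k R' in auto)
    show ?thesis
    proof (cases "k = aa n")
      case True
      then show ?thesis using lk R' by (simp add: QQ_top)
    next
      case False
      then have k1: "k + 1 \<le> aa n" using k by simp
      have e: "err n < g" "yy n < r0" using N3 n by (auto simp: N_def)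
      have "ln (QQ n k) - g \<le> ln (QQ n (k + 1))" using QQ_step(2)[of "k + 1" n] k k1 e by simp
      moreover have "ln (QQ n (k + 1)) - g \<le> ln (QQ n (aa n))" using N2 k k1 n kmax by (simp add: N_def)
      ultimately show ?thesis using lk R' g by (simp add: QQ_top)
    qed
  qed
  have Qp: "0 < QQ n 0" for n using QQ_pos[of 0 n] aa1[of n] by simp
  have "\<exists>n\<ge>N. ln R \<le> ln (QQ n 0)"
  proof (rule ccontr)
    assume "\<not> ?thesis"
    then have small: "ln (QQ n 0) < ln R" if "n \<ge> N" for n using that by force
    have lin: "ln (QQ N 0) + real i * g \<le> ln (QQ (N + i) 0)" for i
    proof (induction i)
      case (Suc i)
      then show ?case using step[of "N + i"] small[of "Suc (N + i)"] by (simp add: algebra_simps)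
    qed simp
    obtain i where "ln R - ln (QQ N 0) < real i * g" using reals_Archimedean3[OF g(1)] by blast
    then have "ln R < ln (QQ N 0) + real i * g" by simp
    also have "\<dots> \<le> ln (QQ (N + i) 0)" by (rule lin)
    finally show False using small[of "N + i"] by simp
  qed
  then obtain n0 where n0: "n0 \<ge> N" "ln R \<le> ln (QQ n0 0)" by blast
  have "ln R \<le> ln (QQ n 0)" if "n \<ge> n0" for n
    using that
  proof (induction n rule: dec_induct)
    case (step n)
    then show ?case using \<open>n0 \<ge> N\<close> g \<open>\<And>n. n \<ge> N \<Longrightarrow> ln (QQ n 0) + g \<le> ln (QQ (Suc n) 0) \<or> ln R \<le> ln (QQ (Suc n) 0)\<close>[of n] by auto
  qed (rule n0)
  then have "R \<le> QQ n 0" if "n \<ge> n0" for n using that Qp[of n] R by (metis ln_le_cancel_iff less_le_trans zero_less_one)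
  then show ?thesis by (auto simp: eventually_sequentially)
qed

text \<open>If \<open>Yn (Suc (Suc n))\<close> were not small compared with \<open>Yn n\<close>,
  then \<open>mm (Suc n)\<close>, which is larger, and with it \<open>mm n\<close> would be at least
  of the order of \<open>Yn n\<close>, while \<open>Yn (Suc n)\<close> is at most of that order.
  This bounds \<open>QQ n 0\<close> by \<open>R - 1\<close>.\<close>

theorem ratio_tendsto_zero: "(\<lambda>n. yy (Suc (Suc n)) / yy n) \<longlonglongrightarrow> 0"
proof -
  obtain K N1 where K: "K \<ge> 1" and N1: "\<forall>n\<ge>N1. mm (Suc n) \<le> K * mm n \<and> mm n \<le> K * Yn n" using image_bounds by blast
  have "eventually (\<lambda>n. yy n < r0) sequentially" using yy_lim r0 by (intro order_tendstoD) auto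
  then obtain N2 where N2: "\<forall>n\<ge>N2. yy n < r0" by (auto simp: eventually_sequentially)
  have *: "eventually (\<lambda>n. yy (Suc (Suc n)) / yy n < e) sequentially" if e: "e > 0" for e
  proof -
    \<comment> \<open>The drop of \<open>ln Yn\<close> that the power law converts into a factor
      \<open>e\<close> for the distances.\<close>
    define D where "D = C * r0 - \<nu> * ln e"
    define R where "R = sqrt K * (exp D * (1 + K)) + 1"
    have "R \<ge> 1" using K by (simp add: R_def)
    from QQ_unbounded[OF this] obtain N3 where N3: "\<forall>n\<ge>N3. R \<le> QQ n 0" by (auto simp: eventually_sequentially)
    have "yy (Suc (Suc n)) / yy n < e" if n: "n \<ge> max 1 (max N1 (max N2 N3))" for n
    proof -
      have b: "mm (Suc n) \<le> K * mm n" "mm n \<le> K * Yn n" "yy n < r0" "R \<le> QQ n 0" using N1 N2 N3 n by auto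
      have p: "0 < Yn n" "0 < Yn (Suc n)" "0 < mm n" "0 < mm (Suc n)" "0 < Yn (Suc (Suc n))" "0 < yy n" "0 < yy (Suc (Suc n))" using seq_pos by auto
      have "exp D * Yn (Suc (Suc n)) < Yn n"
      proof (rule ccontr)
        assume "\<not> ?thesis"
        then have "Yn n \<le> exp D * Yn (Suc (Suc n))" by simp
        also have "\<dots> \<le> exp D * mm (Suc n)" using Yn_less_mm[of "Suc n"] by simp
        finally have i1: "1 / mm (Suc n) \<le> exp D / Yn n" using p by (simp add: field_simps)
        have "1 / mm n \<le> K / mm (Suc n)" using b p by (simp add: field_simps)
        also have "\<dots> = K * (1 / mm (Suc n))" by simp
        also have "\<dots> \<le> K * (exp D / Yn n)" using i1 K by (intro mult_left_mono) auto
        finally have i2: "1 / mm n \<le> K * (exp D / Yn n)" .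
        have "Yn (Suc n) * Yn n \<le> (K * Yn n) * Yn n" using Yn_less_mm[of n] b n p by (intro mult_right_mono) auto
        then have "sqrt (Yn (Suc n) * Yn n) \<le> sqrt (K * (Yn n)\<^sup>2)" by (simp add: power2_eq_square)
        also have "\<dots> = sqrt K * Yn n" using p by (simp add: real_sqrt_mult)
        finally have "QQ n 0 \<le> (sqrt K * Yn n) * (exp D / Yn n + K * (exp D / Yn n))"
          unfolding QQ_def rk_0 using i1 i2 p K by (intro mult_mono add_mono) auto
        also have "\<dots> = sqrt K * (exp D * (1 + K))" using p by (simp add: field_simps)
        finally show False using b by (simp add: R_def)
      qed
      then have "ln (exp D * Yn (Suc (Suc n))) < ln (Yn n)" using p by simp
      then have "D + ln (Yn (Suc (Suc n))) < ln (Yn n)" using p by (simp add: ln_mult)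
      moreover have "\<bar>\<nu> * (ln (yy n) - ln (yy (Suc (Suc n)))) - (ln (Yn n) - ln (Yn (Suc (Suc n))))\<bar> \<le> C * yy n"
        using rk_ratio[of 0 "aa n" n] aa1[of n] b by (simp add: rk_0 rk_top)
      moreover have "C * yy n \<le> C * r0" using b C0 by (intro mult_left_mono) auto
      ultimately have "\<nu> * (- ln e) < \<nu> * (ln (yy n) - ln (yy (Suc (Suc n))))" by (simp add: D_def abs_le_iff)
      then have "- ln e < ln (yy n) - ln (yy (Suc (Suc n)))" using nu by (subst (asm) mult_less_cancel_left_pos) auto
      then have "ln (yy (Suc (Suc n)) / yy n) < ln e" using p by (simp add: ln_div)
      then show ?thesis using p e by (subst (asm) ln_less_cancel_iff) auto
    qed
    then show ?thesis unfolding eventually_sequentially by blast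
  qed
  show ?thesis
  proof (rule order_tendstoI)
    fix a :: real assume "a < 0"
    then show "\<forall>\<^sub>F n in sequentially. a < yy (Suc (Suc n)) / yy n" using seq_pos(1) by (intro always_eventually allI) (meson divide_pos_pos less_trans)
  qed (use * in blast)
qed

end

end

section \<open>Lifts of almost smooth circle maps\<close>

text \<open>The derivative has no zero because the inverse is differentiable too: by the chain rule
  the product of the two derivatives is one.\<close>

lemma C2_diffeo_on_deriv:
  assumes S: "open S" and D: "C2_diffeo_on S f"
  obtains f' f'' where "\<And>x. x \<in> S \<Longrightarrow> (f has_real_derivative f' x) (at x)"
    "\<And>x. x \<in> S \<Longrightarrow> (f' has_real_derivative f'' x) (at x)" "\<And>x. x \<in> S \<Longrightarrow> f' x \<noteq> 0" "continuous_on S f''"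
proof -
  obtain f' f'' where f: "\<And>x. x \<in> S \<Longrightarrow> (f has_real_derivative f' x) (at x)"
    "\<And>x. x \<in> S \<Longrightarrow> (f' has_real_derivative f'' x) (at x)" "continuous_on S f''"
    using D unfolding C2_diffeo_on_def C2_on_def by blast
  obtain g' where g: "\<And>y. y \<in> f ` S \<Longrightarrow> (the_inv_into S f has_real_derivative g' y) (at y)"
    using D unfolding C2_diffeo_on_def C2_on_def by blast
  have inj: "inj_on f S" using D by (simp add: C2_diffeo_on_def)
  have "f' x \<noteq> 0" if x: "x \<in> S" for x
  proof
    assume 0: "f' x = 0"
    have "((\<lambda>x. the_inv_into S f (f x)) has_real_derivative g' (f x) * f' x) (at x)"
      by (rule DERIV_chain2[OF g f(1)]) (use x in auto)
    then have "((\<lambda>x. x) has_real_derivative g' (f x) * f' x) (at x)"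
      by (rule DERIV_cong_ev[THEN iffD1, rotated -1, OF _ refl])
        (auto intro!: eventually_mono[OF eventually_nhds_in_open[OF S x]] simp: the_inv_into_f_f[OF inj])
    then have "g' (f x) * f' x = 1" by (rule DERIV_unique) simp
    then show False using 0 by simp
  qed
  then show ?thesis using that f by blast
qed

text \<open>\<open>M\<close> bounds the nonlinearity \<open>h'' / h'\<close>, which is what controls
  ratios of values of \<open>h'\<close>.\<close>

definition local_C2 where
  "local_C2 h h' h'' r M \<longleftrightarrow> 0 < r \<and> 0 \<le> M \<and> (\<forall>s. \<bar>s\<bar> < r \<longrightarrow> (h has_real_derivative h' s) (at s) \<and>
     (h' has_real_derivative h'' s) (at s) \<and> h' s \<noteq> 0 \<and> \<bar>h'' s\<bar> \<le> M * \<bar>h' s\<bar>)"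
  for h h' h'' :: "real \<Rightarrow> real" and r M :: real

lemma local_C2_minus: "local_C2 h h' h'' r M \<Longrightarrow> local_C2 (\<lambda>s. c - h s) (\<lambda>s. - h' s) (\<lambda>s. - h'' s) r M"
  unfolding local_C2_def by (auto intro!: derivative_eq_intros)

lemma local_C2_exists:
  assumes "open N" "0 \<in> N" "C2_diffeo_on N h"
  shows "\<exists>h' h'' r M. local_C2 h h' h'' r M"
proof -
  obtain h' h'' where h: "\<And>x. x \<in> N \<Longrightarrow> (h has_real_derivative h' x) (at x)"
    "\<And>x. x \<in> N \<Longrightarrow> (h' has_real_derivative h'' x) (at x)" "\<And>x. x \<in> N \<Longrightarrow> h' x \<noteq> 0" "continuous_on N h''"
    using C2_diffeo_on_deriv[OF assms(1,3)] by blast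
  have c': "continuous_on N h'" by (rule DERIV_continuous_on) (use h(2) in \<open>auto intro: has_field_derivative_at_within\<close>)
  have "continuous_on N (\<lambda>s. h'' s / h' s)" by (intro continuous_intros c' h(4)) (use h(3) in auto)
  then have "isCont (\<lambda>s. h'' s / h' s) 0" using assms by (simp add: continuous_on_eq_continuous_at)
  then have "((\<lambda>s. h'' s / h' s) \<longlongrightarrow> h'' 0 / h' 0) (nhds 0)"
    using tendsto_at_iff_tendsto_nhds[of "\<lambda>s. h'' s / h' s" 0] by (simp add: isCont_def)
  then have "\<forall>\<^sub>F s in nhds 0. \<bar>h'' s / h' s - h'' 0 / h' 0\<bar> < 1"
    unfolding tendsto_iff dist_real_def by (metis zero_less_one)
  moreover have "\<forall>\<^sub>F s in nhds 0. s \<in> N" using assms(1,2) by (rule eventually_nhds_in_open)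
  ultimately have "\<forall>\<^sub>F s in nhds 0. \<bar>h'' s / h' s - h'' 0 / h' 0\<bar> < 1 \<and> s \<in> N" by (rule eventually_conj)
  then obtain r where r: "r > 0" "\<And>s. \<bar>s\<bar> < r \<Longrightarrow> \<bar>h'' s / h' s - h'' 0 / h' 0\<bar> < 1 \<and> s \<in> N"
    unfolding eventually_nhds_metric dist_real_def by auto
  define M where "M = \<bar>h'' 0 / h' 0\<bar> + 1"
  have "\<bar>h'' s\<bar> \<le> M * \<bar>h' s\<bar>" if s: "\<bar>s\<bar> < r" for s
  proof -
    have "\<bar>h'' s / h' s\<bar> \<le> M" using r(2)[OF s] unfolding M_def by linarith
    then show ?thesis using h(3)[of s] r(2)[OF s] by (simp add: abs_divide pos_divide_le_eq)
  qed
  then have "local_C2 h h' h'' r M" unfolding local_C2_def using r h by (auto simp: M_def)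
  then show ?thesis by blast
qed

section \<open>Normal form at the ends of the flat spot\<close>

lemma powr_le_self: "0 < x \<Longrightarrow> x \<le> 1 \<Longrightarrow> 1 \<le> \<nu> \<Longrightarrow> x powr \<nu> \<le> (x :: real)"
  using powr_mono'[of 1 \<nu> x] by simp

text \<open>The nonlinearity of a composition is that of the inner map, here
  \<open>(\<nu> - 1) / (x - b)\<close>, plus that of \<open>h\<close> times the derivative of the
  inner map; the latter is bounded since \<open>\<nu> > 1\<close>.\<close>

lemma endpoint_nonlinearity:
  assumes nu: "\<nu> > 1" and loc: "local_C2 h h' h'' r M" and \<eta>: "0 < \<eta>"
    and f: "\<And>x. b < x \<Longrightarrow> x < b + \<eta> \<Longrightarrow> f x = h ((x - b) powr \<nu>)"
    and f': "\<And>x. b < x \<Longrightarrow> x < b + \<eta> \<Longrightarrow> (f has_real_derivative f' x) (at x)"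
    and f'': "\<And>x. b < x \<Longrightarrow> x < b + \<eta> \<Longrightarrow> (f' has_real_derivative f'' x) (at x)"
  shows "\<exists>\<delta>>0. \<forall>x. b < x \<longrightarrow> x < b + \<delta> \<longrightarrow> \<bar>f'' x / f' x - (\<nu> - 1) / (x - b)\<bar> \<le> M * \<nu> \<and>
      f' x = h' ((x - b) powr \<nu>) * (\<nu> * (x - b) powr (\<nu> - 1))"
proof -
  define \<delta> where "\<delta> = min \<eta> (min r 1)"
  have de: "0 < \<delta>" "\<delta> \<le> \<eta>" "\<delta> \<le> r" "\<delta> \<le> 1" using \<eta> loc by (auto simp: \<delta>_def local_C2_def)
  have s: "\<bar>(x - b) powr \<nu>\<bar> < r" if "b < x" "x < b + \<delta>" for x
    using powr_le_self[of "x - b" \<nu>] that nu de by auto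
  have hd: "(h has_real_derivative h' s) (at s)" "(h' has_real_derivative h'' s) (at s)" "h' s \<noteq> 0" "\<bar>h'' s\<bar> \<le> M * \<bar>h' s\<bar>"
    if "\<bar>s\<bar> < r" for s using loc that by (auto simp: local_C2_def)
  have ev: "\<forall>\<^sub>F y in nhds x. b < y \<and> y < b + \<delta>" if "b < x" "x < b + \<delta>" for x
    using eventually_nhds_in_open[of "{b<..<b + \<delta>}" x] that by (auto simp: greaterThanLessThan_iff)
  have f1: "f' x = h' ((x - b) powr \<nu>) * (\<nu> * (x - b) powr (\<nu> - 1))" if x: "b < x" "x < b + \<delta>" for x
  proof -
    have "((\<lambda>x. h ((x - b) powr \<nu>)) has_real_derivative h' ((x - b) powr \<nu>) * (\<nu> * (x - b) powr (\<nu> - 1))) (at x)"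
      by (rule DERIV_chain2[where f = h and g = "\<lambda>x. (x - b) powr \<nu>", OF hd(1)[OF s[OF x]]]) (use x in \<open>auto intro!: derivative_eq_intros\<close>)
    then have "(f has_real_derivative h' ((x - b) powr \<nu>) * (\<nu> * (x - b) powr (\<nu> - 1))) (at x)"
      by (rule DERIV_cong_ev[THEN iffD1, rotated -1, OF _ refl])
        (use f de in \<open>auto intro: eventually_mono[OF ev[OF x]]\<close>)
    then show ?thesis using f'[of x] x de DERIV_unique by fastforce
  qed
  have "\<bar>f'' x / f' x - (\<nu> - 1) / (x - b)\<bar> \<le> M * \<nu>" if x: "b < x" "x < b + \<delta>" for x
  proof -
    define t where "t = (x - b) powr \<nu>"
    define p where "p = (x - b) powr (\<nu> - 1)"
    have p: "0 < p" "p \<le> 1" using x de nu powr_le_one_le[of "x - b" "\<nu> - 1"] powr_mono2[of "\<nu> - 1" "x - b" 1] by (auto simp: p_def)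
    have t: "\<bar>t\<bar> < r" using s[OF x] by (simp add: t_def)
    have "((\<lambda>x. h' ((x - b) powr \<nu>) * (\<nu> * (x - b) powr (\<nu> - 1))) has_real_derivative
        h'' t * (\<nu> * p) * (\<nu> * p) + h' t * (\<nu> * ((\<nu> - 1) * (x - b) powr (\<nu> - 2)))) (at x)"
    proof -
      have "((\<lambda>x. h' ((x - b) powr \<nu>)) has_real_derivative h'' t * (\<nu> * p)) (at x)"
        unfolding t_def p_def by (rule DERIV_chain2[where f = h' and g = "\<lambda>x. (x - b) powr \<nu>", OF hd(2)[OF s[OF x]]]) (use x in \<open>auto intro!: derivative_eq_intros\<close>)
      moreover have "((\<lambda>x. \<nu> * (x - b) powr (\<nu> - 1)) has_real_derivative \<nu> * ((\<nu> - 1) * (x - b) powr (\<nu> - 2))) (at x)"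
        using x by (auto intro!: derivative_eq_intros)
      ultimately show ?thesis by (rule DERIV_cong[OF DERIV_mult]) (simp add: t_def p_def mult_ac)
    qed
    then have "(f' has_real_derivative h'' t * (\<nu> * p) * (\<nu> * p) + h' t * (\<nu> * ((\<nu> - 1) * (x - b) powr (\<nu> - 2)))) (at x)"
      by (rule DERIV_cong_ev[THEN iffD1, rotated -1, OF _ refl]) (use f1 in \<open>auto intro: eventually_mono[OF ev[OF x]]\<close>)
    then have e: "f'' x = h'' t * (\<nu> * p) * (\<nu> * p) + h' t * (\<nu> * ((\<nu> - 1) * (x - b) powr (\<nu> - 2)))"
      using f''[of x] x de DERIV_unique by fastforce
    have p2: "(x - b) powr (\<nu> - 2) = p / (x - b)" using x powr_diff[of "x - b" "\<nu> - 1" 1] by (simp add: p_def)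
    have "f'' x / f' x = h'' t * (\<nu> * p) / h' t + (\<nu> - 1) / (x - b)"
      unfolding e f1[OF x] p2 t_def[symmetric] p_def[symmetric] using hd(3)[OF t] p nu x by (simp add: field_simps)
    then have "\<bar>f'' x / f' x - (\<nu> - 1) / (x - b)\<bar> = \<bar>h'' t\<bar> * (\<nu> * p) / \<bar>h' t\<bar>" using p nu by (simp add: abs_mult)
    also have "\<dots> \<le> (M * \<bar>h' t\<bar>) * (\<nu> * p) / \<bar>h' t\<bar>" using hd(4)[OF t] p nu by (intro divide_right_mono mult_right_mono) auto
    also have "\<dots> = M * \<nu> * p" using hd(3)[OF t] by simp
    also have "\<dots> \<le> M * \<nu> * 1" using p nu loc by (intro mult_left_mono) (auto simp: local_C2_def)
    finally show ?thesis by simp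
  qed
  then show ?thesis using de(1) f1 by blast
qed

lemma local_C2_pos:
  assumes loc: "local_C2 h h' h'' r M" and s0: "\<bar>s0\<bar> < r" "h' s0 > 0" and s: "\<bar>s\<bar> < r"
  shows "h' s > 0"
proof (rule ccontr)
  have hd: "(h' has_real_derivative h'' s) (at s)" "h' s \<noteq> 0" if "\<bar>s\<bar> < r" for s
    using loc that by (auto simp: local_C2_def)
  assume "\<not> ?thesis"
  then have neg: "h' s \<le> 0" by simp
  have c: "continuous_on I h'" if "I \<subseteq> {- r<..<r}" for I
  proof (rule DERIV_continuous_on[where D = h''])
    fix x assume "x \<in> I"
    then have "\<bar>x\<bar> < r" using that by (force simp: abs_less_iff)
    then show "(h' has_real_derivative h'' x) (at x within I)" by (rule has_field_derivative_at_within[OF hd(1)])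
  qed
  have "\<exists>z. \<bar>z\<bar> < r \<and> h' z = 0"
  proof (cases "s \<le> s0")
    case True
    have "{s..s0} \<subseteq> {- r<..<r}" using s s0 by (auto simp: abs_less_iff)
    from IVT'[OF neg less_imp_le[OF s0(2)] True c[OF this]] obtain z where "s \<le> z" "z \<le> s0" "h' z = 0" by blast
    then show ?thesis using s s0 by (intro exI[of _ z]) (simp add: abs_less_iff)
  next
    case False
    then have le: "s0 \<le> s" by simp
    have "{s0..s} \<subseteq> {- r<..<r}" using s s0 by (auto simp: abs_less_iff)
    from IVT2'[OF neg less_imp_le[OF s0(2)] le c[OF this]] obtain z where "s0 \<le> z" "z \<le> s" "h' z = 0" by blast
    then show ?thesis using s s0 by (intro exI[of _ z]) (simp add: abs_less_iff)
  qed
  then show False using hd(2) by blast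
qed

text \<open>By the mean value theorem the increments of \<open>h\<close> are the powers times values
  of \<open>h'\<close> at two points less than \<open>t\<close> apart, and \<open>ln h'\<close> has
  Lipschitz constant \<open>M\<close>.\<close>

lemma endpoint_power_law:
  assumes nu: "\<nu> > 1" and loc: "local_C2 h h' h'' r M" and s0: "\<bar>s0\<bar> < r" "h' s0 > 0"
  shows "\<exists>\<delta>>0. \<forall>s t. 0 < s \<longrightarrow> s \<le> t \<longrightarrow> t < \<delta> \<longrightarrow>
     exp (- (M * t)) * (s / t) powr \<nu> * (h (t powr \<nu>) - h 0) \<le> h (s powr \<nu>) - h 0 \<and>
     h (s powr \<nu>) - h 0 \<le> exp (M * t) * (s / t) powr \<nu> * (h (t powr \<nu>) - h 0)"
proof -
  have hd: "(h has_real_derivative h' s) (at s)" "(h' has_real_derivative h'' s) (at s)" "\<bar>h'' s\<bar> \<le> M * \<bar>h' s\<bar>"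
    if "\<bar>s\<bar> < r" for s using loc that by (auto simp: local_C2_def)
  have r: "0 < r" "0 \<le> M" using loc by (auto simp: local_C2_def)
  have h'p: "0 < h' s" if s: "0 \<le> s" "s < r" for s using local_C2_pos[OF loc s0] that by simp
  have lnlip: "\<bar>ln (h' x) - ln (h' y)\<bar> \<le> M * \<bar>x - y\<bar>" if xy: "0 \<le> x" "x < r" "0 \<le> y" "y < r" for x y
  proof -
    have "norm (ln (h' x) - ln (h' y)) \<le> M * norm (x - y)"
    proof (rule field_differentiable_bound[where S = "{0..<r}" and f' = "\<lambda>s. h'' s / h' s"])
      fix z assume z: "z \<in> {0..<r}"
      have "((\<lambda>s. ln (h' s)) has_real_derivative 1 / h' z * h'' z) (at z)"
        by (rule DERIV_chain2[where f = ln, OF DERIV_ln_divide hd(2)]) (use z h'p[of z] in auto)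
      then show "((\<lambda>s. ln (h' s)) has_field_derivative h'' z / h' z) (at z within {0..<r})"
        by (auto intro: has_field_derivative_at_within)
      show "norm (h'' z / h' z) \<le> M" using z h'p[of z] hd(3)[of z] by (simp add: abs_divide pos_divide_le_eq)
    qed (use xy in \<open>auto simp: convex_real_interval\<close>)
    then show ?thesis by simp
  qed
  define \<delta> where "\<delta> = min r 1"
  have "exp (- (M * t)) * (s / t) powr \<nu> * (h (t powr \<nu>) - h 0) \<le> h (s powr \<nu>) - h 0 \<and>
     h (s powr \<nu>) - h 0 \<le> exp (M * t) * (s / t) powr \<nu> * (h (t powr \<nu>) - h 0)" if st: "0 < s" "s \<le> t" "t < \<delta>" for s t
  proof -
    have t1: "0 < t" "t < 1" "t < r" "s < 1" using st by (auto simp: \<delta>_def)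
    have S: "0 < s powr \<nu>" "s powr \<nu> \<le> t powr \<nu>" "t powr \<nu> \<le> t" "0 < t powr \<nu>"
      using st t1 nu powr_le_self[of t \<nu>] by (auto intro: powr_mono2)
    obtain x where x: "0 < x" "x < s powr \<nu>" "h (s powr \<nu>) - h 0 = s powr \<nu> * h' x"
      using MVT2[OF S(1), of h h'] hd(1) S t1 by auto
    obtain y where y: "0 < y" "y < t powr \<nu>" "h (t powr \<nu>) - h 0 = t powr \<nu> * h' y"
      using MVT2[OF S(4), of h h'] hd(1) S t1 by auto
    have xy: "0 < h' x" "0 < h' y" using h'p x y S t1 by auto
    have "\<bar>ln (h' x) - ln (h' y)\<bar> \<le> M * \<bar>x - y\<bar>" using x y S t1 by (intro lnlip) auto
    also have "\<dots> \<le> M * t" using x y S r by (intro mult_left_mono) auto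
    finally have "ln (h' x) \<le> ln (exp (M * t) * h' y)" "ln (exp (- (M * t)) * h' y) \<le> ln (h' x)"
      using xy by (simp_all add: ln_mult_pos abs_le_iff)
    then have "h' x \<le> exp (M * t) * h' y" "exp (- (M * t)) * h' y \<le> h' x"
      using xy ln_le_cancel_iff[of "h' x" "exp (M * t) * h' y"] ln_le_cancel_iff[of "exp (- (M * t)) * h' y" "h' x"] by (simp_all del: ln_le_cancel_iff)
    then have m: "s powr \<nu> * h' x \<le> s powr \<nu> * (exp (M * t) * h' y)" "s powr \<nu> * (exp (- (M * t)) * h' y) \<le> s powr \<nu> * h' x"
      using S by (auto intro!: mult_left_mono simp del: mult_le_cancel_left_pos)
    have "(s / t) powr \<nu> * (t powr \<nu> * h' y) = s powr \<nu> * h' y" using S st by (simp add: powr_divide)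
    then have "c * (s / t) powr \<nu> * (t powr \<nu> * h' y) = s powr \<nu> * (c * h' y)" for c by (simp add: mult.assoc mult.left_commute)
    then show ?thesis unfolding x(3) y(3) using m by (simp only:)
  qed
  moreover have "0 < \<delta>" using r by (simp add: \<delta>_def)
  ultimately show ?thesis by blast
qed

lemma bounded_on_open_interval:
  fixes g :: "real \<Rightarrow> real"
  assumes c: "continuous_on {b<..<e} g" and be: "b < e"
    and l: "\<exists>M. \<exists>\<delta>>0. \<forall>x. b < x \<longrightarrow> x < b + \<delta> \<longrightarrow> \<bar>g x\<bar> \<le> M"
    and r: "\<exists>M. \<exists>\<delta>>0. \<forall>x. e - \<delta> < x \<longrightarrow> x < e \<longrightarrow> \<bar>g x\<bar> \<le> M"
  shows "\<exists>M\<ge>0. \<forall>x. b < x \<longrightarrow> x < e \<longrightarrow> \<bar>g x\<bar> \<le> M"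
proof -
  obtain M1 d1 where 1: "d1 > 0" "\<And>x. b < x \<Longrightarrow> x < b + d1 \<Longrightarrow> \<bar>g x\<bar> \<le> M1" using l by blast
  obtain M2 d2 where 2: "d2 > 0" "\<And>x. e - d2 < x \<Longrightarrow> x < e \<Longrightarrow> \<bar>g x\<bar> \<le> M2" using r by blast
  define d where "d = min d1 d2 / 2"
  have d: "0 < d" "d < d1" "d < d2" using 1 2 by (auto simp: d_def)
  have "compact (g ` {b + d..e - d})" by (intro compact_continuous_image continuous_on_subset[OF c]) (use d in auto)
  then obtain M3 where 3: "\<And>x. x \<in> {b + d..e - d} \<Longrightarrow> \<bar>g x\<bar> \<le> M3"
    by (metis bounded_iff compact_imp_bounded imageI real_norm_def)
  have "\<bar>g x\<bar> \<le> max 0 (max M1 (max M2 M3))" if "b < x" "x < e" for x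
  proof -
    consider "x < b + d1" | "e - d2 < x" | "x \<in> {b + d..e - d}" using d by force
    then show ?thesis by cases (use 1(2)[of x] 2(2)[of x] 3[of x] that in \<open>auto simp: le_max_iff_disj\<close>)
  qed
  then show ?thesis by (intro exI[of _ "max 0 (max M1 (max M2 M3))"]) auto
qed

lemma endpoint:
  assumes nu: "\<nu> > 1" and loc: "local_C2 h h' h'' r M" and \<eta>: "0 < \<eta>"
    and f: "\<And>x. b < x \<Longrightarrow> x < b + \<eta> \<Longrightarrow> f x = h ((x - b) powr \<nu>)"
    and f': "\<And>x. b < x \<Longrightarrow> x < b + \<eta> \<Longrightarrow> (f has_real_derivative f' x) (at x) \<and> 0 < f' x"
    and f'': "\<And>x. b < x \<Longrightarrow> x < b + \<eta> \<Longrightarrow> (f' has_real_derivative f'' x) (at x)"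
    and cont: "isCont f b" and mono: "mono f"
  shows "\<exists>K\<ge>0. \<exists>\<delta>>0. (\<forall>x. b < x \<longrightarrow> x < b + \<delta> \<longrightarrow> \<bar>f'' x / f' x - (\<nu> - 1) / (x - b)\<bar> \<le> K) \<and>
     (\<forall>s t. 0 < s \<longrightarrow> s \<le> t \<longrightarrow> t < \<delta> \<longrightarrow>
       exp (- (K * t)) * (s / t) powr \<nu> * (f (b + t) - f b) \<le> f (b + s) - f b \<and>
       f (b + s) - f b \<le> exp (K * t) * (s / t) powr \<nu> * (f (b + t) - f b))"
proof -
  obtain d1 where d1: "d1 > 0" "\<And>x. b < x \<Longrightarrow> x < b + d1 \<Longrightarrow> \<bar>f'' x / f' x - (\<nu> - 1) / (x - b)\<bar> \<le> M * \<nu> \<and>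
      f' x = h' ((x - b) powr \<nu>) * (\<nu> * (x - b) powr (\<nu> - 1))"
    using endpoint_nonlinearity[OF nu loc \<eta> f, of f' f''] f' f'' by blast
  have rM: "0 < r" "0 \<le> M" using loc by (auto simp: local_C2_def)
  define u where "u = min (min (d1 / 2) (\<eta> / 2)) (min (r / 2) 1)"
  have u: "0 < u" "u < d1" "u < \<eta>" "u < r" "u \<le> 1" using d1 \<eta> rM by (auto simp: u_def)
  have s0: "\<bar>u powr \<nu>\<bar> < r" using powr_le_self[of u \<nu>] u nu by simp
  have "0 < h' (u powr \<nu>) * (\<nu> * u powr (\<nu> - 1))" using d1(2)[of "b + u"] f'[of "b + u"] u by auto
  then have "0 < h' (u powr \<nu>)" by (rule zero_less_mult_pos2) (use nu u in simp)
  from endpoint_power_law[OF nu loc s0 this] obtain d2 where d2: "d2 > 0"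
    "\<And>s t. 0 < s \<Longrightarrow> s \<le> t \<Longrightarrow> t < d2 \<Longrightarrow>
     exp (- (M * t)) * (s / t) powr \<nu> * (h (t powr \<nu>) - h 0) \<le> h (s powr \<nu>) - h 0 \<and>
     h (s powr \<nu>) - h 0 \<le> exp (M * t) * (s / t) powr \<nu> * (h (t powr \<nu>) - h 0)" by blast
  \<comment> \<open>The normal form is given only to the right of \<open>b\<close>; continuity
    identifies its value at \<open>b\<close>.\<close>
  have fb: "f b = h 0"
  proof (rule tendsto_unique)
    have "((\<lambda>s. f (b + s)) \<longlongrightarrow> f b) (at 0)" using cont by (simp add: isCont_iff)
    then show "((\<lambda>s. f (b + s)) \<longlongrightarrow> f b) (at_right 0)" by (rule tendsto_within_subset) simp
    have "(h has_real_derivative h' 0) (at 0)" using loc by (auto simp: local_C2_def)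
    then have "isCont h 0" by (rule DERIV_isCont)
    moreover have "((\<lambda>s. s powr \<nu>) \<longlongrightarrow> 0) (at_right (0::real))"
    proof (rule tendsto_sandwich[where f = "\<lambda>_. 0" and h = "\<lambda>s. s"])
      show "\<forall>\<^sub>F s in at_right (0::real). s powr \<nu> \<le> s"
        unfolding eventually_at_right_field by (rule exI[of _ 1]) (use nu powr_le_self in auto)
    qed (auto intro!: tendsto_intros)
    ultimately have "((\<lambda>s. h (s powr \<nu>)) \<longlongrightarrow> h 0) (at_right (0::real))" by (rule isCont_tendsto_compose)
    then show "((\<lambda>s. f (b + s)) \<longlongrightarrow> h 0) (at_right 0)"
    proof (rule Lim_transform_eventually)
      show "\<forall>\<^sub>F s in at_right 0. h (s powr \<nu>) = f (b + s)"
        unfolding eventually_at_right_field by (rule exI[of _ \<eta>]) (use \<eta> f in auto)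
    qed
  qed simp
  define K where "K = M * \<nu>"
  have MK: "M \<le> K" "0 \<le> K" using rM nu mult_left_mono[of 1 \<nu> M] by (auto simp: K_def)
  define \<delta> where "\<delta> = min d1 (min d2 \<eta>)"
  have de: "0 < \<delta>" "\<delta> \<le> d1" "\<delta> \<le> d2" "\<delta> \<le> \<eta>" using d1 d2 \<eta> by (auto simp: \<delta>_def)
  have "exp (- (K * t)) * (s / t) powr \<nu> * (f (b + t) - f b) \<le> f (b + s) - f b \<and>
       f (b + s) - f b \<le> exp (K * t) * (s / t) powr \<nu> * (f (b + t) - f b)"
    if st: "0 < s" "s \<le> t" "t < \<delta>" for s t
  proof -
    have e: "f (b + t) = h (t powr \<nu>)" "f (b + s) = h (s powr \<nu>)" using f[of "b + t"] f[of "b + s"] st de by auto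
    have "M * t \<le> K * t" using MK st by (intro mult_right_mono) auto
    have p: "0 \<le> (s / t) powr \<nu> * (f (b + t) - f b)"
      using monoD[OF mono, of b "b + t"] st by simp
    have "exp (- (K * t)) * ((s / t) powr \<nu> * (f (b + t) - f b)) \<le> exp (- (M * t)) * ((s / t) powr \<nu> * (f (b + t) - f b))"
      "exp (M * t) * ((s / t) powr \<nu> * (f (b + t) - f b)) \<le> exp (K * t) * ((s / t) powr \<nu> * (f (b + t) - f b))"
      using \<open>M * t \<le> K * t\<close> p by (intro mult_right_mono; simp)+
    then show ?thesis using d2(2)[OF st(1,2)] st(3) de unfolding e fb by (simp add: mult.assoc)
  qed
  moreover have "\<bar>f'' x / f' x - (\<nu> - 1) / (x - b)\<bar> \<le> K" if "b < x" "x < b + \<delta>" for x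
    using d1(2)[of x] that de unfolding K_def by linarith
  ultimately show ?thesis using de(1) MK(2) by blast
qed

section \<open>From a lift of the circle map to the abstract setting\<close>

locale flat_lift =
  fixes f :: "real \<Rightarrow> real" and a b \<nu> :: real
  assumes mono_f: "mono f" and cont_f: "continuous_on UNIV f" and per_f: "\<And>x. f (x + 1) = f x + 1"
    and ab: "a < b" "b < a + 1" and fab: "f a = f b" and nu: "\<nu> > 1"
    and diffeo: "C2_diffeo_on {b<..<a + 1} f"
    and right_end: "\<exists>h N. open N \<and> 0 \<in> N \<and> C2_diffeo_on N h \<and> (\<forall>\<^sub>F x in at_right b. f x = h ((x - b) powr \<nu>))"
    and left_end: "\<exists>h N. open N \<and> 0 \<in> N \<and> C2_diffeo_on N h \<and> (\<forall>\<^sub>F x in at_left a. f x = h ((a - x) powr \<nu>))"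
begin

lemma isCont_f: "isCont f x"
  using cont_f by (simp add: continuous_on_eq_continuous_at)

lemma smooth_constants:
  "\<exists>C f' K \<delta>. profile b (a + 1) (\<nu> - 1) C f f' \<and> K \<ge> 0 \<and> \<delta> > 0 \<and>
     (\<forall>s t. 0 < s \<longrightarrow> s \<le> t \<longrightarrow> t < \<delta> \<longrightarrow>
       exp (- (K * t)) * (s / t) powr \<nu> * (f (b + t) - f b) \<le> f (b + s) - f b \<and>
       f (b + s) - f b \<le> exp (K * t) * (s / t) powr \<nu> * (f (b + t) - f b)) \<and>
     (\<forall>s t. 0 < s \<longrightarrow> s \<le> t \<longrightarrow> t < \<delta> \<longrightarrow>
       exp (- (K * t)) * (s / t) powr \<nu> * (f a - f (a - t)) \<le> f a - f (a - s) \<and>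
       f a - f (a - s) \<le> exp (K * t) * (s / t) powr \<nu> * (f a - f (a - t)))"
proof -
  define e where "e = a + 1"
  have be: "b < e" "e \<le> b + 1" using ab by (auto simp: e_def)
  obtain f' f'' where f: "\<And>x. x \<in> {b<..<e} \<Longrightarrow> (f has_real_derivative f' x) (at x)"
    "\<And>x. x \<in> {b<..<e} \<Longrightarrow> (f' has_real_derivative f'' x) (at x)" "\<And>x. x \<in> {b<..<e} \<Longrightarrow> f' x \<noteq> 0" "continuous_on {b<..<e} f''"
    using C2_diffeo_on_deriv[OF _ diffeo[folded e_def]] by (metis open_greaterThanLessThan)
  have f'p: "0 < f' x" if "x \<in> {b<..<e}" for x
  proof -
    have "mono_on UNIV f" using mono_f by (simp add: mono_on_def mono_def)
    from mono_on_imp_deriv_nonneg[OF this f(1)[OF that]] show ?thesis using f(3)[OF that] by simp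
  qed
  obtain hr Nr where hr: "open Nr" "0 \<in> Nr" "C2_diffeo_on Nr hr" "\<forall>\<^sub>F x in at_right b. f x = hr ((x - b) powr \<nu>)"
    using right_end by blast
  obtain h' h'' r M where loc: "local_C2 hr h' h'' r M" using local_C2_exists[OF hr(1-3)] by blast
  obtain y1 where y1: "y1 > b" "\<And>x. b < x \<Longrightarrow> x < y1 \<Longrightarrow> f x = hr ((x - b) powr \<nu>)"
    using hr(4) unfolding eventually_at_right_field by blast
  define n1 where "n1 = min (y1 - b) (e - b)"
  obtain K1 d1 where 1: "K1 \<ge> 0" "d1 > 0" "\<And>x. b < x \<Longrightarrow> x < b + d1 \<Longrightarrow> \<bar>f'' x / f' x - (\<nu> - 1) / (x - b)\<bar> \<le> K1"
    "\<And>s t. 0 < s \<Longrightarrow> s \<le> t \<Longrightarrow> t < d1 \<Longrightarrow>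
       exp (- (K1 * t)) * (s / t) powr \<nu> * (f (b + t) - f b) \<le> f (b + s) - f b \<and>
       f (b + s) - f b \<le> exp (K1 * t) * (s / t) powr \<nu> * (f (b + t) - f b)"
  proof -
    have "0 < n1" using y1 be by (simp add: n1_def)
    have "\<exists>K\<ge>0. \<exists>\<delta>>0. (\<forall>x. b < x \<longrightarrow> x < b + \<delta> \<longrightarrow> \<bar>f'' x / f' x - (\<nu> - 1) / (x - b)\<bar> \<le> K) \<and>
     (\<forall>s t. 0 < s \<longrightarrow> s \<le> t \<longrightarrow> t < \<delta> \<longrightarrow>
       exp (- (K * t)) * (s / t) powr \<nu> * (f (b + t) - f b) \<le> f (b + s) - f b \<and>
       f (b + s) - f b \<le> exp (K * t) * (s / t) powr \<nu> * (f (b + t) - f b))"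
    proof (rule endpoint[OF nu loc \<open>0 < n1\<close> _ _ _ isCont_f mono_f])
      fix x assume x: "b < x" "x < b + n1"
      then have xi: "x \<in> {b<..<e}" "x < y1" by (auto simp: n1_def)
      show "f x = hr ((x - b) powr \<nu>)" using y1 x xi by simp
      show "(f has_real_derivative f' x) (at x) \<and> 0 < f' x" using f f'p xi by simp
      show "(f' has_real_derivative f'' x) (at x)" using f xi by simp
    qed
    then show ?thesis using that by blast
  qed
  obtain hl Nl where hl: "open Nl" "0 \<in> Nl" "C2_diffeo_on Nl hl" "\<forall>\<^sub>F x in at_left a. f x = hl ((a - x) powr \<nu>)"
    using left_end by blast
  obtain k' k'' r2 M2 where "local_C2 hl k' k'' r2 M2" using local_C2_exists[OF hl(1-3)] by blast
  \<comment> \<open>The end \<open>a\<close> is moved to \<open>e = a + 1\<close> and treated as the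
    point \<open>- e\<close> of the reflected map \<open>F\<close>. The translation adds 1 to
    \<open>f\<close> and the reflection changes the sign, whence \<open>-1 - hl s\<close>.\<close>
  from local_C2_minus[OF this, of "-1"] have loc2: "local_C2 (\<lambda>s. -1 - hl s) (\<lambda>s. - k' s) (\<lambda>s. - k'' s) r2 M2" .
  obtain y2 where y2: "y2 < a" "\<And>x. y2 < x \<Longrightarrow> x < a \<Longrightarrow> f x = hl ((a - x) powr \<nu>)"
    using hl(4) unfolding eventually_at_left_field by blast
  define n2 where "n2 = min (a - y2) (e - b)"
  define F F1 F2 where "F x = - f (- x)" and "F1 x = f' (- x)" and "F2 x = - f'' (- x)" for x
  obtain K2 d2 where 2: "K2 \<ge> 0" "d2 > 0" "\<And>x. - e < x \<Longrightarrow> x < - e + d2 \<Longrightarrow> \<bar>F2 x / F1 x - (\<nu> - 1) / (x - (- e))\<bar> \<le> K2"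
    "\<And>s t. 0 < s \<Longrightarrow> s \<le> t \<Longrightarrow> t < d2 \<Longrightarrow>
       exp (- (K2 * t)) * (s / t) powr \<nu> * (F (- e + t) - F (- e)) \<le> F (- e + s) - F (- e) \<and>
       F (- e + s) - F (- e) \<le> exp (K2 * t) * (s / t) powr \<nu> * (F (- e + t) - F (- e))"
  proof -
    have "0 < n2" using y2 be by (simp add: n2_def)
    have "\<exists>K\<ge>0. \<exists>\<delta>>0. (\<forall>x. - e < x \<longrightarrow> x < - e + \<delta> \<longrightarrow> \<bar>F2 x / F1 x - (\<nu> - 1) / (x - (- e))\<bar> \<le> K) \<and>
     (\<forall>s t. 0 < s \<longrightarrow> s \<le> t \<longrightarrow> t < \<delta> \<longrightarrow>
       exp (- (K * t)) * (s / t) powr \<nu> * (F (- e + t) - F (- e)) \<le> F (- e + s) - F (- e) \<and>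
       F (- e + s) - F (- e) \<le> exp (K * t) * (s / t) powr \<nu> * (F (- e + t) - F (- e)))"
    proof (rule endpoint[OF nu loc2 \<open>0 < n2\<close>])
      fix x assume x: "- e < x" "x < - e + n2"
      then have xi: "- x \<in> {b<..<e}" "y2 < - x - 1" "- x - 1 < a" by (auto simp: n2_def e_def)
      have "f (- x) = f (- x - 1) + 1" using per_f[of "- x - 1"] by simp
      then show "F x = - 1 - hl ((x - (- e)) powr \<nu>)" using y2(2)[OF xi(2,3)] by (simp add: F_def e_def algebra_simps)
      show "(F has_real_derivative F1 x) (at x) \<and> 0 < F1 x"
      proof
        have "((\<lambda>x. f (- x)) has_real_derivative f' (- x) * -1) (at x)"
          by (rule DERIV_chain2[where f = f and g = uminus, OF f(1)[OF xi(1)]]) (auto intro!: derivative_eq_intros)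
        from DERIV_minus[OF this] show "(F has_real_derivative F1 x) (at x)" by (simp add: F_def[abs_def] F1_def)
        show "0 < F1 x" using f'p xi by (simp add: F1_def)
      qed
      have "((\<lambda>x. f' (- x)) has_real_derivative f'' (- x) * -1) (at x)"
        by (rule DERIV_chain2[where f = f' and g = uminus, OF f(2)[OF xi(1)]]) (auto intro!: derivative_eq_intros)
      then show "(F1 has_real_derivative F2 x) (at x)" by (simp add: F1_def[abs_def] F2_def)
    next
      show "isCont F (- e)" unfolding F_def by (intro continuous_intros isCont_o2[OF _ isCont_f])
      show "mono F" using mono_f by (auto simp: F_def mono_def)
    qed
    then show ?thesis using that by blast
  qed
  \<comment> \<open>The derivative of the logarithm of \<open>f'\<close> over the weight. The poles
    of \<open>f'' / f'\<close> at \<open>b\<close> and \<open>e\<close> cancel, so it is bounded,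
    which is the Lipschitz condition of \<open>profile\<close>.\<close>
  define g where "g x = f'' x / f' x - (\<nu> - 1) / (x - b) + (\<nu> - 1) / (e - x)" for x
  have "\<exists>M\<ge>0. \<forall>x. b < x \<longrightarrow> x < e \<longrightarrow> \<bar>g x\<bar> \<le> M"
  proof (rule bounded_on_open_interval[OF _ be(1)])
    have "continuous_on {b<..<e} f'"
      by (rule DERIV_continuous_on[where D = f'']) (use f(2) in \<open>simp add: has_field_derivative_at_within\<close>)
    then show "continuous_on {b<..<e} g" unfolding g_def using f(3,4) by (intro continuous_intros) auto
    define m where "m = (e - b) / 2"
    have m: "0 < m" using be by (simp add: m_def)
    have "\<bar>g x\<bar> \<le> K1 + (\<nu> - 1) / m" if "b < x" "x < b + min d1 m" for x
    proof -
      have mx: "m \<le> e - x"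
      proof -
        have "m + m = e - b" by (simp add: m_def)
        then show ?thesis using that by linarith
      qed
      have "0 \<le> (\<nu> - 1) / (e - x)" using mx m nu by simp
      moreover have "(\<nu> - 1) / (e - x) \<le> (\<nu> - 1) / m" using mx m nu by (intro divide_left_mono) auto
      ultimately show ?thesis using 1(3)[of x] that unfolding g_def by linarith
    qed
    then show "\<exists>M. \<exists>\<delta>>0. \<forall>x. b < x \<longrightarrow> x < b + \<delta> \<longrightarrow> \<bar>g x\<bar> \<le> M"
      using 1(2) m by (intro exI[of _ "K1 + (\<nu> - 1) / m"] exI[of _ "min d1 m"]) auto
    have "\<bar>g x\<bar> \<le> K2 + (\<nu> - 1) / m" if "e - min d2 m < x" "x < e" for x
    proof -
      have mx: "m \<le> x - b"
      proof -
        have "m + m = e - b" by (simp add: m_def)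
        then show ?thesis using that by linarith
      qed
      have "0 \<le> (\<nu> - 1) / (x - b)" using mx m nu by simp
      moreover have "(\<nu> - 1) / (x - b) \<le> (\<nu> - 1) / m" using mx m nu by (intro divide_left_mono) auto
      moreover have "\<bar>- (f'' x / f' x) - (\<nu> - 1) / (e - x)\<bar> \<le> K2" using 2(3)[of "- x"] that by (simp add: F1_def F2_def)
      ultimately show ?thesis unfolding g_def by linarith
    qed
    then show "\<exists>M. \<exists>\<delta>>0. \<forall>x. e - \<delta> < x \<longrightarrow> x < e \<longrightarrow> \<bar>g x\<bar> \<le> M"
      using 2(2) m by (intro exI[of _ "K2 + (\<nu> - 1) / m"] exI[of _ "min d2 m"]) auto
  qed
  then obtain C where C: "C \<ge> 0" "\<And>x. b < x \<Longrightarrow> x < e \<Longrightarrow> \<bar>g x\<bar> \<le> C" by blast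
  define L where "L x = ln (f' x) - (\<nu> - 1) * (ln (x - b) + ln (e - x))" for x
  have L: "ln (f' x / ((x - b) * (e - x)) powr (\<nu> - 1)) = L x" if "b < x" "x < e" for x
    using that f'p[of x] by (simp add: L_def ln_div ln_mult ln_powr)
  have "profile b e (\<nu> - 1) C f f'"
  proof
    show "b < e" "e \<le> b + 1" "0 < \<nu> - 1" "0 \<le> C" using be nu C by auto
    show "continuous_on {b..e} f" using cont_f by (rule continuous_on_subset) simp
    show "(f has_real_derivative f' x) (at x)" "0 < f' x" if "b < x" "x < e" for x using f(1) f'p that by auto
    fix x y assume xy: "b < x" "x < e" "b < y" "y < e"
    have "norm (L x - L y) \<le> C * norm (x - y)"
    proof (rule field_differentiable_bound[where S = "{b<..<e}" and f' = g])
      fix z assume z: "z \<in> {b<..<e}"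
      have l: "((\<lambda>x. ln (f' x)) has_real_derivative 1 / f' z * f'' z) (at z)"
        by (rule DERIV_chain2[where f = ln, OF DERIV_ln_divide f(2)]) (use z f'p in auto)
      have "((\<lambda>x. (\<nu> - 1) * (ln (x - b) + ln (e - x))) has_real_derivative (\<nu> - 1) * (1 / (z - b) - 1 / (e - z))) (at z)"
        using z by (auto intro!: derivative_eq_intros)
      from DERIV_diff[OF l this] have "(L has_real_derivative g z) (at z)"
        unfolding L_def[abs_def] g_def by (simp add: algebra_simps diff_divide_distrib)
      then show "(L has_field_derivative g z) (at z within {b<..<e})" by (rule has_field_derivative_at_within)
      show "norm (g z) \<le> C" using C z by simp
    qed (use xy in auto)
    then show "\<bar>ln (f' x / ((x - b) * (e - x)) powr (\<nu> - 1)) - ln (f' y / ((y - b) * (e - y)) powr (\<nu> - 1))\<bar> \<le> C * \<bar>x - y\<bar>"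
      using L xy by simp
  qed
  moreover define K where "K = max K1 K2"
  moreover define d where "d = min d1 d2"
  have nn: "0 \<le> (s / t) powr \<nu> * z" if "0 \<le> z" for s t z using that by simp
  have w: "exp (- (K * t)) * u \<le> exp (- (k * t)) * u \<and> exp (k * t) * u \<le> exp (K * t) * u" if "k \<le> K" "0 \<le> u" "0 < t" for k u t
    using that mult_right_mono[of k K t] by (auto intro!: mult_right_mono)
  have p: "0 \<le> f (b + t) - f b" "0 \<le> f a - f (a - t)" if "0 < t" for t using mono_f that by (auto simp: mono_def)
  have Fe: "F (- e + t) - F (- e) = f a - f (a - t)" for t
    using per_f[of a] per_f[of "a - t"] by (simp add: F_def e_def algebra_simps)
  have "exp (- (K * t)) * (s / t) powr \<nu> * (f (b + t) - f b) \<le> f (b + s) - f b \<and>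
       f (b + s) - f b \<le> exp (K * t) * (s / t) powr \<nu> * (f (b + t) - f b)" if "0 < s" "s \<le> t" "t < d" for s t
  proof -
    have "0 < t" "t < d1" "K1 \<le> K" using that by (auto simp: d_def K_def)
    then show ?thesis using 1(4)[OF that(1,2)] w[OF \<open>K1 \<le> K\<close> nn[OF p(1)], of t t s t] unfolding mult.assoc by linarith
  qed
  moreover have "exp (- (K * t)) * (s / t) powr \<nu> * (f a - f (a - t)) \<le> f a - f (a - s) \<and>
       f a - f (a - s) \<le> exp (K * t) * (s / t) powr \<nu> * (f a - f (a - t))" if "0 < s" "s \<le> t" "t < d" for s t
  proof -
    have "0 < t" "t < d2" "K2 \<le> K" using that by (auto simp: d_def K_def)
    then show ?thesis using 2(4)[OF that(1,2)] w[OF \<open>K2 \<le> K\<close> nn[OF p(2)], of t t s t] unfolding mult.assoc Fe by linarith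
  qed
  moreover have "0 \<le> K" "0 < d" using 1 2 by (auto simp: K_def d_def)
  ultimately show ?thesis unfolding e_def by blast
qed

lemma f_int: "f (x + of_int k) = f x + of_int k"
proof -
  have n: "f (x + of_nat n) = f x + of_nat n" for x n
  proof (induction n)
    case (Suc n)
    then show ?case using per_f[of "x + of_nat n"] by (simp add: add.assoc add.commute[of 1])
  qed simp
  show ?thesis
  proof (cases "k \<ge> 0")
    case True
    then show ?thesis using n[of x "nat k"] by simp
  next
    case False
    then show ?thesis using n[of "x + of_int k" "nat (- k)"] by simp
  qed
qed

lemma surj_f: "surj f"
proof -
  have "\<exists>x. f x = y" for y
  proof -
    define k where "k = \<lfloor>y - f 0\<rfloor>"
    have "f (0 + of_int k) \<le> y" "y \<le> f (0 + of_int (k + 1))" unfolding f_int k_def by linarith+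
    then show ?thesis using IVT'[of f "of_int k" y "of_int (k + 1)"] continuous_on_subset[OF cont_f] by auto
  qed
  then show ?thesis by (metis surjI)
qed

text \<open>At negative times \<open>inv f\<close> picks arbitrary preimages. Any choice works: the
  recursion and the order of the two ends are preserved, and the order of the whole orbit follows
  from the rotation number.\<close>

definition orb :: "real \<Rightarrow> int \<Rightarrow> real" where
  "orb x e = (if e \<ge> 0 then (f ^^ nat e) x else (inv f ^^ nat (- e)) x)"

lemma orb_step: "f (orb x e) = orb x (e + 1)"
proof -
  have "e \<ge> 0 \<or> e = - int (Suc (nat (- e - 1)))" by linarith
  then consider "e \<ge> 0" | n where "e = - int (Suc n)" by blast
  then show ?thesis
  proof cases
    case 1
    then show ?thesis by (simp add: orb_def nat_add_distrib)
  next
    case 2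
    have "nat (- e) = Suc n" using 2 by simp
    then have "f (orb x e) = (inv f ^^ n) x" using 2 surj_f by (simp add: orb_def surj_f_inv_f)
    also have "\<dots> = orb x (e + 1)" using 2 by (cases n) (auto simp: orb_def nat_add_distrib)
    finally show ?thesis .
  qed
qed

lemma orb_le: "orb a e \<le> orb b e"
proof (cases "e \<ge> 0")
  case True
  have "(f ^^ n) a \<le> (f ^^ n) b" for n by (induction n) (use ab mono_f in \<open>auto simp: mono_def\<close>)
  then show ?thesis using True by (simp add: orb_def)
next
  case False
  have "orb a (- int n) < orb b (- int n)" for n
  proof (induction n)
    case (Suc n)
    have "f (orb a (- int (Suc n))) < f (orb b (- int (Suc n)))" using Suc by (simp add: orb_step)
    then show ?case using mono_f by (meson monoD not_less)
  qed (use ab in \<open>simp add: orb_def\<close>)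
  from this[of "nat (- e)"] show ?thesis using False by simp
qed

lemma flat_exists:
  assumes irr: "\<rho> \<notin> \<rat>" and rot: "\<And>n x. \<bar>(f ^^ n) x - x - real n * \<rho>\<bar> \<le> 2"
  shows "\<exists>C C1 r0. flat f (orb a) (orb b) \<rho> \<nu> C C1 r0"
proof -
  obtain C f' K \<delta> where pr: "profile b (a + 1) (\<nu> - 1) C f f'" and K: "K \<ge> 0" "\<delta> > 0"
    and pr1: "\<forall>s t. 0 < s \<longrightarrow> s \<le> t \<longrightarrow> t < \<delta> \<longrightarrow>
       exp (- (K * t)) * (s / t) powr \<nu> * (f (b + t) - f b) \<le> f (b + s) - f b \<and>
       f (b + s) - f b \<le> exp (K * t) * (s / t) powr \<nu> * (f (b + t) - f b)"
    and pl: "\<forall>s t. 0 < s \<longrightarrow> s \<le> t \<longrightarrow> t < \<delta> \<longrightarrow>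
       exp (- (K * t)) * (s / t) powr \<nu> * (f a - f (a - t)) \<le> f a - f (a - s) \<and>
       f a - f (a - s) \<le> exp (K * t) * (s / t) powr \<nu> * (f a - f (a - t))"
    using smooth_constants by blast
  interpret p: profile b "a + 1" "\<nu> - 1" C f f' by (rule pr)
  define C' where "C' = max (2 * p.C2) K"
  define C1 where "C1 = max 1 (exp C * p.D0)"
  have C': "2 * p.C2 \<le> C'" "K \<le> C'" "0 \<le> C'" using K by (auto simp: C'_def)
  have o: "orb a 0 = a" "orb b 0 = b" "orb a 1 = f a" "orb b 1 = f b" by (simp_all add: orb_def)
  have crnn: "0 \<le> cr w x y z" "0 \<le> po w x y z" if "w < x" "x < y" "y < z" for w x y z using that by (auto simp: cr_def po_def)
  have ex: "exp (2 * p.C2 * t) \<le> exp (C' * t)" "exp (- (C' * t)) \<le> exp (- (2 * p.C2 * t))" if "0 \<le> t" for t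
    using mult_right_mono[OF C'(1) that] by auto
  have exK: "exp (K * t) \<le> exp (C' * t)" "exp (- (C' * t)) \<le> exp (- (K * t))" if "0 \<le> t" for t
    using mult_right_mono[OF C'(2) that] by auto
  have pp: "0 \<le> f (b + t) - f b" "0 \<le> f a - f (a - t)" if "0 < t" for t using mono_f that by (auto simp: mono_def)
  have "flat f (orb a) (orb b) \<rho> \<nu> C' C1 \<delta>"
  proof
    fix w x y z assume "orb b 0 \<le> w" and ord: "w < x" "x < y" "y < z" and "z \<le> orb a 0 + 1"
    then have w: "b \<le> w" "z \<le> a + 1" by (auto simp: o)
    note d = p.distortion[OF w(1) ord w(2)]
    show "cr (f w) (f x) (f y) (f z) \<le> exp (C' * (y - x)) * cr w x y z"
      by (rule order_trans[OF d(1) mult_right_mono[OF ex(1) crnn(1)[OF ord]]]) (use ord in simp)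
    show "exp (- (C' * (x - w))) * po w x y z \<le> po (f w) (f x) (f y) (f z)"
      by (rule order_trans[OF mult_right_mono[OF ex(2) crnn(2)[OF ord]] d(2)]) (use ord in simp)
    show "exp (- (C' * (z - y))) * po w x y z \<le> po (f w) (f x) (f y) (f z)"
      by (rule order_trans[OF mult_right_mono[OF ex(2) crnn(2)[OF ord]] d(3)]) (use ord in simp)
  next
    fix w x y z assume w: "orb b 0 \<le> w" "w \<le> x" "x < y" "y \<le> z" "z \<le> orb a 0 + 1"
    have "f y - f x \<le> exp C * p.D0 * ((y - x) / (z - w)) * (f z - f w)" using w by (intro p.doubling) (auto simp: o)
    also have "\<dots> \<le> C1 * ((y - x) / (z - w)) * (f z - f w)"
      using w monoD[OF mono_f, of w z] by (intro mult_right_mono) (auto simp: C1_def)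
    finally show "f y - f x \<le> C1 * ((y - x) / (z - w)) * (f z - f w)" .
  next
    fix x y assume "orb b 0 \<le> x" "x < y" "y \<le> orb a 0 + 1"
    then show "f x < f y" using p.incf by (simp add: o)
  next
    fix s t :: real assume st: "0 < s" "s \<le> t" "t < \<delta>"
    have t: "0 < t" using st by simp
    have w: "exp (- (C' * t)) * u \<le> exp (- (K * t)) * u" "exp (K * t) * u \<le> exp (C' * t) * u" if "0 \<le> u" for u
      using that exK[of t] t by (auto intro!: mult_right_mono)
    have u: "0 \<le> (s / t) powr \<nu> * (f (b + t) - f b)" "0 \<le> (s / t) powr \<nu> * (f a - f (a - t))" using pp[OF t] by auto
    show "exp (- (C' * t)) * (s / t) powr \<nu> * (f (orb b 0 + t) - orb a 1) \<le> f (orb b 0 + s) - orb a 1 \<and>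
        f (orb b 0 + s) - orb a 1 \<le> exp (C' * t) * (s / t) powr \<nu> * (f (orb b 0 + t) - orb a 1)"
      using pr1[rule_format, OF st] w[OF u(1)] unfolding o fab mult.assoc by linarith
    show "exp (- (C' * t)) * (s / t) powr \<nu> * (orb a 1 - f (orb a 0 - t)) \<le> orb a 1 - f (orb a 0 - s) \<and>
        orb a 1 - f (orb a 0 - s) \<le> exp (C' * t) * (s / t) powr \<nu> * (orb a 1 - f (orb a 0 - t))"
      using pl[rule_format, OF st] w[OF u(2)] unfolding o mult.assoc by linarith
  qed (use mono_f per_f ab orb_step orb_le irr rot nu C' K surj_f fab in \<open>auto simp: o C1_def\<close>)
  then show ?thesis by blast
qed

end

section \<open>Rotation numbers through lifts\<close>

lemma translation_number_exists:
  fixes f :: "real \<Rightarrow> real"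
  assumes mono: "mono f" and per: "\<And>x. f (x + 1) = f x + 1"
  shows "\<exists>R. \<forall>n x. \<bar>(f ^^ n) x - x - real n * R\<bar> \<le> 2"
proof -
  define a where "a n = (f ^^ n) 0" for n
  have im: "(f ^^ n) x \<le> (f ^^ n) y" if "x \<le> y" for n x y
    by (induction n) (use that mono in \<open>auto simp: mono_def\<close>)
  have i1: "(f ^^ n) (x + 1) = (f ^^ n) x + 1" for n x by (induction n) (auto simp: per)
  have inat: "(f ^^ n) (x + real k) = (f ^^ n) x + real k" for n x k
  proof (induction k)
    case (Suc k)
    then show ?case using i1[of n "x + real k"] by (simp add: add_ac)
  qed simp
  have iint: "(f ^^ n) (of_int k) = a n + of_int k" for n k
  proof (cases "k \<ge> 0")
    case True
    then show ?thesis using inat[of n 0 "nat k"] by (simp add: a_def)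
  next
    case False
    then show ?thesis using inat[of n "of_int k" "nat (- k)"] by (simp add: a_def)
  qed
  have osc: "\<bar>(f ^^ n) x - x - a n\<bar> \<le> 1" for n x
  proof -
    have "(f ^^ n) (of_int \<lfloor>x\<rfloor>) \<le> (f ^^ n) x" "(f ^^ n) x \<le> (f ^^ n) (of_int (\<lfloor>x\<rfloor> + 1))"
      by (intro im; linarith)+
    then have "a n + of_int \<lfloor>x\<rfloor> \<le> (f ^^ n) x" "(f ^^ n) x \<le> a n + of_int \<lfloor>x\<rfloor> + 1" unfolding iint by auto
    moreover have "of_int \<lfloor>x\<rfloor> \<le> x" "x < of_int \<lfloor>x\<rfloor> + 1" by linarith+
    ultimately show ?thesis by linarith
  qed
  have mul: "\<bar>a (m * n) - real n * a m\<bar> \<le> real n" for m n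
  proof (induction n)
    case 0
    then show ?case by (simp add: a_def)
  next
    case (Suc n)
    have "a (m * Suc n) = (f ^^ m) (a (m * n))" by (simp add: a_def funpow_add)
    then have "\<bar>a (m * Suc n) - a (m * n) - a m\<bar> \<le> 1" using osc[of m "a (m * n)"] by simp
    moreover have "real (Suc n) * a m = real n * a m + a m" by (simp add: algebra_simps)
    ultimately show ?case using Suc by (simp add: abs_le_iff)
  qed
  have cmp: "(a m - 1) / real m \<le> (a n + 1) / real n" if "m \<ge> 1" "n \<ge> 1" for m n
  proof -
    have "real n * a m - real n \<le> real m * a n + real m" using mul[of m n] mul[of n m] by (simp add: abs_le_iff mult.commute)
    then show ?thesis using that by (simp add: field_simps)
  qed
  \<comment> \<open>By \<open>cmp\<close> each \<open>(a m - 1) / m\<close> is below each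
    \<open>(a n + 1) / n\<close>, and the supremum separates the two families. This gives an error
    of 1 for the orbit of \<open>0\<close>; passing to the orbit of \<open>x\<close> adds another
    1.\<close>
  define R where "R = (SUP m\<in>{1..}. (a m - 1) / real m)"
  have R: "(a n - 1) / real n \<le> R \<and> R \<le> (a n + 1) / real n" if "n \<ge> 1" for n
    unfolding R_def
    by (intro conjI cSUP_upper cSUP_least) (use that cmp in \<open>auto intro!: bdd_aboveI2[of _ _ "(a n + 1) / real n"]\<close>)
  have "\<bar>(f ^^ n) x - x - real n * R\<bar> \<le> 2" for n x
  proof (cases "n = 0")
    case False
    then have "a n - 1 \<le> real n * R" "real n * R \<le> a n + 1" using R[of n] by (auto simp: field_simps)
    then show ?thesis using osc[of n x] by (simp add: abs_le_iff)
  qed simp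
  then show ?thesis by blast
qed

lemma translation_number_limit:
  fixes g :: "nat \<Rightarrow> real"
  assumes "\<And>n. \<bar>g n - x - real n * R\<bar> \<le> 2"
  shows "(\<lambda>n. g n / real n) \<longlonglongrightarrow> R"
proof -
  have "(\<lambda>n. g n / real n - R) \<longlonglongrightarrow> 0"
  proof (rule Lim_null_comparison)
    show "\<forall>\<^sub>F n in sequentially. norm (g n / real n - R) \<le> (2 + \<bar>x\<bar>) / real n"
      unfolding eventually_sequentially
    proof (intro exI allI impI)
      fix n :: nat assume "1 \<le> n"
      then have "g n / real n - R = (g n - real n * R) / real n" by (simp add: field_simps)
      moreover have "\<bar>g n - real n * R\<bar> \<le> 2 + \<bar>x\<bar>" using assms[of n] by linarith
      ultimately show "norm (g n / real n - R) \<le> (2 + \<bar>x\<bar>) / real n" by (simp add: abs_divide divide_right_mono)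
    qed
    show "(\<lambda>n. (2 + \<bar>x\<bar>) / real n) \<longlonglongrightarrow> 0" by (rule lim_const_over_n)
  qed
  then show ?thesis by (simp add: LIM_zero_iff)
qed

lemma circ_eq_iff: "circ x = circ y \<longleftrightarrow> (\<exists>k::int. x = y + of_int k)"
proof
  assume "circ x = circ y"
  then obtain n :: int where "\<i> * of_real (2 * pi * x) = \<i> * of_real (2 * pi * y) + (of_int (2 * n) * pi) * \<i>"
    unfolding circ_def cis_conv_exp exp_eq by blast
  then have "Im (\<i> * of_real (2 * pi * x)) = Im (\<i> * of_real (2 * pi * y) + (of_int (2 * n) * pi) * \<i>)" by (rule arg_cong)
  then have "pi * (2 * x) = pi * (2 * (y + of_int n))" by (simp add: algebra_simps)
  then have "x = y + of_int n" unfolding mult_cancel_left by simp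
  then show "\<exists>k::int. x = y + of_int k" by blast
next
  assume "\<exists>k::int. x = y + of_int k"
  then obtain k :: int where k: "x = y + of_int k" by blast
  have e: "cis (2 * pi * (y + of_int k)) = cis (2 * pi * y) * cis (2 * pi * of_int k)" by (simp only: cis_mult distrib_left)
  have "cis (2 * pi * of_int k) = 1" by (rule cis_multiple_2pi) simp
  then show "circ x = circ y" by (simp only: circ_def k e mult_1_right)
qed

lemma circle_lift_unique:
  assumes "circle_lift F f" "circle_lift F g"
  obtains k :: int where "\<And>x. g x = f x + of_int k"
proof -
  have "\<exists>k::int. g x - f x = of_int k" for x
  proof -
    have "circ (g x) = circ (f x)" using assms by (metis circle_lift_def)
    then show ?thesis by (auto simp: circ_eq_iff)
  qed
  then obtain k where k: "\<And>x. g x - f x = of_int (k x)" by metis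
  have "(\<lambda>x. g x - f x) constant_on UNIV"
  proof (rule continuous_discrete_range_constant)
    show "continuous_on UNIV (\<lambda>x. g x - f x)" using assms by (intro continuous_intros) (auto simp: circle_lift_def)
    fix x
    show "\<exists>e>0. \<forall>y. y \<in> UNIV \<and> g y - f y \<noteq> g x - f x \<longrightarrow> e \<le> norm (g y - f y - (g x - f x))"
    proof (intro exI[of _ 1] conjI allI impI)
      fix y assume "y \<in> UNIV \<and> g y - f y \<noteq> g x - f x"
      then have "1 \<le> \<bar>k y - k x\<bar>" unfolding k by auto
      then have "1 \<le> \<bar>real_of_int (k y - k x)\<bar>" by linarith
      then show "1 \<le> norm (g y - f y - (g x - f x))" unfolding k by simp
    qed simp
  qed simp
  then have "g x - f x = of_int (k 0)" for x using k[of 0] unfolding constant_on_def by (metis UNIV_I)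
  then show ?thesis using that[of "k 0"] by (metis add.commute diff_add_cancel)
qed

lemma rotation_number_lift:
  assumes "monotone_degree_one F"
  obtains f where "circle_lift F f" "mono f" "\<And>x. f (x + 1) = f x + 1"
    "\<And>n x. \<bar>(f ^^ n) x - x - real n * rotation_number F\<bar> \<le> 2" "0 \<le> rotation_number F" "rotation_number F < 1"
proof -
  obtain g where g: "circle_lift F g" "mono g" "\<And>x. g (x + 1) = g x + 1"
    using assms by (auto simp: monotone_degree_one_def)
  obtain R where R: "\<And>n x. \<bar>(g ^^ n) x - x - real n * R\<bar> \<le> 2" using translation_number_exists[OF g(2,3)] by blast
  have gnat: "g (x + real k) = g x + real k" for x k
  proof (induction k)
    case (Suc k)
    then show ?case using g(3)[of "x + real k"] by (simp add: add_ac)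
  qed simp
  have gint: "g (x + of_int k) = g x + of_int k" for x k
  proof (cases "k \<ge> 0")
    case True
    then show ?thesis using gnat[of x "nat k"] by simp
  next
    case False
    then show ?thesis using gnat[of "x + of_int k" "nat (- k)"] by simp
  qed
  have itn: "((\<lambda>x. g x + of_int k) ^^ n) x = (g ^^ n) x + real n * of_int k" for n k x
  proof (induction n)
    case (Suc n)
    have "g ((g ^^ n) x + of_int (int n * k)) = g ((g ^^ n) x) + of_int (int n * k)" by (rule gint)
    then show ?case using Suc by (simp add: algebra_simps)
  qed simp
  have shift: "\<bar>((\<lambda>x. g x + of_int k) ^^ n) x - x - real n * (R + of_int k)\<bar> \<le> 2" for k n x
    using R[of n x] unfolding itn by (simp add: algebra_simps)
  have lim: "\<exists>k::int. (\<lambda>n. (h ^^ n) x / real n) \<longlonglongrightarrow> frac R + of_int k" if h: "circle_lift F h" for h x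
  proof -
    obtain k :: int where k: "\<And>x. h x = g x + of_int k" using circle_lift_unique[OF g(1) h] by blast
    have "h = (\<lambda>x. g x + of_int k)" using k by auto
    then have "(\<lambda>n. (h ^^ n) x / real n) \<longlonglongrightarrow> R + of_int k" using translation_number_limit[OF shift[of _ k x]] by simp
    moreover have "R + of_int k = frac R + of_int (k + \<lfloor>R\<rfloor>)" by (simp add: frac_def)
    ultimately show ?thesis by metis
  qed
  have rn: "rotation_number F = frac R"
    unfolding rotation_number_def
  proof (rule the_equality)
    show "0 \<le> frac R \<and> frac R < 1 \<and> (\<forall>f x. circle_lift F f \<longrightarrow> (\<exists>k::int. (\<lambda>n. (f ^^ n) x / real n) \<longlonglongrightarrow> frac R + of_int k))"
      using lim by (simp add: frac_lt_1)
    fix \<rho> assume rho: "0 \<le> \<rho> \<and> \<rho> < 1 \<and> (\<forall>f x. circle_lift F f \<longrightarrow> (\<exists>k::int. (\<lambda>n. (f ^^ n) x / real n) \<longlonglongrightarrow> \<rho> + of_int k))"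
    then obtain k :: int where k: "(\<lambda>n. (g ^^ n) 0 / real n) \<longlonglongrightarrow> \<rho> + of_int k" using g(1) by blast
    have "\<rho> + of_int k = R" by (rule LIMSEQ_unique[OF k translation_number_limit[OF R[of _ 0]]])
    then have "frac R = frac (\<rho> + of_int k)" by simp
    also have "\<dots> = frac \<rho>" by simp
    also have "\<dots> = \<rho>" using rho by (simp add: frac_eq)
    finally show "\<rho> = frac R" by simp
  qed
  \<comment> \<open>Among all lifts, the one whose translation number is the representative in
    \<open>[0, 1)\<close>.\<close>
  define f where "f = (\<lambda>x. g x + of_int (- \<lfloor>R\<rfloor>))"
  show ?thesis
  proof (rule that)
    have "circ (f x) = circ (g x)" for x unfolding f_def circ_eq_iff by blast
    then show "circle_lift F f" using g(1) by (auto simp: circle_lift_def f_def intro!: continuous_intros)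
    show "mono f" using g(2) by (auto simp: f_def mono_def)
    show "f (x + 1) = f x + 1" for x using g(3) by (simp add: f_def)
    have "frac R = R + of_int (- \<lfloor>R\<rfloor>)" by (simp add: frac_def)
    then show "\<bar>(f ^^ n) x - x - real n * rotation_number F\<bar> \<le> 2" for n x
      using shift[of n "- \<lfloor>R\<rfloor>" x] unfolding rn f_def by simp
    show "0 \<le> rotation_number F" "rotation_number F < 1" unfolding rn by (auto simp: frac_lt_1)
  qed
qed

section \<open>Continued fraction of the rotation number\<close>

fun cf_num :: "real \<Rightarrow> nat \<Rightarrow> int" where
  "cf_num x 0 = 0"
| "cf_num x (Suc 0) = 1"
| "cf_num x (Suc (Suc n)) = cf_coeff x (Suc (Suc n)) * cf_num x (Suc n) + cf_num x n"

context
  fixes \<rho> :: real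
  assumes irr: "\<rho> \<notin> \<rat>" and r01: "0 < \<rho>" "\<rho> < 1"
begin

lemma frac_cf_quot: "cf_quot \<rho> n \<notin> \<rat> \<and> 0 < frac (cf_quot \<rho> n)"
proof (induction n)
  case 0
  then show ?case using irr by (auto simp: frac_gt_0_iff Ints_subset_Rats[THEN subsetD])
next
  case (Suc n)
  have "frac (cf_quot \<rho> n) \<notin> \<rat>"
  proof
    assume "frac (cf_quot \<rho> n) \<in> \<rat>"
    then have "frac (cf_quot \<rho> n) + of_int \<lfloor>cf_quot \<rho> n\<rfloor> \<in> \<rat>" by (intro Rats_add Rats_of_int)
    then show False using Suc by (simp add: frac_def)
  qed
  then have "1 / frac (cf_quot \<rho> n) \<notin> \<rat>" using Rats_inverse by (metis inverse_eq_divide inverse_inverse_eq)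
  then show ?case by (auto simp: frac_gt_0_iff Ints_subset_Rats[THEN subsetD])
qed

lemma cf_coeff_pos: "1 \<le> cf_coeff \<rho> (Suc n)"
proof -
  have "1 \<le> cf_quot \<rho> (Suc n)" using frac_cf_quot[of n] frac_lt_1[of "cf_quot \<rho> n"] by simp
  then show ?thesis by (simp add: cf_coeff_def le_floor_iff)
qed

lemma int_cf_denom:
  "int (cf_denom \<rho> 0) = 1" "int (cf_denom \<rho> 1) = cf_coeff \<rho> 1"
  "int (cf_denom \<rho> (Suc (Suc n))) = cf_coeff \<rho> (Suc (Suc n)) * int (cf_denom \<rho> (Suc n)) + int (cf_denom \<rho> n)"
  using cf_coeff_pos[of 0] cf_coeff_pos[of "Suc n"] by simp_all

text \<open>The factor is a fractional part, strictly between 0 and 1, so the errors alternate in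
  sign and never vanish. The numerators start with 0 and 1 because \<open>\<rho>\<close> has integer
  part 0.\<close>

lemma cf_error:
  "of_int (int (cf_denom \<rho> (Suc n))) * \<rho> - of_int (cf_num \<rho> (Suc n)) =
    - (of_int (int (cf_denom \<rho> n)) * \<rho> - of_int (cf_num \<rho> n)) * frac (cf_quot \<rho> (Suc n))"
proof (induction n)
  case 0
  have "frac \<rho> = \<rho>" using r01 by (simp add: frac_eq)
  then have "cf_quot \<rho> 1 = 1 / \<rho>" by simp
  then have "frac (cf_quot \<rho> 1) = 1 / \<rho> - of_int (cf_coeff \<rho> 1)" by (simp add: frac_def cf_coeff_def)
  then show ?case using int_cf_denom(1,2) r01 by (simp add: field_simps)
next
  case (Suc n)
  define x where "x = cf_quot \<rho> (Suc (Suc n))"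
  define v where "v k = of_int (int (cf_denom \<rho> k)) * \<rho> - of_int (cf_num \<rho> k)" for k
  define y where "y = frac (cf_quot \<rho> (Suc n))"
  have xy: "x * y = 1" using frac_cf_quot[of "Suc n"] by (simp add: x_def y_def)
  have sv: "v (Suc n) = - v n * y" using Suc unfolding v_def y_def .
  have "v n = v n * (x * y)" by (simp add: xy)
  also have "\<dots> = - (v (Suc n)) * x" by (simp add: sv)
  finally have vn: "v n = - (v (Suc n)) * x" .
  have "v (Suc (Suc n)) = of_int (cf_coeff \<rho> (Suc (Suc n))) * v (Suc n) + v n"
    unfolding v_def int_cf_denom(3) by (simp add: algebra_simps)
  also have "\<dots> = - (v (Suc n)) * frac x" unfolding vn by (simp add: frac_def cf_coeff_def x_def algebra_simps)
  finally show ?case by (simp add: v_def x_def)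
qed

lemma cf_error_ne: "of_int (int (cf_denom \<rho> n)) * \<rho> - of_int (cf_num \<rho> n) \<noteq> 0"
proof (induction n)
  case (Suc n)
  then show ?case unfolding cf_error using frac_cf_quot[of "Suc n"] by simp
qed (use r01 in simp)

text \<open>\<open>aa n\<close> leads from levels \<open>n\<close> and \<open>n + 1\<close> to level
  \<open>n + 2\<close>, hence the shift of the partial quotients by two.\<close>

lemma cfflat_exists:
  assumes "flat f A B \<rho> \<nu> C C1 r0"
  shows "cfflat f A B \<rho> \<nu> C C1 r0 (\<lambda>n. int (cf_denom \<rho> n)) (cf_num \<rho>) (\<lambda>n. cf_coeff \<rho> (Suc (Suc n)))"
proof -
  interpret flat f A B \<rho> \<nu> C C1 r0 by fact
  show ?thesis
  proof
    show "int (cf_denom \<rho> (Suc (Suc n))) = cf_coeff \<rho> (Suc (Suc n)) * int (cf_denom \<rho> (Suc n)) + int (cf_denom \<rho> n)" for n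
      by (rule int_cf_denom(3))
    show "cf_num \<rho> (Suc (Suc n)) = cf_coeff \<rho> (Suc (Suc n)) * cf_num \<rho> (Suc n) + cf_num \<rho> n" for n by simp
    show "1 \<le> cf_coeff \<rho> (Suc (Suc n))" for n by (rule cf_coeff_pos)
    show "1 \<le> int (cf_denom \<rho> 0)" by simp
    show "1 \<le> int (cf_denom \<rho> 1)" using int_cf_denom(2) cf_coeff_pos[of 0] by simp
    show "(of_int (int (cf_denom \<rho> n)) * \<rho> - of_int (cf_num \<rho> n)) * (of_int (int (cf_denom \<rho> (Suc n))) * \<rho> - of_int (cf_num \<rho> (Suc n))) < 0" for n
    proof -
      define v where "v = of_int (int (cf_denom \<rho> n)) * \<rho> - of_int (cf_num \<rho> n)"
      have "0 < v * v" using cf_error_ne[of n, folded v_def] by (auto simp: zero_less_mult_iff neq_iff)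
      then have "0 < v * v * frac (cf_quot \<rho> (Suc n))" using frac_cf_quot[of "Suc n"] by (metis mult_pos_pos)
      then show ?thesis unfolding cf_error v_def[symmetric] by (simp add: mult_ac del: cf_quot.simps)
    qed
    show "\<bar>int (cf_denom \<rho> n) * cf_num \<rho> (Suc n) - int (cf_denom \<rho> (Suc n)) * cf_num \<rho> n\<bar> = 1" for n
    proof (induction n)
      case (Suc n)
      have "int (cf_denom \<rho> (Suc n)) * cf_num \<rho> (Suc (Suc n)) - int (cf_denom \<rho> (Suc (Suc n))) * cf_num \<rho> (Suc n) =
        - (int (cf_denom \<rho> n) * cf_num \<rho> (Suc n) - int (cf_denom \<rho> (Suc n)) * cf_num \<rho> n)"
        unfolding int_cf_denom(3) by (simp add: algebra_simps)
      then show ?case using Suc by linarith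
    qed simp
    show "\<bar>of_int (int (cf_denom \<rho> 0)) * \<rho> - of_int (cf_num \<rho> 0)\<bar> < 1" using r01 by simp
  qed
qed

lemma bounded_type_coeff:
  assumes "bounded_type \<rho>"
  obtains c where "\<And>n. cf_coeff \<rho> (Suc (Suc n)) \<le> c"
proof -
  obtain K where K: "\<forall>n\<ge>1. real (cf_denom \<rho> n) / real (cf_denom \<rho> (n - 1)) \<le> K" using assms by (auto simp: bounded_type_def)
  have dp: "0 < cf_denom \<rho> n" for n
  proof (induction n rule: induct_nat_012)
    case 1
    then show ?case using int_cf_denom(2) cf_coeff_pos[of 0] by simp
  qed auto
  have "cf_coeff \<rho> (Suc (Suc n)) \<le> \<lceil>K\<rceil>" for n
  proof -
    have p: "0 < real (cf_denom \<rho> (Suc n))" using dp by simp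
    have "real_of_int (cf_coeff \<rho> (Suc (Suc n))) * real (cf_denom \<rho> (Suc n)) \<le> real_of_int (int (cf_denom \<rho> (Suc (Suc n))))"
      unfolding int_cf_denom(3) by simp
    also have "\<dots> \<le> K * real (cf_denom \<rho> (Suc n))" using K[rule_format, of "Suc (Suc n)"] p by (simp add: pos_divide_le_eq del: cf_denom.simps)
    finally have "real_of_int (cf_coeff \<rho> (Suc (Suc n))) \<le> K" using p by simp
    then show ?thesis by linarith
  qed
  then show ?thesis by (rule that)
qed

end

section \<open>Distances on the circle\<close>

lemma circle_dist_circ: "\<exists>k::int. circle_dist (circ x) (circ y) = \<bar>x - y + of_int k\<bar>"
proof -
  define z where "z = circ x / circ y"
  have z: "z = circ (x - y)" by (simp add: z_def circ_def cis_divide right_diff_distrib)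
  then have z0: "z \<noteq> 0" "sgn z = z" by (simp_all add: circ_def sgn_eq)
  have "circ (Arg z / (2 * pi)) = circ (x - y)" using cis_Arg[OF z0(1)] z0 z by (simp add: circ_def)
  then obtain k :: int where "Arg z / (2 * pi) = x - y + of_int k" unfolding circ_eq_iff by blast
  moreover have "circle_dist (circ x) (circ y) = \<bar>Arg z / (2 * pi)\<bar>" by (simp add: circle_dist_def z_def)
  ultimately show ?thesis by metis
qed

lemma circle_dist_eq:
  assumes "\<bar>x - y\<bar> < 1 / 2"
  shows "circle_dist (circ x) (circ y) = \<bar>x - y\<bar>"
proof -
  have "circ x / circ y = cis (2 * pi * (x - y))" by (simp add: circ_def cis_divide right_diff_distrib)
  moreover have "2 * pi * (x - y) \<in> {-pi<..pi}"
  proof -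
    have "(2 * pi) * (x - y) < (2 * pi) * (1 / 2)" "(2 * pi) * (- (1 / 2)) < (2 * pi) * (x - y)"
      using assms by (intro mult_strict_left_mono; simp add: abs_less_iff; linarith)+
    then show ?thesis by simp
  qed
  ultimately have "Arg (circ x / circ y) = 2 * pi * (x - y)" by (simp only: Arg_cis)
  then show ?thesis by (simp add: circle_dist_def abs_mult)
qed

text \<open>The condition \<open>2 * d < 1 - (b - a)\<close> makes the way round the other side of
  the circle longer than \<open>d\<close>.\<close>

lemma circle_setdist_arc:
  assumes ab: "a < b" and d: "0 < d" "2 * d < 1 - (b - a)" and y: "y = b + d \<or> y = a - d"
  shows "circle_setdist (circ ` {a<..<b}) {circ y} = d"
proof -
  define S where "S = circ ` {a<..<b} \<times> {circ y}"
  have low: "d \<le> circle_dist z w" if zw: "(z, w) \<in> S" for z w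
  proof -
    obtain x where x: "a < x" "x < b" "z = circ x" "w = circ y" using zw by (auto simp: S_def)
    obtain k :: int where k: "circle_dist (circ x) (circ y) = \<bar>x - y + of_int k\<bar>" using circle_dist_circ by blast
    consider "k \<le> -1" | "k = 0" | "k \<ge> 1" by linarith
    then have "d \<le> \<bar>x - y + of_int k\<bar>"
    proof cases
      case 1
      then have "real_of_int k \<le> -1" by linarith
      then have "d \<le> - (x - y + of_int k)" using x y d by (elim disjE) linarith+
      then show ?thesis by linarith
    next
      case 3
      then have "1 \<le> real_of_int k" by linarith
      then have "d \<le> x - y + of_int k" using x y d by (elim disjE) linarith+
      then show ?thesis by linarith
    qed (use x y d in \<open>auto simp: abs_if\<close>)
    then show ?thesis using k x by simp
  qed
  have ne: "S \<noteq> {}" using dense[OF ab] by (auto simp: S_def)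
  have Inf_eq: "circle_setdist (circ ` {a<..<b}) {circ y} = (INF p\<in>S. case p of (z, w) \<Rightarrow> circle_dist z w)"
    by (simp add: circle_setdist_def S_def)
  have bd: "bdd_below ((\<lambda>(z, w). circle_dist z w) ` S)" using low by (intro bdd_belowI2[of _ d]) auto
  show ?thesis
  proof (rule antisym)
    show "d \<le> circle_setdist (circ ` {a<..<b}) {circ y}"
      unfolding Inf_eq by (rule cINF_greatest[OF ne]) (use low in auto)
    show "circle_setdist (circ ` {a<..<b}) {circ y} \<le> d"
    proof (rule field_le_epsilon)
      fix e :: real assume e: "e > 0"
      \<comment> \<open>The arc is open, so the infimum is only approached, by points at depth
        \<open>h\<close> inside it. The last bound keeps \<open>d + h\<close> below one half, where
        distances on the circle and on the line agree.\<close>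
      define h where "h = min e (min ((b - a) / 2) ((1 / 2 - d) / 2))"
      have "d < 1 / 2" using d ab by simp
      then have h: "0 < h" "h \<le> e" "h < b - a" "h < 1 / 2 - d" using e ab by (auto simp: h_def min_less_iff_disj)
      obtain x where x: "a < x" "x < b" "\<bar>x - y\<bar> = d + h"
      proof (cases "y = b + d")
        case True
        show ?thesis by (rule that[of "b - h"]) (use True h d in auto)
      next
        case False
        then have "y = a - d" using y by simp
        then show ?thesis by (intro that[of "a + h"]) (use h d in auto)
      qed
      have "circle_setdist (circ ` {a<..<b}) {circ y} \<le> (case (circ x, circ y) of (z, w) \<Rightarrow> circle_dist z w)"
        unfolding Inf_eq by (rule cINF_lower[OF bd]) (use x in \<open>auto simp: S_def\<close>)
      also have "\<dots> = d + h" using circle_dist_eq[of x y] x h by simp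
      finally show "circle_setdist (circ ` {a<..<b}) {circ y} \<le> d + e" using h by simp
    qed
  qed
qed

lemma lift_iterate:
  assumes "circle_lift F f"
  shows "(F ^^ n) (circ x) = circ ((f ^^ n) x)"
  by (induction n) (use assms in \<open>auto simp: circle_lift_def\<close>)

text \<open>Since \<open>F\<close> is constant on the arc, \<open>f\<close> can change only by
  integers there. Continuity makes it constant and extends this to both ends.\<close>

lemma lift_constant_on_flat_spot:
  assumes lift: "circle_lift F f" and ab: "a < b" and c: "F ` circ ` {a<..<b} = {c}" and x: "x \<in> {a..b}"
  shows "f x = f a"
proof -
  have cont: "continuous_on UNIV f" using lift by (simp add: circle_lift_def)
  have Fc: "F (circ x) = c" if "x \<in> {a<..<b}" for x
  proof -
    have "F (circ x) \<in> F ` circ ` {a<..<b}" by (intro imageI that)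
    then show ?thesis by (simp only: c singleton_iff)
  qed
  have "\<exists>k::int. f x - f ((a + b) / 2) = of_int k" if "x \<in> {a<..<b}" for x
  proof -
    have "(a + b) / 2 \<in> {a<..<b}" using ab by simp
    then have "F (circ x) = F (circ ((a + b) / 2))" using Fc that by metis
    then have "circ (f x) = circ (f ((a + b) / 2))" using lift by (simp add: circle_lift_def)
    then show ?thesis by (auto simp: circ_eq_iff)
  qed
  then have k: "\<forall>x\<in>{a<..<b}. f x - f ((a + b) / 2) \<in> \<int>" by (metis Ints_of_int)
  have "f constant_on {a<..<b}"
  proof (rule continuous_discrete_range_constant)
    show "continuous_on {a<..<b} f" using cont by (rule continuous_on_subset) simp
    fix x assume x: "x \<in> {a<..<b}"
    show "\<exists>e>0. \<forall>y. y \<in> {a<..<b} \<and> f y \<noteq> f x \<longrightarrow> e \<le> norm (f y - f x)"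
    proof (intro exI[of _ 1] conjI allI impI)
      fix y assume y: "y \<in> {a<..<b} \<and> f y \<noteq> f x"
      have "(f y - f ((a + b) / 2)) - (f x - f ((a + b) / 2)) \<in> \<int>" using Ints_diff[OF bspec[OF k] bspec[OF k]] x y by blast
      then obtain j :: int where j: "f y - f x = of_int j" by (auto elim: Ints_cases)
      then have "1 \<le> \<bar>j\<bar>" using y by auto
      then have "1 \<le> \<bar>real_of_int j\<bar>" by linarith
      then show "1 \<le> norm (f y - f x)" using j by simp
    qed simp
  qed simp
  then obtain w where w: "\<And>x. x \<in> {a<..<b} \<Longrightarrow> f x = w" by (auto simp: constant_on_def)
  have cl: "continuous_on (closure {a<..<b}) f" using cont by (rule continuous_on_subset) simp
  have "f x = w" if "x \<in> closure {a<..<b}" for x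
    by (rule continuous_constant_on_closure[OF cl w that])
  then show ?thesis using x ab by simp
qed

theorem theorem2:
  fixes F :: "complex \<Rightarrow> complex" and U :: "complex set" and \<nu> :: real
  assumes "\<nu> > 1"
    and "almost_smooth_flat F U \<nu> \<nu>"
    and "rotation_number F \<notin> \<rat>"
  shows "(\<nu> \<le> 2 \<longrightarrow> sigma_ratio F U \<longlonglongrightarrow> 0) \<and>
         (\<nu> > 2 \<and> bounded_type (rotation_number F) \<longrightarrow>
            liminf (\<lambda>n. ereal (sigma_ratio F U n)) > 0)"
proof -
  define \<rho> where "\<rho> = rotation_number F"
  have mdo: "monotone_degree_one F" using assms(2) by (simp add: almost_smooth_flat_def)
  from rotation_number_lift[OF mdo] obtain f where lift: "circle_lift F f" and mono: "mono f" and per: "\<And>x. f (x + 1) = f x + 1"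
    and rot: "\<And>n x. \<bar>(f ^^ n) x - x - real n * \<rho>\<bar> \<le> 2" and r01: "0 \<le> \<rho>" "\<rho> < 1" unfolding \<rho>_def by blast
  have irr: "\<rho> \<notin> \<rat>" using assms(3) by (simp add: \<rho>_def)
  then have r0: "0 < \<rho>" using r01 by (metis Rats_0 order_le_less)
  obtain a b where arc: "arc_lift U a b" using assms(2) by (auto simp: almost_smooth_flat_def)
  then have ab: "a < b" "b < a + 1" and U: "U = circ ` {a<..<b}" by (auto simp: arc_lift_def)
  obtain c where c: "F ` U = {c}" using assms(2) by (auto simp: almost_smooth_flat_def)
  have flatf: "f x = f a" if "x \<in> {a..b}" for x
    by (rule lift_constant_on_flat_spot[OF lift ab(1) c[unfolded U] that])
  interpret l: flat_lift f a b \<nu>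
  proof
    show "continuous_on UNIV f" using lift by (simp add: circle_lift_def)
    show "f a = f b" using flatf[of b] ab by simp
    show "C2_diffeo_on {b<..<a + 1} f"
      "\<exists>h N. open N \<and> 0 \<in> N \<and> C2_diffeo_on N h \<and> (\<forall>\<^sub>F x in at_right b. f x = h ((x - b) powr \<nu>))"
      "\<exists>h N. open N \<and> 0 \<in> N \<and> C2_diffeo_on N h \<and> (\<forall>\<^sub>F x in at_left a. f x = h ((a - x) powr \<nu>))"
      using assms(2) lift arc unfolding almost_smooth_flat_def by blast+
  qed (use mono per ab assms(1) in auto)
  obtain C C1 r where "flat f (l.orb a) (l.orb b) \<rho> \<nu> C C1 r" using l.flat_exists[OF irr rot] by blast
  from cfflat_exists[OF irr r0 r01(2) this]
  interpret c: cfflat f "l.orb a" "l.orb b" \<rho> \<nu> C C1 r "\<lambda>n. int (cf_denom \<rho> n)" "cf_num \<rho>" "\<lambda>n. cf_coeff \<rho> (Suc (Suc n))" .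
  have img: "(F ^^ n) ` U = {circ ((f ^^ n) a)}" if n: "n \<ge> 1" for n
  proof -
    obtain m where m: "n = Suc m" using n by (cases n) auto
    have "(F ^^ n) (circ x) = circ ((f ^^ n) a)" if "x \<in> {a<..<b}" for x
      using flatf[of x] that unfolding lift_iterate[OF lift] m by (simp add: funpow_swap1)
    moreover have "\<exists>x. a < x \<and> x < b" using ab by (intro dense)
    ultimately show ?thesis unfolding U by (auto simp: image_iff)
  qed
  have dist: "circle_setdist U ((F ^^ cf_denom \<rho> n) ` U) = c.yy n" if small: "2 * c.yy n < 1 - (b - a)" for n
  proof -
    have q1: "1 \<le> cf_denom \<rho> n" using c.q_pos[of n] by simp
    define y where "y = (f ^^ cf_denom \<rho> n) a"
    have oy: "l.orb a (int (cf_denom \<rho> n)) = y" "l.orb b (int (cf_denom \<rho> n)) = y"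
      using c.AB_eq[of "int (cf_denom \<rho> n)"] q1 by (simp_all add: l.orb_def y_def)
    have o0: "l.orb a 0 = a" "l.orb b 0 = b" by (simp_all add: l.orb_def)
    \<comment> \<open>Translation by the numerator brings the return next to the lift
      \<open>(a, b)\<close> of \<open>U\<close>; on which side depends on the parity of
      \<open>n\<close>.\<close>
    define k where "k = cf_num \<rho> n"
    have "y - of_int k = b + c.yy n \<or> y - of_int k = a - c.yy n"
      by (simp add: c.yy_def c.rd_def oy o0 k_def)
    then have "circle_setdist (circ ` {a<..<b}) {circ (y - of_int k)} = c.yy n"
      using small ab c.seq_pos(1)[of n] by (intro circle_setdist_arc) auto
    moreover have "circ y = circ (y - of_int k)" unfolding circ_eq_iff by (intro exI[of _ k]) simp
    ultimately show ?thesis unfolding img[OF q1] y_def[symmetric] by (simp add: U)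
  qed
  \<comment> \<open>Eventually the returns are so close that \<open>yy\<close> is the distance
    measured on the circle.\<close>
  have "eventually (\<lambda>n. c.yy n < (1 - (b - a)) / 2) sequentially"
    using c.yy_lim ab by (intro order_tendstoD) auto
  then obtain N0 where N0: "\<And>n. n \<ge> N0 \<Longrightarrow> 2 * c.yy n < 1 - (b - a)" by (auto simp: eventually_sequentially field_simps)
  have sig: "sigma_ratio F U (Suc (Suc n)) = c.yy (Suc (Suc n)) / c.yy n" if "n \<ge> N0" for n
    using dist[of n] dist[of "Suc (Suc n)"] N0[of n] N0[of "Suc (Suc n)"] that
    by (simp add: sigma_ratio_def Let_def \<rho>_def[symmetric] del: cf_denom.simps)
  have "sigma_ratio F U \<longlonglongrightarrow> 0" if "\<nu> \<le> 2"
  proof -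
    have "(\<lambda>n. sigma_ratio F U (n + 2)) \<longlonglongrightarrow> 0"
    proof (rule Lim_transform_eventually[OF c.ratio_tendsto_zero[OF that]])
      show "\<forall>\<^sub>F n in sequentially. c.yy (Suc (Suc n)) / c.yy n = sigma_ratio F U (n + 2)"
        unfolding eventually_sequentially by (intro exI[of _ N0]) (use sig in simp)
    qed
    then show ?thesis by (rule LIMSEQ_offset)
  qed
  moreover have "0 < liminf (\<lambda>n. ereal (sigma_ratio F U n))" if nu: "\<nu> > 2" and bt: "bounded_type (rotation_number F)"
  proof -
    obtain K where K: "\<And>n. cf_coeff \<rho> (Suc (Suc n)) \<le> K"
      using bounded_type_coeff[OF irr r0 r01(2) bt[folded \<rho>_def]] by blast
    from c.bounded_type_ratio[OF nu K] obtain e N where e: "e > 0" "\<forall>n\<ge>N. e * c.yy n \<le> c.yy (Suc (Suc n))" by blast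
    have "e \<le> sigma_ratio F U n" if n: "n \<ge> Suc (Suc (max N0 N))" for n
    proof -
      obtain m where m: "n = Suc (Suc m)" "m \<ge> N0" "m \<ge> N" using n by (metis Suc_le_D Suc_le_mono max.bounded_iff)
      have "e * c.yy m \<le> c.yy (Suc (Suc m))" using e m by simp
      then show ?thesis using sig[OF m(2)] c.seq_pos(1)[of m] by (simp add: m(1) pos_le_divide_eq)
    qed
    then have "\<forall>\<^sub>F n in sequentially. ereal e \<le> ereal (sigma_ratio F U n)"
      unfolding eventually_sequentially by auto
    then have "ereal e \<le> liminf (\<lambda>n. ereal (sigma_ratio F U n))" by (rule Liminf_bounded)
    then show ?thesis using e(1) by (metis ereal_less(2) less_le_trans)
  qed
  ultimately show ?thesis by blast
qed

end
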